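(* Let $d\geq 1$ and $k\geq 1$ be integers and let $\mathcal{C}\subset\mathbb{P}^{2}_{\mathbb{C}}$ be a conic-line arrangement consisting of $d$ lines and $k$ smooth conics, of degree $m=2k+d$, all of whose singular points are nodes, tacnodes, or ordinary triple points. If $\mathcal{C}$ is nearly free, then $m\leq 12$.
   Context: A conic-line arrangement $\mathcal{C}\subset\mathbb{P}^2_{\mathbb{C}}$ with $d$ lines and $k$ smooth conics is the reduced plane curve that is the union of $d$ pairwise distinct lines and $k$ pairwise distinct smooth conics; its degree is $m=2k+d$ and its defining equation is $f=0$, where $f\in S:=\mathbb{C}[x,y,z]$ is the product of the defining forms of all components. A node is an $A_1$ singularity (two smooth branches meeting transversally), a tacnode is an $A_3$ singularity (two smooth branches meeting with intersection multiplicity $2$), and an ordinary triple point is a $D_4$ singularity (three smooth branches with pairwise distinct tangents). It is not required that all three types occur. For a reduced plane curve $C: f=0$ with $f\in S$ homogeneous of degree $m$, let $J_f=\langle \partial_x f,\partial_y f,\partial_z f\rangle$ be the Jacobian ideal, let $I_f$ be the saturation of $J_f$ with respect to $\mathfrak{m}=\langle x,y,z\rangle$, and let $N(f)=I_f/J_f$, a graded $S$-module. The curve $C$ is nearly free if $N(f)\neq 0$ and $\dim_{\mathbb{C}} N(f)_j\leq 1$ for every integer $j$. *)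

theory Defs
  imports
    "HOL-Analysis.Analysis"
    "HOL-Library.Poly_Mapping"
    "HOL-Library.Extended_Nat"
    "HOL-Computational_Algebra.Formal_Power_Series"
begin

section \<open>Ideals and quotient spaces\<close>

definition ideal_gen :: "'a::comm_ring_1 set \<Rightarrow> 'a set" where
  "ideal_gen B = module.span (*) B"

definition ideal_power :: "'a::comm_ring_1 set \<Rightarrow> nat \<Rightarrow> 'a set" where
  "ideal_power I n = ideal_gen {(\<Prod>i<n. a i) | a. \<forall>i<n. a i \<in> I}"

definition saturation :: "'a::comm_ring_1 set \<Rightarrow> 'a set \<Rightarrow> 'a set" where
  "saturation J K = {g. \<exists>n. \<forall>h\<in>ideal_power K n. h * g \<in> J}"

text \<open>
  Here \<open>\<phi>\<close> is the structure map of a commutative complex algebra and \<open>W \<subseteq> V\<close> are complex subspaces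
  of it. The set \<open>B\<close> consists of representatives, in \<open>V\<close>, of the members of a finite basis of the
  complex vector space \<open>V/W\<close>; distinct elements of \<open>B\<close> have distinct classes by independence.
\<close>

definition quotient_basis ::
    "(complex \<Rightarrow> 'a::comm_ring_1) \<Rightarrow> 'a set \<Rightarrow> 'a set \<Rightarrow> 'a set \<Rightarrow> bool" where
  "quotient_basis \<phi> V W B \<longleftrightarrow> finite B \<and> B \<subseteq> V \<and>
     (\<forall>c. (\<Sum>b\<in>B. \<phi> (c b) * b) \<in> W \<longrightarrow> (\<forall>b\<in>B. c b = 0)) \<and>
     (\<forall>v\<in>V. \<exists>c. v - (\<Sum>b\<in>B. \<phi> (c b) * b) \<in> W)"

definition quotient_dim ::
    "(complex \<Rightarrow> 'a::comm_ring_1) \<Rightarrow> 'a set \<Rightarrow> 'a set \<Rightarrow> enat" where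
  "quotient_dim \<phi> V W =
     (if \<exists>B. quotient_basis \<phi> V W B then enat (card (SOME B. quotient_basis \<phi> V W B)) else \<infinity>)"

section \<open>The polynomial ring in three variables over the complex numbers\<close>

text \<open>
  Monomials are exponent vectors indexed by the three-element type \<open>3\<close>, whose elements
  \<open>1\<close>, \<open>2\<close>, \<open>3\<close> (with \<open>3 = 0\<close>) stand for the variables \<open>x\<close>, \<open>y\<close>, \<open>z\<close>; multiplication of
  polynomials is the convolution product of \<^theory>\<open>HOL-Library.Poly_Mapping\<close>.
\<close>

type_synonym mono3 = "3 \<Rightarrow>\<^sub>0 nat"
type_synonym poly3 = "mono3 \<Rightarrow>\<^sub>0 complex"

definition Const :: "complex \<Rightarrow> poly3" where
  "Const c = Poly_Mapping.single 0 c"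

definition Var :: "3 \<Rightarrow> poly3" where
  "Var i = Poly_Mapping.single (Poly_Mapping.single i 1) 1"

definition mono_degree :: "mono3 \<Rightarrow> nat" where
  "mono_degree t = (\<Sum>i\<in>UNIV. Poly_Mapping.lookup t i)"

definition graded_part :: "int \<Rightarrow> poly3 set" where
  "graded_part j = {f. \<forall>t\<in>Poly_Mapping.keys f. int (mono_degree t) = j}"

definition eval_hom :: "(complex \<Rightarrow> 'a::comm_ring_1) \<Rightarrow> (3 \<Rightarrow> 'a) \<Rightarrow> poly3 \<Rightarrow> 'a" where
  "eval_hom \<phi> v f =
     (\<Sum>t\<in>Poly_Mapping.keys f. \<phi> (Poly_Mapping.lookup f t) *
        (\<Prod>i\<in>UNIV. v i ^ Poly_Mapping.lookup t i))"

definition eval_at :: "poly3 \<Rightarrow> complex ^ 3 \<Rightarrow> complex" where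
  "eval_at f p = eval_hom (\<lambda>c. c) (\<lambda>i. p $ i) f"

text \<open>If \<open>x\<^sub>i\<close> does not occur in \<open>t\<close>, the truncated exponent is harmless: the coefficient is \<open>0\<close>.\<close>

definition partial_deriv :: "3 \<Rightarrow> poly3 \<Rightarrow> poly3" where
  "partial_deriv i f =
     (\<Sum>t\<in>Poly_Mapping.keys f. Poly_Mapping.single (t - Poly_Mapping.single i 1)
        (of_nat (Poly_Mapping.lookup t i) * Poly_Mapping.lookup f t))"

section \<open>Nearly free curves\<close>

definition irrelevant_ideal :: "poly3 set" where
  "irrelevant_ideal = ideal_gen (range Var)"

definition jacobian_ideal :: "poly3 \<Rightarrow> poly3 set" where
  "jacobian_ideal f = ideal_gen (range (\<lambda>i. partial_deriv i f))"

definition saturated_jacobian_ideal :: "poly3 \<Rightarrow> poly3 set" where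
  "saturated_jacobian_ideal f = saturation (jacobian_ideal f) irrelevant_ideal"

text \<open>
  For homogeneous \<open>f\<close>, the degree \<open>j\<close> component of the quotient module \<open>N(f)\<close> is the quotient of the
  degree \<open>j\<close> components of the two (homogeneous) ideals; and \<open>N(f) \<noteq> 0\<close> says that the ideals differ.
\<close>

definition dim_N :: "poly3 \<Rightarrow> int \<Rightarrow> enat" where
  "dim_N f j = quotient_dim Const
     (saturated_jacobian_ideal f \<inter> graded_part j) (jacobian_ideal f \<inter> graded_part j)"

definition nearly_free :: "poly3 \<Rightarrow> bool" where
  "nearly_free f \<longleftrightarrow>
     saturated_jacobian_ideal f \<noteq> jacobian_ideal f \<and> (\<forall>j. dim_N f j \<le> 1)"

section \<open>Plane curves and conic-line arrangements\<close>

text \<open>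
  Points of the projective plane are given by nonzero vectors of homogeneous coordinates. All
  predicates on points used below are invariant under rescaling, and two homogeneous forms have the
  same zero set in the projective plane iff the following cones agree.
\<close>

definition zero_locus :: "poly3 \<Rightarrow> (complex ^ 3) set" where
  "zero_locus f = {p. p \<noteq> 0 \<and> eval_at f p = 0}"

definition singular_points :: "poly3 \<Rightarrow> (complex ^ 3) set" where
  "singular_points f = {p \<in> zero_locus f. \<forall>i. eval_at (partial_deriv i f) p = 0}"

definition is_line :: "poly3 \<Rightarrow> bool" where
  "is_line f \<longleftrightarrow> f \<in> graded_part 1 \<and> f \<noteq> 0"

text \<open>The zero form is excluded, since all points are singular points of it.\<close>

definition is_smooth_conic :: "poly3 \<Rightarrow> bool" where
  "is_smooth_conic f \<longleftrightarrow> f \<in> graded_part 2 \<and> singular_points f = {}"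

definition conic_line_arrangement ::
    "nat \<Rightarrow> nat \<Rightarrow> (nat \<Rightarrow> poly3) \<Rightarrow> (nat \<Rightarrow> poly3) \<Rightarrow> bool" where
  "conic_line_arrangement d k l q \<longleftrightarrow>
     (\<forall>i<d. is_line (l i)) \<and> inj_on (\<lambda>i. zero_locus (l i)) {..<d} \<and>
     (\<forall>i<k. is_smooth_conic (q i)) \<and> inj_on (\<lambda>i. zero_locus (q i)) {..<k}"

definition defining_form ::
    "nat \<Rightarrow> nat \<Rightarrow> (nat \<Rightarrow> poly3) \<Rightarrow> (nat \<Rightarrow> poly3) \<Rightarrow> poly3" where
  "defining_form d k l q = (\<Prod>i<d. l i) * (\<Prod>i<k. q i)"

section \<open>Local branches and singularity types\<close>

text \<open>
  The ring \<open>\<complex>[[u,v]]\<close> is represented as \<open>\<complex>[[v]][[u]]\<close>: the outer variable is \<open>u\<close>.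
\<close>

type_synonym fps2 = "complex fps fps"

definition fps2_const :: "complex \<Rightarrow> fps2" where
  "fps2_const c = fps_const (fps_const c)"

definition coeff2 :: "fps2 \<Rightarrow> nat \<Rightarrow> nat \<Rightarrow> complex" where
  "coeff2 g i j = fps_nth (fps_nth g i) j"

definition fps2_u :: fps2 where "fps2_u = fps_X"
definition fps2_v :: fps2 where "fps2_v = fps_const fps_X"

text \<open>
  If \<open>p\<close>, \<open>a\<close>, \<open>b\<close> are linearly independent, then \<open>(u, v) \<mapsto> p + u a + v b\<close> is an affine chart of the
  projective plane centred at \<open>p\<close>; in it, the curve \<open>f = 0\<close> has the local equation \<open>germ f p a b = 0\<close>.
\<close>

definition local_frame :: "complex ^ 3 \<Rightarrow> complex ^ 3 \<Rightarrow> complex ^ 3 \<Rightarrow> bool" where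
  "local_frame p a b \<longleftrightarrow> det (vector [p, a, b] :: complex ^ 3 ^ 3) \<noteq> 0"

definition germ :: "poly3 \<Rightarrow> complex ^ 3 \<Rightarrow> complex ^ 3 \<Rightarrow> complex ^ 3 \<Rightarrow> fps2" where
  "germ f p a b = eval_hom fps2_const
     (\<lambda>i. fps2_const (p $ i) + fps2_const (a $ i) * fps2_u + fps2_const (b $ i) * fps2_v) f"

text \<open>Power series of order one; they are irreducible, so each of them is a single branch.\<close>

definition smooth_branch :: "fps2 \<Rightarrow> bool" where
  "smooth_branch g \<longleftrightarrow> coeff2 g 0 0 = 0 \<and> (coeff2 g 1 0 \<noteq> 0 \<or> coeff2 g 0 1 \<noteq> 0)"

definition distinct_tangents :: "fps2 \<Rightarrow> fps2 \<Rightarrow> bool" where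
  "distinct_tangents g h \<longleftrightarrow> coeff2 g 1 0 * coeff2 h 0 1 \<noteq> coeff2 g 0 1 * coeff2 h 1 0"

definition intersection_multiplicity :: "fps2 \<Rightarrow> fps2 \<Rightarrow> enat" where
  "intersection_multiplicity g h = quotient_dim fps2_const UNIV (ideal_gen {g, h})"

text \<open>
  \<open>has_smooth_branches f p gs\<close>: in some affine chart centred at \<open>p\<close>, the branches of \<open>f = 0\<close> at \<open>p\<close>
  are smooth and given by the members of the list \<open>gs\<close>. The conditions imposed on the branches
  below do not depend on the chart, nor on the choice of the equations of the branches.
\<close>

definition has_smooth_branches :: "poly3 \<Rightarrow> complex ^ 3 \<Rightarrow> fps2 list \<Rightarrow> bool" where
  "has_smooth_branches f p gs \<longleftrightarrow>
     (\<exists>a b w. local_frame p a b \<and> w dvd 1 \<and> germ f p a b = w * prod_list gs) \<and>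
     (\<forall>g\<in>set gs. smooth_branch g)"

definition is_node :: "poly3 \<Rightarrow> complex ^ 3 \<Rightarrow> bool" where
  "is_node f p \<longleftrightarrow> (\<exists>g h. has_smooth_branches f p [g, h] \<and> distinct_tangents g h)"

definition is_tacnode :: "poly3 \<Rightarrow> complex ^ 3 \<Rightarrow> bool" where
  "is_tacnode f p \<longleftrightarrow>
     (\<exists>g h. has_smooth_branches f p [g, h] \<and> intersection_multiplicity g h = 2)"

definition is_ordinary_triple_point :: "poly3 \<Rightarrow> complex ^ 3 \<Rightarrow> bool" where
  "is_ordinary_triple_point f p \<longleftrightarrow>
     (\<exists>g h e. has_smooth_branches f p [g, h, e] \<and>
        distinct_tangents g h \<and> distinct_tangents g e \<and> distinct_tangents h e)"

end

theory Submission
  imports Defs "HOL-Computational_Algebra.Polynomial"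
begin

text \<open>
  Suppose \<open>m \<ge> 13\<close>. Near freeness yields a nonzero triple \<open>\<theta>\<close> of forms of degree \<open>r = \<lfloor>m/2\<rfloor>\<close> with
  \<open>\<theta>\<^sub>x f\<^sub>x + \<theta>\<^sub>y f\<^sub>y + \<theta>\<^sub>z f\<^sub>z = 0\<close>: on a general line this is a count of coefficients of binary forms,
  and the bound \<open>dim N(f)\<^sub>j \<le> 1\<close> allows one to lift a solution to the plane. The vector field \<open>\<theta>\<close>
  kills \<open>f\<close>, hence preserves the weights \<open>|f|\<^bsup>-2s\<^esup>\<close>. For a polynomial field \<open>T\<close> of degree \<open>\<rho>\<close> which kills
  \<open>f\<close>, Stokes' theorem on \<open>\<complex>\<^sup>3\<close> with \<open>s = (\<rho> + 2)/m\<close> gives \<open>div T = 0\<close>, provided that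
  \<open>|f|\<^bsup>-2s\<^esup> |div T| |T|\<close> is locally integrable away from the origin. Nodes, tacnodes and triple points
  have log canonical thresholds \<open>1\<close>, \<open>3/4\<close> and \<open>2/3\<close>. As \<open>(r + 2)/m < 2/3\<close>, it follows that \<open>div \<theta> = 0\<close>, and
  this forces \<open>\<theta>\<close> to vanish at the triple points. Then \<open>T = x\<^sub>k \<theta>\<close> with \<open>s = (r + 3)/m < 3/4\<close> is
  also admissible, and \<open>0 = div T = \<theta>\<^sub>k\<close> for all \<open>k\<close>, a contradiction.
\<close>

section \<open>Integrals of negative powers\<close>

text \<open>The number 12 is where both inequalities become equalities: \<open>m = 12\<close>,
  \<open>r = 6\<close> gives \<open>(r + 2)/m = 2/3\<close> and \<open>(r + 3)/m = 3/4\<close>. The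
  degree \<open>r\<close> is the least one for which the coefficient count on a line leaves two
  independent solutions, \<open>3(r + 1)\<close> unknowns against \<open>r + m\<close> equations;
  one of them may be absorbed by N(f). The exponent \<open>s\<close> is dictated by homogeneity:
  removing the radial part of a field of degree \<rho> costs a divergence proportional to \<rho> +
  2, and the weight compensates for it exactly if \<open>s m = \<rho> + 2\<close>. Hence everything
  is done on the cone over the plane, without affine charts. Multiplication by a coordinate turns
  the divergence into a coefficient of \<theta>, but it raises \<open>s\<close> by
  \<open>1/m\<close>, possibly to 2/3 or beyond; at the triple points the loss is made up by the
  vanishing of both factors of |div T| |T|. The integrals are bounded without any change of
  variables: an integral over a ball is averaged over translates along complex two-dimensional
  slices, on which the equations of the branches are close to linear coordinates.\<close>

text \<open>The value \<open>\<infinity>\<close> at \<open>0\<close> makes finiteness of an integral imply that \<open>x\<close> vanishes only on a null set.\<close>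

definition pw :: "real \<Rightarrow> real \<Rightarrow> ennreal" where
  "pw a x = (if x = 0 then \<infinity> else ennreal (x powr (-a)))"

lemma pw_antimono: "0 \<le> a \<Longrightarrow> 0 \<le> x \<Longrightarrow> x \<le> y \<Longrightarrow> pw a y \<le> pw a x"
  by (auto simp: pw_def intro!: ennreal_leI powr_mono2')

lemma pw_measurable [measurable]:
  assumes [measurable]: "g \<in> borel_measurable M"
  shows "(\<lambda>x. pw a (g x)) \<in> borel_measurable M"
  unfolding pw_def by measurable

lemma cball_borel [measurable]: "cball (a::'a::real_normed_vector) r \<in> sets borel"
  by simp

lemma ball_borel [measurable]: "ball (a::'a::real_normed_vector) r \<in> sets borel"
  by simp

lemma borel_measurable_continuous_compose2:
  fixes s :: "'b::second_countable_topology \<Rightarrow> 'c::second_countable_topology \<Rightarrow> 'd::topological_space"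
  assumes "continuous_on UNIV (\<lambda>p. s (fst p) (snd p))"
    and [measurable]: "g \<in> borel_measurable M" "h \<in> borel_measurable M"
  shows "(\<lambda>x. s (g x) (h x)) \<in> borel_measurable M"
proof -
  have [measurable]: "(\<lambda>p. s (fst p) (snd p)) \<in> borel_measurable (borel \<Otimes>\<^sub>M borel)"
    using borel_measurable_continuous_onI[OF assms(1)] by (simp add: borel_prod)
  have "(\<lambda>x. (\<lambda>p. s (fst p) (snd p)) (g x, h x)) \<in> borel_measurable M" by measurable
  thus ?thesis by simp
qed

lemma norm_le_diff_triangle:
  fixes d x y :: "'a::real_normed_vector"
  shows "norm d \<le> norm (x - y - d) + norm x + norm y"
proof -
  have "norm d = norm ((x - y) - (x - y - d))" by simp
  also have "\<dots> \<le> norm (x - y) + norm (x - y - d)" by (rule norm_triangle_ineq4)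
  also have "norm (x - y) \<le> norm x + norm y" by (rule norm_triangle_ineq4)
  finally show ?thesis by simp
qed

lemma pw_scale: "c > 0 \<Longrightarrow> x \<ge> 0 \<Longrightarrow> pw a (c * x) = ennreal (c powr (-a)) * pw a x"
  by (auto simp: pw_def powr_mult ennreal_mult ennreal_mult_top)

text \<open>Dyadic discs: where \<open>R / 2 ^ (n+1) < norm z \<le> R / 2 ^ n\<close> the integrand
  is at most \<open>c n\<close>, and the disc of radius \<open>R / 2 ^ n\<close> has area
  proportional to \<open>4 ^ (-n)\<close>. The resulting geometric series has ratio
  \<open>2 powr (b - 2)\<close>, so 2, the real dimension, is the critical exponent.\<close>

lemma nn_integral_pw_cball:
  fixes R :: real
  assumes b: "0 \<le> b" "b < 2" and R: "R > 0"
  shows "(\<integral>\<^sup>+ z. indicator (cball (0::complex) R) z * pw b (norm z) \<partial>lborel) < \<infinity>"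
proof -
  define c where "c n = (R / 2 ^ (n+1)) powr (-b)" for n :: nat
  define h where "h n z = indicator (cball (0::complex) (R / 2 ^ n)) z * ennreal (c n)" for n :: nat and z
  have bound: "indicator (cball (0::complex) R) z * pw b (norm z) \<le> (suminf (\<lambda>n. h n z))" if "z \<noteq> 0" for z
  proof (cases "norm z \<le> R")
    case True
    have ex: "\<exists>n. R / 2 ^ n < norm z"
    proof -
      obtain n where "R / norm z < 2 ^ n" using real_arch_pow[of 2 "R / norm z"] by auto
      thus ?thesis using that by (intro exI[of _ n]) (auto simp: field_simps)
    qed
    define N where "N = (LEAST n. R / 2 ^ n < norm z)"
    have N: "R / 2 ^ N < norm z" unfolding N_def by (rule LeastI_ex[OF ex])
    have "N \<noteq> 0" using N True by (intro notI) auto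
    then obtain n where n: "N = Suc n" by (cases N) auto
    have "\<not> R / 2 ^ n < norm z" using not_less_Least[of n "\<lambda>n. R / 2 ^ n < norm z"] n N_def by auto
    hence nn: "norm z \<le> R / 2 ^ n" by simp
    have "pw b (norm z) \<le> pw b (R / 2 ^ (n+1))"
      using N n R b by (intro pw_antimono) auto
    also have "\<dots> = ennreal (c n)" using R by (simp add: pw_def c_def)
    finally have "indicator (cball (0::complex) R) z * pw b (norm z) \<le> h n z"
      using nn True by (simp add: h_def)
    also have "\<dots> \<le> (suminf (\<lambda>n. h n z))"
      using sum_le_suminf[of "\<lambda>n. h n z" "{n}"] by simp
    finally show ?thesis .
  qed simp
  have "(\<integral>\<^sup>+ z. indicator (cball (0::complex) R) z * pw b (norm z) \<partial>lborel) \<le> (\<integral>\<^sup>+ z. (suminf (\<lambda>n. h n z)) \<partial>lborel)"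
    using AE_lborel_singleton[of "0::complex"]
    by (intro nn_integral_mono_AE) (auto elim!: eventually_mono intro: bound)
  also have "\<dots> = (suminf (\<lambda>n. \<integral>\<^sup>+ z. h n z \<partial>lborel))"
    unfolding h_def by (intro nn_integral_suminf) simp
  also have "\<dots> = (suminf (\<lambda>n. ennreal (pi * R^2 * (R/2) powr (-b) * (2 powr (b - 2)) ^ n)))"
  proof (intro suminf_cong)
    fix n
    have "(\<integral>\<^sup>+ z. h n z \<partial>lborel) = emeasure lborel (cball (0::complex) (R / 2^n)) * ennreal (c n)"
      unfolding h_def by (subst nn_integral_multc) auto
    also have "emeasure lborel (cball (0::complex) (R / 2^n)) = ennreal (pi * (R/2^n)^2)"
      using R by (simp add: emeasure_cball unit_ball_vol_2)
    also have "\<dots> * ennreal (c n) = ennreal (pi * (R/2^n)^2 * c n)"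
      by (simp add: ennreal_mult c_def)
    also have "pi * (R/2^n)^2 * c n = pi * R^2 * (R/2) powr (-b) * (2 powr (b - 2)) ^ n"
    proof -
      have "c n = ((R/2) * (1/2)^n) powr (-b)" unfolding c_def by (simp add: power_one_over field_simps)
      also have "\<dots> = (R/2) powr (-b) * ((1/2)^n) powr (-b)" by (rule powr_mult)
      also have "((1/2::real)^n) powr (-b) = (2 powr b)^n"
        by (simp add: powr_powr powr_minus powr_realpow[symmetric] powr_divide mult.commute)
      finally have c: "c n = (R/2) powr (-b) * (2 powr b)^n" .
      have "(2 powr (-2::real)) = 1/4" by (simp add: powr_minus)
      moreover have "(2::real)^(n*2) = 4^n" by (metis power_mult power_commutes mult.commute num_double power2_eq_square numeral_times_numeral power_mult)
      ultimately have d: "(R/2^n)^2 = R^2 * (2 powr (-2))^n"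
        by (simp only:) (simp add: power_divide power_mult[symmetric] power_one_over)
      have "2 powr (b-2) = 2 powr b * (2::real) powr (-2)" by (simp add: powr_add[symmetric])
      thus ?thesis unfolding c d by (simp add: power_mult_distrib)
    qed
    finally show "(\<integral>\<^sup>+ z. h n z \<partial>lborel) = ennreal (pi * R^2 * (R/2) powr (-b) * (2 powr (b - 2)) ^ n)" .
  qed
  also have "\<dots> = ennreal (suminf (\<lambda>n. pi * R^2 * (R/2) powr (-b) * (2 powr (b - 2)) ^ n))"
  proof (intro suminf_ennreal2 summable_mult summable_geometric)
    show "norm (2 powr (b-2)) < 1" using b powr_less_mono[of "b-2" 0 2] by simp
  qed auto
  also have "\<dots> < \<infinity>" by simp
  finally show ?thesis .
qed

text \<open>The common majorant for all slices. If \<open>k\<close> is close to a coordinate on the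
  disc of radius \<rho> and \<open>t0\<close> is a point where its modulus is least, then the
  modulus of \<open>k t\<close> is at least a quarter of the distance from \<open>t\<close> to
  \<open>t0\<close>; recentring at \<open>t0\<close> puts the disc inside one of radius
  \<open>2*\<rho>\<close>.\<close>

definition pwI :: "real \<Rightarrow> real \<Rightarrow> ennreal" where
  "pwI a \<rho> = (\<integral>\<^sup>+ z. indicator (cball (0::complex) (2*\<rho>)) z * pw a (norm z / 4) \<partial>lborel)"

lemma pwI_finite: "0 \<le> a \<Longrightarrow> a < 2 \<Longrightarrow> \<rho> > 0 \<Longrightarrow> pwI a \<rho> < \<infinity>"
proof -
  assume a: "0 \<le> a" "a < 2" "\<rho> > 0"
  have "pwI a \<rho> = ennreal ((1/4) powr (-a)) * (\<integral>\<^sup>+ z. indicator (cball (0::complex) (2*\<rho>)) z * pw a (norm z) \<partial>lborel)"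
    unfolding pwI_def
    by (subst nn_integral_cmult[symmetric]) (auto intro!: nn_integral_cong simp: pw_scale[of "1/4", simplified] mult_ac)
  also have "\<dots> < \<infinity>" using nn_integral_pw_cball[of a "2*\<rho>"] a by (simp add: ennreal_mult_less_top)
  finally show ?thesis .
qed

lemma nn_integral_translate:
  fixes a :: "'a::euclidean_space"
  assumes [measurable]: "F \<in> borel_measurable borel"
  shows "(\<integral>\<^sup>+ x. F (x + a) \<partial>lborel) = (\<integral>\<^sup>+ x. F x \<partial>lborel)"
proof -
  have "(\<integral>\<^sup>+ x. F x \<partial>lborel) = (\<integral>\<^sup>+ x. F x \<partial>distr lborel borel ((+) a))"
    by (simp add: lborel_distr_plus)
  also have "\<dots> = (\<integral>\<^sup>+ x. F (a + x) \<partial>lborel)" by (subst nn_integral_distr) auto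
  finally show ?thesis by (simp add: add.commute)
qed

text \<open>A point \<open>t0\<close> of least modulus serves as a substitute for a zero of
  \<open>k\<close>, which may lie outside the disc: \<open>norm (t - t0)\<close> is at most twice
  \<open>norm (k t - k t0)\<close>, hence at most four times \<open>norm (k t)\<close>.\<close>

lemma pw_slice:
  fixes k :: "complex \<Rightarrow> complex"
  assumes a: "0 \<le> a" and \<rho>: "\<rho> > 0" and cont: "continuous_on UNIV k"
    and lip: "\<And>t t'. t \<in> cball 0 \<rho> \<Longrightarrow> t' \<in> cball 0 \<rho> \<Longrightarrow> norm (t - t') \<le> 2 * norm (k t - k t')"
  shows "(\<integral>\<^sup>+ t. indicator (cball 0 \<rho>) t * pw a (norm (k t)) \<partial>lborel) \<le> pwI a \<rho>"
proof -
  have "continuous_on (cball 0 \<rho>) (\<lambda>t. norm (k t))"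
    by (intro continuous_on_norm continuous_on_subset[OF cont]) auto
  then obtain t0 where t0: "t0 \<in> cball 0 \<rho>" and min: "\<And>t. t \<in> cball 0 \<rho> \<Longrightarrow> norm (k t0) \<le> norm (k t)"
    using continuous_attains_inf[of "cball (0::complex) \<rho>" "\<lambda>t. norm (k t)"] \<rho> by auto
  have b: "norm (t - t0) / 4 \<le> norm (k t)" if "t \<in> cball 0 \<rho>" for t
    using lip[OF that t0] min[OF that] norm_triangle_ineq4[of "k t" "k t0"] by linarith
  have "(\<integral>\<^sup>+ t. indicator (cball 0 \<rho>) t * pw a (norm (k t)) \<partial>lborel)
     \<le> (\<integral>\<^sup>+ t. indicator (cball 0 (2*\<rho>)) (t + (-t0)) * pw a (norm (t + (-t0)) / 4) \<partial>lborel)"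
  proof (intro nn_integral_mono)
    fix t :: complex
    show "indicator (cball 0 \<rho>) t * pw a (norm (k t)) \<le> indicator (cball 0 (2*\<rho>)) (t + (-t0)) * pw a (norm (t + (-t0)) / 4)"
    proof (cases "t \<in> cball 0 \<rho>")
      case True
      have "norm (t + (-t0)) \<le> 2*\<rho>" using True t0 norm_triangle_ineq4[of t t0] by simp
      moreover have "pw a (norm (k t)) \<le> pw a (norm (t + (-t0)) / 4)"
        using b[OF True] a by (intro pw_antimono) auto
      ultimately show ?thesis using True by simp
    qed simp
  qed
  also have "\<dots> = pwI a \<rho>"
    unfolding pwI_def by (rule nn_integral_translate) measurable
  finally show ?thesis .
qed

text \<open>A point \<open>(t0, u0)\<close> minimizing the larger of the two moduli bounds that
  larger modulus from below by a quarter of the distance. This controls one factor at a time: where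
  \<open>k1\<close> dominates, its factor is replaced by that of \<open>t - t0\<close>, and the
  factor of \<open>k2\<close> is integrated over \<open>u\<close> for fixed \<open>t\<close> by
  \<open>pw_slice\<close>; the other region is symmetric. The two regions account for the factor
  2.\<close>

lemma pw_polydisc:
  fixes k1 k2 :: "complex \<Rightarrow> complex \<Rightarrow> complex"
  assumes a: "0 \<le> a" and b: "0 \<le> b" and \<rho>: "\<rho> > 0"
    and c1: "continuous_on UNIV (\<lambda>(t,u). k1 t u)" and c2: "continuous_on UNIV (\<lambda>(t,u). k2 t u)"
    and n1: "\<And>t t' u u'. t \<in> cball 0 \<rho> \<Longrightarrow> t' \<in> cball 0 \<rho> \<Longrightarrow> u \<in> cball 0 \<rho> \<Longrightarrow> u' \<in> cball 0 \<rho> \<Longrightarrow>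
        2 * norm (k1 t u - k1 t' u' - (t - t')) \<le> max (norm (t - t')) (norm (u - u'))"
    and n2: "\<And>t t' u u'. t \<in> cball 0 \<rho> \<Longrightarrow> t' \<in> cball 0 \<rho> \<Longrightarrow> u \<in> cball 0 \<rho> \<Longrightarrow> u' \<in> cball 0 \<rho> \<Longrightarrow>
        2 * norm (k2 t u - k2 t' u' - (u - u')) \<le> max (norm (t - t')) (norm (u - u'))"
  shows "(\<integral>\<^sup>+ t. \<integral>\<^sup>+ u. indicator (cball 0 \<rho>) t * indicator (cball 0 \<rho>) u *
            (pw a (norm (k1 t u)) * pw b (norm (k2 t u))) \<partial>lborel \<partial>lborel) \<le> 2 * (pwI a \<rho> * pwI b \<rho>)"
proof -
  let ?D = "cball (0::complex) \<rho>"
  have c1': "continuous_on UNIV (\<lambda>p. k1 (fst p) (snd p))" and c2': "continuous_on UNIV (\<lambda>p. k2 (fst p) (snd p))"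
    using c1 c2 by (simp_all add: case_prod_unfold)
  have c1a: "continuous_on UNIV (\<lambda>t. k1 t u)" for u
    using continuous_on_compose2[OF c1', of UNIV "\<lambda>t. (t,u)"] by (simp add: continuous_on_Pair)
  have c2a: "continuous_on UNIV (\<lambda>u. k2 t u)" for t
    using continuous_on_compose2[OF c2', of UNIV "\<lambda>u. (t,u)"] by (simp add: continuous_on_Pair)
  note [measurable] = borel_measurable_continuous_compose2[OF c1'] borel_measurable_continuous_compose2[OF c2']
  define M where "M p = max (norm (k1 (fst p) (snd p))) (norm (k2 (fst p) (snd p)))" for p
  have "continuous_on (?D \<times> ?D) M"
    unfolding M_def
    by (intro continuous_on_max continuous_on_norm continuous_on_subset[OF c1' subset_UNIV] continuous_on_subset[OF c2' subset_UNIV])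
  then obtain z0 where z0: "z0 \<in> ?D \<times> ?D" and min: "\<And>z. z \<in> ?D \<times> ?D \<Longrightarrow> M z0 \<le> M z"
    using continuous_attains_inf[of "?D \<times> ?D" M] \<rho> by (auto simp: compact_Times)
  obtain t0 u0 where z0': "z0 = (t0,u0)" by fastforce
  have t0: "t0 \<in> ?D" and u0: "u0 \<in> ?D" using z0 z0' by auto
  have key: "max (norm (t - t0)) (norm (u - u0)) / 4 \<le> M (t,u)" if "t \<in> ?D" "u \<in> ?D" for t u
  proof -
    have "M z0 \<le> M (t,u)" using min that by auto
    hence x: "norm (k1 t0 u0) \<le> M (t,u)" "norm (k2 t0 u0) \<le> M (t,u)"
       "norm (k1 t u) \<le> M (t,u)" "norm (k2 t u) \<le> M (t,u)" by (auto simp: M_def z0')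
    have "norm (t - t0) \<le> norm (k1 t u - k1 t0 u0 - (t - t0)) + norm (k1 t u) + norm (k1 t0 u0)"
      by (rule norm_le_diff_triangle)
    moreover have "norm (u - u0) \<le> norm (k2 t u - k2 t0 u0 - (u - u0)) + norm (k2 t u) + norm (k2 t0 u0)"
      by (rule norm_le_diff_triangle)
    ultimately show ?thesis using n1[OF that(1) t0 that(2) u0] n2[OF that(1) t0 that(2) u0] x by linarith
  qed
  define A where "A t u = indicator ?D t * indicator ?D u * (pw a (norm (t - t0) / 4) * pw b (norm (k2 t u)))" for t u
  define B where "B t u = indicator ?D t * indicator ?D u * (pw a (norm (k1 t u)) * pw b (norm (u - u0) / 4))" for t u
  have pt: "indicator ?D t * indicator ?D u * (pw a (norm (k1 t u)) * pw b (norm (k2 t u))) \<le> A t u + B t u" for t u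
  proof (cases "t \<in> ?D \<and> u \<in> ?D")
    case True
    show ?thesis
    proof (cases "norm (k1 t u) \<ge> norm (k2 t u)")
      case 1: True
      hence "norm (t - t0)/4 \<le> norm (k1 t u)" using key[of t u] True by (auto simp: M_def max_def split: if_splits)
      hence "pw a (norm (k1 t u)) \<le> pw a (norm (t - t0)/4)" using a by (intro pw_antimono) auto
      hence "indicator ?D t * indicator ?D u * (pw a (norm (k1 t u)) * pw b (norm (k2 t u))) \<le> A t u"
        unfolding A_def by (intro mult_mono) auto
      thus ?thesis by (simp add: add_increasing2)
    next
      case 2: False
      hence "norm (u - u0)/4 \<le> norm (k2 t u)" using key[of t u] True by (auto simp: M_def max_def split: if_splits)
      hence "pw b (norm (k2 t u)) \<le> pw b (norm (u - u0)/4)" using b by (intro pw_antimono) auto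
      hence "indicator ?D t * indicator ?D u * (pw a (norm (k1 t u)) * pw b (norm (k2 t u))) \<le> B t u"
        unfolding B_def by (intro mult_mono) auto
      thus ?thesis by (simp add: add_increasing)
    qed
  qed auto
  have t0I: "(\<integral>\<^sup>+ t. indicator ?D t * pw a (norm (t - t0)/4) \<partial>lborel) \<le> pwI a \<rho>" if "t0 \<in> ?D" for t0 a
  proof -
    have "(\<integral>\<^sup>+ t. indicator ?D t * pw a (norm (t - t0)/4) \<partial>lborel) \<le> (\<integral>\<^sup>+ t. indicator (cball 0 (2*\<rho>)) (t + (-t0)) * pw a (norm (t + (-t0)) / 4) \<partial>lborel)"
    proof (intro nn_integral_mono)
      fix t :: complex
      have "t \<in> ?D \<Longrightarrow> norm (t + (-t0)) \<le> 2*\<rho>" using that norm_triangle_ineq4[of t t0] by simp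
      thus "indicator ?D t * pw a (norm (t - t0)/4) \<le> indicator (cball 0 (2*\<rho>)) (t + (-t0)) * pw a (norm (t + (-t0)) / 4)"
        by (cases "t \<in> ?D") auto
    qed
    also have "\<dots> = pwI a \<rho>"
      unfolding pwI_def by (rule nn_integral_translate) measurable
    finally show ?thesis .
  qed
  have s1: "(\<integral>\<^sup>+ t. indicator ?D t * pw a (norm (k1 t u)) \<partial>lborel) \<le> pwI a \<rho>" if "u \<in> ?D" for u
  proof (rule pw_slice[OF a \<rho>])
    show "continuous_on UNIV (\<lambda>t. k1 t u)" by (rule c1a)
    fix t t' assume "t \<in> ?D" "t' \<in> ?D"
    thus "norm (t - t') \<le> 2 * norm (k1 t u - k1 t' u)"
      using n1[of t t' u u] that norm_triangle_ineq4[of "k1 t u - k1 t' u" "k1 t u - k1 t' u - (t - t')"] by auto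
  qed
  have s2: "(\<integral>\<^sup>+ u. indicator ?D u * pw b (norm (k2 t u)) \<partial>lborel) \<le> pwI b \<rho>" if "t \<in> ?D" for t
  proof (rule pw_slice[OF b \<rho>])
    show "continuous_on UNIV (\<lambda>u. k2 t u)" by (rule c2a)
    fix u u' assume "u \<in> ?D" "u' \<in> ?D"
    thus "norm (u - u') \<le> 2 * norm (k2 t u - k2 t u')"
      using n2[of t t u u'] that norm_triangle_ineq4[of "k2 t u - k2 t u'" "k2 t u - k2 t u' - (u - u')"] by simp
  qed
  have IA: "(\<integral>\<^sup>+ t. \<integral>\<^sup>+ u. A t u \<partial>lborel \<partial>lborel) \<le> pwI a \<rho> * pwI b \<rho>"
  proof -
    have "(\<integral>\<^sup>+ t. \<integral>\<^sup>+ u. A t u \<partial>lborel \<partial>lborel) =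
       (\<integral>\<^sup>+ t. (indicator ?D t * pw a (norm (t - t0)/4)) * (\<integral>\<^sup>+ u. indicator ?D u * pw b (norm (k2 t u)) \<partial>lborel) \<partial>lborel)"
      unfolding A_def by (subst nn_integral_cmult[symmetric]) (auto simp: mult_ac)
    also have "\<dots> \<le> (\<integral>\<^sup>+ t. (indicator ?D t * pw a (norm (t - t0)/4)) * pwI b \<rho> \<partial>lborel)"
    proof (intro nn_integral_mono)
      fix t show "(indicator ?D t * pw a (norm (t - t0)/4)) * (\<integral>\<^sup>+ u. indicator ?D u * pw b (norm (k2 t u)) \<partial>lborel)
          \<le> (indicator ?D t * pw a (norm (t - t0)/4)) * pwI b \<rho>"
        by (cases "t \<in> ?D") (auto simp del: mem_cball intro!: mult_left_mono s2)
    qed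
    also have "\<dots> = (\<integral>\<^sup>+ t. (indicator ?D t * pw a (norm (t - t0)/4)) \<partial>lborel) * pwI b \<rho>"
      by (subst nn_integral_multc) auto
    also have "\<dots> \<le> pwI a \<rho> * pwI b \<rho>" by (intro mult_right_mono t0I t0) auto
    finally show ?thesis .
  qed
  have IB: "(\<integral>\<^sup>+ t. \<integral>\<^sup>+ u. B t u \<partial>lborel \<partial>lborel) \<le> pwI a \<rho> * pwI b \<rho>"
  proof -
    have "(\<integral>\<^sup>+ t. \<integral>\<^sup>+ u. B t u \<partial>lborel \<partial>lborel) = (\<integral>\<^sup>+ u. \<integral>\<^sup>+ t. B t u \<partial>lborel \<partial>lborel)"
      unfolding B_def by (rule lborel_pair.Fubini') (simp add: case_prod_unfold, measurable)
    also have "\<dots> =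
       (\<integral>\<^sup>+ u. (indicator ?D u * pw b (norm (u - u0)/4)) * (\<integral>\<^sup>+ t. indicator ?D t * pw a (norm (k1 t u)) \<partial>lborel) \<partial>lborel)"
      unfolding B_def by (subst nn_integral_cmult[symmetric]) (auto simp: mult_ac)
    also have "\<dots> \<le> (\<integral>\<^sup>+ u. (indicator ?D u * pw b (norm (u - u0)/4)) * pwI a \<rho> \<partial>lborel)"
    proof (intro nn_integral_mono)
      fix u show "(indicator ?D u * pw b (norm (u - u0)/4)) * (\<integral>\<^sup>+ t. indicator ?D t * pw a (norm (k1 t u)) \<partial>lborel)
          \<le> (indicator ?D u * pw b (norm (u - u0)/4)) * pwI a \<rho>"
        by (cases "u \<in> ?D") (auto simp del: mem_cball intro!: mult_left_mono s1)
    qed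
    also have "\<dots> = (\<integral>\<^sup>+ u. (indicator ?D u * pw b (norm (u - u0)/4)) \<partial>lborel) * pwI a \<rho>"
      by (subst nn_integral_multc) auto
    also have "\<dots> \<le> pwI b \<rho> * pwI a \<rho>" by (intro mult_right_mono t0I u0) auto
    finally show ?thesis by (simp add: mult.commute)
  qed
  have mA: "(\<lambda>p. A (fst p) (snd p)) \<in> borel_measurable (lborel \<Otimes>\<^sub>M lborel)"
    unfolding A_def by measurable
  have mB: "(\<lambda>p. B (fst p) (snd p)) \<in> borel_measurable (lborel \<Otimes>\<^sub>M lborel)"
    unfolding B_def by measurable
  have mAs: "(\<lambda>u. A t u) \<in> borel_measurable lborel" and mBs: "(\<lambda>u. B t u) \<in> borel_measurable lborel" for t
    unfolding A_def B_def by measurable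
  have "(\<integral>\<^sup>+ t. \<integral>\<^sup>+ u. indicator ?D t * indicator ?D u *
            (pw a (norm (k1 t u)) * pw b (norm (k2 t u))) \<partial>lborel \<partial>lborel)
      \<le> (\<integral>\<^sup>+ t. \<integral>\<^sup>+ u. A t u + B t u \<partial>lborel \<partial>lborel)"
    by (intro nn_integral_mono pt)
  also have "\<dots> = (\<integral>\<^sup>+ t. \<integral>\<^sup>+ u. A t u \<partial>lborel \<partial>lborel) + (\<integral>\<^sup>+ t. \<integral>\<^sup>+ u. B t u \<partial>lborel \<partial>lborel)"
    using lborel.borel_measurable_nn_integral_fst[OF mA] lborel.borel_measurable_nn_integral_fst[OF mB]
    by (subst nn_integral_add[symmetric]) (auto intro!: nn_integral_cong nn_integral_add mAs mBs)
  also have "\<dots> \<le> pwI a \<rho> * pwI b \<rho> + pwI a \<rho> * pwI b \<rho>" by (intro add_mono IA IB)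
  finally show ?thesis by (simp add: mult_2)
qed

text \<open>Translation invariance: for each \<open>(t, u)\<close> the integral over the ball equals
  the integral of the function shifted by \<open>s t u\<close>. Averaging over the bidisc and
  exchanging the integrations brings the slice integrals inside, where they are bounded uniformly in
  \<open>x\<close>; the shifts enlarge the ball by \<open>\<delta>\<close>. The direction
  transversal to the slices needs no coordinate.\<close>

lemma slice_average_finite:
  fixes F :: "'a::euclidean_space \<Rightarrow> ennreal" and s :: "complex \<Rightarrow> complex \<Rightarrow> 'a"
  assumes [measurable]: "F \<in> borel_measurable borel"
    and cs: "continuous_on UNIV (\<lambda>p. s (fst p) (snd p))"
    and \<rho>: "\<rho> > 0"
    and small: "\<And>t u. t \<in> cball 0 \<rho> \<Longrightarrow> u \<in> cball 0 \<rho> \<Longrightarrow> norm (s t u) \<le> \<delta>"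
    and bd: "\<And>x. x \<in> ball p (\<eta> + \<delta>) \<Longrightarrow> (\<integral>\<^sup>+ t. \<integral>\<^sup>+ u. indicator (cball 0 \<rho>) t * indicator (cball 0 \<rho>) u *
            F (x + s t u) \<partial>lborel \<partial>lborel) \<le> C"
    and C: "C < \<infinity>"
  shows "(\<integral>\<^sup>+ x. indicator (ball p \<eta>) x * F x \<partial>lborel) < \<infinity>"
proof -
  let ?D = "cball (0::complex) \<rho>"
  define V where "V = emeasure lborel ?D"
  have V: "V > 0" "V < \<infinity>" using \<rho> unfolding V_def
    by (auto simp: emeasure_cball unit_ball_vol_2 ennreal_zero_less_mult_iff)
  note [measurable] = borel_measurable_continuous_compose2[OF cs]
  define J where "J = (\<integral>\<^sup>+ x. indicator (ball p \<eta>) x * F x \<partial>lborel)"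
  have m1[measurable]: "(\<lambda>x. indicator (ball p \<eta>) x * F x) \<in> borel_measurable borel" by measurable
  have "V * (V * J) = (\<integral>\<^sup>+ t. \<integral>\<^sup>+ u. indicator ?D t * indicator ?D u * J \<partial>lborel \<partial>lborel)"
  proof -
    have "(\<integral>\<^sup>+ t. \<integral>\<^sup>+ u. indicator ?D t * indicator ?D u * J \<partial>lborel \<partial>lborel)
       = (\<integral>\<^sup>+ t. indicator ?D t * (V * J) \<partial>lborel)"
      unfolding V_def by (subst nn_integral_indicator[symmetric], simp, subst nn_integral_multc[symmetric])
         (auto simp: mult.assoc nn_integral_cmult nn_integral_multc intro!: nn_integral_cong)
    also have "\<dots> = V * (V * J)"  by (subst nn_integral_multc) (auto simp: V_def)
    finally show ?thesis ..
  qed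
  also have "\<dots> = (\<integral>\<^sup>+ t. \<integral>\<^sup>+ u. \<integral>\<^sup>+ x. indicator ?D t * indicator ?D u * (indicator (ball p \<eta>) (x + s t u) * F (x + s t u)) \<partial>lborel \<partial>lborel \<partial>lborel)"
    by (intro nn_integral_cong, subst nn_integral_cmult, measurable)
       (simp add: J_def nn_integral_translate[OF m1])
  also have "\<dots> \<le> (\<integral>\<^sup>+ t. \<integral>\<^sup>+ u. \<integral>\<^sup>+ x. indicator (ball p (\<eta>+\<delta>)) x * (indicator ?D t * indicator ?D u * F (x + s t u)) \<partial>lborel \<partial>lborel \<partial>lborel)"
  proof (intro nn_integral_mono)
    fix t u x
    show "indicator ?D t * indicator ?D u * (indicator (ball p \<eta>) (x + s t u) * F (x + s t u))
       \<le> indicator (ball p (\<eta>+\<delta>)) x * (indicator ?D t * indicator ?D u * F (x + s t u))"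
    proof (cases "t \<in> ?D \<and> u \<in> ?D \<and> x + s t u \<in> ball p \<eta>")
      case True
      have "dist p x \<le> dist p (x + s t u) + dist (x + s t u) x" by (rule dist_triangle)
      also have "dist (x + s t u) x = norm (s t u)" by (simp add: dist_norm)
      finally have "x \<in> ball p (\<eta>+\<delta>)" using True small[of t u] by simp
      thus ?thesis using True by simp
    qed auto
  qed
  also have "\<dots> = (\<integral>\<^sup>+ t. \<integral>\<^sup>+ x. \<integral>\<^sup>+ u. indicator (ball p (\<eta>+\<delta>)) x * (indicator ?D t * indicator ?D u * F (x + s t u)) \<partial>lborel \<partial>lborel \<partial>lborel)"
    by (intro nn_integral_cong lborel_pair.Fubini') measurable
  also have "\<dots> = (\<integral>\<^sup>+ x. \<integral>\<^sup>+ t. \<integral>\<^sup>+ u. indicator (ball p (\<eta>+\<delta>)) x * (indicator ?D t * indicator ?D u * F (x + s t u)) \<partial>lborel \<partial>lborel \<partial>lborel)"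
    by (intro lborel_pair.Fubini') measurable
  also have "\<dots> = (\<integral>\<^sup>+ x. indicator (ball p (\<eta>+\<delta>)) x * (\<integral>\<^sup>+ t. \<integral>\<^sup>+ u. indicator ?D t * indicator ?D u * F (x + s t u) \<partial>lborel \<partial>lborel) \<partial>lborel)"
    by (intro nn_integral_cong) (auto simp: indicator_def)
  also have "\<dots> \<le> (\<integral>\<^sup>+ x. indicator (ball p (\<eta>+\<delta>)) x * C \<partial>lborel)"
  proof (intro nn_integral_mono)
    fix x
    show "indicator (ball p (\<eta>+\<delta>)) x * (\<integral>\<^sup>+ t. \<integral>\<^sup>+ u. indicator ?D t * indicator ?D u * F (x + s t u) \<partial>lborel \<partial>lborel)
       \<le> indicator (ball p (\<eta>+\<delta>)) x * C"
      by (cases "x \<in> ball p (\<eta>+\<delta>)") (auto simp del: mem_ball intro!: bd)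
  qed
  also have "\<dots> = emeasure lborel (ball p (\<eta>+\<delta>)) * C"
    by (subst nn_integral_multc) auto
  also have "\<dots> < \<infinity>" using C emeasure_lborel_ball_finite[of p "\<eta>+\<delta>"] by (simp add: ennreal_mult_less_top)
  finally have "V * (V * J) < \<infinity>" .
  thus ?thesis using V unfolding J_def[symmetric] by (auto simp: ennreal_mult_less_top)
qed


text \<open>Strict differentiability of \<open>k\<close> at \<open>p\<close> with derivative
  \<open>g\<close>. Both points move, so that the estimate holds uniformly on all slices near
  \<open>p\<close> and not only on those through \<open>p\<close>.\<close>

definition sdiff :: "(complex^3 \<Rightarrow> complex) \<Rightarrow> complex^3 \<Rightarrow> (complex^3 \<Rightarrow> complex) \<Rightarrow> bool" where
  "sdiff k p g \<longleftrightarrow> (\<forall>\<epsilon>>0. \<exists>\<eta>>0. \<forall>y\<in>ball p \<eta>. \<forall>y'\<in>ball p \<eta>. norm (k y - k y' - g (y - y')) \<le> \<epsilon> * norm (y - y'))"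

lemma norm_vector_smult: "norm (t *s (e::complex^3)) = norm t * norm e"
  by (simp add: norm_vec_def norm_mult L2_set_right_distrib)

lemma continuous_smult2: "continuous_on UNIV (\<lambda>p. fst p *s e0 + snd p *s (e1::complex^3))"
  unfolding vector_scalar_mult_def by (intro continuous_intros)

text \<open>The directions \<open>e0\<close>, \<open>e1\<close> are dual to the derivatives
  \<open>g1\<close>, \<open>g2\<close>. On every slice \<open>x + t *s e0 + u *s e1\<close> close to
  \<open>p\<close>, the pair \<open>(k1, k2)\<close> therefore differs from \<open>(t, u)\<close>,
  up to a constant, by a map with Lipschitz constant one half. This is what
  \<open>pw_polydisc\<close> asks for.\<close>

lemma pw_local:
  fixes k1 k2 g1 g2 :: "complex^3 \<Rightarrow> complex"
  assumes a: "0 \<le> a" "a < 2" and b: "0 \<le> b" "b < 2"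
    and c1: "continuous_on UNIV k1" and c2: "continuous_on UNIV k2"
    and d1: "sdiff k1 p g1" and d2: "sdiff k2 p g2"
    and e1: "\<And>t u. g1 (t *s e0 + u *s e1) = t" and e2: "\<And>t u. g2 (t *s e0 + u *s e1) = u"
  shows "\<exists>\<eta>>0. (\<integral>\<^sup>+ x. indicator (ball p \<eta>) x * (pw a (norm (k1 x)) * pw b (norm (k2 x))) \<partial>lborel) < \<infinity>"
proof -
  \<comment> \<open>A Lipschitz constant of the slice map for the maximum norm; the summand 1 keeps
    it positive. The accuracy \<open>1 / (2*L)\<close> then becomes one half in the
    parameters.\<close>
  define L where "L = norm e0 + norm e1 + 1"
  have L: "L > 0" unfolding L_def by (smt (verit) norm_ge_zero)
  have \<epsilon>: "1 / (2*L) > 0" using L by simp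
  obtain \<eta>1 where \<eta>1: "\<eta>1 > 0" "\<And>y y'. y \<in> ball p \<eta>1 \<Longrightarrow> y' \<in> ball p \<eta>1 \<Longrightarrow> norm (k1 y - k1 y' - g1 (y - y')) \<le> 1/(2*L) * norm (y - y')"
    using d1 \<epsilon> unfolding sdiff_def by blast
  obtain \<eta>2 where \<eta>2: "\<eta>2 > 0" "\<And>y y'. y \<in> ball p \<eta>2 \<Longrightarrow> y' \<in> ball p \<eta>2 \<Longrightarrow> norm (k2 y - k2 y' - g2 (y - y')) \<le> 1/(2*L) * norm (y - y')"
    using d2 \<epsilon> unfolding sdiff_def by blast
  \<comment> \<open>A third suffices: centres \<open>x\<close> run through the ball of radius
    \<open>2 * \<eta>\<close>, and the slices add at most \<open>\<eta>\<close>.\<close>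
  define \<eta> where "\<eta> = min \<eta>1 \<eta>2 / 3"
  have \<eta>: "\<eta> > 0" "3 * \<eta> \<le> \<eta>1" "3 * \<eta> \<le> \<eta>2" using \<eta>1 \<eta>2 by (auto simp: \<eta>_def)
  define \<rho> where "\<rho> = \<eta> / L"
  have \<rho>: "\<rho> > 0" using \<eta> L by (simp add: \<rho>_def)
  define s where "s t u = t *s e0 + u *s e1" for t u
  have gs1: "g1 (s t u) = t" and gs2: "g2 (s t u) = u" for t u
    unfolding s_def by (rule e1 e2)+
  have s_norm: "norm (s t u) \<le> max (norm t) (norm u) * L" for t u
  proof -
    have "norm (s t u) \<le> norm t * norm e0 + norm u * norm e1"
      unfolding s_def by (intro norm_triangle_le) (simp add: norm_vector_smult)
    also have "\<dots> \<le> max (norm t) (norm u) * norm e0 + max (norm t) (norm u) * norm e1"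
      by (intro add_mono mult_right_mono) auto
    also have "\<dots> \<le> max (norm t) (norm u) * L" unfolding L_def by (simp add: algebra_simps max_def)
    finally show ?thesis .
  qed
  have s_diff: "(x + s t u) - (x + s t' u') = s (t - t') (u - u')" for x t u t' u'
    by (simp add: s_def vec_eq_iff algebra_simps)
  have cs: "continuous_on UNIV (\<lambda>p. s (fst p) (snd p))"
    unfolding s_def by (rule continuous_smult2)
  have small: "norm (s t u) \<le> \<eta>" if "t \<in> cball 0 \<rho>" "u \<in> cball 0 \<rho>" for t u
  proof -
    have "norm (s t u) \<le> max (norm t) (norm u) * L" by (rule s_norm)
    also have "\<dots> \<le> \<rho> * L" using that L by (intro mult_right_mono) auto
    finally show ?thesis using L by (simp add: \<rho>_def)
  qed
  have near: "2 * norm (k (x + s t u) - k (x + s t' u') - c) \<le> max (norm (t - t')) (norm (u - u'))"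
    if x: "x \<in> ball p (\<eta> + \<eta>)" and tu: "t \<in> cball 0 \<rho>" "t' \<in> cball 0 \<rho>" "u \<in> cball 0 \<rho>" "u' \<in> cball 0 \<rho>"
    and k: "\<And>y y'. y \<in> ball p (3*\<eta>) \<Longrightarrow> y' \<in> ball p (3*\<eta>) \<Longrightarrow> norm (k y - k y' - g (y - y')) \<le> 1/(2*L) * norm (y - y')"
    and c: "c = g (s (t - t') (u - u'))"
    for x t u t' u' c and k g :: "complex^3 \<Rightarrow> complex"
  proof -
    have in3: "x + s t u \<in> ball p (3*\<eta>)" if "t \<in> cball 0 \<rho>" "u \<in> cball 0 \<rho>" for t u
    proof -
      have "dist p (x + s t u) \<le> dist p x + dist x (x + s t u)" by (rule dist_triangle)
      also have "dist x (x + s t u) = norm (s t u)" by (simp add: dist_norm)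
      finally show ?thesis using small[OF that] x by simp
    qed
    have "norm (k (x + s t u) - k (x + s t' u') - c) \<le> 1/(2*L) * norm (s (t - t') (u - u'))"
      using k[OF in3[OF tu(1,3)] in3[OF tu(2,4)]] unfolding s_diff c .
    also have "\<dots> \<le> 1/(2*L) * (max (norm (t - t')) (norm (u - u')) * L)"
      using L by (intro mult_left_mono s_norm) auto
    also have "\<dots> = max (norm (t - t')) (norm (u - u')) / 2" using L by simp
    finally show ?thesis by simp
  qed
  have [measurable]: "k1 \<in> borel_measurable borel" "k2 \<in> borel_measurable borel"
    using c1 c2 by (auto intro: borel_measurable_continuous_onI)
  have cc: "continuous_on UNIV (\<lambda>(t,u). k (x + s t u))" if "continuous_on UNIV k" for x and k :: "complex^3 \<Rightarrow> complex"
    using continuous_on_compose2[OF that, of UNIV "\<lambda>p. x + s (fst p) (snd p)"] cs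
    by (simp add: case_prod_unfold continuous_on_add[OF continuous_on_const cs])
  have "(\<integral>\<^sup>+ x. indicator (ball p \<eta>) x * (pw a (norm (k1 x)) * pw b (norm (k2 x))) \<partial>lborel) < \<infinity>"
  proof (rule slice_average_finite[OF _ cs \<rho> small])
    show "(\<lambda>x. pw a (norm (k1 x)) * pw b (norm (k2 x))) \<in> borel_measurable borel" by measurable
    fix x assume x: "x \<in> ball p (\<eta> + \<eta>)"
    show "(\<integral>\<^sup>+ t. \<integral>\<^sup>+ u. indicator (cball 0 \<rho>) t * indicator (cball 0 \<rho>) u *
       (pw a (norm (k1 (x + s t u))) * pw b (norm (k2 (x + s t u)))) \<partial>lborel \<partial>lborel) \<le> 2 * (pwI a \<rho> * pwI b \<rho>)"
    proof (rule pw_polydisc[OF a(1) b(1) \<rho> cc[OF c1] cc[OF c2]])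
      fix t t' u u' :: complex assume tu: "t \<in> cball 0 \<rho>" "t' \<in> cball 0 \<rho>" "u \<in> cball 0 \<rho>" "u' \<in> cball 0 \<rho>"
      show "2 * norm (k1 (x + s t u) - k1 (x + s t' u') - (t - t')) \<le> max (norm (t - t')) (norm (u - u'))"
        by (rule near[OF x tu, where g = g1]) (use \<eta>1(2) \<eta> gs1 in auto)
      show "2 * norm (k2 (x + s t u) - k2 (x + s t' u') - (u - u')) \<le> max (norm (t - t')) (norm (u - u'))"
        by (rule near[OF x tu, where g = g2]) (use \<eta>2(2) \<eta> gs2 in auto)
    qed
  next
    show "2 * (pwI a \<rho> * pwI b \<rho>) < \<infinity>"
      using pwI_finite[OF a \<rho>] pwI_finite[OF b \<rho>] by (simp add: ennreal_mult_less_top)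
  qed
  thus ?thesis using \<eta>(1) by blast
qed

section \<open>Polynomials in three variables\<close>

lemma prod_UNIV_3: "prod f (UNIV::3 set) = f 1 * f 2 * f 3"
  unfolding UNIV_3 by (simp add: mult.assoc)

lemma poly_mapping_eq_sum_single: "f = (\<Sum>t\<in>Poly_Mapping.keys f. Poly_Mapping.single t (Poly_Mapping.lookup f t))"
proof (rule poly_mapping_eqI)
  fix k
  have "(\<Sum>t\<in>Poly_Mapping.keys f. Poly_Mapping.lookup f t when t = k) = Poly_Mapping.lookup f k"
    by (cases "k \<in> Poly_Mapping.keys f") (auto simp: when_def not_in_keys_iff_lookup_eq_zero intro!: sum.neutral)
  thus "Poly_Mapping.lookup f k = Poly_Mapping.lookup (\<Sum>t\<in>Poly_Mapping.keys f. Poly_Mapping.single t (Poly_Mapping.lookup f t)) k"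
    by (simp add: lookup_sum lookup_single)
qed

lemma poly_mapping_single_induct [case_names zero single add]:
  assumes "P 0" "\<And>t c. P (Poly_Mapping.single t c)" "\<And>f g. P f \<Longrightarrow> P g \<Longrightarrow> P (f + g)"
  shows "P (f :: 'a \<Rightarrow>\<^sub>0 'b::comm_monoid_add)"
proof -
  have "P (\<Sum>t\<in>A. Poly_Mapping.single t (Poly_Mapping.lookup f t))" if "finite A" for A
    using that by (induction A) (auto intro: assms)
  thus ?thesis using poly_mapping_eq_sum_single[of f] by (metis finite_keys)
qed

section \<open>Evaluation homomorphisms into points, power series and polynomial rings\<close>

definition scalar_hom :: "(complex \<Rightarrow> 'a::comm_ring_1) \<Rightarrow> bool" where
  "scalar_hom \<phi> \<longleftrightarrow> \<phi> 0 = 0 \<and> \<phi> 1 = 1 \<and> (\<forall>a b. \<phi> (a + b) = \<phi> a + \<phi> b) \<and> (\<forall>a b. \<phi> (a * b) = \<phi> a * \<phi> b)"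

context
  fixes \<phi> :: "complex \<Rightarrow> 'a::comm_ring_1" and v :: "3 \<Rightarrow> 'a"
  assumes \<phi>: "scalar_hom \<phi>"
begin

lemma eval_hom_0 [simp]: "eval_hom \<phi> v 0 = 0"
  by (simp add: eval_hom_def)

lemma eval_hom_single [simp]:
  "eval_hom \<phi> v (Poly_Mapping.single t c) = \<phi> c * (\<Prod>i\<in>UNIV. v i ^ Poly_Mapping.lookup t i)"
  using \<phi> by (auto simp: eval_hom_def scalar_hom_def)

lemma eval_hom_add [simp]: "eval_hom \<phi> v (f + g) = eval_hom \<phi> v f + eval_hom \<phi> v g"
  unfolding eval_hom_def by (rule setsum_keys_plus_distrib) (use \<phi> in \<open>auto simp: scalar_hom_def algebra_simps\<close>)

lemma eval_hom_mult [simp]: "eval_hom \<phi> v (f * g) = eval_hom \<phi> v f * eval_hom \<phi> v g"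
proof (induction f rule: poly_mapping_single_induct)
  case (single t c)
  show ?case
  proof (induction g rule: poly_mapping_single_induct)
    case (single s d)
    show ?case using \<phi> by (simp add: mult_single lookup_add power_add prod.distrib scalar_hom_def mult_ac)
  qed (simp_all add: algebra_simps)
qed (simp_all add: algebra_simps)

lemma eval_hom_Const [simp]: "eval_hom \<phi> v (Const c) = \<phi> c"
  by (simp add: Const_def)

lemma eval_hom_Var [simp]: "eval_hom \<phi> v (Var i) = v i"
proof -
  have "(\<Prod>j\<in>UNIV. v j ^ Poly_Mapping.lookup (Poly_Mapping.single i (1::nat)) j) = (\<Prod>j\<in>UNIV. if j = i then v i else 1)"
    by (intro prod.cong) (auto simp: lookup_single when_def)
  thus ?thesis using \<phi> by (simp add: Var_def scalar_hom_def)
qed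

lemma eval_hom_1 [simp]: "eval_hom \<phi> v 1 = 1"
  using eval_hom_Const[of 1] \<phi> by (simp add: Const_def scalar_hom_def)

lemma eval_hom_minus [simp]: "eval_hom \<phi> v (- f) = - eval_hom \<phi> v f"
  using eval_hom_add[of "-f" f] by (simp add: eq_neg_iff_add_eq_0)

lemma eval_hom_diff [simp]: "eval_hom \<phi> v (f - g) = eval_hom \<phi> v f - eval_hom \<phi> v g"
  using eval_hom_add[of f "-g"] by simp

lemma eval_hom_sum [simp]: "eval_hom \<phi> v (sum f A) = (\<Sum>a\<in>A. eval_hom \<phi> v (f a))"
  by (induction A rule: infinite_finite_induct) auto

lemma eval_hom_prod [simp]: "eval_hom \<phi> v (prod f A) = (\<Prod>a\<in>A. eval_hom \<phi> v (f a))"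
  by (induction A rule: infinite_finite_induct) auto

lemma eval_hom_power [simp]: "eval_hom \<phi> v (f ^ n) = eval_hom \<phi> v f ^ n"
  by (induction n) auto

end

lemma scalar_hom_id [simp]: "scalar_hom (\<lambda>c. c)"
  by (simp add: scalar_hom_def)

lemma eval_at_simps [simp]:
  "eval_at 0 p = 0" "eval_at 1 p = 1" "eval_at (f + g) p = eval_at f p + eval_at g p"
  "eval_at (f * g) p = eval_at f p * eval_at g p" "eval_at (- f) p = - eval_at f p"
  "eval_at (f - g) p = eval_at f p - eval_at g p" "eval_at (Const c) p = c" "eval_at (Var i) p = p $ i"
  "eval_at (sum F A) p = (\<Sum>a\<in>A. eval_at (F a) p)" "eval_at (prod F A) p = (\<Prod>a\<in>A. eval_at (F a) p)"
  "eval_at (f ^ n) p = eval_at f p ^ n"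
  "eval_at (Poly_Mapping.single t c) p = c * (\<Prod>i\<in>UNIV. p $ i ^ Poly_Mapping.lookup t i)"
  by (simp_all add: eval_at_def)

lemma scalar_hom_Const: "scalar_hom Const"
  by (simp add: scalar_hom_def Const_def single_add[symmetric] mult_single)

section \<open>Formal partial derivatives as complex derivatives\<close>

lemma partial_deriv_0 [simp]: "partial_deriv i 0 = 0"
  by (simp add: partial_deriv_def)

lemma partial_deriv_single: "partial_deriv i (Poly_Mapping.single t c) =
    Poly_Mapping.single (t - Poly_Mapping.single i 1) (of_nat (Poly_Mapping.lookup t i) * c)"
  by (simp add: partial_deriv_def)

lemma partial_deriv_add [simp]: "partial_deriv i (f + g) = partial_deriv i f + partial_deriv i g"
  unfolding partial_deriv_def by (rule setsum_keys_plus_distrib) (auto simp: single_add algebra_simps)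

lemma has_derivative_eval_at_single:
  "(eval_at (Poly_Mapping.single t c) has_derivative
     (\<lambda>h. \<Sum>i\<in>UNIV. eval_at (partial_deriv i (Poly_Mapping.single t c)) x * h $ i)) (at x)"
proof -
  have nth: "((\<lambda>x::complex^3. x $ i) has_derivative (\<lambda>h. h $ i)) (at x)" for i
    by (rule bounded_linear_imp_has_derivative[OF bounded_linear_vec_nth])
  have e: "eval_at (Poly_Mapping.single t c) = (\<lambda>x. c * (x $ 1 ^ Poly_Mapping.lookup t 1 * x $ 2 ^ Poly_Mapping.lookup t 2 * x $ 3 ^ Poly_Mapping.lookup t 3))"
    by (rule ext) (simp add: prod_UNIV_3)
  let ?n = "Poly_Mapping.lookup t"
  have p: "((\<lambda>x::complex^3. x $ i ^ ?n i) has_derivative (\<lambda>h. of_nat (?n i) * h $ i * x $ i ^ (?n i - 1))) (at x)" for i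
    by (rule has_derivative_power[OF nth])
  have "(eval_at (Poly_Mapping.single t c) has_derivative
      (\<lambda>h. c * ((x $ 1 ^ ?n 1 * x $ 2 ^ ?n 2) * (of_nat (?n 3) * h $ 3 * x $ 3 ^ (?n 3 - 1)) +
         (x $ 1 ^ ?n 1 * (of_nat (?n 2) * h $ 2 * x $ 2 ^ (?n 2 - 1)) + (of_nat (?n 1) * h $ 1 * x $ 1 ^ (?n 1 - 1)) * x $ 2 ^ ?n 2) * x $ 3 ^ ?n 3))) (at x)"
    unfolding e by (intro has_derivative_mult_right has_derivative_mult p)
  also have "(\<lambda>h. c * ((x $ 1 ^ ?n 1 * x $ 2 ^ ?n 2) * (of_nat (?n 3) * h $ 3 * x $ 3 ^ (?n 3 - 1)) +
         (x $ 1 ^ ?n 1 * (of_nat (?n 2) * h $ 2 * x $ 2 ^ (?n 2 - 1)) + (of_nat (?n 1) * h $ 1 * x $ 1 ^ (?n 1 - 1)) * x $ 2 ^ ?n 2) * x $ 3 ^ ?n 3))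
     = (\<lambda>h. \<Sum>i\<in>UNIV. eval_at (partial_deriv i (Poly_Mapping.single t c)) x * h $ i)"
    by (rule ext) (simp add: partial_deriv_single sum_3 prod_UNIV_3 lookup_minus lookup_single algebra_simps)
  finally show ?thesis .
qed

lemma has_derivative_eval_at:
  "(eval_at f has_derivative (\<lambda>h. \<Sum>i\<in>UNIV. eval_at (partial_deriv i f) x * h $ i)) (at x)"
proof (induction f rule: poly_mapping_single_induct)
  case zero
  show ?case by (simp add: eval_at_simps[abs_def])
next
  case (add f g)
  have "((\<lambda>x. eval_at f x + eval_at g x) has_derivative (\<lambda>h. (\<Sum>i\<in>UNIV. eval_at (partial_deriv i f) x * h $ i) + (\<Sum>i\<in>UNIV. eval_at (partial_deriv i g) x * h $ i))) (at x)"
    by (rule has_derivative_add[OF add])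
  moreover have "eval_at (f + g) = (\<lambda>x. eval_at f x + eval_at g x)" by auto
  ultimately show ?case by (simp add: sum.distrib distrib_right)
qed (rule has_derivative_eval_at_single)

lemma continuous_eval_at: "continuous_on A (eval_at f)"
  by (rule has_derivative_continuous_on[OF has_derivative_at_withinI[OF has_derivative_eval_at]])

text \<open>A derivative is unique, and its coefficients are its values at the axis vectors.
  Differentiation rules for \<open>partial_deriv\<close> can thus be imported from analysis at the
  level of values.\<close>

lemma eval_partial_deriv_unique:
  assumes "(eval_at f has_derivative (\<lambda>h. \<Sum>i\<in>UNIV. A i * h $ i)) (at x)"
  shows "eval_at (partial_deriv i f) x = A i"
proof -
  have "(\<lambda>h. \<Sum>i\<in>UNIV. eval_at (partial_deriv i f) x * h $ i) = (\<lambda>h. \<Sum>i\<in>UNIV. A i * h $ i)"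
    by (rule has_derivative_unique[OF has_derivative_eval_at assms])
  from fun_cong[OF this, of "axis i 1"] show ?thesis
    by (simp add: axis_def if_distrib cong: if_cong)
qed

lemma eval_partial_deriv_mult:
  "eval_at (partial_deriv i (f * g)) x =
     eval_at (partial_deriv i f) x * eval_at g x + eval_at f x * eval_at (partial_deriv i g) x"
proof (rule eval_partial_deriv_unique)
  have e: "eval_at (f * g) = (\<lambda>x. eval_at f x * eval_at g x)" by auto
  show "(eval_at (f * g) has_derivative (\<lambda>h. \<Sum>i\<in>UNIV. (eval_at (partial_deriv i f) x * eval_at g x + eval_at f x * eval_at (partial_deriv i g) x) * h $ i)) (at x)"
    unfolding e using has_derivative_mult[OF has_derivative_eval_at[of f x] has_derivative_eval_at[of g x]]
    by (simp add: sum_distrib_left sum_distrib_right sum.distrib algebra_simps)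
qed

section \<open>Homogeneous forms and Euler's formula\<close>

lemma graded_part_0 [simp]: "0 \<in> graded_part j"
  by (simp add: graded_part_def)

lemma graded_part_add: "f \<in> graded_part j \<Longrightarrow> g \<in> graded_part j \<Longrightarrow> f + g \<in> graded_part j"
  using keys_add[of f g] by (auto simp: graded_part_def)

lemma graded_part_uminus: "f \<in> graded_part j \<Longrightarrow> - f \<in> graded_part j"
  by (auto simp: graded_part_def in_keys_iff)

lemma graded_part_diff: "f \<in> graded_part j \<Longrightarrow> g \<in> graded_part j \<Longrightarrow> f - g \<in> graded_part j"
  using graded_part_add[of f j "-g"] graded_part_uminus[of g j] by simp

lemma graded_part_sum: "(\<And>a. a \<in> A \<Longrightarrow> f a \<in> graded_part j) \<Longrightarrow> sum f A \<in> graded_part j"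
  by (induction A rule: infinite_finite_induct) (auto intro: graded_part_add)

lemma mono_degree_add: "mono_degree (s + t) = mono_degree s + mono_degree t"
  by (simp add: mono_degree_def lookup_add sum.distrib)

lemma mono_degree_single [simp]: "mono_degree (Poly_Mapping.single i n) = n"
  by (simp add: mono_degree_def lookup_single when_def)

lemma graded_part_mult: "f \<in> graded_part i \<Longrightarrow> g \<in> graded_part j \<Longrightarrow> f * g \<in> graded_part (i + j)"
  using keys_mult[of f g] by (fastforce simp: graded_part_def mono_degree_add)

lemma graded_part_single: "c \<noteq> 0 \<longrightarrow> int (mono_degree t) = j \<Longrightarrow> Poly_Mapping.single t c \<in> graded_part j"
  by (auto simp: graded_part_def)

lemma graded_part_Const [simp]: "Const c \<in> graded_part 0"
  unfolding Const_def by (rule graded_part_single) (simp add: mono_degree_def)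

lemma graded_part_Const_mult: "f \<in> graded_part j \<Longrightarrow> Const c * f \<in> graded_part j"
  using graded_part_mult[OF graded_part_Const, of f j c] by simp

lemma graded_part_Var [simp]: "Var i \<in> graded_part 1"
  unfolding Var_def by (rule graded_part_single) simp

lemma graded_part_1 [simp]: "1 \<in> graded_part 0"
  using graded_part_Const[of 1] by (simp add: Const_def)

lemma graded_part_prod:
  "(\<And>a. a \<in> A \<Longrightarrow> F a \<in> graded_part (j a)) \<Longrightarrow> (\<Prod>a\<in>A. F a) \<in> graded_part (\<Sum>a\<in>A. j a)"
  by (induction A rule: infinite_finite_induct) (auto intro: graded_part_mult)

lemma graded_part_partial_deriv: "f \<in> graded_part j \<Longrightarrow> partial_deriv i f \<in> graded_part (j - 1)"
  unfolding partial_deriv_def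
proof (intro graded_part_sum graded_part_single impI)
  fix t assume f: "f \<in> graded_part j" and t: "t \<in> Poly_Mapping.keys f"
    and nz: "of_nat (Poly_Mapping.lookup t i) * Poly_Mapping.lookup f t \<noteq> 0"
  have "t = (t - Poly_Mapping.single i 1) + Poly_Mapping.single i 1"
    using nz by (intro poly_mapping_eqI) (auto simp: lookup_add lookup_minus lookup_single when_def)
  hence "mono_degree t = mono_degree (t - Poly_Mapping.single i 1) + 1"
    by (metis mono_degree_add mono_degree_single)
  thus "int (mono_degree (t - Poly_Mapping.single i 1)) = j - 1"
    using f t by (auto simp: graded_part_def)
qed

lemma Var_mult_partial_deriv_single:
  "Var i * partial_deriv i (Poly_Mapping.single t c) = Poly_Mapping.single t (of_nat (Poly_Mapping.lookup t i) * c)"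
proof (cases "Poly_Mapping.lookup t i = 0")
  case False
  hence "Poly_Mapping.single i 1 + (t - Poly_Mapping.single i 1) = t"
    by (intro poly_mapping_eqI) (auto simp: lookup_add lookup_minus lookup_single when_def)
  thus ?thesis by (simp add: partial_deriv_single Var_def mult_single)
qed (simp add: partial_deriv_single)

lemma euler_formula:
  assumes "f \<in> graded_part (int m)"
  shows "(\<Sum>i\<in>UNIV. Var i * partial_deriv i f) = Const (of_nat m) * f"
proof -
  have s: "(\<Sum>i\<in>UNIV. Var i * partial_deriv i (Poly_Mapping.single t c)) = Const (of_nat m) * Poly_Mapping.single t c"
    if "mono_degree t = m" for t c
  proof -
    have "(\<Sum>i\<in>UNIV. Var i * partial_deriv i (Poly_Mapping.single t c)) =
        Poly_Mapping.single t ((\<Sum>i\<in>UNIV. of_nat (Poly_Mapping.lookup t i)) * c)"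
      unfolding Var_mult_partial_deriv_single by (simp add: sum_3 distrib_right single_add)
    also have "\<dots> = Poly_Mapping.single t (of_nat m * c)" using that by (simp add: mono_degree_def flip: of_nat_sum)
    also have "\<dots> = Const (of_nat m) * Poly_Mapping.single t c" unfolding Const_def mult_single by simp
    finally show ?thesis .
  qed
  have pd: "partial_deriv i (sum F A) = (\<Sum>a\<in>A. partial_deriv i (F a))" for F :: "mono3 \<Rightarrow> poly3" and A i
    by (induction A rule: infinite_finite_induct) auto
  have "(\<Sum>i\<in>UNIV. Var i * partial_deriv i f) = (\<Sum>i\<in>UNIV. Var i * partial_deriv i (\<Sum>t\<in>Poly_Mapping.keys f. Poly_Mapping.single t (Poly_Mapping.lookup f t)))"
    by (rule arg_cong[OF poly_mapping_eq_sum_single[of f]])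
  also have "\<dots> = (\<Sum>t\<in>Poly_Mapping.keys f. \<Sum>i\<in>UNIV. Var i * partial_deriv i (Poly_Mapping.single t (Poly_Mapping.lookup f t)))"
    unfolding pd sum_distrib_left by (rule sum.swap)
  also have "\<dots> = (\<Sum>t\<in>Poly_Mapping.keys f. Const (of_nat m) * Poly_Mapping.single t (Poly_Mapping.lookup f t))"
    using assms by (intro sum.cong refl s) (auto simp: graded_part_def)
  also have "\<dots> = Const (of_nat m) * f"
    unfolding sum_distrib_left[symmetric] by (rule arg_cong[OF poly_mapping_eq_sum_single[of f, symmetric]])
  finally show ?thesis .
qed

lemma eval_euler:
  assumes "f \<in> graded_part (int m)"
  shows "(\<Sum>i\<in>UNIV. x $ i * eval_at (partial_deriv i f) x) = of_nat m * eval_at f x"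
  using arg_cong[OF euler_formula[OF assms], of "\<lambda>g. eval_at g x"] by simp

lemma eval_at_smult:
  assumes "f \<in> graded_part (int m)"
  shows "eval_at f (c *s x) = c ^ m * eval_at f x"
proof -
  have "(\<Prod>i\<in>UNIV. (c * x $ i) ^ Poly_Mapping.lookup t i) = c ^ m * (\<Prod>i\<in>UNIV. x $ i ^ Poly_Mapping.lookup t i)"
    if "t \<in> Poly_Mapping.keys f" for t
  proof -
    have "mono_degree t = m" using that assms by (auto simp: graded_part_def)
    thus ?thesis unfolding mono_degree_def by (simp add: power_mult_distrib prod.distrib flip: power_sum)
  qed
  thus ?thesis unfolding eval_at_def eval_hom_def
    by (simp add: sum_distrib_left mult_ac cong: sum.cong)
qed

text \<open>Kronecker substitution \<open>x\<^sub>i \<mapsto> T ^ B\<^sup>i\<close>: for large \<open>B\<close>, distinct monomials get distinct exponents.\<close>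

definition kron :: "nat \<Rightarrow> 3 \<Rightarrow> nat" where
  "kron B i = (if i = 1 then 1 else if i = 2 then B else B^2)"

text \<open>The three exponents are the digits in base \<open>B\<close> of the weighted sum, and are
  recovered one by one modulo \<open>B\<close>.\<close>

lemma kron_inj:
  assumes "\<And>i. Poly_Mapping.lookup s i < B" "\<And>i. Poly_Mapping.lookup t i < B"
    and "(\<Sum>i\<in>UNIV. kron B i * Poly_Mapping.lookup s i) = (\<Sum>i\<in>UNIV. kron B i * Poly_Mapping.lookup t i)"
  shows "s = (t :: mono3)"
proof -
  let ?s = "Poly_Mapping.lookup s" and ?t = "Poly_Mapping.lookup t"
  have B: "B > 0" using assms(1)[of 1] by auto
  have e: "?s 1 + B * (?s 2 + B * ?s 3) = ?t 1 + B * (?t 2 + B * ?t 3)"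
    using assms(3) by (simp add: sum_3 kron_def power2_eq_square algebra_simps)
  have 1: "?s 1 = ?t 1" using arg_cong[OF e, of "\<lambda>n. n mod B"] assms(1,2)[of 1] by simp
  hence e2: "?s 2 + B * ?s 3 = ?t 2 + B * ?t 3" using e B by simp
  have 2: "?s 2 = ?t 2" using arg_cong[OF e2, of "\<lambda>n. n mod B"] assms(1,2)[of 2] by simp
  hence 3: "?s 3 = ?t 3" using e2 B by simp
  show ?thesis
  proof (rule poly_mapping_eqI)
    fix i :: 3 show "?s i = ?t i" using 1 2 3 exhaust_3[of i] by auto
  qed
qed

definition kron_poly :: "nat \<Rightarrow> poly3 \<Rightarrow> complex poly" where
  "kron_poly B = eval_hom (\<lambda>c. [:c:]) (\<lambda>i. monom 1 (kron B i))"

lemma poly_kron_poly: "poly (kron_poly B f) z = eval_at f (\<chi> i. z ^ kron B i)"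
  by (simp add: kron_poly_def eval_at_def eval_hom_def poly_sum poly_prod poly_monom)

lemma kron_poly_nonzero:
  assumes "f \<noteq> 0" shows "\<exists>B0. \<forall>B\<ge>B0. kron_poly B f \<noteq> 0"
proof -
  \<comment> \<open>Strictly larger than every exponent that occurs in \<open>f\<close>.\<close>
  define B0 where "B0 = Suc (\<Sum>t\<in>Poly_Mapping.keys f. mono_degree t)"
  have lt: "Poly_Mapping.lookup t i < B" if "t \<in> Poly_Mapping.keys f" "B \<ge> B0" for t i B
  proof -
    have "Poly_Mapping.lookup t i \<le> mono_degree t"
      unfolding mono_degree_def by (rule member_le_sum) auto
    also have "\<dots> \<le> (\<Sum>t\<in>Poly_Mapping.keys f. mono_degree t)"
      using that(1) by (intro member_le_sum) auto
    finally show ?thesis using that(2) by (simp add: B0_def)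
  qed
  obtain t where t: "t \<in> Poly_Mapping.keys f" using assms by (metis poly_mapping_eqI lookup_zero in_keys_iff)
  have "kron_poly B f \<noteq> 0" if B: "B \<ge> B0" for B
  proof -
    define e where "e t = (\<Sum>i\<in>UNIV. kron B i * Poly_Mapping.lookup t i)" for t :: mono3
    have m: "(\<Prod>i\<in>UNIV. (monom 1 (kron B i) :: complex poly) ^ Poly_Mapping.lookup s i) = monom 1 (e s)" for s
      by (simp add: sum_3 prod_UNIV_3 e_def monom_power mult_monom)
    have "kron_poly B f = (\<Sum>s\<in>Poly_Mapping.keys f. monom (Poly_Mapping.lookup f s) (e s))"
      unfolding kron_poly_def eval_hom_def m by (simp add: smult_monom)
    hence "coeff (kron_poly B f) (e t) = (\<Sum>s\<in>Poly_Mapping.keys f. if e s = e t then Poly_Mapping.lookup f s else 0)"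
      by (simp add: coeff_sum)
    also have "\<dots> = (\<Sum>s\<in>Poly_Mapping.keys f. if s = t then Poly_Mapping.lookup f s else 0)"
      using kron_inj[of _ B t] lt B t by (intro sum.cong) (auto simp: e_def)
    also have "\<dots> = Poly_Mapping.lookup f t" using t by simp
    finally show ?thesis using t by (auto simp: in_keys_iff)
  qed
  thus ?thesis by blast
qed

text \<open>One base \<open>B\<close> can serve all members of the finite family. The product of
  their Kronecker images is then a nonzero polynomial in one variable, and any \<open>z\<close> that
  is not a root gives the point with coordinates \<open>z\<close>, \<open>z ^ B\<close>,
  \<open>z ^ (B^2)\<close>.\<close>

lemma prod_eval_nonzero:
  assumes "finite A" "\<And>a. a \<in> A \<Longrightarrow> F a \<noteq> (0::poly3)"
  shows "\<exists>p. \<forall>a\<in>A. eval_at (F a) p \<noteq> 0"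
proof -
  have "\<exists>B0. \<forall>a\<in>A. \<forall>B\<ge>B0. kron_poly B (F a) \<noteq> 0"
  proof -
    have "\<forall>a\<in>A. \<exists>B0. \<forall>B\<ge>B0. kron_poly B (F a) \<noteq> 0" using kron_poly_nonzero assms(2) by blast
    then obtain b where b: "\<And>a B. a \<in> A \<Longrightarrow> B \<ge> b a \<Longrightarrow> kron_poly B (F a) \<noteq> 0" by metis
    show ?thesis
      using assms(1) b by (intro exI[of _ "\<Sum>a\<in>A. b a"]) (meson le_trans member_le_sum zero_le)
  qed
  then obtain B where B: "\<And>a. a \<in> A \<Longrightarrow> kron_poly B (F a) \<noteq> 0" by blast
  have "(\<Prod>a\<in>A. kron_poly B (F a)) \<noteq> 0" using assms(1) B by simp
  then obtain z where "poly (\<Prod>a\<in>A. kron_poly B (F a)) z \<noteq> 0" using poly_all_0_iff_0 by blast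
  thus ?thesis using assms(1) by (auto simp: poly_prod poly_kron_poly)
qed

lemma poly3_eq_0_iff: "f = 0 \<longleftrightarrow> (\<forall>p. eval_at f p = 0)"
  using prod_eval_nonzero[of "{f}" "\<lambda>f. f"] by auto

section \<open>Stokes' theorem and vanishing of the divergence\<close>

text \<open>The difference quotients \<open>F n\<close> have integral 0 because Lebesgue measure is
  translation invariant. They converge pointwise to the derivative and, by the mean value
  inequality, are bounded by a constant on one fixed ball outside which they vanish, so dominated
  convergence applies.\<close>

lemma integral_directional_derivative_eq_0:
  fixes \<Phi> :: "'a::euclidean_space \<Rightarrow> complex"
  assumes d: "\<And>x. (\<Phi> has_derivative \<Phi>' x) (at x)"
    and cont: "continuous_on UNIV (\<lambda>x. \<Phi>' x e)"
    and supp: "\<And>x. norm x > R \<Longrightarrow> \<Phi> x = 0"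
  shows "integrable lborel (\<lambda>x. \<Phi>' x e)" "(\<integral>x. \<Phi>' x e \<partial>lborel) = 0"
proof -
  have c\<Phi>: "continuous_on UNIV \<Phi>"
    by (rule has_derivative_continuous_on[OF has_derivative_at_withinI[OF d]])
  have [measurable]: "\<Phi> \<in> borel_measurable borel" "(\<lambda>x. \<Phi>' x e) \<in> borel_measurable borel"
    using c\<Phi> cont by (auto intro: borel_measurable_continuous_onI)
  have line: "((\<lambda>t. \<Phi> (x + t *\<^sub>R e)) has_vector_derivative \<Phi>' (x + t *\<^sub>R e) e) (at t)" for x t
  proof -
    have "((\<lambda>t. x + t *\<^sub>R e) has_vector_derivative e) (at t)"
      by (auto intro!: derivative_eq_intros)
    from vector_derivative_diff_chain_within[OF this has_derivative_at_withinI[OF d]]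
    show ?thesis by (simp add: o_def)
  qed
  \<comment> \<open>The summand \<open>norm e\<close> makes room for the translates, which are all
    by vectors of length at most \<open>norm e\<close>.\<close>
  define R' where "R' = \<bar>R\<bar> + norm e + 1"
  have supp': "\<Phi>' x e = 0" if "norm x > R" for x
  proof -
    have op: "open {y::'a. norm y > R}" by (intro open_Collect_less continuous_intros)
    have "((\<lambda>x. 0) has_derivative \<Phi>' x) (at x)"
      by (rule has_derivative_transform_within_open[OF d op]) (use that supp in auto)
    from has_derivative_unique[OF this has_derivative_const] show ?thesis by (metis)
  qed
  have "bounded ((\<lambda>x. \<Phi>' x e) ` cball 0 \<bar>R\<bar>)"
    by (intro compact_imp_bounded compact_continuous_image continuous_on_subset[OF cont]) auto
  then obtain M0 where M0: "\<And>x. norm x \<le> \<bar>R\<bar> \<Longrightarrow> norm (\<Phi>' x e) \<le> M0"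
    unfolding bounded_iff by (metis image_eqI mem_cball_0)
  define M where "M = max M0 0"
  have M: "norm (\<Phi>' x e) \<le> M" for x
    using M0[of x] supp'[of x] by (cases "norm x \<le> \<bar>R\<bar>") (auto simp: M_def)
  have M_nonneg: "M \<ge> 0" by (simp add: M_def)
  define F where "F n x = real (Suc n) *\<^sub>R (\<Phi> (x + (1 / real (Suc n)) *\<^sub>R e) - \<Phi> x)" for n x
  have mvt: "norm (\<Phi> (x + h *\<^sub>R e) - \<Phi> x) \<le> h * M" if "h > 0" for h x
  proof -
    have "norm ((\<lambda>t. \<Phi> (x + t *\<^sub>R e)) h - (\<lambda>t. \<Phi> (x + t *\<^sub>R e)) 0) \<le> M * norm (h - 0)"
    proof (rule differentiable_bound[of "{0..h}" _ "\<lambda>t s. s *\<^sub>R \<Phi>' (x + t *\<^sub>R e) e"])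
      fix t assume "t \<in> {0..h}"
      show "((\<lambda>t. \<Phi> (x + t *\<^sub>R e)) has_derivative (\<lambda>s. s *\<^sub>R \<Phi>' (x + t *\<^sub>R e) e)) (at t within {0..h})"
        using line[of x t] unfolding has_vector_derivative_def by (rule has_derivative_at_withinI)
      show "onorm (\<lambda>s. s *\<^sub>R \<Phi>' (x + t *\<^sub>R e) e) \<le> M"
        by (intro onorm_bound M_nonneg) (auto simp: mult.commute[of M] intro!: mult_left_mono M)
    qed (use that in auto)
    thus ?thesis using that by (simp add: mult.commute)
  qed
  have Fb: "norm (F n x) \<le> M * indicator (cball 0 R') x" for n x
  proof (cases "norm x \<le> R'")
    case True
    have "norm (F n x) \<le> real (Suc n) * (1 / real (Suc n) * M)"
      unfolding F_def norm_scaleR by (intro mult_mono mvt) auto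
    thus ?thesis using True by (simp add: mem_cball)
  next
    case False
    have "norm ((1 / real (Suc n)) *\<^sub>R e) \<le> norm e" by (simp add: divide_le_eq mult_le_cancel_left1)
    hence "norm (x + (1 / real (Suc n)) *\<^sub>R e) > R"
      using False norm_diff_ineq[of x "(1 / real (Suc n)) *\<^sub>R e"] unfolding R'_def by linarith
    moreover have "norm x > R" using False unfolding R'_def by (smt (verit) norm_ge_zero)
    ultimately show ?thesis using M_nonneg by (simp add: F_def supp)
  qed
  have lim: "(\<lambda>n. F n x) \<longlonglongrightarrow> \<Phi>' x e" for x
  proof -
    let ?\<phi> = "\<lambda>t. \<Phi> (x + t *\<^sub>R e)"
    have l0: "((\<lambda>h. norm (?\<phi> (0 + h) - ?\<phi> 0 - h *\<^sub>R \<Phi>' x e) / norm h) \<longlongrightarrow> 0) (at 0)"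
      using line[of x 0] unfolding has_vector_derivative_def has_derivative_at by simp
    have f0: "filterlim (\<lambda>n. 1 / real (Suc n)) (at 0) sequentially"
      using LIMSEQ_inverse_real_of_nat by (simp add: filterlim_at inverse_eq_divide del: of_nat_Suc)
    have "(\<lambda>n. norm (?\<phi> (0 + 1 / real (Suc n)) - ?\<phi> 0 - (1 / real (Suc n)) *\<^sub>R \<Phi>' x e) / norm (1 / real (Suc n))) \<longlonglongrightarrow> 0"
      using filterlim_compose[OF l0 f0] .
    moreover have "norm (?\<phi> (0 + 1 / real (Suc n)) - ?\<phi> 0 - (1 / real (Suc n)) *\<^sub>R \<Phi>' x e) / norm (1 / real (Suc n)) = norm (F n x - \<Phi>' x e)" for n
    proof -
      have "F n x - \<Phi>' x e = real (Suc n) *\<^sub>R (?\<phi> (0 + 1 / real (Suc n)) - ?\<phi> 0 - (1 / real (Suc n)) *\<^sub>R \<Phi>' x e)"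
        by (simp add: F_def scaleR_diff_right del: of_nat_Suc)
      thus ?thesis by (simp del: of_nat_Suc)
    qed
    ultimately have "(\<lambda>n. norm (F n x - \<Phi>' x e)) \<longlonglongrightarrow> 0" by simp
    thus ?thesis by (simp add: tendsto_norm_zero_iff LIM_zero_iff)
  qed
  have [measurable]: "F n \<in> borel_measurable borel" for n unfolding F_def[abs_def] by measurable
  have domint: "integrable lborel (\<lambda>x::'a. M * indicator (cball 0 R') x)"
    using emeasure_lborel_cball_finite[of "0::'a" R'] by (intro integrable_mult_right integrable_real_indicator) auto
  have A: "integrable lborel (\<lambda>x. \<Phi>' x e)"
    using domint lim Fb by (intro integrable_dominated_convergence[where s = F and w = "\<lambda>x::'a. M * indicator (cball 0 R') x"]) auto
  have B: "(\<lambda>n. \<integral>x. F n x \<partial>lborel) \<longlonglongrightarrow> (\<integral>x. \<Phi>' x e \<partial>lborel)"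
    using domint lim Fb by (intro integral_dominated_convergence[where w = "\<lambda>x::'a. M * indicator (cball 0 R') x"]) auto
  have \<Phi>int: "integrable lborel \<Phi>"
  proof -
    have "bounded (\<Phi> ` cball 0 \<bar>R\<bar>)"
      by (intro compact_imp_bounded compact_continuous_image continuous_on_subset[OF c\<Phi>]) auto
    then obtain N0 where N0: "\<And>x. norm x \<le> \<bar>R\<bar> \<Longrightarrow> norm (\<Phi> x) \<le> N0"
      unfolding bounded_iff by (metis image_eqI mem_cball_0)
    have "norm (\<Phi> x) \<le> max N0 0 * indicator (cball 0 \<bar>R\<bar>) x" for x
      using N0[of x] supp[of x] by (cases "norm x \<le> \<bar>R\<bar>") (auto simp: mem_cball)
    moreover have "integrable lborel (\<lambda>x::'a. max N0 0 * indicator (cball 0 \<bar>R\<bar>) x)"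
      using emeasure_lborel_cball_finite[of "0::'a" "\<bar>R\<bar>"] by (intro integrable_mult_right integrable_real_indicator) auto
    ultimately show ?thesis by (elim Bochner_Integration.integrable_bound) (auto simp: abs_mult intro!: AE_I2)
  qed
  have tr: "integrable lborel (\<lambda>x. \<Phi> (x + a))" "(\<integral>x. \<Phi> (x + a) \<partial>lborel) = (\<integral>x. \<Phi> x \<partial>lborel)" for a
  proof -
    have e: "lborel = distr lborel borel ((+) a)" by (simp add: lborel_distr_plus)
    have i: "integrable (distr lborel borel ((+) a)) \<Phi>" using \<Phi>int e by simp
    show "integrable lborel (\<lambda>x. \<Phi> (x + a))"
      using i by (subst (asm) integrable_distr_eq) (auto simp: add.commute)
    have "(\<integral>x. \<Phi> x \<partial>lborel) = (\<integral>x. \<Phi> x \<partial>(distr lborel borel ((+) a)))" using e by simp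
    also have "\<dots> = (\<integral>x. \<Phi> (a + x) \<partial>lborel)" by (subst integral_distr) auto
    finally show "(\<integral>x. \<Phi> (x + a) \<partial>lborel) = (\<integral>x. \<Phi> x \<partial>lborel)" by (simp add: add.commute)
  qed
  have "(\<integral>x. F n x \<partial>lborel) = 0" for n
    unfolding F_def using tr \<Phi>int by simp
  with B have "(\<integral>x. \<Phi>' x e \<partial>lborel) = 0" by (simp add: LIMSEQ_const_iff)
  with A show "integrable lborel (\<lambda>x. \<Phi>' x e)" "(\<integral>x. \<Phi>' x e \<partial>lborel) = 0" by auto
qed

text \<open>\<open>A\<close> and \<open>B\<close> are the Wirtinger derivatives of \<open>F\<close>
  at \<open>x\<close>: the coefficients of the complex linear and of the antilinear part of its real
  derivative. Only the linear part is integrated by parts, so that conjugates of holomorphic factors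
  behave like constants.\<close>

definition wirtinger :: "(complex^3 \<Rightarrow> complex) \<Rightarrow> complex^3 \<Rightarrow> (3 \<Rightarrow> complex) \<Rightarrow> (3 \<Rightarrow> complex) \<Rightarrow> bool" where
  "wirtinger F x A B \<longleftrightarrow> (F has_derivative (\<lambda>h. \<Sum>i\<in>UNIV. A i * h $ i + B i * cnj (h $ i))) (at x)"

lemma wirtinger_eval: "wirtinger (eval_at f) x (\<lambda>i. eval_at (partial_deriv i f) x) (\<lambda>i. 0)"
  using has_derivative_eval_at[of f x] by (simp add: wirtinger_def)

lemma wirtinger_cnj: "wirtinger F x A B \<Longrightarrow> wirtinger (\<lambda>x. cnj (F x)) x (\<lambda>i. cnj (B i)) (\<lambda>i. cnj (A i))"
  unfolding wirtinger_def by (drule has_derivative_cnj) (simp add: add.commute)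

lemma wirtinger_mult:
  assumes "wirtinger F x A B" "wirtinger G x A' B'"
  shows "wirtinger (\<lambda>x. F x * G x) x (\<lambda>i. A i * G x + F x * A' i) (\<lambda>i. B i * G x + F x * B' i)"
  using has_derivative_mult[OF assms[unfolded wirtinger_def]] unfolding wirtinger_def
  by (simp add: sum_distrib_left sum_distrib_right sum.distrib algebra_simps)

lemma wirtinger_diff:
  assumes "wirtinger F x A B" "wirtinger G x A' B'"
  shows "wirtinger (\<lambda>x. F x - G x) x (\<lambda>i. A i - A' i) (\<lambda>i. B i - B' i)"
  using has_derivative_diff[OF assms[unfolded wirtinger_def]] unfolding wirtinger_def
  by (simp add: sum_subtractf[symmetric] algebra_simps)

lemma wirtinger_sum:
  assumes "\<And>j. j \<in> J \<Longrightarrow> wirtinger (F j) x (A j) (B j)"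
  shows "wirtinger (\<lambda>x. \<Sum>j\<in>J. F j x) x (\<lambda>i. \<Sum>j\<in>J. A j i) (\<lambda>i. \<Sum>j\<in>J. B j i)"
proof -
  have "((\<lambda>x. \<Sum>j\<in>J. F j x) has_derivative (\<lambda>h. \<Sum>j\<in>J. \<Sum>i\<in>UNIV. A j i * h $ i + B j i * cnj (h $ i))) (at x)"
    using assms by (intro has_derivative_sum) (auto simp: wirtinger_def)
  moreover have "(\<Sum>j\<in>J. \<Sum>i\<in>UNIV. A j i * h $ i + B j i * cnj (h $ i)) = (\<Sum>i\<in>UNIV. (\<Sum>j\<in>J. A j i) * h $ i + (\<Sum>j\<in>J. B j i) * cnj (h $ i))" for h
    by (subst sum.swap) (simp add: sum_distrib_right sum.distrib)
  ultimately show ?thesis unfolding wirtinger_def by simp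
qed

text \<open>Since \<open>u\<close> is real, so is its derivative \<open>L\<close>: the imaginary
  part of \<open>L\<close> is the derivative of the zero function. Hence \<open>c * Re (L h)\<close>
  is \<open>c * L h\<close>, and the real chain rule takes Wirtinger form.\<close>

lemma wirtinger_real_compose:
  fixes u :: "complex^3 \<Rightarrow> real"
  assumes u: "wirtinger (\<lambda>x. complex_of_real (u x)) x A B" and \<phi>: "(\<phi> has_real_derivative c) (at (u x))"
  shows "wirtinger (\<lambda>x. complex_of_real (\<phi> (u x))) x (\<lambda>i. of_real c * A i) (\<lambda>i. of_real c * B i)"
proof -
  define L where "L h = (\<Sum>i\<in>UNIV. A i * h $ i + B i * cnj (h $ i))" for h
  have d: "((\<lambda>x. complex_of_real (u x)) has_derivative L) (at x)" using u by (simp add: wirtinger_def L_def[abs_def])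
  have re: "(u has_derivative (\<lambda>h. Re (L h))) (at x)" using has_derivative_Re[OF d] by simp
  have "((\<lambda>x. 0) has_derivative (\<lambda>h. Im (L h))) (at x)" using has_derivative_Im[OF d] by simp
  from has_derivative_unique[OF this has_derivative_const] have im: "Im (L h) = 0" for h by metis
  have "((\<lambda>x. \<phi> (u x)) has_derivative (\<lambda>h. c * Re (L h))) (at x)"
    using has_derivative_compose[OF re, of \<phi> "\<lambda>h. c * h"] \<phi> by (simp add: has_field_derivative_def)
  from has_derivative_of_real[OF this]
  have "((\<lambda>x. complex_of_real (\<phi> (u x))) has_derivative (\<lambda>h. of_real (c * Re (L h)))) (at x)" .
  moreover have "(\<lambda>h. of_real (c * Re (L h))) = (\<lambda>h. \<Sum>i\<in>UNIV. of_real c * A i * h $ i + of_real c * B i * cnj (h $ i))"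
  proof
    fix h have "of_real (c * Re (L h)) = of_real c * L h" using im[of h] by (simp add: complex_eq_iff)
    thus "of_real (c * Re (L h)) = (\<Sum>i\<in>UNIV. of_real c * A i * h $ i + of_real c * B i * cnj (h $ i))"
      by (simp add: L_def sum_distrib_left distrib_left mult.assoc)
  qed
  ultimately show ?thesis unfolding wirtinger_def by simp
qed

text \<open>The coefficient \<open>A x i\<close> is half of the derivative along
  \<open>axis i 1\<close> minus \<i> times the derivative along \<open>axis i \<i>\<close>, and both
  real directional derivatives have integral 0.\<close>

lemma integral_wirtinger_eq_0:
  assumes w: "\<And>x. wirtinger F x (A x) (B x)"
    and cA: "continuous_on UNIV (\<lambda>x. A x i)" and cB: "continuous_on UNIV (\<lambda>x. B x i)"
    and supp: "\<And>x. norm x > R \<Longrightarrow> F x = 0"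
  shows "integrable lborel (\<lambda>x. A x i)" "(\<integral>x. A x i \<partial>lborel) = 0"
proof -
  define L where "L x h = (\<Sum>i\<in>UNIV. A x i * h $ i + B x i * cnj (h $ i))" for x and h :: "complex^3"
  have d: "(F has_derivative L x) (at x)" for x using w[of x] by (simp add: wirtinger_def L_def[abs_def])
  have La: "L x (axis i c) = A x i * c + B x i * cnj c" for x c
  proof -
    have "L x (axis i c) = (\<Sum>j\<in>UNIV. if j = i then A x i * c + B x i * cnj c else 0)"
      unfolding L_def by (intro sum.cong) (auto simp: axis_def)
    thus ?thesis by simp
  qed
  have c: "continuous_on UNIV (\<lambda>x. L x (axis i c))" for c
    unfolding La by (intro continuous_intros cA cB)
  note I = integral_directional_derivative_eq_0[OF d c supp]
  have e: "A x i = (L x (axis i 1) - \<i> * L x (axis i \<i>)) / 2" for x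
    by (simp add: La algebra_simps)
  show "integrable lborel (\<lambda>x. A x i)" unfolding e using I(1) by (intro integrable_divide integrable_diff integrable_mult_right) auto
  show "(\<integral>x. A x i \<partial>lborel) = 0" unfolding e using I by simp
qed


text \<open>Squaring the positive part makes the cutoff in Stokes' theorem continuously
  differentiable, and one derivative is all that the integration by parts takes.\<close>

lemma has_real_derivative_max_0_power2:
  "((\<lambda>y. (max 0 y)^2) has_real_derivative 2 * max 0 y) (at (y::real))"
proof (cases y "0::real" rule: linorder_cases)
  case greater
  have "((\<lambda>y. y^2) has_real_derivative 2 * y) (at y)" by (auto intro!: derivative_eq_intros)
  hence "((\<lambda>y. (max 0 y)^2) has_real_derivative 2 * y) (at y)"
    by (rule has_field_derivative_transform_within_open[where S = "{0<..}"]) (use greater in auto)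
  thus ?thesis using greater by simp
next
  case less
  have "((\<lambda>y. 0) has_real_derivative 0) (at y)" by simp
  hence "((\<lambda>y. (max 0 y)^2) has_real_derivative 0) (at y)"
    by (rule has_field_derivative_transform_within_open[where S = "{..<0}"]) (use less in auto)
  thus ?thesis using less by simp
next
  case equal
  have "((\<lambda>h::real. (max 0 h)^2 / h) \<longlongrightarrow> 0) (at 0)"
  proof (rule Lim_null_comparison)
    have "norm ((max 0 h)^2 / h) \<le> \<bar>h\<bar>" for h :: real
      by (cases h "0::real" rule: linorder_cases) (auto simp: power2_eq_square)
    thus "\<forall>\<^sub>F h in at 0. norm ((max 0 h)^2 / h) \<le> \<bar>h\<bar>" by simp
    show "((\<lambda>h::real. \<bar>h\<bar>) \<longlongrightarrow> 0) (at 0)" by (rule tendsto_eq_intros refl tendsto_ident_at)+ simp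
  qed
  thus ?thesis using equal by (simp add: DERIV_def)
qed

lemma continuous_nonneg_integral_eq_0:
  fixes g :: "'a::euclidean_space \<Rightarrow> real"
  assumes c: "continuous_on UNIV g" and nn: "\<And>x. g x \<ge> 0" and i: "integrable lborel g"
    and z: "(\<integral>x. g x \<partial>lborel) \<le> 0"
  shows "g x = 0"
proof (rule ccontr)
  assume "g x \<noteq> 0"
  define U where "U = {x. g x > 0}"
  have U: "open U" unfolding U_def by (intro open_Collect_less continuous_intros c)
  have "x \<in> U" using \<open>g x \<noteq> 0\<close> nn[of x] by (simp add: U_def)
  hence nU: "\<not> negligible U" using open_not_negligible[OF U] by blast
  have "(\<integral>x. g x \<partial>lborel) = 0" using z Bochner_Integration.integral_nonneg[of lborel g] nn by (intro antisym) auto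
  hence "AE x in lborel. g x = 0" using integral_nonneg_eq_0_iff_AE[OF i] nn by simp
  hence "AE x in lborel. x \<notin> U" by (auto simp: U_def elim: eventually_mono)
  hence "U \<in> null_sets lborel" using U by (subst AE_iff_null_sets) auto
  thus False using nU by (simp add: negligible_iff_null_sets null_sets_completionI)
qed

text \<open>
  Stokes' theorem is applied to the component \<open>P\<close> of \<open>|x|\<^sup>2 T\<close> orthogonal to \<open>x\<close>, with the weight
  \<open>\<psi>(|x|\<^sup>2) (|f|\<^sup>2 + \<epsilon>)\<^bsup>-s\<^esup>\<close> times the conjugate of \<open>div T\<close>. The cutoff contributes nothing since
  \<open>P\<close> is tangent to the spheres, and \<open>s m = \<rho> + 2\<close> makes the radial terms cancel as \<open>\<epsilon> \<rightarrow> 0\<close>,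
  so that the integral of \<open>\<psi> |f|\<^bsup>-2s\<^esup> |x|\<^sup>2 |div T|\<^sup>2\<close> is \<open>0\<close>.
\<close>

lemma divergence_eq_0:
  fixes f :: poly3 and T :: "3 \<Rightarrow> poly3" and m \<rho> :: nat
  assumes f: "f \<in> graded_part (int m)" and m: "m > 0"
    and T: "\<And>i. T i \<in> graded_part (int \<rho>)"
    and Tf: "\<And>x. (\<Sum>i\<in>UNIV. eval_at (T i) x * eval_at (partial_deriv i f) x) = 0"
    and ae: "AE x in lborel. 1 \<le> norm x \<and> norm x \<le> 2 \<longrightarrow> eval_at f x \<noteq> 0"
    and s: "s = (real \<rho> + 2) / real m"
    and fin: "(\<integral>\<^sup>+ x. indicator {x. 1 \<le> norm x \<and> norm x \<le> 2} x *
        (ennreal (norm (eval_at (\<Sum>i\<in>UNIV. partial_deriv i (T i)) x) * (\<Sum>i\<in>UNIV. norm (eval_at (T i) x)))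
          * pw (2 * s) (norm (eval_at f x))) \<partial>lborel) < \<infinity>"
  shows "(\<Sum>i\<in>UNIV. partial_deriv i (T i)) = 0"
proof -
  define \<delta> where "\<delta> = eval_at (\<Sum>i\<in>UNIV. partial_deriv i (T i))"
  define F where "F = eval_at f"
  define \<theta> where "\<theta> i = eval_at (T i)" for i
  define dF where "dF i = eval_at (partial_deriv i f)" for i
  define d\<theta> where "d\<theta> j i = eval_at (partial_deriv j (T i))" for i j
  define V :: "complex^3 \<Rightarrow> complex" where "V x = (\<Sum>i\<in>UNIV. x $ i * cnj (x $ i))" for x
  define S where "S x = (\<Sum>i\<in>UNIV. \<theta> i x * cnj (x $ i))" for x
  define P where "P i x = V x * \<theta> i x - x $ i * S x" for i x
  define v where "v x = (norm x)^2" for x :: "complex^3"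
  \<comment> \<open>Applied to \<open>t = v x\<close>, the squared norm, \<open>h\<close> is
    positive exactly for norms strictly between 1 and 2.\<close>
  define h where "h t = (t - 1) * (4 - t)" for t :: real
  define \<psi> where "\<psi> t = (max 0 (h t))^2" for t
  define \<psi>' where "\<psi>' t = 2 * max 0 (h t) * (5 - 2 * t)" for t
  have \<psi>d: "(\<psi> has_real_derivative \<psi>' t) (at t)" for t
  proof -
    have "(h has_real_derivative (5 - 2*t)) (at t)" unfolding h_def by (auto intro!: derivative_eq_intros)
    from DERIV_chain2[OF has_real_derivative_max_0_power2 this] show ?thesis by (simp add: \<psi>_def[abs_def] \<psi>'_def)
  qed
  have \<psi>_nn: "\<psi> t \<ge> 0" for t by (simp add: \<psi>_def)
  have Vv: "V x = of_real (v x)" for x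
    by (simp add: V_def v_def norm_vec_def L2_set_def sum_nonneg complex_norm_square[symmetric])
  have \<delta>e: "\<delta> x = (\<Sum>i\<in>UNIV. d\<theta> i i x)" for x by (simp add: \<delta>_def d\<theta>_def)
  have cont[continuous_intros]: "continuous_on A F" "continuous_on A (\<theta> i)" "continuous_on A (dF i)" "continuous_on A (d\<theta> i j)"
     "continuous_on A \<delta>" for A i j
    unfolding F_def \<theta>_def dF_def d\<theta>_def \<delta>_def by (rule continuous_eval_at)+
  have contV[continuous_intros]: "continuous_on A V" "continuous_on A v" "continuous_on A S" "continuous_on A (P i)" for A i
    unfolding P_def S_def V_def v_def by (intro continuous_intros; simp)+
  have eul: "(\<Sum>i\<in>UNIV. x $ i * dF i x) = of_nat m * F x" for x
    unfolding dF_def F_def by (rule eval_euler[OF f])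
  have eul\<theta>: "(\<Sum>j\<in>UNIV. x $ j * d\<theta> j i x) = of_nat \<rho> * \<theta> i x" for x i
    unfolding d\<theta>_def \<theta>_def by (rule eval_euler[OF T])
  have wx: "wirtinger (\<lambda>x. x $ i) x (\<lambda>j. if j = i then 1 else 0) (\<lambda>j. 0)" for i x
    unfolding wirtinger_def using bounded_linear_imp_has_derivative[OF bounded_linear_vec_nth[of i]]
    by (simp add: if_distrib[of "\<lambda>c. c * _"] cong: if_cong)
  have wcx: "wirtinger (\<lambda>x. cnj (x $ i)) x (\<lambda>j. 0) (\<lambda>j. if j = i then 1 else 0)" for i x
    using wirtinger_cnj[OF wx[of i x]] by (simp add: if_distrib[of cnj] cong: if_cong)
  have wV: "wirtinger V x (\<lambda>i. cnj (x $ i)) (\<lambda>i. x $ i)" for x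
    using wirtinger_sum[of UNIV "\<lambda>i x. x $ i * cnj (x $ i)", OF wirtinger_mult[OF wx wcx]] unfolding V_def[abs_def]
    by (simp add: if_distrib[of "\<lambda>c. c * _"] if_distrib[of "\<lambda>c. _ * c"] cong: if_cong)
  have w\<theta>: "wirtinger (\<theta> i) x (\<lambda>j. d\<theta> j i x) (\<lambda>j. 0)" for i x
    unfolding \<theta>_def d\<theta>_def by (rule wirtinger_eval)
  have wS: "wirtinger S x (\<lambda>j. \<Sum>i\<in>UNIV. d\<theta> j i x * cnj (x $ i)) (\<lambda>j. \<theta> j x)" for x
    using wirtinger_sum[of UNIV "\<lambda>i x. \<theta> i x * cnj (x $ i)", OF wirtinger_mult[OF w\<theta> wcx]] unfolding S_def[abs_def]
    by (simp add: if_distrib[of "\<lambda>c. c * _"] if_distrib[of "\<lambda>c. _ * c"] cong: if_cong)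
  define PA where "PA i x j = (cnj (x $ j) * \<theta> i x + V x * d\<theta> j i x) - ((if j = i then 1 else 0) * S x + x $ i * (\<Sum>k\<in>UNIV. d\<theta> j k x * cnj (x $ k)))" for i x j
  define PB where "PB i x j = (x $ j * \<theta> i x + V x * 0) - (0 * S x + x $ i * \<theta> j x)" for i x j
  have wP: "wirtinger (P i) x (PA i x) (PB i x)" for i x
    unfolding P_def[abs_def] PA_def PB_def by (intro wirtinger_diff wirtinger_mult wV w\<theta> wx wS)
  define w where "w \<epsilon> x = ((norm (F x))^2 + \<epsilon>) powr (-s)" for \<epsilon> x
  define w' where "w' \<epsilon> x = -s * ((norm (F x))^2 + \<epsilon>) powr (-s - 1)" for \<epsilon> x
  have wF: "wirtinger F x (\<lambda>i. dF i x) (\<lambda>i. 0)" for x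
    unfolding F_def dF_def by (rule wirtinger_eval)
  have wF2: "wirtinger (\<lambda>x. of_real ((norm (F x))^2)) x (\<lambda>i. cnj (F x) * dF i x) (\<lambda>i. F x * cnj (dF i x))" for x
    using wirtinger_mult[OF wF[of x] wirtinger_cnj[OF wF[of x]]] unfolding complex_norm_square by (simp add: mult.commute)
  have wW: "wirtinger (\<lambda>x. of_real (w \<epsilon> x)) x (\<lambda>i. of_real (w' \<epsilon> x) * (cnj (F x) * dF i x)) (\<lambda>i. of_real (w' \<epsilon> x) * (F x * cnj (dF i x)))"
    if "\<epsilon> > 0" for \<epsilon> x
    unfolding w_def w'_def
  proof (rule wirtinger_real_compose[where \<phi> = "\<lambda>t. (t + \<epsilon>) powr (-s)", OF wF2])
    have "(norm (F x))^2 + \<epsilon> > 0" using that by (simp add: add_nonneg_pos)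
    thus "((\<lambda>t. (t + \<epsilon>) powr (-s)) has_real_derivative -s * ((norm (F x))^2 + \<epsilon>) powr (-s - 1)) (at ((norm (F x))^2))"
      by (auto intro!: derivative_eq_intros)
  qed
  have wX: "wirtinger (\<lambda>x. of_real (\<psi> (v x))) x (\<lambda>i. of_real (\<psi>' (v x)) * cnj (x $ i)) (\<lambda>i. of_real (\<psi>' (v x)) * (x $ i))" for x
    by (rule wirtinger_real_compose[OF _ \<psi>d]) (use wV[of x] in \<open>simp add: Vv[abs_def]\<close>)
  have w\<delta>: "wirtinger (\<lambda>x. cnj (\<delta> x)) x (\<lambda>i. 0) (\<lambda>i. cnj (eval_at (partial_deriv i (\<Sum>i\<in>UNIV. partial_deriv i (T i))) x))" for x
    using wirtinger_cnj[OF wirtinger_eval[of "\<Sum>i\<in>UNIV. partial_deriv i (T i)" x]] by (simp add: \<delta>_def)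
  define \<Phi> where "\<Phi> \<epsilon> i x = (of_real (\<psi> (v x)) * of_real (w \<epsilon> x)) * cnj (\<delta> x) * P i x" for \<epsilon> i x
  \<comment> \<open>The final summand with factor 0 is the holomorphic derivative of
    \<open>cnj (\<delta> x)\<close>. This is the reason for the conjugate in the weight: it is not
    differentiated, and multiplies the divergence to its squared modulus.\<close>
  define KA where "KA \<epsilon> x j = ((of_real (\<psi>' (v x)) * cnj (x $ j)) * of_real (w \<epsilon> x) + of_real (\<psi> (v x)) * (of_real (w' \<epsilon> x) * (cnj (F x) * dF j x))) * cnj (\<delta> x) + (of_real (\<psi> (v x)) * of_real (w \<epsilon> x)) * 0" for \<epsilon> x j
  define KB where "KB \<epsilon> x j = ((of_real (\<psi>' (v x)) * x $ j) * of_real (w \<epsilon> x) + of_real (\<psi> (v x)) * (of_real (w' \<epsilon> x) * (F x * cnj (dF j x)))) * cnj (\<delta> x) + (of_real (\<psi> (v x)) * of_real (w \<epsilon> x)) * cnj (eval_at (partial_deriv j (\<Sum>i\<in>UNIV. partial_deriv i (T i))) x)" for \<epsilon> x j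
  define A where "A \<epsilon> i x j = KA \<epsilon> x j * P i x + (of_real (\<psi> (v x)) * of_real (w \<epsilon> x)) * cnj (\<delta> x) * PA i x j" for \<epsilon> i x j
  define B where "B \<epsilon> i x j = KB \<epsilon> x j * P i x + (of_real (\<psi> (v x)) * of_real (w \<epsilon> x)) * cnj (\<delta> x) * PB i x j" for \<epsilon> i x j
  have w\<Phi>: "wirtinger (\<Phi> \<epsilon> i) x (A \<epsilon> i x) (B \<epsilon> i x)" if "\<epsilon> > 0" for \<epsilon> i x
    unfolding \<Phi>_def[abs_def] A_def B_def KA_def KB_def by (intro wirtinger_mult wX wW[OF that] w\<delta> wP)
  have cw: "continuous_on U (w \<epsilon>)" "continuous_on U (w' \<epsilon>)" if "\<epsilon> > 0" for \<epsilon> U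
  proof -
    have "(norm (F x))^2 + \<epsilon> \<noteq> 0" for x using that by (smt (verit) zero_le_power2)
    thus "continuous_on U (w \<epsilon>)" "continuous_on U (w' \<epsilon>)" unfolding w_def w'_def
      by (auto intro!: continuous_intros)
  qed
  have c\<psi>: "continuous_on U (\<lambda>x. \<psi> (v x))" "continuous_on U (\<lambda>x. \<psi>' (v x))" for U
    unfolding \<psi>_def \<psi>'_def h_def by (intro continuous_intros)+
  have cA: "continuous_on UNIV (\<lambda>x. A \<epsilon> i x i)" and cB: "continuous_on UNIV (\<lambda>x. B \<epsilon> i x i)" if "\<epsilon> > 0" for \<epsilon> i
    unfolding A_def B_def KA_def KB_def PA_def PB_def
    by (intro continuous_intros continuous_eval_at cw[OF that] c\<psi>)+
  have supp\<psi>: "\<psi> (v x) = 0" if "\<not> (1 \<le> norm x \<and> norm x \<le> 2)" for x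
  proof -
    have "v x < 1 \<or> v x > 4" using that power_mono[of 2 "norm x" 2] power_strict_mono[of 2 "norm x" 2]
      by (auto simp: v_def not_le power2_eq_square dest: mult_strict_mono)
        (metis mult_strict_mono norm_ge_zero mult_1 zero_less_one less_le_trans not_le linorder_not_less mult_less_cancel_left2 abs_norm_cancel abs_square_less_1 power2_eq_square)+
    hence "h (v x) \<le> 0" unfolding h_def v_def
      by (auto simp: mult_nonpos_nonneg mult_nonneg_nonpos)
    thus ?thesis by (simp add: \<psi>_def)
  qed
  have supp: "\<Phi> \<epsilon> i x = 0" if "norm x > 2" for \<epsilon> i x using supp\<psi>[of x] that by (simp add: \<Phi>_def)
  \<comment> \<open>Origin of \<rho> + 2: differentiating \<open>V\<close> gives \<open>S\<close>,
    the trace of the identity times \<open>S\<close> gives \<open>- 3 * S\<close>, and Euler's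
    formula for the coefficients of the field gives minus \<rho> times \<open>S\<close>.\<close>
  have divP: "(\<Sum>i\<in>UNIV. PA i x i) = V x * \<delta> x - (of_nat \<rho> + 2) * S x" for x
  proof -
    have "(\<Sum>i\<in>UNIV. x $ i * (\<Sum>k\<in>UNIV. d\<theta> i k x * cnj (x $ k))) = (\<Sum>k\<in>UNIV. (\<Sum>i\<in>UNIV. x $ i * d\<theta> i k x) * cnj (x $ k))"
      by (simp add: sum_distrib_left sum_distrib_right mult.assoc) (rule sum.swap)
    also have "\<dots> = of_nat \<rho> * S x" unfolding eul\<theta> S_def by (simp add: sum_distrib_left mult.assoc)
    finally have "(\<Sum>i\<in>UNIV. x $ i * (\<Sum>k\<in>UNIV. d\<theta> i k x * cnj (x $ k))) = of_nat \<rho> * S x" .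
    moreover have "(\<Sum>i\<in>UNIV. cnj (x $ i) * \<theta> i x) = S x" by (simp add: S_def mult.commute)
    ultimately show ?thesis
      unfolding PA_def sum_subtractf sum.distrib by (simp add: \<delta>e sum_distrib_left algebra_simps sum_3)
  qed
  have PV: "(\<Sum>i\<in>UNIV. cnj (x $ i) * P i x) = 0" for x
    by (simp add: P_def S_def V_def sum_3 algebra_simps)
  have PF: "(\<Sum>i\<in>UNIV. dF i x * P i x) = - S x * of_nat m * F x" for x
  proof -
    have "(\<Sum>i\<in>UNIV. dF i x * P i x) = V x * (\<Sum>i\<in>UNIV. \<theta> i x * dF i x) - S x * (\<Sum>i\<in>UNIV. x $ i * dF i x)"
      by (simp add: P_def sum_3 algebra_simps)
    thus ?thesis using Tf[of x] unfolding eul by (simp add: \<theta>_def dF_def)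
  qed
  define G where "G \<epsilon> x = \<psi> (v x) * w \<epsilon> x * v x * (norm (\<delta> x))^2" for \<epsilon> x
  \<comment> \<open>What the radial terms leave over. The derivative of the weight contributes minus
    \<rho> + 2 times \<open>w\<close> times the quotient of the squared norm of \<open>F x\<close>
    by the same plus \<epsilon>, because \<open>s * m = \<rho> + 2\<close>; together with the
    divergence of \<open>P\<close> this leaves the factor
    \<open>\<epsilon> / ((norm (F x))^2 + \<epsilon>)\<close>. It is at most 1 and tends to 0 off
    the curve.\<close>
  define H where "H \<epsilon> x = (of_nat \<rho> + 2) * (of_real (\<psi> (v x) * (w \<epsilon> x * (\<epsilon> / ((norm (F x))^2 + \<epsilon>)))) * cnj (\<delta> x) * S x)" for \<epsilon> x
  have sumA: "(\<Sum>i\<in>UNIV. A \<epsilon> i x i) = of_real (G \<epsilon> x) - H \<epsilon> x" if \<epsilon>: "\<epsilon> > 0" for \<epsilon> x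
  proof -
    let ?q = "(norm (F x))^2 + \<epsilon>" and ?c = "complex_of_real (\<psi> (v x))"
    have FF: "F x * cnj (F x) = (of_real (norm (F x)))^2" and \<delta>\<delta>: "\<delta> x * cnj (\<delta> x) = (of_real (norm (\<delta> x)))^2"
      using complex_norm_square[of "F x"] complex_norm_square[of "\<delta> x"] by simp_all
    have q: "?q > 0" using \<epsilon> by (simp add: add_nonneg_pos)
    have "(\<Sum>i\<in>UNIV. A \<epsilon> i x i) = of_real (\<psi>' (v x)) * of_real (w \<epsilon> x) * cnj (\<delta> x) * (\<Sum>i\<in>UNIV. cnj (x $ i) * P i x)
       + ?c * of_real (w' \<epsilon> x) * cnj (F x) * cnj (\<delta> x) * (\<Sum>i\<in>UNIV. dF i x * P i x)
       + ?c * of_real (w \<epsilon> x) * cnj (\<delta> x) * (\<Sum>i\<in>UNIV. PA i x i)"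
      unfolding A_def KA_def by (simp add: sum_3 algebra_simps)
    also have "\<dots> = ?c * cnj (\<delta> x) * (of_real (w \<epsilon> x) * (V x * \<delta> x) - S x * (of_real (w' \<epsilon> x) * of_nat m * (F x * cnj (F x)) + of_real (w \<epsilon> x) * (of_nat \<rho> + 2)))"
      unfolding PV PF divP by (simp add: algebra_simps)
    also have "of_real (w' \<epsilon> x) * of_nat m * (F x * cnj (F x)) + of_real (w \<epsilon> x) * (of_nat \<rho> + 2) = of_real (w' \<epsilon> x * m * (norm (F x))^2 + w \<epsilon> x * (\<rho> + 2))"
      by (simp add: FF add.commute)
    also have "w' \<epsilon> x * m * (norm (F x))^2 + w \<epsilon> x * (\<rho> + 2) = (\<rho> + 2) * (w \<epsilon> x * (\<epsilon> / ?q))"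
    proof -
      have "w' \<epsilon> x = - s * (w \<epsilon> x / ?q)"
        unfolding w_def w'_def using q by (simp add: powr_diff)
      hence "w' \<epsilon> x * m * (norm (F x))^2 = - (s * m) * (w \<epsilon> x / ?q) * (norm (F x))^2" by (simp only: mult_ac mult_minus_left mult_minus_right)
      also have "s * m = \<rho> + 2" using s m by simp
      finally have "w' \<epsilon> x * m * (norm (F x))^2 = - real (\<rho> + 2) * (w \<epsilon> x / ?q) * (norm (F x))^2" .
      thus ?thesis using q by (simp add: field_simps)
    qed
    finally show ?thesis unfolding G_def H_def Vv
      by (simp add: FF[symmetric] \<delta>\<delta>[symmetric] algebra_simps)
  qed
  have GH: "integrable lborel (\<lambda>x. of_real (G \<epsilon> x) - H \<epsilon> x)" "(\<integral>x. of_real (G \<epsilon> x) - H \<epsilon> x \<partial>lborel) = 0" if \<epsilon>: "\<epsilon> > 0" for \<epsilon>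
  proof -
    note I = integral_wirtinger_eq_0[OF w\<Phi>[OF \<epsilon>] cA[OF \<epsilon>] cB[OF \<epsilon>] supp]
    show "integrable lborel (\<lambda>x. of_real (G \<epsilon> x) - H \<epsilon> x)"
      unfolding sumA[OF \<epsilon>, symmetric] by (intro Bochner_Integration.integrable_sum I(1))
    show "(\<integral>x. of_real (G \<epsilon> x) - H \<epsilon> x \<partial>lborel) = 0"
      unfolding sumA[OF \<epsilon>, symmetric] by (subst Bochner_Integration.integral_sum) (simp_all add: I)
  qed
  define q where "q n = 1 / real (Suc n)" for n
  have q: "q n > 0" "q n \<le> 1" for n by (auto simp: q_def)
  have q0: "q \<longlonglongrightarrow> 0" using LIMSEQ_inverse_real_of_nat by (simp add: q_def[abs_def] inverse_eq_divide del: of_nat_Suc)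
  have s0: "s > 0" using s m by simp
  define Ann where "Ann = {x::complex^3. 1 \<le> norm x \<and> norm x \<le> 2}"
  have Ann[measurable]: "Ann \<in> sets borel" unfolding Ann_def by measurable
  \<comment> \<open>\<open>9/4\<close> is the maximum of \<open>h\<close>, attained at
    \<open>5/2\<close>, so its square bounds the cutoff; the factor 2 bounds \<open>norm x\<close>
    in the estimate of \<open>S\<close> by the coefficients of the field.\<close>
  define C where "C = (real \<rho> + 2) * ((9/4)^2 * 2)"
  have C: "C \<ge> 0" by (simp add: C_def)
  define D where "D x = C * (indicator Ann x * (norm (\<delta> x) * (\<Sum>i\<in>UNIV. norm (\<theta> i x)) * (norm (F x)) powr (-(2 * s))))" for x
  have [measurable]: "F \<in> borel_measurable borel" "\<delta> \<in> borel_measurable borel" "\<theta> i \<in> borel_measurable borel"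
     "S \<in> borel_measurable borel" "v \<in> borel_measurable borel" "(\<lambda>x. \<psi> (v x)) \<in> borel_measurable borel" for i
    by (rule borel_measurable_continuous_onI, rule cont contV c\<psi>)+
  have [measurable]: "(\<lambda>x. cnj (\<delta> x)) \<in> borel_measurable borel"
    by (intro borel_measurable_continuous_onI continuous_intros)
  have [measurable]: "H \<epsilon> \<in> borel_measurable borel" for \<epsilon>
    unfolding H_def[abs_def] w_def[abs_def] by measurable
  have \<psi>b: "\<psi> (v x) \<le> (9/4)^2 * indicator Ann x" for x
  proof (cases "x \<in> Ann")
    case True
    have "h t \<le> 9/4" for t
    proof -
      have "9/4 - h t = (t - 5/2)^2" by (simp add: h_def power2_eq_square field_simps)
      thus ?thesis by (smt (verit) zero_le_power2)
    qed
    hence "max 0 (h (v x)) \<le> 9/4" by (metis max.bounded_iff zero_le_divide_iff zero_le_numeral)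
    thus ?thesis using True power_mono[of "max 0 (h (v x))" "9/4" 2] by (simp add: \<psi>_def)
  qed (use supp\<psi> in \<open>auto simp: Ann_def\<close>)
  have wb: "w \<epsilon> x \<le> (norm (F x)) powr (-(2 * s))" if "\<epsilon> > 0" "F x \<noteq> 0" for \<epsilon> x
  proof -
    have "w \<epsilon> x \<le> ((norm (F x))^2) powr (-s)"
      unfolding w_def using that s0 by (intro powr_mono2') auto
    also have "\<dots> = (norm (F x)) powr (-(2 * s))" using that by (simp add: powr_powr flip: powr_numeral)
    finally show ?thesis .
  qed
  have HD: "norm (H \<epsilon> x) \<le> D x" if \<epsilon>: "\<epsilon> > 0" and nz: "F x \<noteq> 0" for \<epsilon> x
  proof -
    have w0: "w \<epsilon> x \<ge> 0" by (simp add: w_def)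
    have r: "\<epsilon> / ((norm (F x))^2 + \<epsilon>) \<le> 1" "\<epsilon> / ((norm (F x))^2 + \<epsilon>) \<ge> 0" using \<epsilon> by (auto simp: divide_le_eq add_nonneg_pos)
    have wr: "w \<epsilon> x * (\<epsilon> / ((norm (F x))^2 + \<epsilon>)) \<le> (norm (F x)) powr (-(2 * s))"
      using mult_mono[OF wb[OF \<epsilon> nz] r(1)] r w0 by simp
    have Sb: "norm (S x) \<le> norm x * (\<Sum>i\<in>UNIV. norm (\<theta> i x))"
      unfolding S_def sum_distrib_left
      by (intro sum_norm_le) (auto simp: norm_mult mult.commute intro!: mult_right_mono Finite_Cartesian_Product.norm_nth_le)
    have n1: "norm (H \<epsilon> x) = (real \<rho> + 2) * (\<psi> (v x) * (w \<epsilon> x * (\<epsilon> / ((norm (F x))^2 + \<epsilon>))) * norm (\<delta> x) * norm (S x))"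
    proof -
      have "norm (of_nat \<rho> + 2 :: complex) = real \<rho> + 2"
        using norm_of_nat[of "\<rho> + 2", where 'a = complex] by (simp add: add.commute)
      moreover have "\<bar>\<psi> (v x) * (w \<epsilon> x * (\<epsilon> / ((norm (F x))^2 + \<epsilon>)))\<bar> = \<psi> (v x) * (w \<epsilon> x * (\<epsilon> / ((norm (F x))^2 + \<epsilon>)))"
        using \<psi>_nn[of "v x"] r w0 by (intro abs_of_nonneg mult_nonneg_nonneg)
      ultimately show ?thesis unfolding H_def norm_mult norm_of_real complex_mod_cnj by simp
    qed
    show ?thesis
    proof (cases "x \<in> Ann")
      case False
      hence "\<psi> (v x) = 0" using supp\<psi>[of x] by (auto simp: Ann_def)
      thus ?thesis unfolding n1 D_def using False by simp
    next
      case True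
      have "\<psi> (v x) * (w \<epsilon> x * (\<epsilon> / ((norm (F x))^2 + \<epsilon>))) * norm (\<delta> x) * norm (S x)
         \<le> (9/4)^2 * (norm (F x)) powr (-(2 * s)) * norm (\<delta> x) * (2 * (\<Sum>i\<in>UNIV. norm (\<theta> i x)))"
      proof (intro mult_mono wr)
        show "\<psi> (v x) \<le> (9/4)\<^sup>2" using \<psi>b[of x] True by simp
        have "norm x \<le> 2" using True by (simp add: Ann_def)
        thus "norm (S x) \<le> 2 * (\<Sum>i\<in>UNIV. norm (\<theta> i x))"
          by (intro order_trans[OF Sb] mult_right_mono) (auto intro: sum_nonneg)
      qed (use mult_nonneg_nonneg[OF w0 r(2)] \<psi>_nn in \<open>auto\<close>)
      from mult_left_mono[OF this, of "real \<rho> + 2"] show ?thesis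
        unfolding n1 D_def C_def using True by (simp add: mult_ac)
    qed
  qed
  have [measurable]: "D \<in> borel_measurable borel" unfolding D_def[abs_def] by measurable
  have Dint: "integrable lborel D"
  proof (rule integrableI_bounded)
    show "D \<in> borel_measurable lborel" by simp
    have "(\<integral>\<^sup>+ x. ennreal (norm (D x)) \<partial>lborel) \<le> (\<integral>\<^sup>+ x. ennreal C * (indicator {x. 1 \<le> norm x \<and> norm x \<le> 2} x *
        (ennreal (norm (\<delta> x) * (\<Sum>i\<in>UNIV. norm (\<theta> i x))) * pw (2 * s) (norm (F x)))) \<partial>lborel)"
    proof (rule nn_integral_mono)
      fix x
      have "ennreal (norm (F x) powr (-(2 * s))) \<le> pw (2 * s) (norm (F x))" by (simp add: pw_def)
      hence "ennreal (norm (\<delta> x) * (\<Sum>i\<in>UNIV. norm (\<theta> i x)) * norm (F x) powr (-(2 * s)))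
        \<le> ennreal (norm (\<delta> x) * (\<Sum>i\<in>UNIV. norm (\<theta> i x))) * pw (2 * s) (norm (F x))"
        by (subst ennreal_mult) (auto intro!: mult_left_mono sum_nonneg mult_nonneg_nonneg)
      moreover have "ennreal (norm (D x)) = ennreal C * (indicator Ann x * ennreal (norm (\<delta> x) * (\<Sum>i\<in>UNIV. norm (\<theta> i x)) * norm (F x) powr (-(2 * s))))"
        unfolding D_def using C by (auto simp: indicator_def abs_mult ennreal_mult[symmetric] sum_nonneg)
      ultimately show "ennreal (norm (D x)) \<le> ennreal C * (indicator {x. 1 \<le> norm x \<and> norm x \<le> 2} x *
        (ennreal (norm (\<delta> x) * (\<Sum>i\<in>UNIV. norm (\<theta> i x))) * pw (2 * s) (norm (F x))))"
        by (simp add: Ann_def mult_left_mono)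
    qed
    also have "\<dots> = ennreal C * (\<integral>\<^sup>+ x. indicator Ann x *
        (ennreal (norm (\<delta> x) * (\<Sum>i\<in>UNIV. norm (\<theta> i x))) * pw (2 * s) (norm (F x))) \<partial>lborel)"
      unfolding Ann_def[symmetric] by (rule nn_integral_cmult) measurable
    also have "\<dots> < \<infinity>" using fin unfolding \<delta>_def \<theta>_def F_def Ann_def by (simp add: ennreal_mult_less_top)
    finally show "(\<integral>\<^sup>+ x. ennreal (norm (D x)) \<partial>lborel) < \<infinity>" .
  qed
  have ae': "AE x in lborel. x \<in> Ann \<longrightarrow> F x \<noteq> 0" using ae by (simp add: F_def Ann_def)
  have Hout: "H \<epsilon> x = 0" "D x = 0" if "x \<notin> Ann" for \<epsilon> x
    using supp\<psi>[of x] that by (simp_all add: H_def D_def Ann_def)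
  have HD': "norm (H \<epsilon> x) \<le> D x" if "\<epsilon> > 0" "x \<in> Ann \<longrightarrow> F x \<noteq> 0" for \<epsilon> x
    using HD[OF that(1)] Hout that(2) by (cases "x \<in> Ann") auto
  have Hint: "integrable lborel (H \<epsilon>)" if "\<epsilon> > 0" for \<epsilon>
  proof (rule Bochner_Integration.integrable_bound[OF Dint])
    show "AE x in lborel. norm (H \<epsilon> x) \<le> norm (D x)"
      using ae' by eventually_elim (use HD'[OF that] in fastforce)
  qed measurable
  have Gint: "integrable lborel (G \<epsilon>)" "(\<integral>x. G \<epsilon> x \<partial>lborel) = Re (\<integral>x. H \<epsilon> x \<partial>lborel)" if \<epsilon>: "\<epsilon> > 0" for \<epsilon>
  proof -
    have i: "integrable lborel (\<lambda>x. complex_of_real (G \<epsilon> x))"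
      using Bochner_Integration.integrable_add[OF GH(1)[OF \<epsilon>] Hint[OF \<epsilon>]] by simp
    thus "integrable lborel (G \<epsilon>)" by (subst (asm) complex_of_real_integrable_eq)
    have "(\<integral>x. complex_of_real (G \<epsilon> x) \<partial>lborel) = (\<integral>x. H \<epsilon> x \<partial>lborel)"
      using GH(2)[OF \<epsilon>] i Hint[OF \<epsilon>] by (subst (asm) Bochner_Integration.integral_diff) auto
    thus "(\<integral>x. G \<epsilon> x \<partial>lborel) = Re (\<integral>x. H \<epsilon> x \<partial>lborel)" by (metis Re_complex_of_real integral_complex_of_real)
  qed
  have Hlim: "(\<lambda>n. \<integral>x. H (q n) x \<partial>lborel) \<longlonglongrightarrow> (\<integral>x. 0 \<partial>(lborel :: (complex^3) measure))"
  proof (rule integral_dominated_convergence[OF _ _ Dint])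
    show "AE x in lborel. (\<lambda>n. H (q n) x) \<longlonglongrightarrow> 0"
      using ae'
    proof eventually_elim
      case (elim x)
      show ?case
      proof (cases "x \<in> Ann")
        case False
        thus ?thesis by (simp add: Hout)
      next
        case True
        hence nz: "F x \<noteq> 0" using elim by simp
      have "(\<lambda>n. w (q n) x) \<longlonglongrightarrow> ((norm (F x))^2 + 0) powr (-s)"
        unfolding w_def using nz by (intro tendsto_intros q0) auto
      moreover have "(\<lambda>n. q n / ((norm (F x))^2 + q n)) \<longlonglongrightarrow> 0 / ((norm (F x))^2 + 0)"
        using nz by (intro tendsto_intros q0) auto
      ultimately have "(\<lambda>n. w (q n) x * (q n / ((norm (F x))^2 + q n))) \<longlonglongrightarrow> 0"
        using tendsto_mult by fastforce
      hence "(\<lambda>n. H (q n) x) \<longlonglongrightarrow> (of_nat \<rho> + 2) * (of_real (\<psi> (v x) * 0) * cnj (\<delta> x) * S x)"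
        unfolding H_def by (intro tendsto_intros)
      thus ?thesis by simp
      qed
    qed
    show "AE x in lborel. norm (H (q n) x) \<le> D x" for n
      using ae' by eventually_elim (rule HD'[OF q(1)])
  qed measurable
  have "bounded (F ` cball 0 2)"
    by (intro compact_imp_bounded compact_continuous_image cont) auto
  then obtain M where M: "\<And>x. norm x \<le> 2 \<Longrightarrow> norm (F x) \<le> M"
    unfolding bounded_iff by (metis image_eqI mem_cball_0)
  \<comment> \<open>A lower bound, on the annulus, for all weights \<open>w (q n)\<close> at once,
    as \<open>q n \<le> 1\<close>. It produces a continuous minorant \<open>G0\<close> that is
    independent of \<open>n\<close>.\<close>
  define K where "K = (M^2 + 1) powr (-s)"
  have K: "K > 0" unfolding K_def by (simp add: add_nonneg_pos powr_gt_zero) (metis add_nonneg_eq_0_iff zero_le_power2 zero_le_one zero_neq_one)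
  define G0 where "G0 x = K * (\<psi> (v x) * v x * (norm (\<delta> x))^2)" for x
  have v0: "v x \<ge> 0" for x by (simp add: v_def)
  have G0n: "G0 x \<ge> 0" for x using K \<psi>_nn v0 by (simp add: G0_def)
  have G0G: "G0 x \<le> G (q n) x" for x n
  proof (cases "x \<in> Ann")
    case True
    hence "norm (F x) \<le> M" using M by (simp add: Ann_def)
    hence "(norm (F x))^2 \<le> M^2" by (intro power_mono) auto
    hence "K \<le> w (q n) x" unfolding K_def w_def using q[of n] s0
      by (intro powr_mono2') (auto simp: add_nonneg_pos)
    hence "K * (\<psi> (v x) * v x * (norm (\<delta> x))^2) \<le> w (q n) x * (\<psi> (v x) * v x * (norm (\<delta> x))^2)"
      using \<psi>_nn v0 by (intro mult_right_mono) auto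
    thus ?thesis by (simp add: G0_def G_def mult_ac)
  next
    case False
    hence "\<psi> (v x) = 0" using supp\<psi>[of x] by (auto simp: Ann_def)
    thus ?thesis by (simp add: G0_def G_def)
  qed
  have cG0: "continuous_on UNIV G0" unfolding G0_def by (intro continuous_intros c\<psi>)
  have G0int: "integrable lborel G0"
  proof (rule Bochner_Integration.integrable_bound[OF Gint(1)[OF q(1)[of 0]]])
    show "AE x in lborel. norm (G0 x) \<le> norm (G (q 0) x)" using G0G[of _ 0] G0n by (intro AE_I2) (smt (verit) real_norm_def)
    show "G0 \<in> borel_measurable lborel" using borel_measurable_continuous_onI[OF cG0] by simp
  qed
  have "(\<integral>x. G0 x \<partial>lborel) \<le> Re (\<integral>x. H (q n) x \<partial>lborel)" for n
    unfolding Gint(2)[OF q(1), symmetric] by (intro Bochner_Integration.integral_mono G0int Gint(1) q G0G)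
  moreover have "(\<lambda>n. Re (\<integral>x. H (q n) x \<partial>lborel)) \<longlonglongrightarrow> 0"
    using tendsto_Re[OF Hlim] by simp
  ultimately have "(\<integral>x. G0 x \<partial>lborel) \<le> 0" by (intro LIMSEQ_le_const) auto
  hence G00: "G0 x = 0" for x by (rule continuous_nonneg_integral_eq_0[OF cG0 G0n G0int])
  have gr: "(\<Sum>i\<in>UNIV. partial_deriv i (T i)) \<in> graded_part (int \<rho> - 1)"
    by (intro graded_part_sum graded_part_partial_deriv T)
  show ?thesis
  proof (cases "\<rho> = 0")
    case True
    \<comment> \<open>For constant coefficients the divergence has degree -1, and no monomial has
      this degree.\<close>
    have "int (mono_degree t) \<noteq> -1" for t by simp
    thus ?thesis using gr True unfolding graded_part_def by (metis (mono_tags, lifting) diff_0 mem_Collect_eq of_nat_0 in_keys_iff lookup_zero poly_mapping_eqI)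
  next
    case False
    hence gr': "(\<Sum>i\<in>UNIV. partial_deriv i (T i)) \<in> graded_part (int (\<rho> - 1))" using gr by (simp add: of_nat_diff)
    have z: "\<delta> x = 0" if "x \<noteq> 0" for x
    proof -
      \<comment> \<open>Rescaling to norm 3/2 moves any nonzero vector to a place where the cutoff
        is positive, since \<open>h (9/4)\<close> is 35/16; homogeneity carries the vanishing
        back.\<close>
      define c where "c = (3/2) / norm x"
      have c: "c > 0" using that by (simp add: c_def)
      have "norm (complex_of_real c *s x) = 3/2" unfolding norm_vector_smult norm_of_real using that c by (simp add: c_def)
      hence "v (complex_of_real c *s x) = 9/4" unfolding v_def by (simp only:) (simp add: power2_eq_square)
      hence "\<delta> (complex_of_real c *s x) = 0"
        using G00[of "complex_of_real c *s x"] K by (simp add: G0_def \<psi>_def h_def)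
      thus ?thesis using eval_at_smult[OF gr', of "complex_of_real c" x] c by (simp add: \<delta>_def del: eval_at_simps)
    qed
    have z0: "\<delta> 0 = 0"
    proof -
      \<comment> \<open>If \<rho> is 1, the power is \<open>0 ^ 0 = 1\<close> and \<delta> is a
        constant; the second factor, a value at a nonzero vector, is what vanishes in all
        cases.\<close>
      have "\<delta> (0 *s axis 1 1) = 0 ^ (\<rho> - 1) * \<delta> (axis 1 1)"
        unfolding \<delta>_def by (rule eval_at_smult[OF gr'])
      thus ?thesis using z[of "axis 1 1"] by (simp add: axis_eq_0_iff)
    qed
    show ?thesis unfolding poly3_eq_0_iff using z z0 unfolding \<delta>_def by metis
  qed
qed

section \<open>Branches at the singular points\<close>

lemma module_mult: "module ((*) :: 'a::comm_ring_1 \<Rightarrow> 'a \<Rightarrow> 'a)"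
  by unfold_locales (auto simp: algebra_simps)

lemma ideal_gen_subset:
  assumes "B \<subseteq> S" "0 \<in> S" "\<And>x y. x \<in> S \<Longrightarrow> y \<in> S \<Longrightarrow> x + y \<in> S" "\<And>c x. x \<in> S \<Longrightarrow> c * x \<in> S"
  shows "ideal_gen B \<subseteq> S"
  unfolding ideal_gen_def
  by (rule module.span_minimal[OF module_mult assms(1)])
     (auto simp: module.subspace_def[OF module_mult] intro: assms)

lemma ideal_gen_base: "x \<in> B \<Longrightarrow> x \<in> ideal_gen B"
  unfolding ideal_gen_def by (rule module.span_base[OF module_mult])

lemma ideal_gen_0: "0 \<in> ideal_gen B"
  unfolding ideal_gen_def by (rule module.span_zero[OF module_mult])

lemma ideal_gen_add: "x \<in> ideal_gen B \<Longrightarrow> y \<in> ideal_gen B \<Longrightarrow> x + y \<in> ideal_gen B"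
  unfolding ideal_gen_def by (rule module.span_add[OF module_mult])

lemma ideal_gen_mult: "x \<in> ideal_gen B \<Longrightarrow> c * x \<in> ideal_gen B"
  unfolding ideal_gen_def by (rule module.span_scale[OF module_mult])

text \<open>Gaussian elimination: an equation with nonzero coefficient at \<open>u0\<close> is
  solved for that unknown and substituted into the others. All dimension counts below, for
  intersection multiplicities, pencils of lines and binary forms, take this form.\<close>

lemma underdetermined_system:
  fixes a :: "'e \<Rightarrow> 'u \<Rightarrow> 'k::field"
  assumes "finite E" "finite U" "card E < card U"
  shows "\<exists>x. (\<exists>u\<in>U. x u \<noteq> 0) \<and> (\<forall>e\<in>E. (\<Sum>u\<in>U. a e u * x u) = 0)"
  using assms
proof (induction E arbitrary: U a rule: finite_induct)
  case empty
  then obtain u where "u \<in> U" by fastforce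
  thus ?case by (intro exI[of _ "\<lambda>_. 1"]) auto
next
  case (insert e E)
  show ?case
  proof (cases "\<forall>u\<in>U. a e u = 0")
    case True
    obtain x where x: "\<exists>u\<in>U. x u \<noteq> 0" "\<forall>e\<in>E. (\<Sum>u\<in>U. a e u * x u) = 0"
      using insert.IH[of U a] insert.prems insert.hyps by auto
    thus ?thesis using True by (intro exI[of _ x]) auto
  next
    case False
    then obtain u0 where u0: "u0 \<in> U" "a e u0 \<noteq> 0" by auto
    define U' where "U' = U - {u0}"
    define b where "b e' u = a e' u - a e' u0 / a e u0 * a e u" for e' u
    have "card E < card U'" using insert.prems insert.hyps u0 by (simp add: U'_def)
    then obtain x where x: "\<exists>u\<in>U'. x u \<noteq> 0" "\<And>e. e \<in> E \<Longrightarrow> (\<Sum>u\<in>U'. b e u * x u) = 0"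
      using insert.IH[of U' b] insert.prems by (auto simp: U'_def)
    define S where "S = (\<Sum>u\<in>U'. a e u * x u)"
    define y where "y = x(u0 := - S / a e u0)"
    have split: "(\<Sum>u\<in>U. a e' u * y u) = a e' u0 * (- S / a e u0) + (\<Sum>u\<in>U'. a e' u * x u)" for e'
    proof -
      have "(\<Sum>u\<in>U. a e' u * y u) = a e' u0 * y u0 + (\<Sum>u\<in>U'. a e' u * y u)"
        unfolding U'_def using u0 insert.prems by (simp add: sum.remove)
      also have "(\<Sum>u\<in>U'. a e' u * y u) = (\<Sum>u\<in>U'. a e' u * x u)"
        by (intro sum.cong) (auto simp: y_def U'_def)
      finally show ?thesis by (simp add: y_def)
    qed
    have "(\<Sum>u\<in>U. a e' u * y u) = 0" if "e' \<in> insert e E" for e'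
    proof (cases "e' = e")
      case True
      thus ?thesis unfolding split using u0 by (simp add: S_def)
    next
      case False
      hence "(\<Sum>u\<in>U'. b e' u * x u) = 0" using that x by auto
      moreover have "(\<Sum>u\<in>U'. b e' u * x u) = (\<Sum>u\<in>U'. a e' u * x u) - a e' u0 / a e u0 * S"
        unfolding b_def S_def by (simp add: algebra_simps sum_subtractf sum_distrib_left)
      ultimately show ?thesis unfolding split by simp
    qed
    moreover have "\<exists>u\<in>U. y u \<noteq> 0" using x(1) by (auto simp: y_def U'_def)
    ultimately show ?thesis by blast
  qed
qed

text \<open>
  Restriction of a power series to the plane curve germ \<open>\<tau> \<mapsto> (A(\<tau>), B(\<tau>))\<close>; it is a ring
  homomorphism only if \<open>A\<close> and \<open>B\<close> have no constant term.
\<close>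

definition along :: "complex fps \<Rightarrow> complex fps \<Rightarrow> fps2 \<Rightarrow> complex fps" where
  "along A B F = Abs_fps (\<lambda>n. \<Sum>i\<le>n. fps_nth ((fps_nth F i oo B) * A ^ i) n)"

lemma fps_mult_nth_cong:
  fixes P P' Q Q' :: "'a::comm_ring_1 fps"
  assumes "\<And>k. k \<le> n \<Longrightarrow> fps_nth P k = fps_nth P' k" "\<And>k. k \<le> n \<Longrightarrow> fps_nth Q k = fps_nth Q' k"
  shows "fps_nth (P * Q) n = fps_nth (P' * Q') n"
  unfolding fps_mult_nth by (intro sum.cong refl) (use assms in auto)

context
  fixes A B :: "complex fps"
  assumes A0: "fps_nth A 0 = 0" and B0: "fps_nth B 0 = 0"
begin

lemma nth_mult_power_eq_0: "n < i \<Longrightarrow> fps_nth (G * A ^ i) n = 0"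
  using startsby_zero_power_prefix[OF A0, of i] by (auto simp: fps_mult_nth intro!: sum.neutral)

text \<open>The power \<open>A ^ i\<close> has order at least \<open>i\<close>, so longer sums agree
  up to degree \<open>n\<close>. With a truncation common to all coefficients up to
  \<open>n\<close>, products can be expanded as finite sums.\<close>

lemma along_trunc: "k \<le> n \<Longrightarrow> fps_nth (along A B F) k = fps_nth (\<Sum>i\<le>n. (fps_nth F i oo B) * A ^ i) k"
proof -
  assume "k \<le> n"
  have "(\<Sum>i\<le>n. fps_nth ((fps_nth F i oo B) * A ^ i) k) = (\<Sum>i\<le>k. fps_nth ((fps_nth F i oo B) * A ^ i) k)"
    using \<open>k \<le> n\<close> by (intro sum.mono_neutral_right) (auto intro: nth_mult_power_eq_0)
  thus ?thesis by (simp add: along_def fps_sum_nth)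
qed

lemma along_add: "along A B (F + G) = along A B F + along A B G"
  by (rule fps_ext) (simp add: along_def fps_compose_add_distrib distrib_right sum.distrib)

lemma along_mult: "along A B (F * G) = along A B F * along A B G"
proof (rule fps_ext)
  fix n
  define P where "P i = (fps_nth F i oo B)" for i
  define Q where "Q i = (fps_nth G i oo B)" for i
  have "fps_nth (along A B F * along A B G) n = fps_nth ((\<Sum>i\<le>n. P i * A ^ i) * (\<Sum>j\<le>n. Q j * A ^ j)) n"
    unfolding P_def Q_def by (intro fps_mult_nth_cong along_trunc)
  also have "\<dots> = (\<Sum>i\<le>n. \<Sum>j\<le>n. fps_nth (P i * Q j * A ^ (i + j)) n)"
    by (simp add: sum_product fps_sum_nth power_add mult_ac)
  also have "\<dots> = (\<Sum>(i,j)\<in>{..n}\<times>{..n}. fps_nth (P i * Q j * A ^ (i + j)) n)"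
    by (simp add: sum.cartesian_product)
  also have "\<dots> = (\<Sum>(i,j)\<in>{(i,j). i + j \<le> n}. fps_nth (P i * Q j * A ^ (i + j)) n)"
    by (intro sum.mono_neutral_right) (auto intro: nth_mult_power_eq_0)
  also have "\<dots> = (\<Sum>k\<le>n. \<Sum>i\<le>k. fps_nth (P i * Q (k - i) * A ^ k) n)"
    by (subst sum.triangle_reindex_eq) simp
  also have "\<dots> = fps_nth (along A B (F * G)) n"
    by (simp add: along_def fps_mult_nth[of F] fps_compose_sum_distrib fps_compose_mult_distrib[OF B0]
        sum_distrib_right fps_sum_nth P_def Q_def atMost_atLeast0)
  finally show "fps_nth (along A B (F * G)) n = fps_nth (along A B F * along A B G) n" ..
qed

lemma along_const: "along A B (fps2_const c) = fps_const c"
proof (rule fps_ext)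
  fix n
  have "(\<Sum>i\<le>n. fps_nth ((fps_nth (fps2_const c) i oo B) * A ^ i) n) = (\<Sum>i\<le>n. if i = 0 then fps_nth (fps_const c) n else 0)"
    by (intro sum.cong) (auto simp: fps2_const_def)
  thus "fps_nth (along A B (fps2_const c)) n = fps_nth (fps_const c) n" by (simp add: along_def)
qed

lemma along_u: "along A B fps2_u = A"
proof (rule fps_ext)
  fix n
  have "(\<Sum>i\<le>n. fps_nth ((fps_nth fps2_u i oo B) * A ^ i) n) = (\<Sum>i\<le>n. if i = 1 then fps_nth A n else 0)"
    by (intro sum.cong) (auto simp: fps2_u_def fps_X_def)
  thus "fps_nth (along A B fps2_u) n = fps_nth A n" using A0 by (cases n) (simp_all add: along_def)
qed

lemma along_v: "along A B fps2_v = B"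
proof (rule fps_ext)
  fix n
  have "(\<Sum>i\<le>n. fps_nth ((fps_nth fps2_v i oo B) * A ^ i) n) = (\<Sum>i\<le>n. if i = 0 then fps_nth B n else 0)"
    using B0 by (intro sum.cong) (auto simp: fps2_v_def)
  thus "fps_nth (along A B fps2_v) n = fps_nth B n" by (simp add: along_def)
qed

lemma along_1: "along A B 1 = 1"
  using along_const[of 1] by (simp add: fps2_const_def)

lemma along_prod: "along A B (prod F S) = (\<Prod>i\<in>S. along A B (F i))"
  by (induction S rule: infinite_finite_induct) (auto simp: along_1 along_mult)

lemma along_prod_list: "along A B (prod_list xs) = prod_list (map (along A B) xs)"
  by (induction xs) (auto simp: along_1 along_mult)

lemma along_0: "along A B 0 = 0"
  using along_add[of 0 0] by simp

lemma along_sum: "along A B (sum F S) = (\<Sum>i\<in>S. along A B (F i))"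
  by (induction S rule: infinite_finite_induct) (auto simp: along_0 along_add)

lemma along_power: "along A B (F ^ n) = along A B F ^ n"
  by (induction n) (auto simp: along_1 along_mult)

lemma along_eval_hom:
  "along A B (eval_hom fps2_const x f) = eval_hom fps_const (\<lambda>i. along A B (x i)) f"
  by (simp add: eval_hom_def along_sum along_mult along_const along_prod along_power)

lemma along_nth:
  "fps_nth (along A B F) 0 = coeff2 F 0 0"
  "fps_nth (along A B F) 1 = coeff2 F 1 0 * fps_nth A 1 + coeff2 F 0 1 * fps_nth B 1"
  "fps_nth (along A B F) 2 = coeff2 F 1 0 * fps_nth A 2 + coeff2 F 0 1 * fps_nth B 2 +
     (coeff2 F 2 0 * fps_nth A 1 ^ 2 + coeff2 F 1 1 * fps_nth A 1 * fps_nth B 1 + coeff2 F 0 2 * fps_nth B 1 ^ 2)"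
  using A0 B0
  by (simp_all add: along_def coeff2_def fps_mult_nth fps_compose_nth numeral_2_eq_2 power2_eq_square algebra_simps)

end

lemma scalar_hom_fps2: "scalar_hom fps2_const"
  by (simp add: scalar_hom_def fps2_const_def)

lemma scalar_hom_fps: "scalar_hom fps_const"
  by (simp add: scalar_hom_def)

section \<open>Linear and quadratic forms, and the local expansion of lines and conics\<close>

lemma mono_degree_eq_0: "mono_degree t = 0 \<Longrightarrow> t = 0"
  by (intro poly_mapping_eqI) (simp add: mono_degree_def)

lemma mono_degree_Suc:
  assumes "mono_degree t = Suc n"
  shows "\<exists>i s. t = Poly_Mapping.single i 1 + s \<and> mono_degree s = n"
proof -
  obtain i where i: "Poly_Mapping.lookup t i \<noteq> 0" using assms unfolding mono_degree_def by fastforce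
  have t: "t = Poly_Mapping.single i 1 + (t - Poly_Mapping.single i 1)"
    using i by (intro poly_mapping_eqI) (auto simp: lookup_add lookup_minus lookup_single when_def)
  moreover have "mono_degree (t - Poly_Mapping.single i 1) = n"
    using arg_cong[OF t, of mono_degree] assms unfolding mono_degree_add mono_degree_single by simp
  ultimately show ?thesis by blast
qed

lemma single_split: "Poly_Mapping.single (Poly_Mapping.single i 1 + s) c = Var i * Poly_Mapping.single s c"
  by (simp add: Var_def mult_single)

lemma single_0_Const: "Poly_Mapping.single 0 c = Const c"
  by (simp add: Const_def)

lemma Const_0 [simp]: "Const 0 = 0" by (simp add: Const_def)
lemma Const_1 [simp]: "Const 1 = 1" by (simp add: Const_def)
lemma Const_add: "Const (a + b) = Const a + Const b" by (simp add: Const_def single_add)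
lemma Const_mult: "Const (a * b) = Const a * Const b" by (simp add: Const_def mult_single)

lemma graded_part_induct [consumes 1, case_names zero single add]:
  assumes "f \<in> graded_part (int n)" "P 0" "\<And>t c. mono_degree t = n \<Longrightarrow> P (Poly_Mapping.single t c)"
    "\<And>f g. P f \<Longrightarrow> P g \<Longrightarrow> P (f + g)"
  shows "P f"
proof -
  have "P (\<Sum>t\<in>A. Poly_Mapping.single t (Poly_Mapping.lookup f t))" if "finite A" "A \<subseteq> Poly_Mapping.keys f" for A
    using that assms(1) by (induction A) (auto intro!: assms simp: graded_part_def)
  thus ?thesis using poly_mapping_eq_sum_single[of f] by (metis finite_keys subset_refl)
qed

text \<open>A common format for lines and conics, with linear coefficients \<open>L\<close> and the
  Gram matrix \<open>M\<close> of a quadratic form, taken symmetric whenever derivatives are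
  computed. Expansions are then proved once for both kinds of components.\<close>

definition qpoly :: "(3 \<Rightarrow> complex) \<Rightarrow> (3 \<Rightarrow> 3 \<Rightarrow> complex) \<Rightarrow> poly3" where
  "qpoly L M = (\<Sum>i\<in>UNIV. Const (L i) * Var i) + (\<Sum>i\<in>UNIV. \<Sum>j\<in>UNIV. Const (M i j) * (Var i * Var j))"

lemma linear_form_rep:
  assumes "f \<in> graded_part 1" shows "\<exists>L. f = qpoly L (\<lambda>i j. 0)"
proof -
  have "f \<in> graded_part (int 1)" using assms by simp
  thus ?thesis
  proof (induction f rule: graded_part_induct)
    case zero show ?case by (intro exI[of _ "\<lambda>i. 0"]) (simp add: qpoly_def)
  next
    case (single t c)
    obtain i s where 1: "t = Poly_Mapping.single i 1 + s" "mono_degree s = 0"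
      using mono_degree_Suc[of t 0] single by auto
    have "Poly_Mapping.single t c = Const c * Var i"
      unfolding 1(1) mono_degree_eq_0[OF 1(2)] single_split single_0_Const by (simp only: mult_ac)
    also have "\<dots> = qpoly (\<lambda>j. if j = i then c else 0) (\<lambda>i j. 0)"
      by (simp add: qpoly_def if_distrib[of Const] if_distrib[of "\<lambda>x. x * _"] cong: if_cong)
    finally show ?case by blast
  next
    case (add f g)
    then obtain L L' where "f = qpoly L (\<lambda>i j. 0)" "g = qpoly L' (\<lambda>i j. 0)" by (elim exE) (rule that; assumption)
    thus ?case by (intro exI[of _ "\<lambda>i. L i + L' i"]) (simp add: qpoly_def Const_add distrib_right sum.distrib)
  qed
qed

lemma quadratic_form_rep:
  assumes "f \<in> graded_part 2" shows "\<exists>M. (\<forall>i j. M i j = M j i) \<and> f = qpoly (\<lambda>i. 0) M"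
proof -
  have "f \<in> graded_part (int 2)" using assms by simp
  thus ?thesis
  proof (induction f rule: graded_part_induct)
    case zero show ?case by (intro exI[of _ "\<lambda>i j. 0"]) (simp add: qpoly_def)
  next
    case (single t c)
    obtain i s where 1: "t = Poly_Mapping.single i 1 + s" "mono_degree s = 1"
      using mono_degree_Suc[of t 1] single by auto
    obtain j r where 2: "s = Poly_Mapping.single j 1 + r" "mono_degree r = 0"
      using mono_degree_Suc[of s 0] 1 by auto
    have "Poly_Mapping.single t c = Const c * (Var i * Var j)"
      unfolding 1(1) 2(1) mono_degree_eq_0[OF 2(2)] single_split single_0_Const by (simp only: mult_ac)
    \<comment> \<open>The coefficient is halved to obtain a symmetric matrix; for
      \<open>i = j\<close> both halves land in the same diagonal entry.\<close>
    also have "\<dots> = Const (c/2) * (Var i * Var j) + Const (c/2) * (Var j * Var i)"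
      unfolding mult.commute[of "Var j"] distrib_right[symmetric] Const_add[symmetric] by simp
    also have "\<dots> = qpoly (\<lambda>i. 0) (\<lambda>a b. (if a = i \<and> b = j then c/2 else 0) + (if a = j \<and> b = i then c/2 else 0))"
    proof -
      have "(\<Sum>a\<in>UNIV. \<Sum>b\<in>UNIV. Const (if a = i \<and> b = j then c/2 else 0) * (Var a * Var b)) = Const (c/2) * (Var i * Var j)" for i j
      proof -
        have "(\<Sum>b\<in>UNIV. Const (if a = i \<and> b = j then c/2 else 0) * (Var a * Var b)) = (if a = i then Const (c/2) * (Var i * Var j) else 0)" for a
          by (simp add: if_distrib[of Const] if_distrib[of "\<lambda>x. x * _"] cong: if_cong)
        thus ?thesis by simp
      qed
      thus ?thesis by (simp add: qpoly_def Const_add distrib_right sum.distrib)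
    qed
    finally have "Poly_Mapping.single t c = qpoly (\<lambda>i. 0) (\<lambda>a b. (if a = i \<and> b = j then c/2 else 0) + (if a = j \<and> b = i then c/2 else 0))" .
    moreover define N where "N = (\<lambda>a b. (if a = i \<and> b = j then c/2 else 0) + (if a = j \<and> b = i then c/2 else 0))"
    ultimately have "Poly_Mapping.single t c = qpoly (\<lambda>i. 0) N" by (simp only: N_def)
    moreover have "\<forall>a b. N a b = N b a" unfolding N_def by (auto simp only: add.commute conj_commute)
    ultimately show ?case by (intro exI[of _ N] conjI)
  next
    case (add f g)
    from add(1) obtain M where M: "\<forall>i j. M i j = M j i" "f = qpoly (\<lambda>i. 0) M" by (elim exE conjE)
    from add(2) obtain N where N: "\<forall>i j. N i j = N j i" "g = qpoly (\<lambda>i. 0) N" by (elim exE conjE)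
    have "f + g = qpoly (\<lambda>i. 0) (\<lambda>i j. M i j + N i j)"
      unfolding M(2) N(2) by (simp add: qpoly_def Const_add distrib_right sum.distrib)
    moreover have "\<forall>i j. M i j + N i j = M j i + N j i"
    proof (intro allI)
      fix i j show "M i j + N i j = M j i + N j i"
        unfolding M(1)[rule_format, of i j] N(1)[rule_format, of i j] ..
    qed
    ultimately show ?case by (intro exI[of _ "\<lambda>i j. M i j + N i j"] conjI)
  qed
qed

definition grad :: "poly3 \<Rightarrow> complex^3 \<Rightarrow> complex^3 \<Rightarrow> complex" where
  "grad c p h = (\<Sum>i\<in>UNIV. eval_at (partial_deriv i c) p * h $ i)"

text \<open>The quadratic part: \<open>0\<close> for a line and \<open>c\<close> itself for a conic.\<close>

definition quad :: "poly3 \<Rightarrow> complex^3 \<Rightarrow> complex" where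
  "quad c h = eval_at c h - grad c 0 h"

definition is_component :: "poly3 \<Rightarrow> bool" where
  "is_component c \<longleftrightarrow> is_line c \<or> is_smooth_conic c"

lemma grad_add: "grad c p (x + y) = grad c p x + grad c p y"
  by (simp add: grad_def distrib_left sum.distrib)
lemma grad_diff: "grad c p (x - y) = grad c p x - grad c p y"
  by (simp add: grad_def right_diff_distrib sum_subtractf)
lemma grad_smult: "grad c p (t *s x) = t * grad c p x"
  by (simp add: grad_def sum_distrib_left mult_ac)

lemma eval_qpoly: "eval_at (qpoly L M) x = (\<Sum>i\<in>UNIV. L i * x $ i) + (\<Sum>i\<in>UNIV. \<Sum>j\<in>UNIV. M i j * (x $ i * x $ j))"
  by (simp add: qpoly_def)

lemma partial_deriv_sum: "partial_deriv i (sum F A) = (\<Sum>a\<in>A. partial_deriv i (F a))"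
  by (induction A rule: infinite_finite_induct) auto

lemma partial_deriv_Const [simp]: "partial_deriv i (Const c) = 0"
  by (simp add: Const_def partial_deriv_single)

lemma eval_partial_deriv_Var [simp]: "eval_at (partial_deriv i (Var j)) x = (if i = j then 1 else 0)"
  by (rule eval_partial_deriv_unique)
     (use bounded_linear_imp_has_derivative[OF bounded_linear_vec_nth[of j]] in
       \<open>simp add: eval_at_simps[abs_def] if_distrib[of "\<lambda>c. c * _"] cong: if_cong\<close>)

lemma grad_qpoly:
  assumes M: "\<And>i j. M i j = M j i"
  shows "grad (qpoly L M) p h = (\<Sum>i\<in>UNIV. L i * h $ i) + 2 * (\<Sum>i\<in>UNIV. \<Sum>j\<in>UNIV. M i j * (p $ i * h $ j))"
proof -
  have M': "M 2 1 = M 1 2" "M 3 1 = M 1 3" "M 3 2 = M 2 3" by (rule M)+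
  show ?thesis
    unfolding grad_def qpoly_def partial_deriv_add partial_deriv_sum eval_at_simps eval_partial_deriv_mult partial_deriv_Const
    by (simp add: sum_3 M' algebra_simps)
qed

lemma quad_qpoly:
  assumes M: "\<And>i j. M i j = M j i"
  shows "quad (qpoly L M) h = (\<Sum>i\<in>UNIV. \<Sum>j\<in>UNIV. M i j * (h $ i * h $ j))"
  unfolding quad_def grad_qpoly[OF M] eval_qpoly by simp

lemma component_rep:
  assumes "is_component c"
  shows "\<exists>L M. (\<forall>i j. M i j = M j i) \<and> c = qpoly L M \<and> (L = (\<lambda>i. 0) \<or> M = (\<lambda>i j. 0))"
proof -
  consider "c \<in> graded_part 1" | "c \<in> graded_part 2"
    using assms unfolding is_component_def is_line_def is_smooth_conic_def by blast
  thus ?thesis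
  proof cases
    case 1
    from linear_form_rep[OF this] obtain L where "c = qpoly L (\<lambda>i j. 0)" ..
    thus ?thesis by (intro exI[of _ L] exI[of _ "\<lambda>i j. 0"]) simp
  next
    case 2
    from quadratic_form_rep[OF this] obtain M where "\<forall>i j. M i j = M j i" "c = qpoly (\<lambda>i. 0) M" by (elim exE conjE)
    thus ?thesis by (intro exI[of _ "\<lambda>i. 0"] exI[of _ M]) simp
  qed
qed

text \<open>The degree is at most two, so the second order expansion has no remainder.\<close>

lemma component_taylor:
  assumes "is_component c"
  shows "eval_at c (x + h) = eval_at c x + grad c x h + quad c h"
proof -
  obtain L M where LM': "\<forall>i j. M i j = M j i" "c = qpoly L M" using component_rep[OF assms] by (elim exE conjE) (rule that; assumption)
  note LM = LM'[rule_format]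
  have M': "M 2 1 = M 1 2" "M 3 1 = M 1 3" "M 3 2 = M 2 3" by (rule LM)+
  show ?thesis unfolding LM(2) eval_qpoly grad_qpoly[OF LM(1)] quad_qpoly[OF LM(1)]
    by (simp add: sum_3 M' algebra_simps)
qed

text \<open>After subtraction of the derivative, only bilinear terms remain, each with one factor
  \<open>y - y'\<close> and one factor \<open>y - p\<close> or \<open>y' - p\<close>. The latter are
  smaller than \<open>\<eta>\<close>; the denominator \<open>2 * K + 1\<close> is positive also for
  a line, where \<open>K\<close> is 0.\<close>

lemma component_sdiff:
  assumes "is_component c"
  shows "sdiff (eval_at c) p (grad c p)"
  unfolding sdiff_def
proof (intro allI impI)
  fix \<epsilon> :: real assume \<epsilon>: "\<epsilon> > 0"
  obtain L M where LM': "\<forall>i j. M i j = M j i" "c = qpoly L M" using component_rep[OF assms] by (elim exE conjE) (rule that; assumption)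
  note LM = LM'[rule_format]
  have M': "M 2 1 = M 1 2" "M 3 1 = M 1 3" "M 3 2 = M 2 3" by (rule LM)+
  define K where "K = (\<Sum>i\<in>UNIV. \<Sum>j\<in>UNIV. norm (M i j))"
  have K: "K \<ge> 0" unfolding K_def by (intro sum_nonneg) auto
  define \<eta> where "\<eta> = \<epsilon> / (2 * K + 1)"
  have \<eta>: "\<eta> > 0" "2 * K * \<eta> \<le> \<epsilon>" using \<epsilon> K by (auto simp: \<eta>_def field_simps)
  have "norm (eval_at c y - eval_at c y' - grad c p (y - y')) \<le> \<epsilon> * norm (y - y')"
    if y: "y \<in> ball p \<eta>" "y' \<in> ball p \<eta>" for y y'
  proof -
    let ?h = "y - y'"
    have "eval_at c y - eval_at c y' - grad c p ?h =
       (\<Sum>i\<in>UNIV. \<Sum>j\<in>UNIV. M i j * ((y - p) $ i * ?h $ j + ?h $ i * (y' - p) $ j))"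
      unfolding LM(2) eval_qpoly grad_qpoly[OF LM(1)] by (simp add: sum_3 M' algebra_simps)
    also have "norm \<dots> \<le> (\<Sum>i\<in>UNIV. \<Sum>j\<in>UNIV. norm (M i j) * (2 * \<eta> * norm ?h))"
    proof (intro sum_norm_le)
      fix i j
      have a: "norm ((y - p) $ i) \<le> \<eta>" "norm ((y' - p) $ j) \<le> \<eta>"
        using y Finite_Cartesian_Product.norm_nth_le[of "y - p" i] Finite_Cartesian_Product.norm_nth_le[of "y' - p" j]
        by (auto simp: dist_norm norm_minus_commute)
      have b: "norm (?h $ i) \<le> norm ?h" "norm (?h $ j) \<le> norm ?h"
        by (rule Finite_Cartesian_Product.norm_nth_le)+
      have "norm ((y - p) $ i * ?h $ j + ?h $ i * (y' - p) $ j) \<le> norm ((y - p) $ i) * norm (?h $ j) + norm (?h $ i) * norm ((y' - p) $ j)"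
        by (metis norm_mult norm_triangle_ineq)
      also have "\<dots> \<le> \<eta> * norm ?h + norm ?h * \<eta>" using \<eta>(1) by (intro add_mono mult_mono a b) auto
      finally show "norm (M i j * ((y - p) $ i * ?h $ j + ?h $ i * (y' - p) $ j)) \<le> norm (M i j) * (2 * \<eta> * norm ?h)"
        unfolding norm_mult by (intro mult_left_mono) auto
    qed
    also have "\<dots> = 2 * K * \<eta> * norm ?h" by (simp add: K_def sum_distrib_right sum_distrib_left mult_ac)
    also have "\<dots> \<le> \<epsilon> * norm ?h" by (intro mult_right_mono \<eta>) auto
    finally show ?thesis .
  qed
  thus "\<exists>\<eta>>0. \<forall>y\<in>ball p \<eta>. \<forall>y'\<in>ball p \<eta>. norm (eval_at c y - eval_at c y' - grad c p (y - y')) \<le> \<epsilon> * norm (y - y')"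
    using \<eta>(1) by blast
qed

lemma component_graded:
  assumes "is_component c" shows "\<exists>n. c \<in> graded_part (int n)"
  using assms unfolding is_component_def is_line_def is_smooth_conic_def by (metis of_nat_1 of_nat_numeral)

lemma component_grad_self:
  assumes "is_component c" "eval_at c p = 0" shows "grad c p p = 0"
proof -
  obtain n where "c \<in> graded_part (int n)" using component_graded[OF assms(1)] by blast
  from eval_euler[OF this, of p] show ?thesis using assms(2) by (simp add: grad_def mult.commute)
qed

lemma component_grad_nonzero:
  assumes c: "is_component c" and p: "p \<noteq> 0" and cp: "eval_at c p = 0"
  obtains h where "grad c p h \<noteq> 0"
proof (cases "is_line c")
  case True
  then obtain L where L: "c = qpoly L (\<lambda>i j. 0)" using linear_form_rep[of c] by (auto simp: is_line_def)
  have g: "grad c p h = eval_at c h" for h unfolding L grad_qpoly[OF refl] eval_qpoly by simp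
  have "c \<noteq> 0" using True by (simp add: is_line_def)
  then obtain h where "eval_at c h \<noteq> 0" using poly3_eq_0_iff by blast
  thus ?thesis using that g by metis
next
  case False
  hence "singular_points c = {}" using c by (auto simp: is_component_def is_smooth_conic_def)
  hence "p \<notin> singular_points c" by simp
  then obtain i where i: "eval_at (partial_deriv i c) p \<noteq> 0" using p cp unfolding singular_points_def zero_locus_def by blast
  have "grad c p (axis i 1) = eval_at (partial_deriv i c) p" by (simp add: grad_def axis_def if_distrib cong: if_cong)
  thus ?thesis using i that by metis
qed

text \<open>A normal form along a tangent vector \<open>w\<close>. The terms in \<open>z^2\<close>
  and \<open>z * v\<close> are multiples of the values of \<open>c\<close> and of its gradient along
  \<open>w\<close>, hence vanish; all others except \<open>v^2\<close> contain \<open>u\<close>.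
  Near \<open>p\<close>, where \<open>z\<close> is 1 and \<open>u\<close>, \<open>v\<close> are 0,
  the cofactor of \<open>u\<close> is close to \<open>grad c p e\<close>.\<close>

lemma component_tangent_coords:
  assumes c: "is_component c" and cp: "eval_at c p = 0" and w: "grad c p w = 0"
  shows "\<exists>\<alpha> \<beta> \<gamma>. \<forall>z u v. eval_at c (z *s p + u *s e + v *s w) =
    u * (grad c p e + \<alpha> * (z - 1) + \<beta> * u + \<gamma> * v) + v^2 * quad c w"
proof -
  obtain L M where LM': "\<forall>i j. M i j = M j i" "c = qpoly L M" "L = (\<lambda>i. 0) \<or> M = (\<lambda>i j. 0)"
    using component_rep[OF c] by (elim exE conjE) (rule that; assumption)
  note LM = LM'[rule_format]
  have M': "M 2 1 = M 1 2" "M 3 1 = M 1 3" "M 3 2 = M 2 3" by (rule LM)+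
  show ?thesis
  proof (cases "L = (\<lambda>i. 0)")
    case True
    define b where "b x y = (\<Sum>i\<in>UNIV. \<Sum>j\<in>UNIV. M i j * (x $ i * y $ j))" for x y :: "complex^3"
    have ev: "eval_at c x = b x x" for x unfolding LM(2) eval_qpoly b_def using True by simp
    have q: "quad c x = b x x" for x unfolding LM(2) quad_qpoly[OF LM(1)] b_def by simp
    have g: "grad c p x = 2 * b p x" for x unfolding LM(2) grad_qpoly[OF LM(1)] b_def using True by simp
    have E: "eval_at c (z *s p + u *s e + v *s w) =
      z^2 * b p p + 2 * z * u * b p e + 2 * z * v * b p w + u^2 * b e e + 2 * u * v * b e w + v^2 * b w w" for z u v
      unfolding ev b_def by (simp add: sum_3 M' algebra_simps power2_eq_square)
    have b0: "b p p = 0" "b p w = 0" using cp w ev g by auto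
    have "eval_at c (z *s p + u *s e + v *s w) =
      u * (grad c p e + (2 * b p e) * (z - 1) + b e e * u + (2 * b e w) * v) + v^2 * quad c w" for z u v
      unfolding E g q b0 by (simp add: algebra_simps power2_eq_square)
    thus ?thesis by blast
  next
    case False
    hence "M = (\<lambda>i j. 0)" using LM(3) by simp
    hence ev: "eval_at c x = grad c p x" and q: "quad c x = 0" for x
      unfolding LM(2) eval_qpoly grad_qpoly[OF LM(1)] quad_qpoly[OF LM(1)] by simp_all
    have "eval_at c (z *s p + u *s e + v *s w) = u * (grad c p e + 0 * (z - 1) + 0 * u + 0 * v) + v^2 * quad c w" for z u v
      unfolding q ev[of "z *s p + u *s e + v *s w"] grad_add grad_smult w using ev[of p] cp by simp
    thus ?thesis by blast
  qed
qed

text \<open>Here \<open>y1\<close> and \<open>y2\<close> are the first two Taylor coefficients of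
  the arc in space. To second order, \<open>c\<close> sees its acceleration through the gradient and
  its velocity through the quadratic part.\<close>

lemma along_germ_component:
  fixes p a b :: "complex^3" and A B :: "complex fps"
  assumes c: "is_component c" and A0: "fps_nth A 0 = 0" and B0: "fps_nth B 0 = 0"
  defines "G \<equiv> along A B (germ c p a b)"
  defines "y1 \<equiv> fps_nth A 1 *s a + fps_nth B 1 *s b" and "y2 \<equiv> fps_nth A 2 *s a + fps_nth B 2 *s b"
  shows "fps_nth G 0 = eval_at c p" "fps_nth G 1 = grad c p y1" "fps_nth G 2 = grad c p y2 + quad c y1"
proof -
  obtain L M where LM': "\<forall>i j. M i j = M j i" "c = qpoly L M" using component_rep[OF c] by (elim exE conjE) (rule that; assumption)
  note LM = LM'[rule_format]
  have M': "M 2 1 = M 1 2" "M 3 1 = M 1 3" "M 3 2 = M 2 3" by (rule LM)+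
  define X where "X i = fps_const (p $ i) + fps_const (a $ i) * A + fps_const (b $ i) * B" for i
  have "G = eval_hom fps_const X c"
    unfolding G_def germ_def along_eval_hom[OF A0 B0] X_def
    by (simp add: along_add[OF A0 B0] along_mult[OF A0 B0] along_const[OF A0 B0] along_u[OF A0 B0] along_v[OF A0 B0])
  hence G: "G = (\<Sum>i\<in>UNIV. fps_const (L i) * X i) + (\<Sum>i\<in>UNIV. \<Sum>j\<in>UNIV. fps_const (M i j) * (X i * X j))"
    unfolding LM(2) qpoly_def using scalar_hom_fps by simp
  have X: "fps_nth (X i) 0 = p $ i" "fps_nth (X i) (Suc 0) = y1 $ i" "fps_nth (X i) (Suc (Suc 0)) = y2 $ i" for i
    using A0 B0 by (simp_all add: X_def y1_def y2_def numeral_2_eq_2 mult.commute)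
  have XX: "fps_nth (X i * X j) 0 = p $ i * p $ j" "fps_nth (X i * X j) (Suc 0) = p $ i * y1 $ j + y1 $ i * p $ j"
    "fps_nth (X i * X j) (Suc (Suc 0)) = p $ i * y2 $ j + y1 $ i * y1 $ j + y2 $ i * p $ j" for i j
    by (simp_all add: fps_mult_nth X)
  show "fps_nth G 0 = eval_at c p" "fps_nth G 1 = grad c p y1" "fps_nth G 2 = grad c p y2 + quad c y1"
    unfolding G LM(2) eval_qpoly grad_qpoly[OF LM(1)] quad_qpoly[OF LM(1)]
    by (simp_all add: fps_sum_nth X XX numeral_2_eq_2 del: fps_mult_nth_0 fps_mult_nth_1)
       (simp_all add: sum_3 M' algebra_simps)
qed

lemma vector_matrix_expand: "v v* (vector [p, a, b] :: complex^3^3) = v $ 1 *s p + v $ 2 *s a + v $ 3 *s b"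
  by (simp add: vec_eq_iff vector_matrix_mult_def sum_3 mult.commute)

lemma local_frame_coords:
  assumes "local_frame p a b"
  obtains Z U V :: "complex^3 \<Rightarrow> complex" where "\<And>x. x = Z x *s p + U x *s a + V x *s b"
    "continuous_on UNIV Z" "continuous_on UNIV U" "continuous_on UNIV V" "Z p = 1" "U p = 0" "V p = 0"
proof -
  let ?M = "vector [p, a, b] :: complex^3^3"
  have "invertible ?M" using assms unfolding local_frame_def invertible_det_nz .
  then obtain N where N: "?M ** N = mat 1" "N ** ?M = mat 1" unfolding invertible_def by blast
  have e: "(x v* N) v* ?M = x" for x
    unfolding vector_matrix_mul_assoc N by (simp add: vector_matrix_mul_rid)
  have e2: "(x v* ?M) v* N = x" for x
    unfolding vector_matrix_mul_assoc N by (simp add: vector_matrix_mul_rid)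
  have c: "continuous_on UNIV (\<lambda>x. (x v* N) $ i)" for i
    unfolding vector_matrix_mult_def by (simp, intro continuous_intros)
  have "(axis 1 1) v* ?M = p" unfolding vector_matrix_expand by (simp add: axis_def)
  hence "p v* N = axis 1 1" using e2 by metis
  thus ?thesis
    using e[unfolded vector_matrix_expand] c
    by (intro that[of "\<lambda>x. (x v* N) $ 1" "\<lambda>x. (x v* N) $ 2" "\<lambda>x. (x v* N) $ 3"]) (auto simp: axis_def)
qed

lemma local_frame_change:
  assumes "local_frame p a b" "e1 * w2 - e2 * w1 \<noteq> 0"
  shows "local_frame p (e1 *s a + e2 *s b) (w1 *s a + w2 *s b)"
proof -
  have "det (vector [p, e1 *s a + e2 *s b, w1 *s a + w2 *s b] :: complex^3^3) = (e1 * w2 - e2 * w1) * det (vector [p, a, b] :: complex^3^3)"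
    by (simp add: det_3 algebra_simps)
  thus ?thesis using assms unfolding local_frame_def by simp
qed

section \<open>Comparison of the components with the branches along test arcs\<close>

lemma prod_nth_lowest:
  fixes P Q :: "'a::comm_ring_1 fps"
  assumes "\<And>k. k < m \<Longrightarrow> fps_nth P k = 0" "\<And>k. k < n \<Longrightarrow> fps_nth Q k = 0"
  shows "\<And>k. k < m + n \<Longrightarrow> fps_nth (P * Q) k = 0" "fps_nth (P * Q) (m + n) = fps_nth P m * fps_nth Q n"
proof -
  fix k assume k: "k < m + n"
  show "fps_nth (P * Q) k = 0" unfolding fps_mult_nth
  proof (intro sum.neutral ballI)
    fix i assume "i \<in> {0..k}"
    thus "fps_nth P i * fps_nth Q (k - i) = 0" using assms k by (cases "i < m") auto
  qed
next
  have "fps_nth (P * Q) (m + n) = (\<Sum>i=0..m+n. if i = m then fps_nth P m * fps_nth Q n else 0)"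
    unfolding fps_mult_nth
  proof (intro sum.cong refl)
    fix i assume "i \<in> {0..m+n}"
    thus "fps_nth P i * fps_nth Q (m + n - i) = (if i = m then fps_nth P m * fps_nth Q n else 0)"
      using assms(1)[of i] assms(2)[of "m + n - i"] by (cases i m rule: linorder_cases) auto
  qed
  thus "fps_nth (P * Q) (m + n) = fps_nth P m * fps_nth Q n" by simp
qed

lemma prod_set_nth_lowest:
  fixes s :: "'i \<Rightarrow> complex fps"
  assumes "finite T" "\<And>i k. i \<in> T \<Longrightarrow> k < e \<Longrightarrow> fps_nth (s i) k = 0"
  shows "(\<forall>k < e * card T. fps_nth (\<Prod>i\<in>T. s i) k = 0) \<and> fps_nth (\<Prod>i\<in>T. s i) (e * card T) = (\<Prod>i\<in>T. fps_nth (s i) e)"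
  using assms
proof (induction T rule: finite_induct)
  case (insert i T)
  thus ?case using prod_nth_lowest[of e "s i" "e * card T" "\<Prod>i\<in>T. s i"] by auto
qed simp

lemma prod_list_nth_lowest:
  fixes s :: "'i \<Rightarrow> complex fps"
  assumes "\<And>i k. i \<in> set gs \<Longrightarrow> k < e \<Longrightarrow> fps_nth (s i) k = 0"
  shows "(\<forall>k < e * length gs. fps_nth (\<Prod>i\<leftarrow>gs. s i) k = 0) \<and> fps_nth (\<Prod>i\<leftarrow>gs. s i) (e * length gs) = (\<Prod>i\<leftarrow>gs. fps_nth (s i) e)"
  using assms
proof (induction gs)
  case (Cons i T)
  thus ?case using prod_nth_lowest[of e "s i" "e * length T" "\<Prod>i\<leftarrow>T. s i"] by auto
qed simp

text \<open>Each pair excludes at most one value of \<open>t\<close>.\<close>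

lemma generic_direction:
  fixes S :: "(complex \<times> complex) set"
  assumes "finite S" "\<And>x y. (x, y) \<in> S \<Longrightarrow> x \<noteq> 0 \<or> y \<noteq> 0"
  shows "\<exists>t. \<forall>(x,y)\<in>S. x + t * y \<noteq> 0"
proof -
  have "finite (\<Union>(x,y)\<in>S. {t. x + t * y = 0})"
  proof (intro finite_UN_I assms(1))
    fix s assume s: "s \<in> S"
    obtain x y where xy: "s = (x,y)" by fastforce
    have "{t. x + t * y = 0} \<subseteq> {- x / y}" if "y \<noteq> 0"
      using that by (auto simp: field_simps eq_neg_iff_add_eq_0)
    moreover have "{t. x + t * y = 0} = {}" if "y = 0" using assms(2)[of x y] s xy that by auto
    ultimately show "finite (case s of (x,y) \<Rightarrow> {t. x + t * y = 0})"
      unfolding xy by (cases "y = 0") (auto intro: finite_subset)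
  qed
  then obtain t where "t \<notin> (\<Union>(x,y)\<in>S. {t. x + t * y = 0})"
    using infinite_UNIV_char_0 by (metis UNIV_eq_I)
  thus ?thesis by (intro exI[of _ t]) auto
qed

text \<open>Linear independence of the two differentials at \<open>p\<close>, expressed by dual
  vectors because these are the directions of the slices in \<open>pw_local\<close>.\<close>

definition indep_grad :: "poly3 \<Rightarrow> poly3 \<Rightarrow> complex^3 \<Rightarrow> bool" where
  "indep_grad c c' p \<longleftrightarrow> (\<exists>e0 e1. grad c p e0 = 1 \<and> grad c p e1 = 0 \<and> grad c' p e0 = 0 \<and> grad c' p e1 = 1)"

text \<open>Cramer's rule gives the dual vectors as combinations of \<open>a\<close> and
  \<open>b\<close>.\<close>

lemma indep_gradI:
  assumes "grad c p a * grad c' p b - grad c p b * grad c' p a \<noteq> 0" (is "?D \<noteq> 0")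
  shows "indep_grad c c' p"
  unfolding indep_grad_def
proof (intro exI conjI)
  let ?e0 = "(grad c' p b / ?D) *s a + (- grad c' p a / ?D) *s b"
  let ?e1 = "(- grad c p b / ?D) *s a + (grad c p a / ?D) *s b"
  have e: "(s / D) * u + (t / D) * v = (s * u + t * v) / D" for s t u v D :: complex
    by (simp add: add_divide_distrib)
  show "grad c p ?e0 = 1" "grad c p ?e1 = 0" "grad c' p ?e0 = 0" "grad c' p ?e1 = 1"
    unfolding grad_add grad_smult e using assms by (simp_all add: divide_eq_eq algebra_simps)
qed

text \<open>The same germ is factored in two ways: into the germs of the components, where those
  missing \<open>p\<close> are units, and into a unit and the smooth branches \<open>gs\<close>.
  Instead of matching factors by unique factorization in the ring of power series, both products are
  restricted to arcs through \<open>p\<close>, and their lowest coefficients are compared.\<close>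

locale component_product =
  fixes I :: "nat set" and c :: "nat \<Rightarrow> poly3" and p a b :: "complex^3" and w :: fps2 and gs :: "fps2 list"
  assumes I: "finite I" and c: "\<And>i. i \<in> I \<Longrightarrow> is_component (c i)" and p: "p \<noteq> 0"
    and frame: "local_frame p a b" and w: "w dvd 1"
    and germ: "germ (\<Prod>i\<in>I. c i) p a b = w * prod_list gs"
    and gs: "\<And>g. g \<in> set gs \<Longrightarrow> smooth_branch g"
begin

definition T where "T = {i \<in> I. eval_at (c i) p = 0}"
definition K where "K = (\<Prod>i\<in>I - T. eval_at (c i) p)"
definition w0 where "w0 = coeff2 w 0 0"
definition x where "x i = grad (c i) p a"
definition y where "y i = grad (c i) p b"
definition g1 :: "fps2 \<Rightarrow> complex" where "g1 g = coeff2 g 1 0"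
definition g2 :: "fps2 \<Rightarrow> complex" where "g2 g = coeff2 g 0 1"

lemma T_sub: "T \<subseteq> I" and T_fin: "finite T"
  using I by (auto simp: T_def)

lemma K: "K \<noteq> 0" using I by (auto simp: K_def T_def)

lemma w0: "w0 \<noteq> 0"
proof -
  obtain v where v: "1 = w * v" using w by (auto simp: dvd_def)
  have "along 0 0 w * along 0 0 v = 1" using v by (simp add: along_mult[symmetric] along_1)
  from arg_cong[OF this, of "\<lambda>f. fps_nth f 0"] have "coeff2 w 0 0 * coeff2 v 0 0 = 1"
    by (simp add: along_nth)
  thus ?thesis by (auto simp: w0_def)
qed

lemma xy: "i \<in> T \<Longrightarrow> x i \<noteq> 0 \<or> y i \<noteq> 0"
proof -
  assume i: "i \<in> T"
  hence ci: "is_component (c i)" "eval_at (c i) p = 0" using c by (auto simp: T_def)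
  obtain h where h: "grad (c i) p h \<noteq> 0" by (rule component_grad_nonzero[OF ci(1) p ci(2)])
  obtain Z U V where "\<And>x. x = Z x *s p + U x *s a + V x *s b" by (rule local_frame_coords[OF frame]) blast
  hence "h = Z h *s p + U h *s a + V h *s b" by blast
  hence "grad (c i) p h = Z h * grad (c i) p p + U h * grad (c i) p a + V h * grad (c i) p b"
    by (metis grad_add grad_smult)
  thus ?thesis using h component_grad_self[OF ci] by (auto simp: x_def y_def)
qed

lemma g12: "g \<in> set gs \<Longrightarrow> g1 g \<noteq> 0 \<or> g2 g \<noteq> 0" "g \<in> set gs \<Longrightarrow> coeff2 g 0 0 = 0"
  using gs by (auto simp: smooth_branch_def g1_def g2_def)

lemma germ_along:
  assumes A0: "fps_nth A 0 = 0" and B0: "fps_nth B 0 = 0"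
  shows "(\<Prod>i\<in>T. along A B (germ (c i) p a b)) * (\<Prod>i\<in>I - T. along A B (germ (c i) p a b)) = along A B w * (\<Prod>g\<leftarrow>gs. along A B g)"
proof -
  have "germ (\<Prod>i\<in>I. c i) p a b = (\<Prod>i\<in>I. germ (c i) p a b)"
    unfolding germ_def using scalar_hom_fps2 by simp
  hence "along A B (\<Prod>i\<in>I. germ (c i) p a b) = along A B (w * prod_list gs)" using germ by simp
  hence "(\<Prod>i\<in>I. along A B (germ (c i) p a b)) = along A B w * (\<Prod>g\<leftarrow>gs. along A B g)"
    by (simp add: along_prod[OF A0 B0] along_mult[OF A0 B0] along_prod_list[OF A0 B0])
  moreover have "(\<Prod>i\<in>I. along A B (germ (c i) p a b)) = (\<Prod>i\<in>T. along A B (germ (c i) p a b)) * (\<Prod>i\<in>I - T. along A B (germ (c i) p a b))"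
    using prod.subset_diff[OF T_sub I] by (simp add: mult.commute)
  ultimately show ?thesis by simp
qed

text \<open>If every component through \<open>p\<close> and every branch has order at least
  \<open>e\<close> along the arc, the two products start in degrees \<open>e * card T\<close> and
  \<open>e * length gs\<close> or later. Equality of the products then kills the coefficient that
  comes too early, or identifies the two. It is applied to straight arcs with \<open>e = 1\<close>
  and to tangent arcs with \<open>e = 2\<close>.\<close>

lemma nth_compare:
  assumes A0: "fps_nth A 0 = 0" and B0: "fps_nth B 0 = 0"
    and e1: "\<And>i k. i \<in> T \<Longrightarrow> k < e \<Longrightarrow> fps_nth (along A B (germ (c i) p a b)) k = 0"
    and e2: "\<And>g k. g \<in> set gs \<Longrightarrow> k < e \<Longrightarrow> fps_nth (along A B g) k = 0"
  shows "e * card T < e * length gs \<Longrightarrow> (\<Prod>i\<in>T. fps_nth (along A B (germ (c i) p a b)) e) = 0"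
    "e * length gs < e * card T \<Longrightarrow> (\<Prod>g\<leftarrow>gs. fps_nth (along A B g) e) = 0"
    "card T = length gs \<Longrightarrow> K * (\<Prod>i\<in>T. fps_nth (along A B (germ (c i) p a b)) e) = w0 * (\<Prod>g\<leftarrow>gs. fps_nth (along A B g) e)"
proof -
  let ?P = "\<Prod>i\<in>T. along A B (germ (c i) p a b)" and ?Q = "\<Prod>i\<in>I - T. along A B (germ (c i) p a b)"
  let ?R = "\<Prod>g\<leftarrow>gs. along A B g"
  have Q0: "fps_nth ?Q 0 = K"
  proof -
    have "fps_nth ?Q 0 = (\<Prod>i\<in>I - T. fps_nth (along A B (germ (c i) p a b)) 0)"
      using prod_set_nth_lowest[of "I - T" 0 "\<lambda>i. along A B (germ (c i) p a b)"] I by simp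
    also have "\<dots> = K" unfolding K_def
      by (intro prod.cong refl along_germ_component(1)[OF c A0 B0]) auto
    finally show ?thesis .
  qed
  have W0: "fps_nth (along A B w) 0 = w0" by (simp add: along_nth[OF A0 B0] w0_def)
  note P = prod_set_nth_lowest[OF T_fin, of e "\<lambda>i. along A B (germ (c i) p a b)", OF e1]
  note R = prod_list_nth_lowest[of gs e "along A B", OF e2]
  have L: "fps_nth (?P * ?Q) (e * card T) = (\<Prod>i\<in>T. fps_nth (along A B (germ (c i) p a b)) e) * K"
    "\<And>k. k < e * card T \<Longrightarrow> fps_nth (?P * ?Q) k = 0"
    using prod_nth_lowest[of "e * card T" ?P 0 ?Q] P Q0 by auto
  have M: "fps_nth (along A B w * ?R) (e * length gs) = w0 * (\<Prod>g\<leftarrow>gs. fps_nth (along A B g) e)"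
    "\<And>k. k < e * length gs \<Longrightarrow> fps_nth (along A B w * ?R) k = 0"
    using prod_nth_lowest[of 0 "along A B w" "e * length gs" ?R] R W0 by auto
  note E = germ_along[OF A0 B0]
  show "e * card T < e * length gs \<Longrightarrow> (\<Prod>i\<in>T. fps_nth (along A B (germ (c i) p a b)) e) = 0"
    using L(1) M(2)[of "e * card T"] K unfolding E by auto
  show "e * length gs < e * card T \<Longrightarrow> (\<Prod>g\<leftarrow>gs. fps_nth (along A B g) e) = 0"
    using L(2)[of "e * length gs"] M(1) w0 unfolding E by auto
  show "card T = length gs \<Longrightarrow> K * (\<Prod>i\<in>T. fps_nth (along A B (germ (c i) p a b)) e) = w0 * (\<Prod>g\<leftarrow>gs. fps_nth (along A B g) e)"
    using L(1) M(1) unfolding E by (simp add: mult.commute)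
qed

lemma along_line:
  assumes 0: "fps_nth A 0 = 0" "fps_nth B 0 = 0"
  shows "\<And>i k. i \<in> T \<Longrightarrow> k < 1 \<Longrightarrow> fps_nth (along A B (germ (c i) p a b)) k = 0"
    "\<And>g k. g \<in> set gs \<Longrightarrow> k < 1 \<Longrightarrow> fps_nth (along A B g) k = 0"
    "\<And>i. i \<in> T \<Longrightarrow> fps_nth (along A B (germ (c i) p a b)) 1 = fps_nth A 1 * x i + fps_nth B 1 * y i"
    "\<And>g. fps_nth (along A B g) 1 = fps_nth A 1 * g1 g + fps_nth B 1 * g2 g"
proof -
  show "fps_nth (along A B (germ (c i) p a b)) k = 0" if "i \<in> T" "k < 1" for i k
    using along_germ_component(1)[OF c 0, of i p a b] that by (auto simp: T_def)
  show "fps_nth (along A B g) k = 0" if "g \<in> set gs" "k < 1" for g k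
    using g12(2) that by (simp add: along_nth[OF 0])
  show "fps_nth (along A B (germ (c i) p a b)) 1 = fps_nth A 1 * x i + fps_nth B 1 * y i" if "i \<in> T" for i
    using along_germ_component(2)[OF c 0, of i p a b] that by (simp add: T_def x_def y_def grad_add grad_smult)
  show "fps_nth (along A B g) 1 = fps_nth A 1 * g1 g + fps_nth B 1 * g2 g" for g
    using along_nth(2)[OF 0] by (simp add: g1_def g2_def mult.commute)
qed

text \<open>Along a straight arc transversal to all components through \<open>p\<close> and to all
  branches, no factor has a vanishing linear coefficient. Both products then have order equal to
  their number of factors.\<close>

lemma card_T: "card T = length gs"
proof -
  let ?S = "(\<lambda>i. (x i, y i)) ` T \<union> (\<lambda>g. (g1 g, g2 g)) ` set gs"
  have "\<exists>t. \<forall>(x,y)\<in>?S. x + t * y \<noteq> 0"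
    by (rule generic_direction) (use T_fin xy g12 in auto)
  then obtain t where t: "\<And>i. i \<in> T \<Longrightarrow> x i + t * y i \<noteq> 0" "\<And>g. g \<in> set gs \<Longrightarrow> g1 g + t * g2 g \<noteq> 0"
    by auto
  let ?A = "fps_X :: complex fps" and ?B = "fps_const t * fps_X"
  have 0: "fps_nth ?A 0 = 0" "fps_nth ?B 0 = 0" and 1: "fps_nth ?A 1 = 1" "fps_nth ?B 1 = t" by simp_all
  note L = along_line[OF 0, unfolded 1]
  note N = nth_compare[where e = 1, OF 0]
  have C1: "card T < length gs \<Longrightarrow> (\<Prod>i\<in>T. fps_nth (along ?A ?B (germ (c i) p a b)) 1) = 0"
    by (rule N(1)) (use L(1,2) in \<open>auto\<close>)
  have C2: "length gs < card T \<Longrightarrow> (\<Prod>g\<leftarrow>gs. fps_nth (along ?A ?B g) 1) = 0"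
    by (rule N(2)) (use L(1,2) in \<open>auto\<close>)
  have 2: "(\<Prod>i\<in>T. fps_nth (along ?A ?B (germ (c i) p a b)) 1) \<noteq> 0"
    using t L(3) T_fin by simp
  have 3: "(\<Prod>g\<leftarrow>gs. fps_nth (along ?A ?B g) 1) \<noteq> 0"
    unfolding L(4) using t by (auto simp: prod_list_zero_iff)
  show ?thesis using C1 C2 2 3 by (cases "card T" "length gs" rule: linorder_cases) auto
qed

text \<open>Equality of the tangent cones up to the units \<open>K\<close> and \<open>w0\<close>,
  read off from straight arcs in every direction.\<close>

lemma leading_form:
  "K * (\<Prod>i\<in>T. \<alpha> * x i + \<beta> * y i) = w0 * (\<Prod>g\<leftarrow>gs. \<alpha> * g1 g + \<beta> * g2 g)"
proof -
  let ?A = "fps_const \<alpha> * fps_X" and ?B = "fps_const \<beta> * fps_X"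
  have 0: "fps_nth ?A 0 = 0" "fps_nth ?B 0 = 0" and 1: "fps_nth ?A 1 = \<alpha>" "fps_nth ?B 1 = \<beta>" by simp_all
  note L = along_line[OF 0, unfolded 1]
  have "(\<Prod>i\<in>T. \<alpha> * x i + \<beta> * y i) = (\<Prod>i\<in>T. fps_nth (along ?A ?B (germ (c i) p a b)) 1)"
    by (intro prod.cong refl L(3)[symmetric])
  moreover have "K * (\<Prod>i\<in>T. fps_nth (along ?A ?B (germ (c i) p a b)) 1) = w0 * (\<Prod>g\<leftarrow>gs. fps_nth (along ?A ?B g) 1)"
    by (rule nth_compare(3)[where e = 1, OF 0]) (use L(1,2) card_T in \<open>auto\<close>)
  ultimately show ?thesis unfolding L(4) by simp
qed

lemma indep_T: "x i * y j - y i * x j \<noteq> 0 \<Longrightarrow> indep_grad (c i) (c j) p"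
  unfolding x_def y_def by (rule indep_gradI)

end

text \<open>The two sides of the hypothesis are the same binary quadratic form in \<alpha> and
  \<beta>; the conclusion compares its discriminant as computed from either factorization.\<close>

lemma quadratic_product_discriminant:
  fixes x y x' y' g1 g2 h1 h2 K w :: complex
  assumes "\<And>\<alpha> \<beta>. K * ((\<alpha> * x + \<beta> * y) * (\<alpha> * x' + \<beta> * y')) = w * ((\<alpha> * g1 + \<beta> * g2) * (\<alpha> * h1 + \<beta> * h2))"
  shows "(K * (x * y' - y * x'))^2 = (w * (g1 * h2 - g2 * h1))^2"
proof -
  have 1: "K * (x * x') = w * (g1 * h1)" using assms[of 1 0] by simp
  have 2: "K * (y * y') = w * (g2 * h2)" using assms[of 0 1] by simp
  have "K * ((x + y) * (x' + y')) = w * ((g1 + g2) * (h1 + h2))" using assms[of 1 1] by simp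
  hence 3: "K * (x * y' + y * x') = w * (g1 * h2 + g2 * h1)" using 1 2 by (simp add: algebra_simps)
  have "(K * (x * y' - y * x'))^2 = (K * (x * y' + y * x'))^2 - 4 * (K * (x * x')) * (K * (y * y'))"
    by (simp add: power2_eq_square algebra_simps)
  also have "\<dots> = (w * (g1 * h2 - g2 * h1))^2"
    unfolding 1 2 3 by (simp add: power2_eq_square algebra_simps)
  finally show ?thesis .
qed

lemma same_kernel:
  fixes x y \<alpha> \<beta> \<alpha>' \<beta>' :: complex
  assumes "x \<noteq> 0 \<or> y \<noteq> 0" "\<alpha> * x + \<beta> * y = 0" "\<alpha>' * x + \<beta>' * y = 0"
  shows "\<alpha> * \<beta>' - \<beta> * \<alpha>' = 0"
proof -
  have "(\<alpha> * \<beta>' - \<beta> * \<alpha>') * x = \<beta>' * (\<alpha> * x + \<beta> * y) - \<beta> * (\<alpha>' * x + \<beta>' * y)"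
    by (simp add: algebra_simps)
  moreover have "(\<alpha> * \<beta>' - \<beta> * \<alpha>') * y = \<alpha> * (\<alpha>' * x + \<beta>' * y) - \<alpha>' * (\<alpha> * x + \<beta> * y)"
    by (simp add: algebra_simps)
  ultimately show ?thesis using assms by auto
qed

text \<open>The three branch directions are zeros of the cubic form on the left. If two of its
  linear factors were proportional, it would have only two zero directions, so two of the three
  pairwise independent directions would be annihilated by one nonzero linear form.\<close>

lemma cubic_product_independent:
  fixes x y x' y' x'' y'' K w :: complex
  assumes id: "\<And>\<alpha> \<beta>. K * ((\<alpha> * x + \<beta> * y) * (\<alpha> * x' + \<beta> * y') * (\<alpha> * x'' + \<beta> * y'')) = w * ((\<alpha> * g1 + \<beta> * g2) * (\<alpha> * h1 + \<beta> * h2) * (\<alpha> * e1 + \<beta> * e2))"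
    and K: "K \<noteq> 0"
    and nz: "x \<noteq> 0 \<or> y \<noteq> 0" "x' \<noteq> 0 \<or> y' \<noteq> 0" "x'' \<noteq> 0 \<or> y'' \<noteq> 0"
    and ind: "g1 * h2 - g2 * h1 \<noteq> 0" "g1 * e2 - g2 * e1 \<noteq> 0" "h1 * e2 - h2 * e1 \<noteq> 0"
  shows "x * y' - y * x' \<noteq> 0"
proof
  assume D: "x * y' - y * x' = 0"
  have eq: "\<alpha> * x + \<beta> * y = 0" if "\<alpha> * x' + \<beta> * y' = 0" for \<alpha> \<beta>
  proof -
    have "(\<alpha> * x + \<beta> * y) * x' = x * (\<alpha> * x' + \<beta> * y') - \<beta> * (x * y' - y * x')" by (simp add: algebra_simps)
    moreover have "(\<alpha> * x + \<beta> * y) * y' = y * (\<alpha> * x' + \<beta> * y') + \<alpha> * (x * y' - y * x')" by (simp add: algebra_simps)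
    ultimately show ?thesis using that D nz(2) by auto
  qed
  have z: "\<alpha> * x + \<beta> * y = 0 \<or> \<alpha> * x'' + \<beta> * y'' = 0"
    if "(\<alpha> * g1 + \<beta> * g2) * (\<alpha> * h1 + \<beta> * h2) * (\<alpha> * e1 + \<beta> * e2) = 0" for \<alpha> \<beta>
    using id[of \<alpha> \<beta>] that K eq[of \<alpha> \<beta>] by auto
  have zg: "g2 * x + (- g1) * y = 0 \<or> g2 * x'' + (- g1) * y'' = 0" by (rule z) (simp add: algebra_simps)
  have zh: "h2 * x + (- h1) * y = 0 \<or> h2 * x'' + (- h1) * y'' = 0" by (rule z) (simp add: algebra_simps)
  have ze: "e2 * x + (- e1) * y = 0 \<or> e2 * x'' + (- e1) * y'' = 0" by (rule z) (simp add: algebra_simps)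
  have k: "False" if "g2 * x + (- g1) * y = 0" "h2 * x + (- h1) * y = 0" "g1 * h2 - g2 * h1 \<noteq> 0" "x \<noteq> 0 \<or> y \<noteq> 0" for g1 g2 h1 h2 x y :: complex
    using same_kernel[OF that(4) that(1,2)] that(3) by (simp add: algebra_simps)
  show False using zg zh ze k[OF _ _ ind(1) nz(1)] k[OF _ _ ind(2) nz(1)] k[OF _ _ ind(3) nz(1)]
     k[OF _ _ ind(1) nz(3)] k[OF _ _ ind(2) nz(3)] k[OF _ _ ind(3) nz(3)] by blast
qed

lemma card_2_obtain: "card T = 2 \<Longrightarrow> \<exists>i j. i \<noteq> j \<and> T = {i, j}"
  by (auto simp: card_2_iff)

lemma node_components:
  fixes I :: "nat set"
  assumes I: "finite I" and c: "\<And>i. i \<in> I \<Longrightarrow> is_component (c i)" and p: "p \<noteq> 0"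
    and node: "is_node (\<Prod>i\<in>I. c i) p"
  shows "\<exists>i j. i \<noteq> j \<and> {i \<in> I. eval_at (c i) p = 0} = {i, j} \<and> indep_grad (c i) (c j) p"
proof -
  obtain g h a b w where 1: "local_frame p a b" "w dvd 1" "germ (\<Prod>i\<in>I. c i) p a b = w * prod_list [g, h]"
    "\<forall>g\<in>set [g, h]. smooth_branch g" "distinct_tangents g h"
    using node unfolding is_node_def has_smooth_branches_def by blast
  interpret component_product I c p a b w "[g, h]" by unfold_locales (use I c p 1 in auto)
  obtain i j where ij: "i \<noteq> j" "T = {i, j}" using card_T card_2_obtain[of T] by auto
  have "K * ((\<alpha> * x i + \<beta> * y i) * (\<alpha> * x j + \<beta> * y j)) = w0 * ((\<alpha> * g1 g + \<beta> * g2 g) * (\<alpha> * g1 h + \<beta> * g2 h))" for \<alpha> \<beta>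
    using leading_form[of \<alpha> \<beta>] ij by simp
  from quadratic_product_discriminant[OF this]
  have "x i * y j - y i * x j \<noteq> 0" using 1(5) w0 by (auto simp: distinct_tangents_def g1_def g2_def)
  thus ?thesis using ij indep_T unfolding T_def by blast
qed

lemma triple_point_components:
  fixes I :: "nat set"
  assumes I: "finite I" and c: "\<And>i. i \<in> I \<Longrightarrow> is_component (c i)" and p: "p \<noteq> 0"
    and D4: "is_ordinary_triple_point (\<Prod>i\<in>I. c i) p"
  shows "\<exists>i j k. i \<noteq> j \<and> i \<noteq> k \<and> j \<noteq> k \<and> {i \<in> I. eval_at (c i) p = 0} = {i, j, k} \<and>
     indep_grad (c i) (c j) p \<and> indep_grad (c i) (c k) p \<and> indep_grad (c j) (c k) p"
proof -
  obtain g h e a b w where 1: "local_frame p a b" "w dvd 1" "germ (\<Prod>i\<in>I. c i) p a b = w * prod_list [g, h, e]"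
    "\<forall>g\<in>set [g, h, e]. smooth_branch g" "distinct_tangents g h" "distinct_tangents g e" "distinct_tangents h e"
    using D4 unfolding is_ordinary_triple_point_def has_smooth_branches_def by blast
  interpret component_product I c p a b w "[g, h, e]" by unfold_locales (use I c p 1 in auto)
  have "card T = 3" using card_T by simp
  then obtain i j k where ij: "i \<noteq> j" "i \<noteq> k" "j \<noteq> k" "T = {i, j, k}" by (auto simp: card_3_iff)
  have L: "K * ((\<alpha> * x i + \<beta> * y i) * (\<alpha> * x j + \<beta> * y j) * (\<alpha> * x k + \<beta> * y k)) = w0 * ((\<alpha> * g1 g + \<beta> * g2 g) * (\<alpha> * g1 h + \<beta> * g2 h) * (\<alpha> * g1 e + \<beta> * g2 e))" for \<alpha> \<beta>
    using leading_form[of \<alpha> \<beta>] ij by (simp add: mult.assoc)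
  have L2: "K * ((\<alpha> * x i + \<beta> * y i) * (\<alpha> * x k + \<beta> * y k) * (\<alpha> * x j + \<beta> * y j)) = w0 * ((\<alpha> * g1 g + \<beta> * g2 g) * (\<alpha> * g1 h + \<beta> * g2 h) * (\<alpha> * g1 e + \<beta> * g2 e))" for \<alpha> \<beta>
    using L[of \<alpha> \<beta>] by (simp add: mult_ac)
  have L3: "K * ((\<alpha> * x j + \<beta> * y j) * (\<alpha> * x k + \<beta> * y k) * (\<alpha> * x i + \<beta> * y i)) = w0 * ((\<alpha> * g1 g + \<beta> * g2 g) * (\<alpha> * g1 h + \<beta> * g2 h) * (\<alpha> * g1 e + \<beta> * g2 e))" for \<alpha> \<beta>
    using L[of \<alpha> \<beta>] by (simp add: mult_ac)
  have d: "g1 g * g2 h - g2 g * g1 h \<noteq> 0" "g1 g * g2 e - g2 g * g1 e \<noteq> 0" "g1 h * g2 e - g2 h * g1 e \<noteq> 0"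
    using 1 by (auto simp: distinct_tangents_def g1_def g2_def)
  have n: "x i \<noteq> 0 \<or> y i \<noteq> 0" "x j \<noteq> 0 \<or> y j \<noteq> 0" "x k \<noteq> 0 \<or> y k \<noteq> 0" using xy ij by auto
  have "x i * y j - y i * x j \<noteq> 0" by (rule cubic_product_independent[OF L K n d])
  moreover have "x i * y k - y i * x k \<noteq> 0" by (rule cubic_product_independent[OF L2 K n(1,3,2) d])
  moreover have "x j * y k - y j * x k \<noteq> 0" by (rule cubic_product_independent[OF L3 K n(2,3,1) d])
  ultimately show ?thesis using ij indep_T unfolding T_def by blast
qed

section \<open>Tacnodes: exact order of contact from the intersection multiplicity\<close>

lemma proportional_zero:
  fixes g1 g2 h1 h2 \<alpha> \<beta> :: complex
  assumes "g1 \<noteq> 0 \<or> g2 \<noteq> 0" "g1 * h2 - g2 * h1 = 0" "\<alpha> * g1 + \<beta> * g2 = 0"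
  shows "\<alpha> * h1 + \<beta> * h2 = 0"
proof -
  have "(\<alpha> * h1 + \<beta> * h2) * g1 = h1 * (\<alpha> * g1 + \<beta> * g2) + \<beta> * (g1 * h2 - g2 * h1)"
    "(\<alpha> * h1 + \<beta> * h2) * g2 = h2 * (\<alpha> * g1 + \<beta> * g2) - \<alpha> * (g1 * h2 - g2 * h1)"
    by (simp_all add: algebra_simps)
  thus ?thesis using assms by auto
qed

lemma affine_form_zero:
  fixes g1 g2 q :: complex
  assumes "g1 \<noteq> 0 \<or> g2 \<noteq> 0"
  obtains u v where "g1 * u + g2 * v + q = 0"
proof (cases "g1 = 0")
  case True thus ?thesis using assms that[of 0 "- q / g2"] by simp
next
  case False thus ?thesis using that[of "- q / g1" 0] by simp
qed

text \<open>If both germs vanish to order three along a regular arc, restriction to the arc maps the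
  quotient by them onto the space of jets modulo the third power of the parameter, so its dimension
  is at least 3.\<close>

lemma intersection_multiplicity_ne_2:
  assumes A0: "fps_nth A 0 = 0" and B0: "fps_nth B 0 = 0" and A1: "fps_nth A 1 \<noteq> 0 \<or> fps_nth B 1 \<noteq> 0"
    and g: "\<And>k. k < 3 \<Longrightarrow> fps_nth (along A B g) k = 0" and h: "\<And>k. k < 3 \<Longrightarrow> fps_nth (along A B h) k = 0"
  shows "intersection_multiplicity g h \<noteq> 2"
proof
  assume two: "intersection_multiplicity g h = 2"
  define W where "W = ideal_gen {g, h}"
  have ex: "\<exists>Bs. quotient_basis fps2_const UNIV W Bs"
    using two unfolding intersection_multiplicity_def quotient_dim_def W_def by (auto split: if_splits)
  define Bs where "Bs = (SOME B. quotient_basis fps2_const UNIV W B)"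
  have Bs: "quotient_basis fps2_const UNIV W Bs" unfolding Bs_def by (rule someI_ex[OF ex])
  have "enat (card Bs) = 2" using two ex unfolding intersection_multiplicity_def quotient_dim_def W_def[symmetric] Bs_def by simp
  hence card: "card Bs = 2" by (simp add: numeral_eq_enat)
  have fin: "finite Bs" using Bs by (simp add: quotient_basis_def)
  let ?N = "\<lambda>F. fps_nth (along A B F)"
  \<comment> \<open>Two basis elements impose two conditions on the three coefficients of a linear
    functional on jets; a nonzero functional \<open>L\<close> satisfies them and therefore
    annihilates all power series.\<close>
  obtain y where y: "\<exists>k\<in>{..<3::nat}. y k \<noteq> 0" "\<forall>b\<in>Bs. (\<Sum>k\<in>{..<3::nat}. ?N b k * y k) = 0"
    using underdetermined_system[of Bs "{..<3::nat}" ?N] fin card by auto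
  define L where "L F = (\<Sum>k<3::nat. ?N F k * y k)" for F
  have Ladd: "L (F + G) = L F + L G" for F G
    by (simp add: L_def along_add[OF A0 B0] distrib_right sum.distrib)
  have Lc: "L (fps2_const c * F) = c * L F" for c F
    by (simp add: L_def along_mult[OF A0 B0] along_const[OF A0 B0] sum_distrib_left mult.assoc)
  have Lsum: "L (\<Sum>b\<in>X. f b) = (\<Sum>b\<in>X. L (f b))" for f :: "fps2 \<Rightarrow> fps2" and X
    by (induction X rule: infinite_finite_induct) (simp_all add: Ladd, simp_all add: L_def along_0[OF A0 B0])
  have "W \<subseteq> {F. \<forall>k<3. ?N F k = 0}"
    unfolding W_def by (rule ideal_gen_subset)
      (auto simp: g h along_0[OF A0 B0] along_add[OF A0 B0] along_mult[OF A0 B0] fps_mult_nth intro!: sum.neutral)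
  hence LW: "L F = 0" if "F \<in> W" for F using that by (auto simp: L_def)
  have L0: "L F = 0" for F
  proof -
    obtain c where "F - (\<Sum>b\<in>Bs. fps2_const (c b) * b) \<in> W"
      using Bs unfolding quotient_basis_def by blast
    hence "L (F - (\<Sum>b\<in>Bs. fps2_const (c b) * b)) = 0" by (rule LW)
    moreover have "L F = L (F - (\<Sum>b\<in>Bs. fps2_const (c b) * b)) + L (\<Sum>b\<in>Bs. fps2_const (c b) * b)"
      by (simp add: Ladd[symmetric])
    moreover have "L (\<Sum>b\<in>Bs. fps2_const (c b) * b) = 0"
      unfolding Lsum Lc using y(2) by (simp add: L_def)
    ultimately show ?thesis by simp
  qed
  \<comment> \<open>A coordinate that restricts to order one on the arc. Testing \<open>L\<close> on
    \<open>1\<close>, \<open>z * z\<close> and \<open>z\<close>, in this order, forces its three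
    coefficients to vanish.\<close>
  obtain z where z: "?N z 0 = 0" "?N z 1 \<noteq> 0"
  proof (cases "fps_nth A 1 = 0")
    case True thus ?thesis using that[of fps2_v] A1 B0 by (simp add: along_v[OF A0 B0])
  next
    case False thus ?thesis using that[of fps2_u] A0 by (simp add: along_u[OF A0 B0])
  qed
  have L3: "L F = ?N F 0 * y 0 + ?N F 1 * y 1 + ?N F 2 * y 2" for F
    by (simp add: L_def numeral_3_eq_3 numeral_2_eq_2)
  have "y 0 = 0" using L0[of 1] unfolding L3 along_1[OF A0 B0] by simp
  moreover have "y 2 = 0"
  proof -
    have "?N (z * z) 0 = 0" "?N (z * z) 1 = 0" "?N (z * z) 2 = ?N z 1 * ?N z 1"
      using z(1) by (simp_all add: along_mult[OF A0 B0] fps_mult_nth numeral_2_eq_2)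
    thus ?thesis using L0[of "z * z"] z(2) unfolding L3 by simp
  qed
  moreover have "y 1 = 0" using L0[of z] z calculation unfolding L3 by simp
  ultimately have "\<forall>k<3. y k = 0" by (metis One_nat_def less_2_cases less_Suc_eq numeral_2_eq_2 numeral_3_eq_3)
  thus False using y(1) by auto
qed

text \<open>The last condition says that the two curves do not osculate: their contact has order exactly two.\<close>

definition tangent_pair :: "poly3 \<Rightarrow> poly3 \<Rightarrow> complex^3 \<Rightarrow> bool" where
  "tangent_pair c c' p \<longleftrightarrow> (\<exists>\<kappa> e w. \<kappa> \<noteq> 0 \<and> (\<forall>h. grad c' p h = \<kappa> * grad c p h) \<and> grad c p e = 1 \<and> grad c p w = 0 \<and>
     local_frame p e w \<and> quad c' w \<noteq> \<kappa> * quad c w)"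

text \<open>If the gradients are dependent, contact of higher order has to be excluded. Were the
  quadratic parts proportional with the same factor as the gradients, a suitable arc along the
  common tangent would make both branches vanish to order three, against multiplicity two. The
  transversal alternative in the conclusion is harmless, as it allows larger exponents.\<close>

lemma tacnode_components:
  fixes I :: "nat set"
  assumes I: "finite I" and c: "\<And>i. i \<in> I \<Longrightarrow> is_component (c i)" and p: "p \<noteq> 0"
    and tac: "is_tacnode (\<Prod>i\<in>I. c i) p"
  shows "\<exists>i j. i \<noteq> j \<and> {i \<in> I. eval_at (c i) p = 0} = {i, j} \<and> (indep_grad (c i) (c j) p \<or> tangent_pair (c i) (c j) p)"
proof -
  obtain g h a b w where 1: "local_frame p a b" "w dvd 1" "germ (\<Prod>i\<in>I. c i) p a b = w * prod_list [g, h]"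
    "\<forall>g\<in>set [g, h]. smooth_branch g" "intersection_multiplicity g h = 2"
    using tac unfolding is_tacnode_def has_smooth_branches_def by blast
  interpret component_product I c p a b w "[g, h]" by unfold_locales (use I c p 1 in auto)
  obtain i j where ij: "i \<noteq> j" "T = {i, j}" using card_T card_2_obtain[of T] by auto
  show ?thesis
  proof (cases "x i * y j - y i * x j = 0")
    case False
    thus ?thesis using ij indep_T unfolding T_def by blast
  next
    case True
    have LF: "K * ((\<alpha> * x i + \<beta> * y i) * (\<alpha> * x j + \<beta> * y j)) = w0 * ((\<alpha> * g1 g + \<beta> * g2 g) * (\<alpha> * g1 h + \<beta> * g2 h))" for \<alpha> \<beta>
      using leading_form[of \<alpha> \<beta>] ij by simp
    have Dgh: "g1 g * g2 h - g2 g * g1 h = 0"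
      using quadratic_product_discriminant[OF LF] True w0 by simp
    have ci: "is_component (c i)" "eval_at (c i) p = 0" "i \<in> T" and cj: "is_component (c j)" "eval_at (c j) p = 0" "j \<in> T"
      using ij c T_sub by (auto simp: T_def)
    have nz: "x i \<noteq> 0 \<or> y i \<noteq> 0" "x j \<noteq> 0 \<or> y j \<noteq> 0" "g1 g \<noteq> 0 \<or> g2 g \<noteq> 0" "g1 h \<noteq> 0 \<or> g2 h \<noteq> 0"
      using xy ci(3) cj(3) g12 by auto
    obtain \<kappa> where \<kappa>: "\<kappa> \<noteq> 0" "x j = \<kappa> * x i" "y j = \<kappa> * y i"
    proof (cases "x i = 0")
      case xi: True
      hence "y i \<noteq> 0" using nz by simp
      moreover have "x j = 0" using xi True nz by auto
      ultimately show ?thesis using that[of "y j / y i"] nz xi by auto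
    next
      case False
      moreover have "x j \<noteq> 0"
      proof
        assume "x j = 0"
        thus False using True False nz(2) by auto
      qed
      ultimately show ?thesis using that[of "x j / x i"] True by (simp add: field_simps)
    qed
    obtain Z U V where ZUV: "\<And>x. x = Z x *s p + U x *s a + V x *s b" by (rule local_frame_coords[OF 1(1)]) blast
    have gprop: "grad (c j) p v = \<kappa> * grad (c i) p v" for v
    proof -
      have "grad (c l) p v = Z v * grad (c l) p p + U v * x l + V v * y l" for l
        using ZUV[of v] unfolding x_def y_def by (metis grad_add grad_smult)
      thus ?thesis using component_grad_self[OF ci(1,2)] component_grad_self[OF cj(1,2)] \<kappa> by (simp add: algebra_simps)
    qed
    define w' where "w' = y i *s a + (- x i) *s b"
    have w': "grad (c i) p w' = 0" unfolding w'_def grad_add grad_smult by (simp add: x_def y_def)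
    obtain e1 e2 where e: "e1 * x i + e2 * y i = 1"
    proof (cases "x i = 0")
      case True thus ?thesis using nz that[of 0 "1 / y i"] by simp
    next
      case False thus ?thesis using that[of "1 / x i" 0] by simp
    qed
    have fr: "local_frame p (e1 *s a + e2 *s b) w'"
    proof -
      have "e1 * (- x i) - e2 * y i = - (e1 * x i + e2 * y i)" by simp
      thus ?thesis unfolding w'_def using e by (intro local_frame_change 1) simp
    qed
    have "quad (c j) w' \<noteq> \<kappa> * quad (c i) w'"
    proof
      assume Q: "quad (c j) w' = \<kappa> * quad (c i) w'"
      \<comment> \<open>Test arcs whose velocity is the common tangent vector \<open>w'\<close> and
        whose second order terms \<open>u\<close>, \<open>v\<close> are free parameters.\<close>
      define A where "A u = fps_const (y i) * fps_X + fps_const u * fps_X ^ 2" for u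
      define B where "B v = fps_const (- x i) * fps_X + fps_const v * fps_X ^ 2" for v
      have AB: "fps_nth (A u) 0 = 0" "fps_nth (A u) 1 = y i" "fps_nth (A u) 2 = u"
        "fps_nth (B u) 0 = 0" "fps_nth (B u) 1 = - x i" "fps_nth (B u) 2 = u" for u
        by (simp_all add: A_def B_def fps_X_power_nth)
      define Y where "Y u v = x i * u + y i * v + quad (c i) w'" for u v
      define q where "q F = coeff2 F 2 0 * y i ^ 2 + coeff2 F 1 1 * y i * (- x i) + coeff2 F 0 2 * (- x i) ^ 2" for F
      define G where "G F u v = g1 F * u + g2 F * v + q F" for F u v
      have gi: "fps_nth (along (A u) (B v) (germ (c i) p a b)) 0 = 0" "fps_nth (along (A u) (B v) (germ (c i) p a b)) 1 = 0"
         "fps_nth (along (A u) (B v) (germ (c i) p a b)) 2 = Y u v" for u v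
        using along_germ_component[OF ci(1) AB(1) AB(4), of u v p a b] ci(2) w'
        unfolding AB by (simp_all add: w'_def Y_def grad_add grad_smult x_def y_def mult.commute)
      have gj: "fps_nth (along (A u) (B v) (germ (c j) p a b)) 0 = 0" "fps_nth (along (A u) (B v) (germ (c j) p a b)) 1 = 0"
         "fps_nth (along (A u) (B v) (germ (c j) p a b)) 2 = \<kappa> * Y u v" for u v
        using along_germ_component[OF cj(1) AB(1) AB(4), of u v p a b] cj(2) w' Q
        unfolding AB gprop w'_def[symmetric] by (simp_all add: Y_def grad_add grad_smult x_def y_def algebra_simps)
      have "y i * g1 g + (- x i) * g2 g = 0 \<or> y i * g1 h + (- x i) * g2 h = 0"
        using LF[of "y i" "- x i"] w0 by (simp add: mult.commute)
      moreover have "y i * g1 g + (- x i) * g2 g = 0 \<Longrightarrow> y i * g1 h + (- x i) * g2 h = 0"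
        by (rule proportional_zero[OF nz(3) Dgh])
      moreover have "y i * g1 h + (- x i) * g2 h = 0 \<Longrightarrow> y i * g1 g + (- x i) * g2 g = 0"
        by (rule proportional_zero[OF nz(4)]) (use Dgh in \<open>simp_all add: algebra_simps\<close>)
      ultimately have k: "y i * g1 g + (- x i) * g2 g = 0" "y i * g1 h + (- x i) * g2 h = 0"
        by blast+
      have br: "fps_nth (along (A u) (B v) F) 0 = 0" "fps_nth (along (A u) (B v) F) 1 = 0" "fps_nth (along (A u) (B v) F) 2 = G F u v"
        if F: "F \<in> {g, h}" for F u v
        using along_nth[OF AB(1) AB(4), of u v F] g12(2)[of F] F k unfolding AB
        by (auto simp: G_def q_def g1_def g2_def mult.commute)
      have lt: "n < 2 \<Longrightarrow> n = 0 \<or> n = 1" for n :: nat by auto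
      \<comment> \<open>All four factors have order at least two along these arcs, so the
        coefficients of degree 4 agree. Each one is a product of two affine functions of
        \<open>(u, v)\<close>; under the assumption \<open>Q\<close> the components contribute
        \<open>Y\<close> and a multiple of \<open>Y\<close>.\<close>
      have id: "K * (Y u v * (\<kappa> * Y u v)) = w0 * (G g u v * G h u v)" for u v
      proof -
        have "K * (\<Prod>l\<in>T. fps_nth (along (A u) (B v) (germ (c l) p a b)) 2) = w0 * (\<Prod>F\<leftarrow>[g,h]. fps_nth (along (A u) (B v) F) 2)"
          by (rule nth_compare(3)[where e = 2, OF AB(1) AB(4)])
            (use ij gi gj br card_T lt in \<open>auto dest!: lt\<close>)
        thus ?thesis using ij gi(3) gj(3) br(3) by simp
      qed
      \<comment> \<open>By \<open>id\<close>, zeros of \<open>G g\<close> and of \<open>G h\<close>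
        are zeros of \<open>Y\<close>. All three have proportional linear parts, so their zero lines
        coincide, and one arc makes both second coefficients vanish.\<close>
      obtain u v where uv: "G g u v = 0" unfolding G_def by (rule affine_form_zero[OF nz(3)])
      obtain u' v' where uv': "G h u' v' = 0" unfolding G_def by (rule affine_form_zero[OF nz(4)])
      have Y0: "Y u v = 0" "Y u' v' = 0" using id[of u v] id[of u' v'] uv uv' K \<kappa>(1) by auto
      have "(u - u') * x i + (v - v') * y i = Y u v - Y u' v'" by (simp add: Y_def algebra_simps)
      hence "(u - u') * x i + (v - v') * y i = 0" unfolding Y0 by simp
      hence "(u - u') * g1 h + (v - v') * g2 h = 0"
        by (rule proportional_zero[OF nz(1), rotated]) (use k in \<open>simp add: algebra_simps\<close>)
      moreover have "G h u v = G h u' v' + ((u - u') * g1 h + (v - v') * g2 h)" by (simp add: G_def algebra_simps)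
      ultimately have Gh: "G h u v = 0" using uv' by simp
      have lt3: "n < 3 \<Longrightarrow> n = 0 \<or> n = 1 \<or> n = 2" for n :: nat by auto
      have "intersection_multiplicity g h \<noteq> 2"
        by (rule intersection_multiplicity_ne_2[OF AB(1) AB(4), of u v])
           (use AB nz(1) br uv Gh in \<open>auto dest!: lt3\<close>)
      thus False using 1 by simp
    qed
    hence "tangent_pair (c i) (c j) p"
      unfolding tangent_pair_def using \<kappa>(1) gprop w' fr e
      by (intro exI[of _ \<kappa>] exI[of _ "e1 *s a + e2 *s b"] exI[of _ w']) (simp add: grad_add grad_smult x_def y_def)
    thus ?thesis using ij unfolding T_def by blast
  qed
qed

section \<open>Syzygies of nearly free curves\<close>

definition is_ideal :: "'a::comm_ring_1 set \<Rightarrow> bool" where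
  "is_ideal A \<longleftrightarrow> 0 \<in> A \<and> (\<forall>x\<in>A. \<forall>y\<in>A. x + y \<in> A) \<and> (\<forall>c. \<forall>x\<in>A. c * x \<in> A)"

lemma is_idealD: "is_ideal A \<Longrightarrow> 0 \<in> A" "is_ideal A \<Longrightarrow> x \<in> A \<Longrightarrow> y \<in> A \<Longrightarrow> x + y \<in> A"
  "is_ideal A \<Longrightarrow> x \<in> A \<Longrightarrow> c * x \<in> A" "is_ideal A \<Longrightarrow> x \<in> A \<Longrightarrow> x * c \<in> A"
  by (auto simp: is_ideal_def mult.commute[of _ c])

lemma is_ideal_minus: "is_ideal A \<Longrightarrow> x \<in> A \<Longrightarrow> - x \<in> A"
  using is_idealD(3)[of A x "-1"] by simp

lemma is_ideal_diff: "is_ideal A \<Longrightarrow> x \<in> A \<Longrightarrow> y \<in> A \<Longrightarrow> x - y \<in> A"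
  using is_idealD(2)[of A x "-y"] is_ideal_minus[of A y] by simp

lemma is_ideal_sum: "is_ideal A \<Longrightarrow> (\<And>i. i \<in> S \<Longrightarrow> F i \<in> A) \<Longrightarrow> sum F S \<in> A"
  by (induction S rule: infinite_finite_induct) (auto intro: is_idealD)

lemma is_ideal_ideal_gen: "is_ideal (ideal_gen B)"
  by (auto simp: is_ideal_def ideal_gen_0 ideal_gen_add ideal_gen_mult)

lemma is_ideal_jacobian: "is_ideal (jacobian_ideal f)"
  unfolding jacobian_ideal_def by (rule is_ideal_ideal_gen)

lemma is_ideal_quotient: "is_ideal J \<Longrightarrow> is_ideal {h. h * g \<in> J}"
  by (auto simp: is_ideal_def distrib_right mult.assoc)

lemma is_ideal_principal: "is_ideal {l * h |h. True}"
  unfolding is_ideal_def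
proof (intro conjI ballI allI)
  show "0 \<in> {l * h |h. True}" by (auto intro: exI[of _ 0])
  show "x + y \<in> {l * h |h. True}" if "x \<in> {l * h |h. True}" "y \<in> {l * h |h. True}" for x y
    using that by (auto simp: distrib_left[symmetric])
  show "c * x \<in> {l * h |h. True}" if "x \<in> {l * h |h. True}" for c x
  proof -
    from that obtain h where "x = l * h" by blast
    hence "c * x = l * (c * h)" by (simp add: mult.left_commute)
    thus ?thesis by blast
  qed
qed

lemma ideal_cong_mult:
  assumes "is_ideal A" "u - u' \<in> A" "v - v' \<in> A"
  shows "u * v - u' * v' \<in> A"
proof -
  have "u * v - u' * v' = u * (v - v') + (u - u') * v'" by (simp add: algebra_simps)
  thus ?thesis using assms by (auto intro: is_idealD)
qed

lemma ideal_cong_prod: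
  assumes A: "is_ideal A" and "\<And>k. k \<in> S \<Longrightarrow> u k - v k \<in> A"
  shows "prod u S - prod v S \<in> A"
  using assms(2)
  by (induction S rule: infinite_finite_induct) (auto intro!: ideal_cong_mult A simp: is_idealD(1)[OF A])

lemma poly3_induct [case_names Const Var add mult]:
  assumes "\<And>c. P (Const c)" "\<And>i. P (Var i)" "\<And>f g. P f \<Longrightarrow> P g \<Longrightarrow> P (f + g)" "\<And>f g. P f \<Longrightarrow> P g \<Longrightarrow> P (f * g)"
  shows "P f"
proof -
  have s: "P (Poly_Mapping.single t c)" for t c
  proof (induction "mono_degree t" arbitrary: t)
    case 0
    thus ?case using mono_degree_eq_0[of t] assms(1)[of c] by (simp add: Const_def)
  next
    case (Suc n)
    then obtain i s where "t = Poly_Mapping.single i 1 + s" "mono_degree s = n" using mono_degree_Suc[of t n] by auto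
    thus ?case using Suc(1)[of s] by (simp only: single_split) (rule assms; simp add: assms)
  qed
  show ?thesis
    by (induction f rule: poly_mapping_single_induct) (use assms(1)[of 0] s assms(3) in auto)
qed

lemma eval_hom_cong_ideal:
  assumes A: "is_ideal A" and v: "\<And>i. v i - Var i \<in> A"
  shows "eval_hom Const v g - g \<in> A"
proof (induction g rule: poly3_induct)
  case (add f g)
  have e: "eval_hom Const v (f + g) - (f + g) = (eval_hom Const v f - f) + (eval_hom Const v g - g)"
    using scalar_hom_Const by simp
  show ?case unfolding e by (rule is_idealD(2)[OF A add])
next
  case (mult f g)
  show ?case using ideal_cong_mult[OF A mult] scalar_hom_Const by simp
qed (use v scalar_hom_Const is_idealD(1)[OF A] in auto)

section \<open>Radicals, saturation, and a nonzerodivisor among the lines of a pencil\<close>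

definition ideal_radical :: "'a::comm_ring_1 set \<Rightarrow> 'a set" where
  "ideal_radical A = {h. \<exists>n. h ^ n \<in> A}"

lemma is_ideal_radical:
  assumes A: "is_ideal (A :: 'a::comm_ring_1 set)" shows "is_ideal (ideal_radical A)"
  unfolding is_ideal_def
proof (intro conjI ballI allI)
  show "0 \<in> ideal_radical A" using is_idealD(1)[OF A] by (auto simp: ideal_radical_def intro!: exI[of _ 1])
  fix x y c :: 'a
  show "c * x \<in> ideal_radical A" if "x \<in> ideal_radical A" for c x
    using that is_idealD(3)[OF A] by (auto simp: ideal_radical_def power_mult_distrib)
  assume "x \<in> ideal_radical A" "y \<in> ideal_radical A"
  then obtain m n where mn: "x ^ m \<in> A" "y ^ n \<in> A" by (auto simp: ideal_radical_def)
  have "(x + y) ^ (m + n) = (\<Sum>k\<le>m + n. of_nat (m + n choose k) * x ^ k * y ^ (m + n - k))" by (rule binomial_ring)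
  moreover have "of_nat (m + n choose k) * x ^ k * y ^ (m + n - k) \<in> A" if "k \<le> m + n" for k
  proof (cases "k \<ge> m")
    case True
    hence "x ^ k = x ^ (k - m) * x ^ m" by (simp add: power_add[symmetric])
    thus ?thesis using is_idealD(3,4)[OF A] mn(1) by (simp add: mult.assoc)
  next
    case False
    hence "y ^ (m + n - k) = y ^ (m - k) * y ^ n" by (simp add: power_add[symmetric])
    thus ?thesis using is_idealD(3,4)[OF A] mn(2) by (simp add: mult.assoc)
  qed
  ultimately have "(x + y) ^ (m + n) \<in> A" by (simp only:) (rule is_ideal_sum[OF A], simp)
  thus "x + y \<in> ideal_radical A" unfolding ideal_radical_def by blast
qed

lemma ideal_radical_power: "h ^ k \<in> ideal_radical A \<Longrightarrow> h \<in> ideal_radical A"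
  by (auto simp: ideal_radical_def power_mult[symmetric])

lemma subset_ideal_radical: "x \<in> A \<Longrightarrow> x \<in> ideal_radical A"
  by (auto simp: ideal_radical_def intro: exI[of _ 1])

lemma finite_mono_degree: "finite {t :: mono3. mono_degree t = n}"
proof -
  have l: "Poly_Mapping.lookup t i \<le> mono_degree t" for t :: mono3 and i
    unfolding mono_degree_def by (rule member_le_sum) auto
  have "inj_on (\<lambda>t. (Poly_Mapping.lookup t 1, Poly_Mapping.lookup t 2, Poly_Mapping.lookup t 3)) {t :: mono3. mono_degree t = n}"
  proof (rule inj_onI)
    fix s t :: mono3
    assume st: "(Poly_Mapping.lookup s 1, Poly_Mapping.lookup s 2, Poly_Mapping.lookup s 3) = (Poly_Mapping.lookup t 1, Poly_Mapping.lookup t 2, Poly_Mapping.lookup t 3)"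
    show "s = t"
    proof (rule poly_mapping_eqI)
      fix i show "Poly_Mapping.lookup s i = Poly_Mapping.lookup t i" using st exhaust_3[of i] by auto
    qed
  qed
  moreover have "(\<lambda>t. (Poly_Mapping.lookup t 1, Poly_Mapping.lookup t 2, Poly_Mapping.lookup t 3)) ` {t :: mono3. mono_degree t = n} \<subseteq> {..n} \<times> {..n} \<times> {..n}"
    using l by auto
  ultimately show ?thesis by (meson finite_SigmaI finite_atMost inj_on_finite)
qed

definition order_ge :: "nat \<Rightarrow> poly3 set" where
  "order_ge k = {h. \<forall>t\<in>Poly_Mapping.keys h. k \<le> mono_degree t}"

lemma order_ge_mult: "f \<in> order_ge i \<Longrightarrow> g \<in> order_ge j \<Longrightarrow> f * g \<in> order_ge (i + j)"
  using keys_mult[of f g] unfolding order_ge_def by (fastforce simp: mono_degree_add intro: add_mono)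

lemma is_ideal_order_ge: "is_ideal (order_ge k)"
  unfolding is_ideal_def
proof (intro conjI ballI allI)
  fix x y c assume x: "x \<in> order_ge k"
  show "x + y \<in> order_ge k" if "y \<in> order_ge k" using x that keys_add[of x y] by (auto simp: order_ge_def)
  show "c * x \<in> order_ge k" using order_ge_mult[of c 0 x k] x by (simp add: order_ge_def)
qed (simp add: order_ge_def)

lemma ideal_gen_subset_ideal: "is_ideal A \<Longrightarrow> B \<subseteq> A \<Longrightarrow> ideal_gen B \<subseteq> A"
  by (rule ideal_gen_subset) (auto intro: is_idealD)

lemma irrelevant_power_subset: "ideal_power irrelevant_ideal k \<subseteq> order_ge k"
proof -
  have irr: "irrelevant_ideal \<subseteq> order_ge 1"
    unfolding irrelevant_ideal_def
    by (rule ideal_gen_subset_ideal[OF is_ideal_order_ge]) (auto simp: order_ge_def Var_def)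
  have "(\<Prod>i<n. a i) \<in> order_ge n" if "\<forall>i<n. a i \<in> irrelevant_ideal" for a :: "nat \<Rightarrow> poly3" and n
    using that
  proof (induction n)
    case (Suc n)
    hence "(\<Prod>i<n. a i) * a n \<in> order_ge (n + 1)" using irr by (intro order_ge_mult) auto
    thus ?case by simp
  qed (simp add: order_ge_def)
  thus ?thesis unfolding ideal_power_def
    by (intro ideal_gen_subset_ideal[OF is_ideal_order_ge]) auto
qed

text \<open>Pigeonhole: a monomial of degree at least \<open>3 * n\<close> in three variables is
  divisible by the \<open>n\<close>-th power of one of them.\<close>

lemma order_ge_subset_ideal:
  assumes A: "is_ideal A" and n: "\<And>i. Var i ^ n \<in> A"
  shows "order_ge (3 * n) \<subseteq> A"
proof
  fix h assume h: "h \<in> order_ge (3 * n)"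
  have s: "Poly_Mapping.single t c \<in> A" if t: "3 * n \<le> mono_degree t" for t c
  proof -
    have "\<exists>i. n \<le> Poly_Mapping.lookup t i"
    proof (rule ccontr)
      assume "\<nexists>i. n \<le> Poly_Mapping.lookup t i"
      hence "Poly_Mapping.lookup t i < n" for i by (meson not_le)
      from this[of 1] this[of 2] this[of 3] show False using t by (simp add: mono_degree_def sum_3)
    qed
    then obtain i where i: "n \<le> Poly_Mapping.lookup t i" by blast
    have "Var i ^ k = Poly_Mapping.single (Poly_Mapping.single i k) 1" for k
      by (induction k) (auto simp: Var_def mult_single single_add[symmetric])
    moreover have "Poly_Mapping.single i n + (t - Poly_Mapping.single i n) = t"
      using i by (intro poly_mapping_eqI) (auto simp: lookup_add lookup_minus lookup_single when_def)
    ultimately have "Poly_Mapping.single t c = Var i ^ n * Poly_Mapping.single (t - Poly_Mapping.single i n) c"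
      by (simp add: mult_single)
    thus ?thesis using is_idealD(4)[OF A n] by simp
  qed
  have "(\<Sum>t\<in>Poly_Mapping.keys h. Poly_Mapping.single t (Poly_Mapping.lookup h t)) \<in> A"
    using h by (intro is_ideal_sum[OF A] s) (auto simp: order_ge_def)
  thus "h \<in> A" using poly_mapping_eq_sum_single[of h] by simp
qed

text \<open>It suffices to treat the variables separately: with a common exponent \<open>N\<close>,
  every polynomial without terms of degree below \<open>3 * N\<close> carries \<open>g\<close> into
  \<open>J\<close>, and the corresponding power of the irrelevant ideal consists of such
  polynomials.\<close>

lemma saturationI:
  assumes J: "is_ideal J" and n: "\<And>i. Var i \<in> ideal_radical {h. h * g \<in> J}"
  shows "g \<in> saturation J irrelevant_ideal"
proof -
  let ?A = "{h. h * g \<in> J}"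
  have A: "is_ideal ?A" by (rule is_ideal_quotient[OF J])
  have "\<forall>i. \<exists>n. Var i ^ n \<in> ?A" using n by (auto simp: ideal_radical_def)
  then obtain k where k: "\<And>i. Var i ^ k i \<in> ?A" by metis
  define N where "N = k 1 + k 2 + k 3"
  have kN: "k i \<le> N" for i using exhaust_3[of i] by (auto simp: N_def)
  have "Var i ^ N \<in> ?A" for i
  proof -
    have "Var i ^ N = Var i ^ (N - k i) * Var i ^ k i" using kN[of i] by (simp add: power_add[symmetric])
    thus ?thesis using is_idealD(3)[OF A k] by metis
  qed
  hence "order_ge (3 * N) \<subseteq> ?A" by (rule order_ge_subset_ideal[OF A])
  hence "ideal_power irrelevant_ideal (3 * N) \<subseteq> ?A" using irrelevant_power_subset by blast
  thus ?thesis by (auto simp: saturation_def)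
qed

lemma Const_mem_iff: "is_ideal A \<Longrightarrow> c \<noteq> 0 \<Longrightarrow> Const c * h \<in> A \<Longrightarrow> h \<in> A"
  using is_idealD(3)[of A "Const c * h" "Const (1/c)"] by (simp add: mult.assoc[symmetric] Const_mult[symmetric])

text \<open>A substitute for avoiding the associated primes. If every line of the pencil through
  \<open>P\<close> failed, with witness \<open>g t\<close>, then finitely many witnesses of degree
  \<open>n\<close> would be linearly dependent. The product \<open>Q\<close> of the other lines
  carries the remaining witness \<open>G q\<close> into \<open>J\<close> as well; modulo
  \<open>l q\<close> those lines are nonzero multiples of \<open>Y\<close>, so \<open>Y\<close>, and
  with it \<open>X\<close>, lies in the radical of the annihilator of \<open>G q\<close> modulo
  \<open>J\<close>. A partial derivative that is nonzero at \<open>P\<close> adds the third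
  variable, so that \<open>G q\<close> belongs to the saturation after all.\<close>

lemma nonzerodivisor_in_pencil:
  fixes f :: poly3 and a b :: complex and n m :: nat
  defines "J \<equiv> jacobian_ideal f"
    and "X \<equiv> Var 1 - Const a * Var 3" and "Y \<equiv> Var 2 - Const b * Var 3"
  assumes f: "f \<in> graded_part (int m)" and P: "eval_at (partial_deriv i f) P \<noteq> 0" "P $ 1 = a" "P $ 2 = b" "P $ 3 = 1" and m: "m > 0"
  shows "\<exists>t. \<forall>g\<in>graded_part (int n). (X + Const t * Y) * g \<in> J \<longrightarrow> g \<in> saturation J irrelevant_ideal"
proof (rule ccontr)
  assume "\<not> ?thesis"
  then obtain g where g: "\<And>t. g t \<in> graded_part (int n)" "\<And>t. (X + Const t * Y) * g t \<in> J" "\<And>t. g t \<notin> saturation J irrelevant_ideal"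
    by metis
  have J: "is_ideal J" unfolding J_def by (rule is_ideal_jacobian)
  define Mon where "Mon = {t :: mono3. mono_degree t = n}"
  \<comment> \<open>One more than the number of monomials of degree \<open>n\<close>, which forces a
    linear relation among the witnesses.\<close>
  define N where "N = Suc (card Mon)"
  have finM: "finite Mon" unfolding Mon_def by (rule finite_mono_degree)
  define G where "G k = g (of_nat k)" for k :: nat
  define l where "l k = X + Const (of_nat k) * Y" for k :: nat
  obtain x where x: "\<exists>k\<in>{..<N}. x k \<noteq> 0" "\<forall>e\<in>Mon. (\<Sum>k\<in>{..<N}. Poly_Mapping.lookup (G k) e * x k) = 0"
    using underdetermined_system[OF finM, of "{..<N}" "\<lambda>e k. Poly_Mapping.lookup (G k) e"] by (auto simp: N_def)
  have dep: "(\<Sum>k<N. Const (x k) * G k) = 0"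
  proof (rule poly_mapping_eqI)
    fix e
    have "Const (x k) * G k = Poly_Mapping.map ((*) (x k)) (G k)" for k
      by (simp add: Const_def mult_map_scale_conv_mult)
    hence L: "Poly_Mapping.lookup (Const (x k) * G k) e = x k * Poly_Mapping.lookup (G k) e" for k
      by (simp add: Poly_Mapping.map.rep_eq when_def)
    show "Poly_Mapping.lookup (\<Sum>k<N. Const (x k) * G k) e = Poly_Mapping.lookup 0 e"
    proof (cases "e \<in> Mon")
      case True
      hence "(\<Sum>k<N. x k * Poly_Mapping.lookup (G k) e) = 0" using x(2) by (simp add: mult.commute)
      thus ?thesis by (simp only: lookup_sum L lookup_zero)
    next
      case False
      hence "Poly_Mapping.lookup (G k) e = 0" for k
        using g(1)[of "of_nat k"] by (auto simp: graded_part_def Mon_def G_def in_keys_iff)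
      thus ?thesis by (simp only: lookup_sum L lookup_zero) simp
    qed
  qed
  obtain q where q: "q < N" "x q \<noteq> 0" using x(1) by auto
  define Q where "Q = (\<Prod>k\<in>{..<N} - {q}. l k)"
  have QG: "Q * G k \<in> J" if "k < N" "k \<noteq> q" for k
  proof -
    have "Q = (\<Prod>k\<in>{..<N} - {q} - {k}. l k) * l k"
      unfolding Q_def using that by (subst prod.remove[of _ k]) (auto simp: mult.commute)
    hence e: "Q * G k = (\<Prod>k\<in>{..<N} - {q} - {k}. l k) * (l k * G k)" by (simp add: mult.assoc)
    have "l k * G k \<in> J" using g(2)[of "of_nat k"] by (simp add: l_def G_def)
    thus ?thesis unfolding e by (rule is_idealD(3)[OF J])
  qed
  have "Q * (\<Sum>k<N. Const (x k) * G k) = Q * (Const (x q) * G q) + (\<Sum>k\<in>{..<N} - {q}. Q * (Const (x k) * G k))"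
    using q by (subst sum.remove[of _ q]) (auto simp: distrib_left sum_distrib_left)
  hence "Const (x q) * (Q * G q) = - (\<Sum>k\<in>{..<N} - {q}. Const (x k) * (Q * G k))"
    unfolding dep by (simp add: mult.left_commute eq_neg_iff_add_eq_0)
  also have "\<dots> \<in> J" by (rule is_ideal_minus[OF J], rule is_ideal_sum[OF J], rule is_idealD(3)[OF J], rule QG) auto
  finally have QGq: "Q * G q \<in> J" using Const_mem_iff[OF J q(2)] by blast
  define A where "A = {h. h * G q \<in> J}"
  have A: "is_ideal A" unfolding A_def by (rule is_ideal_quotient[OF J])
  have R: "is_ideal (ideal_radical A)" by (rule is_ideal_radical[OF A])
  have lA: "l q \<in> A" using g(2)[of "of_nat q"] by (simp add: A_def l_def G_def)
  have QA: "Q \<in> A" using QGq by (simp add: A_def)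
  define C where "C = (\<Prod>k\<in>{..<N} - {q}. (of_nat k :: complex) - of_nat q)"
  have "Q - (\<Prod>k\<in>{..<N} - {q}. Const (of_nat k - of_nat q) * Y) \<in> A"
    unfolding Q_def
  proof (rule ideal_cong_prod[OF A])
    fix k
    \<comment> \<open>Two lines of the pencil differ by a constant multiple of \<open>Y\<close>, and
      the constant is nonzero for distinct parameters.\<close>
    have "Const (of_nat k) * Y = Const (of_nat k - of_nat q) * Y + Const (of_nat q) * Y"
      unfolding distrib_right[symmetric] Const_add[symmetric] by simp
    hence "l k - Const (of_nat k - of_nat q) * Y = l q" unfolding l_def by simp
    thus "l k - Const (of_nat k - of_nat q) * Y \<in> A" using lA by simp
  qed
  moreover have "(\<Prod>k\<in>{..<N} - {q}. Const (of_nat k - of_nat q) * Y) = Const C * Y ^ (N - 1)"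
  proof -
    have "Const (prod F S) = (\<Prod>k\<in>S. Const (F k))" for F and S :: "nat set"
      by (induction S rule: infinite_finite_induct) (auto simp: Const_mult)
    thus ?thesis using q(1) by (simp add: prod.distrib C_def)
  qed
  ultimately have "Q - Const C * Y ^ (N - 1) \<in> A" by simp
  from is_ideal_diff[OF A QA this] have "Const C * Y ^ (N - 1) \<in> A" by simp
  moreover have "C \<noteq> 0" by (auto simp: C_def)
  ultimately have "Y ^ (N - 1) \<in> A" using Const_mem_iff[OF A] by blast
  hence Yr: "Y \<in> ideal_radical A" by (auto simp: ideal_radical_def)
  have "l q - Const (of_nat q) * Y \<in> ideal_radical A"
    by (intro is_ideal_diff[OF R] is_idealD(3)[OF R] Yr subset_ideal_radical lA)
  hence Xr: "X \<in> ideal_radical A" by (simp add: l_def)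
  \<comment> \<open>Modulo \<open>X\<close> and \<open>Y\<close>, every point is a multiple of
    \<open>P\<close>: the substitution turns a form of degree \<open>k\<close> into its value at
    \<open>P\<close> times the \<open>k\<close>-th power of the third variable.\<close>
  define v where "v j = (if j = 1 then Const a * Var 3 else if j = 2 then Const b * Var 3 else Var 3)" for j :: 3
  have vr: "v j - Var j \<in> ideal_radical A" for j
    using is_ideal_minus[OF R Xr] is_ideal_minus[OF R Yr] exhaust_3[of j] is_idealD(1)[OF R]
    by (auto simp: v_def X_def Y_def)
  define F where "F = partial_deriv i f"
  have "F * G q \<in> J" using is_idealD(4)[OF J ideal_gen_base[of F "range (\<lambda>i. partial_deriv i f)", folded jacobian_ideal_def J_def]]
    by (auto simp: F_def)
  hence FA: "F \<in> ideal_radical A" by (intro subset_ideal_radical) (simp add: A_def)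
  have Fgr: "F \<in> graded_part (int (m - 1))" using graded_part_partial_deriv[OF f, of i] m by (simp add: F_def of_nat_diff)
  have vP: "v j = Const (P $ j) * Var 3" for j using exhaust_3[of j] P by (auto simp: v_def)
  have "eval_hom Const v h = Const (eval_at h P) * Var 3 ^ k" if "h \<in> graded_part (int k)" for h k
    using that
  proof (induction h rule: graded_part_induct)
    case (single t c)
    have "Const (prod E S) = (\<Prod>k\<in>S. Const (E k))" for E and S :: "3 set"
      by (induction S rule: infinite_finite_induct) (auto simp: Const_mult)
    moreover have "Const (z ^ n) = Const z ^ n" for z n by (induction n) (auto simp: Const_mult)
    ultimately have "eval_hom Const v (Poly_Mapping.single t c) = Const (eval_at (Poly_Mapping.single t c) P) * Var 3 ^ mono_degree t"
      unfolding eval_hom_single[OF scalar_hom_Const] vP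
      by (simp add: power_mult_distrib prod.distrib Const_mult mult.assoc mono_degree_def power_sum)
    thus ?case using single by simp
  qed (simp_all add: scalar_hom_Const Const_add distrib_right)
  hence "eval_hom Const v F = Const (eval_at F P) * Var 3 ^ (m - 1)" using Fgr by blast
  moreover have "eval_hom Const v F - F \<in> ideal_radical A" by (rule eval_hom_cong_ideal[OF R vr])
  ultimately have "(Const (eval_at F P) * Var 3 ^ (m - 1) - F) + F \<in> ideal_radical A"
    using FA by (intro is_idealD(2)[OF R]) auto
  hence "Const (eval_at F P) * Var 3 ^ (m - 1) \<in> ideal_radical A" by simp
  hence "Var 3 ^ (m - 1) \<in> ideal_radical A" using Const_mem_iff[OF R] P(1) by (auto simp: F_def)
  hence 3: "Var 3 \<in> ideal_radical A" by (rule ideal_radical_power)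
  have "X + Const a * Var 3 \<in> ideal_radical A" "Y + Const b * Var 3 \<in> ideal_radical A"
    by (intro is_idealD(2)[OF R] is_idealD(3)[OF R] Xr Yr 3)+
  hence "Var j \<in> ideal_radical A" for j
    using 3 exhaust_3[of j] by (auto simp: X_def Y_def)
  hence "G q \<in> saturation J irrelevant_ideal" unfolding A_def by (rule saturationI[OF J])
  thus False using g(3) by (simp add: G_def)
qed


section \<open>Homogeneous components and graded quotients\<close>

definition hom_comp :: "int \<Rightarrow> poly3 \<Rightarrow> poly3" where
  "hom_comp n f = (\<Sum>t\<in>Poly_Mapping.keys f. if int (mono_degree t) = n then Poly_Mapping.single t (Poly_Mapping.lookup f t) else 0)"

lemma hom_comp_add: "hom_comp n (f + g) = hom_comp n f + hom_comp n g"
  unfolding hom_comp_def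
  using setsum_keys_plus_distrib[of "\<lambda>t c. if int (mono_degree t) = n then Poly_Mapping.single t c else 0" f g]
  by (simp add: single_add)

lemma hom_comp_sum: "hom_comp n (sum F A) = (\<Sum>a\<in>A. hom_comp n (F a))"
  by (induction A rule: infinite_finite_induct) (auto simp: hom_comp_add, auto simp: hom_comp_def)

lemma hom_comp_graded: "hom_comp n f \<in> graded_part n"
  unfolding hom_comp_def by (intro graded_part_sum) (auto intro!: graded_part_single)

lemma hom_comp_id: "f \<in> graded_part n \<Longrightarrow> hom_comp n f = f"
proof -
  assume "f \<in> graded_part n"
  hence "hom_comp n f = (\<Sum>t\<in>Poly_Mapping.keys f. Poly_Mapping.single t (Poly_Mapping.lookup f t))"
    unfolding hom_comp_def by (intro sum.cong) (auto simp: graded_part_def)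
  thus ?thesis using poly_mapping_eq_sum_single[of f] by simp
qed

lemma hom_comp_other: "f \<in> graded_part n' \<Longrightarrow> n' \<noteq> n \<Longrightarrow> hom_comp n f = 0"
  unfolding hom_comp_def by (intro sum.neutral) (auto simp: graded_part_def)

lemma hom_comp_mult: "f \<in> graded_part d \<Longrightarrow> hom_comp n (g * f) = hom_comp (n - d) g * f"
proof (induction g rule: poly_mapping_single_induct)
  case zero show ?case by (simp add: hom_comp_def)
next
  case (single t c)
  have s: "Poly_Mapping.single t c \<in> graded_part (int (mono_degree t))" by (rule graded_part_single) simp
  have sf: "Poly_Mapping.single t c * f \<in> graded_part (int (mono_degree t) + d)" by (rule graded_part_mult[OF s single])
  show ?case
  proof (cases "int (mono_degree t) = n - d")
    case True
    thus ?thesis using hom_comp_id[OF s] hom_comp_id[OF sf] by simp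
  next
    case False
    thus ?thesis using hom_comp_other[OF s, of "n - d"] hom_comp_other[OF sf, of n] by simp
  qed
next
  case (add g h)
  thus ?case by (simp add: hom_comp_add distrib_right)
qed

text \<open>In any representation of the homogeneous \<open>g\<close> by the partial derivatives,
  the coefficients may be replaced by their components of degree
  \<open>n - (int m - 1)\<close>.\<close>

lemma jacobian_ideal_graded:
  assumes f: "f \<in> graded_part (int m)" and g: "g \<in> jacobian_ideal f" "g \<in> graded_part n"
  obtains \<beta> where "\<And>i. \<beta> i \<in> graded_part (n - (int m - 1))" "g = (\<Sum>i\<in>UNIV. \<beta> i * partial_deriv i f)"
proof -
  have "jacobian_ideal f \<subseteq> {\<Sum>i\<in>UNIV. \<beta> i * partial_deriv i f |\<beta>. True}"
    unfolding jacobian_ideal_def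
  proof (rule ideal_gen_subset)
    show "range (\<lambda>i. partial_deriv i f) \<subseteq> {\<Sum>i\<in>UNIV. \<beta> i * partial_deriv i f |\<beta>. True}"
    proof safe
      fix i
      have "partial_deriv i f = (\<Sum>j\<in>UNIV. (if j = i then 1 else 0) * partial_deriv j f)"
        by (simp add: if_distrib[of "\<lambda>c. c * _"] cong: if_cong)
      thus "\<exists>\<beta>. partial_deriv i f = (\<Sum>i\<in>UNIV. \<beta> i * partial_deriv i f) \<and> True"
        by (intro exI[of _ "\<lambda>j. if j = i then 1 else 0"] conjI TrueI)
    qed
    show "0 \<in> {\<Sum>i\<in>UNIV. \<beta> i * partial_deriv i f |\<beta>. True}" by (auto intro!: exI[of _ "\<lambda>i. 0"])
    fix x y c
    assume x: "x \<in> {\<Sum>i\<in>UNIV. \<beta> i * partial_deriv i f |\<beta>. True}"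
    then obtain \<beta> where \<beta>: "x = (\<Sum>i\<in>UNIV. \<beta> i * partial_deriv i f)" by blast
    have "c * x = (\<Sum>i\<in>UNIV. (c * \<beta> i) * partial_deriv i f)" unfolding \<beta> by (simp add: sum_distrib_left mult.assoc)
    thus "c * x \<in> {\<Sum>i\<in>UNIV. \<beta> i * partial_deriv i f |\<beta>. True}"
      unfolding mem_Collect_eq by (intro exI[of _ "\<lambda>i. c * \<beta> i"] conjI TrueI)
    assume "y \<in> {\<Sum>i\<in>UNIV. \<beta> i * partial_deriv i f |\<beta>. True}"
    then obtain \<gamma> where \<gamma>: "y = (\<Sum>i\<in>UNIV. \<gamma> i * partial_deriv i f)" by blast
    have "x + y = (\<Sum>i\<in>UNIV. (\<beta> i + \<gamma> i) * partial_deriv i f)" unfolding \<beta> \<gamma> by (simp add: sum.distrib distrib_right)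
    thus "x + y \<in> {\<Sum>i\<in>UNIV. \<beta> i * partial_deriv i f |\<beta>. True}"
      unfolding mem_Collect_eq by (intro exI[of _ "\<lambda>i. \<beta> i + \<gamma> i"] conjI TrueI)
  qed
  then obtain \<beta> where \<beta>: "g = (\<Sum>i\<in>UNIV. \<beta> i * partial_deriv i f)" using g(1) by blast
  have "g = hom_comp n g" using hom_comp_id[OF g(2)] by simp
  also have "\<dots> = (\<Sum>i\<in>UNIV. hom_comp (n - (int m - 1)) (\<beta> i) * partial_deriv i f)"
    unfolding \<beta> hom_comp_sum by (intro sum.cong refl hom_comp_mult graded_part_partial_deriv f)
  finally show ?thesis using hom_comp_graded by (intro that[of "\<lambda>i. hom_comp (n - (int m - 1)) (\<beta> i)"])
qed

text \<open>A basis has at most one member \<open>b\<close>; expressing both vectors by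
  \<open>b\<close> and eliminating it gives the relation.\<close>

lemma quotient_dim_le_1:
  assumes q: "quotient_dim Const V W \<le> 1" and W: "0 \<in> W" "\<And>x y. x \<in> W \<Longrightarrow> y \<in> W \<Longrightarrow> x - y \<in> W" "\<And>c x. x \<in> W \<Longrightarrow> Const c * x \<in> W"
    and v: "v1 \<in> V" "v2 \<in> V"
  shows "\<exists>c1 c2. (c1 \<noteq> 0 \<or> c2 \<noteq> 0) \<and> Const c1 * v1 + Const c2 * v2 \<in> W"
proof -
  have ex: "\<exists>B. quotient_basis Const V W B"
    using q unfolding quotient_dim_def by (auto split: if_splits simp: one_enat_def)
  define B where "B = (SOME B. quotient_basis Const V W B)"
  have B: "quotient_basis Const V W B" unfolding B_def by (rule someI_ex[OF ex])
  have "enat (card B) \<le> 1" using q ex unfolding quotient_dim_def B_def by simp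
  hence card: "card B \<le> 1" by (simp add: one_enat_def)
  have fin: "finite B" using B by (simp add: quotient_basis_def)
  have "\<exists>b. B \<subseteq> {b}"
  proof (cases "B = {}")
    case False
    hence "card B = 1" using card fin by (simp add: card_gt_0_iff le_Suc_eq)
    thus ?thesis by (metis card_1_singletonE subset_refl)
  qed simp
  then obtain b where b: "B \<subseteq> {b}" by blast
  have r: "\<exists>c. v - Const c * b \<in> W" if "v \<in> V" for v
  proof -
    obtain c where c: "v - (\<Sum>b\<in>B. Const (c b) * b) \<in> W" using B \<open>v \<in> V\<close> unfolding quotient_basis_def by blast
    have "B = {} \<or> B = {b}" using b by blast
    thus ?thesis using c by (auto intro: exI[of _ 0])
  qed
  obtain c1 c2 where c: "v1 - Const c1 * b \<in> W" "v2 - Const c2 * b \<in> W" using r v by blast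
  show ?thesis
  proof (cases "c1 = 0 \<and> c2 = 0")
    case True
    thus ?thesis using c(1) by (intro exI[of _ 1] exI[of _ 0]) simp
  next
    case False
    have "Const c2 * (v1 - Const c1 * b) - Const c1 * (v2 - Const c2 * b) \<in> W" using c W by blast
    also have "Const c2 * (v1 - Const c1 * b) - Const c1 * (v2 - Const c2 * b) = Const c2 * v1 + Const (- c1) * v2"
    proof -
      have "Const (- c1) = - Const c1" by (simp add: Const_def single_uminus)
      thus ?thesis by (simp add: algebra_simps)
    qed
    finally show ?thesis using False by (intro exI[of _ c2] exI[of _ "-c1"]) auto
  qed
qed

lemma lookup_Const_mult: "Poly_Mapping.lookup (Const c * f) t = c * Poly_Mapping.lookup f t"
proof -
  have "Const c * f = Poly_Mapping.map ((*) c) f" by (simp add: Const_def mult_map_scale_conv_mult)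
  thus ?thesis by (simp add: Poly_Mapping.map.rep_eq when_def)
qed

text \<open>The monomials of binary forms of degree \<open>n\<close>: on the line chosen below, the
  first variable is a linear form in the other two.\<close>

definition yz_mono :: "nat \<Rightarrow> nat \<Rightarrow> mono3" where
  "yz_mono n k = Poly_Mapping.single 2 k + Poly_Mapping.single 3 (n - k)"

lemma lookup_yz_mono: "Poly_Mapping.lookup (yz_mono n k) 1 = 0" "Poly_Mapping.lookup (yz_mono n k) 2 = k"
  "Poly_Mapping.lookup (yz_mono n k) 3 = n - k"
  by (simp_all add: yz_mono_def lookup_add lookup_single)

lemma mono_degree_yz_mono: "k \<le> n \<Longrightarrow> mono_degree (yz_mono n k) = n"
  by (simp add: yz_mono_def mono_degree_add)

lemma yz_mono_exhaust:
  assumes "mono_degree t = n" "Poly_Mapping.lookup t 1 = 0"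
  shows "t \<in> yz_mono n ` {..n}"
proof (rule image_eqI)
  have s: "Poly_Mapping.lookup t 2 + Poly_Mapping.lookup t 3 = n" using assms by (simp add: mono_degree_def sum_3)
  thus "Poly_Mapping.lookup t 2 \<in> {..n}" by simp
  show "t = yz_mono n (Poly_Mapping.lookup t 2)"
  proof (rule poly_mapping_eqI)
    fix i show "Poly_Mapping.lookup t i = Poly_Mapping.lookup (yz_mono n (Poly_Mapping.lookup t 2)) i"
      using exhaust_3[of i] s assms(2) by (auto simp: lookup_yz_mono)
  qed
qed

text \<open>
  Restriction to a general line \<open>l = 0\<close>: among the restrictions of syzygies of degree \<open>r\<close> there
  are at least two independent solutions, by counting coefficients of binary forms; since
  \<open>N(f)\<close> has dimension at most one in each degree, some combination of them lifts.
\<close>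

lemma syzygy_of_nearly_free:
  fixes f :: poly3 and m r :: nat
  assumes f: "f \<in> graded_part (int m)" "f \<noteq> 0" and m: "m \<ge> 2" and r: "m < 2 * r + 2" and nf: "nearly_free f"
  shows "\<exists>\<theta>. (\<forall>i. \<theta> i \<in> graded_part (int r)) \<and> (\<exists>i. \<theta> i \<noteq> 0) \<and> (\<Sum>i\<in>UNIV. \<theta> i * partial_deriv i f) = 0"
proof -
  define J where "J = jacobian_ideal f"
  have J: "is_ideal J" unfolding J_def by (rule is_ideal_jacobian)
  \<comment> \<open>The degree of the quotient by \<open>l\<close> of a form of degree
    \<open>r + m - 1\<close>; in this degree the dimension of N(f) is used.\<close>
  define n where "n = r + m - 2"
  \<comment> \<open>By Euler's formula, a point off the curve has a nonvanishing partial derivative,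
    as the choice of the line requires; the third coordinate is to be normalized to 1.\<close>
  obtain P0 where P0: "eval_at f P0 \<noteq> 0" "P0 $ 3 \<noteq> 0"
  proof -
    have "(Var 3 :: poly3) \<noteq> 0"
    proof
      assume "(Var 3 :: poly3) = 0"
      from arg_cong[OF this, of "\<lambda>g. eval_at g (axis 3 1)"] show False by (simp add: axis_def)
    qed
    hence "\<exists>p. \<forall>g\<in>{f, Var 3}. eval_at g p \<noteq> 0" using f by (intro prod_eval_nonzero[of _ "\<lambda>g. g"]) auto
    thus ?thesis using that by auto
  qed
  define P where "P = (1 / P0 $ 3) *s P0"
  have P3: "P $ 3 = 1" using P0 by (simp add: P_def)
  have fP: "eval_at f P \<noteq> 0" unfolding P_def eval_at_smult[OF f(1)] using P0 by simp
  obtain i0 where i0: "eval_at (partial_deriv i0 f) P \<noteq> 0"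
  proof (rule ccontr)
    assume "\<not> thesis"
    hence "eval_at (partial_deriv i f) P = 0" for i using that by blast
    hence "(\<Sum>i\<in>UNIV. P $ i * eval_at (partial_deriv i f) P) = 0" by simp
    thus False using eval_euler[OF f(1), of P] fP m by simp
  qed
  define a where "a = P $ 1"
  define b where "b = P $ 2"
  obtain t where t: "\<And>g. g \<in> graded_part (int n) \<Longrightarrow> (Var 1 - Const a * Var 3 + Const t * (Var 2 - Const b * Var 3)) * g \<in> J \<Longrightarrow> g \<in> saturation J irrelevant_ideal"
    using nonzerodivisor_in_pencil[OF f(1) i0 a_def[symmetric] b_def[symmetric] P3, of n] m unfolding J_def by auto
  define l where "l = Var 1 - Const a * Var 3 + Const t * (Var 2 - Const b * Var 3)"
  have lgr: "l \<in> graded_part 1"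
    unfolding l_def by (intro graded_part_add graded_part_diff graded_part_Const_mult graded_part_Var)
  \<comment> \<open>Solves \<open>l = 0\<close> for the first variable. The substitution is the
    restriction to the line, realized inside the same polynomial ring, and its kernel is generated
    by \<open>l\<close>.\<close>
  define v :: "3 \<Rightarrow> poly3" where "v i = (if i = 1 then Const a * Var 3 - Const t * (Var 2 - Const b * Var 3) else Var i)" for i
  define \<rho> where "\<rho> = eval_hom Const v"
  have \<rho>: "\<rho> (g + h) = \<rho> g + \<rho> h" "\<rho> (g * h) = \<rho> g * \<rho> h" "\<rho> (g - h) = \<rho> g - \<rho> h" "\<rho> (Const c) = Const c" "\<rho> (Var i) = v i"
     "\<rho> (sum F A) = (\<Sum>a\<in>A. \<rho> (F a))" "\<rho> 0 = 0" for g h c i A and F :: "'z \<Rightarrow> poly3"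
    unfolding \<rho>_def using scalar_hom_Const by simp_all
  have \<rho>l: "\<rho> l = 0" unfolding l_def \<rho> by (simp add: v_def)
  have \<rho>div: "\<rho> g - g \<in> {l * h |h. True}" for g
    unfolding \<rho>_def
  proof (rule eval_hom_cong_ideal[OF is_ideal_principal])
    fix i
    have "v i - Var i = l * (if i = 1 then -1 else 0)" by (simp add: v_def l_def)
    thus "v i - Var i \<in> {l * h |h. True}" by blast
  qed
  have divl: "\<exists>h\<in>graded_part (k - 1). g = l * h" if "\<rho> g = 0" "g \<in> graded_part k" for g k
  proof -
    obtain h where h: "\<rho> g - g = l * h" using \<rho>div by blast
    hence "- g = h * l" using that(1) by (simp add: mult.commute)
    hence "g = (- h) * l" by (metis minus_minus mult_minus_left)
    hence "g = hom_comp (k - 1) (- h) * l"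
      using hom_comp_id[OF that(2)] hom_comp_mult[OF lgr, of k "-h"] by simp
    thus ?thesis using hom_comp_graded by (auto simp: mult.commute)
  qed
  \<comment> \<open>Restrictions are binary forms. This bounds the number of equations: a form of
    degree \<open>r + m - 1\<close> on the line has only \<open>r + m\<close> coefficients.\<close>
  have no1: "Poly_Mapping.lookup s 1 = 0" if "s \<in> Poly_Mapping.keys (\<rho> g)" for s g
    using that
  proof (induction g arbitrary: s rule: poly3_induct)
    case (Const c) thus ?case unfolding \<rho> by (auto simp: Const_def split: if_splits)
  next
    case (Var i)
    have k: "Poly_Mapping.lookup s 1 = 0" if "s \<in> Poly_Mapping.keys (Const c * Var j)" "j \<noteq> 1" for s c j
      using that by (auto simp: Const_def Var_def mult_single lookup_single split: if_splits)
    have "Const a * Var 3 - Const t * (Var 2 - Const b * Var 3) = Const a * Var 3 + (Const (-t) * Var 2 + Const (t * b) * Var 3)"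
      by (simp add: Const_mult algebra_simps) (simp add: Const_def single_uminus)
    hence v1: "v 1 = Const a * Var 3 + (Const (-t) * Var 2 + Const (t * b) * Var 3)" by (simp add: v_def)
    show ?case
    proof (cases "i = 1")
      case True
      have "s \<in> Poly_Mapping.keys (Const a * Var 3 + (Const (-t) * Var 2 + Const (t * b) * Var 3))"
        using Var unfolding \<rho> True v1 .
      hence "s \<in> Poly_Mapping.keys (Const a * Var 3) \<or> s \<in> Poly_Mapping.keys (Const (-t) * Var 2) \<or> s \<in> Poly_Mapping.keys (Const (t * b) * Var 3)"
        using keys_add[of "Const a * Var 3" "Const (-t) * Var 2 + Const (t * b) * Var 3"]
          keys_add[of "Const (-t) * Var 2" "Const (t * b) * Var 3"] by blast
      thus ?thesis using k by (elim disjE) auto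
    next
      case False
      thus ?thesis using Var unfolding \<rho> by (auto simp: v_def Var_def lookup_single split: if_splits)
    qed
  next
    case (add f g)
    thus ?case using keys_add[of "\<rho> f" "\<rho> g"] unfolding \<rho> by blast
  next
    case (mult f g)
    then obtain u w where "s = u + w" "u \<in> Poly_Mapping.keys (\<rho> f)" "w \<in> Poly_Mapping.keys (\<rho> g)"
      using keys_mult[of "\<rho> f" "\<rho> g"] unfolding \<rho> by blast
    thus ?case using mult by (simp add: lookup_add)
  qed
  have \<rho>gr: "\<rho> g \<in> graded_part k" if "g \<in> graded_part k" for g k
  proof -
    have vg: "v i \<in> graded_part 1" for i
      unfolding v_def by (auto intro!: graded_part_diff graded_part_Const_mult)
    have s: "\<rho> (Poly_Mapping.single t c) \<in> graded_part (int (mono_degree t))" for t c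
    proof (induction "mono_degree t" arbitrary: t)
      case 0
      hence "t = 0" by (intro mono_degree_eq_0) simp
      thus ?case using graded_part_Const[of c] by (simp add: single_0_Const \<rho> mono_degree_def)
    next
      case (Suc k)
      then obtain i s where ts: "t = Poly_Mapping.single i 1 + s" "mono_degree s = k" using mono_degree_Suc[of t k] by auto
      have "v i * \<rho> (Poly_Mapping.single s c) \<in> graded_part (1 + int (mono_degree s))"
        by (rule graded_part_mult[OF vg Suc(1)]) (use ts in simp)
      thus ?case unfolding ts(1) single_split \<rho> mono_degree_add mono_degree_single by simp
    qed
    have "\<rho> (\<Sum>t\<in>Poly_Mapping.keys g. Poly_Mapping.single t (Poly_Mapping.lookup g t)) \<in> graded_part k"
      unfolding \<rho>
    proof (intro graded_part_sum)
      fix t assume "t \<in> Poly_Mapping.keys g"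
      hence "int (mono_degree t) = k" using that by (auto simp: graded_part_def)
      thus "\<rho> (Poly_Mapping.single t (Poly_Mapping.lookup g t)) \<in> graded_part k" using s by metis
    qed
    thus ?thesis using poly_mapping_eq_sum_single[of g] by simp
  qed
  define M where "M k = Poly_Mapping.single (yz_mono r k) (1::complex)" for k
  have Mgr: "M k \<in> graded_part (int r)" if "k \<le> r" for k
    unfolding M_def by (rule graded_part_single) (use that in \<open>simp add: mono_degree_yz_mono\<close>)
  have \<rho>M: "\<rho> (M k) = M k" for k
  proof -
    have "(\<Prod>i\<in>UNIV. v i ^ Poly_Mapping.lookup (yz_mono r k) i) = (\<Prod>i\<in>UNIV. Var i ^ Poly_Mapping.lookup (yz_mono r k) i)"
      by (intro prod.cong refl) (metis v_def lookup_yz_mono(1) power_0)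
    moreover have "eval_hom Const Var g = g" for g
      by (induction g rule: poly3_induct) (simp_all add: scalar_hom_Const)
    ultimately show ?thesis
      using eval_hom_single[OF scalar_hom_Const, of v "yz_mono r k" 1] eval_hom_single[OF scalar_hom_Const, of Var "yz_mono r k" 1]
      by (simp add: \<rho>_def M_def)
  qed
  define U where "U = (UNIV :: 3 set) \<times> {..r}"
  have U: "finite U" "card U = 3 * (r + 1)" by (simp_all add: U_def card_cartesian_product)
  define \<alpha> where "\<alpha> x i = (\<Sum>k\<le>r. Const (x (i, k)) * M k)" for x :: "3 \<times> nat \<Rightarrow> complex" and i
  have \<alpha>gr: "\<alpha> x i \<in> graded_part (int r)" for x i
    unfolding \<alpha>_def by (intro graded_part_sum graded_part_Const_mult Mgr) auto
  have \<rho>\<alpha>: "\<rho> (\<alpha> x i) = \<alpha> x i" for x i unfolding \<alpha>_def \<rho> \<rho>M ..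
  have lookup\<alpha>: "Poly_Mapping.lookup (\<alpha> x i) (yz_mono r k) = x (i, k)" if "k \<le> r" for x i k
  proof -
    have "Poly_Mapping.lookup (\<alpha> x i) (yz_mono r k) = (\<Sum>k'\<le>r. if k' = k then x (i, k) else 0)"
      unfolding \<alpha>_def lookup_sum lookup_Const_mult M_def lookup_single
    proof (intro sum.cong refl)
      fix k'
      have "yz_mono r k' = yz_mono r k \<longleftrightarrow> k' = k" using lookup_yz_mono(2) by metis
      thus "x (i, k') * (1 when yz_mono r k' = yz_mono r k) = (if k' = k then x (i, k) else 0)" by simp
    qed
    thus ?thesis using that by simp
  qed
  define E where "E = yz_mono (r + m - 1) ` {..r + m - 1}"
  have E: "finite E" "card E \<le> r + m" unfolding E_def using m card_image_le[of "{..r + m - 1}" "yz_mono (r + m - 1)"] by auto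
  define F where "F x = (\<Sum>i\<in>UNIV. \<alpha> x i * partial_deriv i f)" for x
  have Fgr: "F x \<in> graded_part (int (r + m - 1))" for x
  proof -
    have "\<alpha> x i * partial_deriv i f \<in> graded_part (int r + (int m - 1))" for i
      by (intro graded_part_mult \<alpha>gr graded_part_partial_deriv f)
    moreover have "int (r + m - 1) = int r + (int m - 1)" using m by simp
    ultimately show ?thesis unfolding F_def by (simp only:) (rule graded_part_sum)
  qed
  define A where "A e u = Poly_Mapping.lookup (M (snd u) * \<rho> (partial_deriv (fst u) f)) e" for e u
  have FA: "Poly_Mapping.lookup (\<rho> (F x)) e = (\<Sum>u\<in>U. A e u * x u)" for x e
  proof -
    have "\<rho> (F x) = (\<Sum>i\<in>UNIV. \<Sum>k\<le>r. Const (x (i, k)) * (M k * \<rho> (partial_deriv i f)))"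
      unfolding F_def \<rho> \<rho>\<alpha> by (simp add: \<alpha>_def sum_distrib_right mult.assoc)
    hence "Poly_Mapping.lookup (\<rho> (F x)) e = (\<Sum>i\<in>UNIV. \<Sum>k\<le>r. x (i, k) * Poly_Mapping.lookup (M k * \<rho> (partial_deriv i f)) e)"
      by (simp add: lookup_sum lookup_Const_mult)
    thus ?thesis by (simp add: U_def A_def sum.cartesian_product case_prod_unfold mult.commute)
  qed
  have solve: "\<exists>g\<in>graded_part (int n). F x = l * g" if x: "\<forall>e\<in>E. (\<Sum>u\<in>U. A e u * x u) = 0" for x
  proof -
    have "\<rho> (F x) = 0"
    proof (rule poly_mapping_eqI)
      fix e
      show "Poly_Mapping.lookup (\<rho> (F x)) e = Poly_Mapping.lookup 0 e"
      proof (cases "e \<in> E")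
        case True thus ?thesis using x FA by simp
      next
        case False
        have "e \<notin> Poly_Mapping.keys (\<rho> (F x))"
        proof
          assume e: "e \<in> Poly_Mapping.keys (\<rho> (F x))"
          hence "mono_degree e = r + m - 1" using \<rho>gr[OF Fgr, of x] by (auto simp: graded_part_def)
          from yz_mono_exhaust[OF this no1[OF e]] show False using False unfolding E_def by simp
        qed
        thus ?thesis by (simp add: in_keys_iff)
      qed
    qed
    moreover have e: "int (r + m - 1) - 1 = int n" using m by (simp add: n_def of_nat_diff)
    ultimately show ?thesis using divl[OF _ Fgr, of x, unfolded e] by blast
  qed
  \<comment> \<open>There are \<open>3 * (r + 1)\<close> unknowns and at most \<open>r + m\<close>
    equations, so \<open>m < 2 * r + 2\<close> leaves at least two more unknowns than equations; the
    second surplus is spent on \<open>x'\<close>.\<close>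
  obtain x where x: "\<exists>u\<in>U. x u \<noteq> 0" "\<forall>e\<in>E. (\<Sum>u\<in>U. A e u * x u) = 0"
    using underdetermined_system[OF E(1) U(1), of A] E(2) U(2) r by auto
  obtain u where u: "u \<in> U" "x u \<noteq> 0" using x(1) by blast
  \<comment> \<open>The extra equation \<open>None\<close> demands that the coordinate
    \<open>u\<close>, at which \<open>x\<close> is nonzero, vanishes. A nonzero solution
    \<open>x'\<close> is then independent of \<open>x\<close>.\<close>
  define A' where "A' e w = (case e of None \<Rightarrow> if w = u then 1 else 0 | Some e \<Rightarrow> A e w)" for e w
  have "card (insert None (Some ` E)) \<le> r + m + 1" using E card_image_le[of E Some] by (simp add: card_insert_if)
  then obtain x' where x': "\<exists>u\<in>U. x' u \<noteq> 0" "\<forall>e\<in>insert None (Some ` E). (\<Sum>u\<in>U. A' e u * x' u) = 0"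
    using underdetermined_system[of "insert None (Some ` E)" U A'] E(1) U r by auto
  have x'E: "\<forall>e\<in>E. (\<Sum>u\<in>U. A e u * x' u) = 0" using x'(2) by (auto simp: A'_def)
  have x'u: "x' u = 0" using x'(2) u U by (simp add: A'_def if_distrib[of "\<lambda>c. c * _"] cong: if_cong)
  obtain g where g: "g \<in> graded_part (int n)" "F x = l * g" using solve[OF x(2)] by blast
  obtain g' where g': "g' \<in> graded_part (int n)" "F x' = l * g'" using solve[OF x'E] by blast
  have FJ: "F x \<in> J" for x
    unfolding F_def J_def jacobian_ideal_def
    by (intro is_ideal_sum[OF is_ideal_ideal_gen] is_idealD(3)[OF is_ideal_ideal_gen] ideal_gen_base) auto
  have sat: "g \<in> saturated_jacobian_ideal f" "g' \<in> saturated_jacobian_ideal f"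
    using t[OF g(1)] t[OF g'(1)] FJ[of x] FJ[of x'] g(2) g'(2) unfolding l_def saturated_jacobian_ideal_def J_def by auto
  \<comment> \<open>Both quotients \<open>g\<close>, \<open>g'\<close> by the line lie in the
    saturated ideal, because \<open>l\<close> was chosen accordingly. Since N(f) has at most one
    dimension in degree \<open>n\<close>, a combination of them lies in the Jacobian ideal
    itself.\<close>
  define W where "W = J \<inter> graded_part (int n)"
  have "\<exists>c1 c2. (c1 \<noteq> 0 \<or> c2 \<noteq> 0) \<and> Const c1 * g + Const c2 * g' \<in> W"
  proof (rule quotient_dim_le_1)
    show "quotient_dim Const (saturated_jacobian_ideal f \<inter> graded_part (int n)) W \<le> 1"
      using nf unfolding nearly_free_def dim_N_def W_def J_def by blast
    show "0 \<in> W" using is_idealD(1)[OF J] by (simp add: W_def)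
    show "x - y \<in> W" if "x \<in> W" "y \<in> W" for x y
      using that is_ideal_diff[OF J] graded_part_diff by (auto simp: W_def)
    show "Const c * x \<in> W" if "x \<in> W" for c x
      using that is_idealD(3)[OF J] graded_part_Const_mult by (auto simp: W_def)
  qed (use sat g g' in auto)
  then obtain c1 c2 where c: "c1 \<noteq> 0 \<or> c2 \<noteq> 0" "Const c1 * g + Const c2 * g' \<in> J" "Const c1 * g + Const c2 * g' \<in> graded_part (int n)"
    by (auto simp: W_def)
  obtain \<beta> where \<beta>: "\<And>i. \<beta> i \<in> graded_part (int n - (int m - 1))" "Const c1 * g + Const c2 * g' = (\<Sum>i\<in>UNIV. \<beta> i * partial_deriv i f)"
    by (rule jacobian_ideal_graded[OF f(1) c(2)[unfolded J_def] c(3)]) blast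
  \<comment> \<open>The correction by \<open>l * \<beta> i\<close> removes what the combination of
    the two lifts leaves over on \<open>f\<close>. As it vanishes on the line, the restriction of
    the syzygy is the combination of \<open>\<alpha> x\<close> and \<open>\<alpha> x'\<close>, which
    is nonzero by independence.\<close>
  define \<theta> where "\<theta> i = Const c1 * \<alpha> x i + Const c2 * \<alpha> x' i - l * \<beta> i" for i
  have "\<theta> i \<in> graded_part (int r)" for i
  proof -
    have "1 + (int n - (int m - 1)) = int r" using m by (simp add: n_def of_nat_diff)
    hence "l * \<beta> i \<in> graded_part (int r)" using graded_part_mult[OF lgr \<beta>(1)[of i]] by simp
    thus ?thesis unfolding \<theta>_def by (intro graded_part_diff graded_part_add graded_part_Const_mult \<alpha>gr)
  qed
  moreover have "(\<Sum>i\<in>UNIV. \<theta> i * partial_deriv i f) = 0"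
  proof -
    have "(\<Sum>i\<in>UNIV. \<theta> i * partial_deriv i f) = Const c1 * F x + Const c2 * F x' - l * (\<Sum>i\<in>UNIV. \<beta> i * partial_deriv i f)"
      unfolding \<theta>_def F_def by (simp add: sum.distrib sum_subtractf sum_distrib_left algebra_simps)
    thus ?thesis unfolding \<beta>(2)[symmetric] g(2) g'(2) by (simp add: algebra_simps)
  qed
  moreover have "\<exists>i. \<theta> i \<noteq> 0"
  proof (rule ccontr)
    assume "\<nexists>i. \<theta> i \<noteq> 0"
    hence "\<rho> (\<theta> i) = 0" for i by (simp add: \<rho>)
    hence z: "Const c1 * \<alpha> x i + Const c2 * \<alpha> x' i = 0" for i
      unfolding \<theta>_def \<rho> \<rho>\<alpha> \<rho>l by simp
    have zz: "c1 * x w + c2 * x' w = 0" if "w \<in> U" for w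
    proof -
      obtain i k where w: "w = (i, k)" "k \<le> r" using \<open>w \<in> U\<close> by (auto simp: U_def)
      from arg_cong[OF z[of i], of "\<lambda>q. Poly_Mapping.lookup q (yz_mono r k)"] show ?thesis
        using lookup\<alpha>[OF w(2)] w(1) by (simp add: lookup_add lookup_Const_mult)
    qed
    have "c1 = 0" using zz[OF u(1)] u(2) x'u by simp
    moreover obtain w where w: "w \<in> U" "x' w \<noteq> 0" using x'(1) by blast
    ultimately have "c2 = 0" using zz[OF w(1)] w(2) by simp
    thus False using c(1) \<open>c1 = 0\<close> by simp
  qed
  ultimately show ?thesis by blast
qed

section \<open>Local integrability\<close>

lemma pw_mult: "0 \<le> x \<Longrightarrow> 0 \<le> y \<Longrightarrow> pw a (x * y) = pw a x * pw a y"
  by (auto simp: pw_def powr_mult ennreal_mult ennreal_top_mult ennreal_mult_top)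

lemma pw_add: "0 \<le> x \<Longrightarrow> pw a x * pw b x = pw (a + b) x"
  by (auto simp: pw_def ennreal_mult[symmetric] powr_add[symmetric] add.commute)

lemma pw_prod: "finite A \<Longrightarrow> (\<And>i. i \<in> A \<Longrightarrow> 0 \<le> g i) \<Longrightarrow> pw a (\<Prod>i\<in>A. g i) = (\<Prod>i\<in>A. pw a (g i))"
proof (induction A rule: finite_induct)
  case empty show ?case by (simp add: pw_def)
next
  case (insert i A) thus ?case by (simp add: pw_mult prod_nonneg)
qed

lemma pw_square: "0 \<le> x \<Longrightarrow> pw a (x * x) = pw (2 * a) x"
  using pw_add[of x a a] by (simp add: pw_mult)

text \<open>For positive \<open>y\<close> this is an equality; at 0 the left side is 0, being the
  product of 0 and infinity.\<close>

lemma power2_mult_pw: "0 \<le> y \<Longrightarrow> ennreal (y^2) * pw a y \<le> pw (a - 2) y"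
proof (cases "y = 0")
  case False
  assume "0 \<le> y"
  hence "y^2 * y powr (-a) = y powr (-(a - 2))" using False by (simp add: powr_diff powr_minus field_simps powr_numeral)
  thus ?thesis using False by (simp add: pw_def ennreal_mult[symmetric])
qed (simp add: pw_def)

definition loc_finite :: "(complex^3 \<Rightarrow> ennreal) \<Rightarrow> complex^3 \<Rightarrow> bool" where
  "loc_finite G p \<longleftrightarrow> (\<exists>\<eta>>0. (\<integral>\<^sup>+ x. indicator (ball p \<eta>) x * G x \<partial>lborel) < \<infinity>)"

lemma loc_finite_const: "C < \<infinity> \<Longrightarrow> loc_finite (\<lambda>x. C) p"
  unfolding loc_finite_def using emeasure_lborel_ball_finite[of p 1]
  by (intro exI[of _ 1], subst nn_integral_multc) (auto simp: ennreal_mult_less_top)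

lemma loc_finite_mono:
  assumes G: "loc_finite G p" and [measurable]: "G \<in> borel_measurable borel" and C: "C < \<infinity>" and \<eta>: "\<eta> > 0"
    and le: "\<And>x. x \<in> ball p \<eta> \<Longrightarrow> H x \<le> C * G x"
  shows "loc_finite H p"
proof -
  obtain \<zeta> where \<zeta>: "\<zeta> > 0" "(\<integral>\<^sup>+ x. indicator (ball p \<zeta>) x * G x \<partial>lborel) < \<infinity>"
    using G by (auto simp: loc_finite_def)
  have "(\<integral>\<^sup>+ x. indicator (ball p (min \<eta> \<zeta>)) x * H x \<partial>lborel) \<le> (\<integral>\<^sup>+ x. C * (indicator (ball p \<zeta>) x * G x) \<partial>lborel)"
    by (intro nn_integral_mono) (auto simp: indicator_def intro: le)
  also have "\<dots> = C * (\<integral>\<^sup>+ x. indicator (ball p \<zeta>) x * G x \<partial>lborel)" by (subst nn_integral_cmult) auto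
  also have "\<dots> < \<infinity>" using C \<zeta>(2) by (simp add: ennreal_mult_less_top)
  finally show ?thesis unfolding loc_finite_def using \<eta> \<zeta>(1) by (intro exI[of _ "min \<eta> \<zeta>"]) auto
qed

lemma loc_finite_add:
  assumes "loc_finite G p" "loc_finite H p" and [measurable]: "G \<in> borel_measurable borel" "H \<in> borel_measurable borel"
  shows "loc_finite (\<lambda>x. G x + H x) p"
proof -
  obtain \<zeta> \<eta> where 1: "\<zeta> > 0" "(\<integral>\<^sup>+ x. indicator (ball p \<zeta>) x * G x \<partial>lborel) < \<infinity>"
    "\<eta> > 0" "(\<integral>\<^sup>+ x. indicator (ball p \<eta>) x * H x \<partial>lborel) < \<infinity>"
    using assms(1,2) by (auto simp: loc_finite_def)
  have "(\<integral>\<^sup>+ x. indicator (ball p (min \<eta> \<zeta>)) x * (G x + H x) \<partial>lborel) \<le> (\<integral>\<^sup>+ x. indicator (ball p \<zeta>) x * G x + indicator (ball p \<eta>) x * H x \<partial>lborel)"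
    by (intro nn_integral_mono) (auto simp: indicator_def)
  also have "\<dots> = (\<integral>\<^sup>+ x. indicator (ball p \<zeta>) x * G x \<partial>lborel) + (\<integral>\<^sup>+ x. indicator (ball p \<eta>) x * H x \<partial>lborel)"
    by (subst nn_integral_add) auto
  also have "\<dots> < \<infinity>" using 1 by simp
  finally show ?thesis unfolding loc_finite_def using 1 by (intro exI[of _ "min \<eta> \<zeta>"]) auto
qed

lemma loc_finite_compact:
  assumes S: "compact S" and loc: "\<And>p. p \<in> S \<Longrightarrow> loc_finite G p" and [measurable]: "G \<in> borel_measurable borel"
  shows "(\<integral>\<^sup>+ x. indicator S x * G x \<partial>lborel) < \<infinity>"
proof -
  have "\<forall>p\<in>S. \<exists>\<eta>>0. (\<integral>\<^sup>+ x. indicator (ball p \<eta>) x * G x \<partial>lborel) < \<infinity>" using loc by (simp add: loc_finite_def)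
  then obtain \<eta> where \<eta>: "\<And>p. p \<in> S \<Longrightarrow> \<eta> p > 0" "\<And>p. p \<in> S \<Longrightarrow> (\<integral>\<^sup>+ x. indicator (ball p (\<eta> p)) x * G x \<partial>lborel) < \<infinity>"
    by metis
  obtain T where T: "T \<subseteq> S" "finite T" "S \<subseteq> (\<Union>p\<in>T. ball p (\<eta> p))"
    by (rule compactE_image[OF S, of S "\<lambda>p. ball p (\<eta> p)"]) (use \<eta>(1) in auto)
  have "(\<integral>\<^sup>+ x. indicator S x * G x \<partial>lborel) \<le> (\<integral>\<^sup>+ x. (\<Sum>p\<in>T. indicator (ball p (\<eta> p)) x * G x) \<partial>lborel)"
  proof (intro nn_integral_mono)
    fix x
    show "indicator S x * G x \<le> (\<Sum>p\<in>T. indicator (ball p (\<eta> p)) x * G x)"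
    proof (cases "x \<in> S")
      case True
      then obtain p where p: "p \<in> T" "x \<in> ball p (\<eta> p)" using T by blast
      have "indicator (ball p (\<eta> p)) x * G x \<le> (\<Sum>p\<in>T. indicator (ball p (\<eta> p)) x * G x)"
        using p T by (intro member_le_sum) auto
      thus ?thesis using True p by simp
    qed simp
  qed
  also have "\<dots> = (\<Sum>p\<in>T. \<integral>\<^sup>+ x. indicator (ball p (\<eta> p)) x * G x \<partial>lborel)"
    by (rule nn_integral_sum) measurable
  also have "\<dots> < \<infinity>" using T \<eta>(2) by (auto simp: ennreal_sum_less_top)
  finally show ?thesis .
qed

lemma eval_at_measurable [measurable]: "eval_at f \<in> borel_measurable borel"
  by (rule borel_measurable_continuous_onI[OF continuous_eval_at])

section \<open>Integrability at one component, at a transversal pair and at a tangent pair\<close>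

lemma loc_finite_pair:
  assumes c: "is_component c" "is_component c'" and ind: "indep_grad c c' p"
    and a: "0 \<le> a" "a < 2" and b: "0 \<le> b" "b < 2"
  shows "loc_finite (\<lambda>x. pw a (norm (eval_at c x)) * pw b (norm (eval_at c' x))) p"
proof -
  obtain e0 e1 where e: "grad c p e0 = 1" "grad c p e1 = 0" "grad c' p e0 = 0" "grad c' p e1 = 1"
    using ind by (auto simp: indep_grad_def)
  show ?thesis unfolding loc_finite_def
    by (rule pw_local[OF a b continuous_eval_at continuous_eval_at component_sdiff[OF c(1)] component_sdiff[OF c(2)], where ?e0.0 = e0 and ?e1.0 = e1])
       (simp_all add: grad_add grad_smult e)
qed

lemma frame_exists:
  fixes p :: "complex^3"
  assumes "p \<noteq> 0" shows "\<exists>a b. local_frame p a b"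
proof -
  obtain i where i: "p $ i \<noteq> 0" using assms by (auto simp: vec_eq_iff)
  have n: "(3::3) \<noteq> 1" "(3::3) \<noteq> 2" "(1::3) \<noteq> 2" by simp_all
  consider "i = 1" | "i = 2" | "i = 3" using exhaust_3[of i] by auto
  thus ?thesis
  proof cases
    case 1
    have "local_frame p (axis 2 1) (axis 3 1)" unfolding local_frame_def using i 1 by (simp add: det_3 axis_def)
    thus ?thesis by blast
  next
    case 2
    have "local_frame p (axis 3 1) (axis 1 1)" unfolding local_frame_def using i 2 by (simp add: det_3 axis_def)
    thus ?thesis by blast
  next
    case 3
    have "local_frame p (axis 1 1) (axis 2 1)" unfolding local_frame_def using i 3 by (simp add: det_3 axis_def)
    thus ?thesis by blast
  qed
qed

lemma adapted_frame:
  assumes c: "is_component c" and p: "p \<noteq> 0" and cp: "eval_at c p = 0"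
  shows "\<exists>e w. local_frame p e w \<and> grad c p e = 1 \<and> grad c p w = 0"
proof -
  obtain a b where fr: "local_frame p a b" using frame_exists[OF p] by blast
  obtain Z U V where ZUV: "\<And>x. x = Z x *s p + U x *s a + V x *s b" by (rule local_frame_coords[OF fr]) blast
  obtain h where h: "grad c p h \<noteq> 0" by (rule component_grad_nonzero[OF c p cp])
  have "grad c p h = Z h * grad c p p + U h * grad c p a + V h * grad c p b"
    using ZUV[of h] by (metis grad_add grad_smult)
  hence nz: "grad c p a \<noteq> 0 \<or> grad c p b \<noteq> 0" using h component_grad_self[OF c cp] by auto
  obtain e1 e2 where e: "e1 * grad c p a + e2 * grad c p b = 1"
  proof (cases "grad c p a = 0")
    case True thus ?thesis using nz that[of 0 "1 / grad c p b"] by simp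
  next
    case False thus ?thesis using that[of "1 / grad c p a" 0] by simp
  qed
  have "e1 * (- grad c p a) - e2 * grad c p b = - (e1 * grad c p a + e2 * grad c p b)" by simp
  hence "local_frame p (e1 *s a + e2 *s b) (grad c p b *s a + (- grad c p a) *s b)"
    using e by (intro local_frame_change fr) simp
  thus ?thesis using e by (intro exI conjI) (auto simp: grad_add grad_smult grad_diff)
qed

lemma grad_line: "is_line c \<Longrightarrow> grad c p h = eval_at c h"
  using linear_form_rep[of c] by (auto simp: is_line_def grad_qpoly eval_qpoly)

text \<open>The coordinate along \<open>w\<close> in the frame, whose coefficients form the third
  column of the inverse matrix.\<close>

lemma frame_line:
  assumes fr: "local_frame p e w"
  shows "\<exists>\<nu>. is_line \<nu> \<and> eval_at \<nu> p = 0 \<and> eval_at \<nu> e = 0 \<and> eval_at \<nu> w = 1"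
proof -
  let ?M = "vector [p, e, w] :: complex^3^3"
  have "invertible ?M" using fr unfolding local_frame_def invertible_det_nz .
  then obtain N where N: "?M ** N = mat 1" "N ** ?M = mat 1" unfolding invertible_def by blast
  define \<nu> where "\<nu> = qpoly (\<lambda>j. N $ j $ 3) (\<lambda>i j. 0)"
  have ev: "eval_at \<nu> x = (x v* N) $ 3" for x
    by (simp add: \<nu>_def eval_qpoly vector_matrix_mult_def mult.commute)
  have e2: "(x v* ?M) v* N = x" for x
    unfolding vector_matrix_mul_assoc N by (simp add: vector_matrix_mul_rid)
  have "(axis 1 1) v* ?M = p" "(axis 2 1) v* ?M = e" "(axis 3 1) v* ?M = w"
    unfolding vector_matrix_expand by (simp_all add: axis_def)
  hence "p v* N = axis 1 1" "e v* N = axis 2 1" "w v* N = axis 3 1" using e2 by metis+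
  hence vals: "eval_at \<nu> p = 0" "eval_at \<nu> e = 0" "eval_at \<nu> w = 1" by (simp_all add: ev axis_def)
  have "\<nu> \<noteq> 0" using vals(3) by auto
  moreover have "\<nu> \<in> graded_part 1"
    unfolding \<nu>_def qpoly_def by (simp, intro graded_part_sum graded_part_Const_mult graded_part_Var)
  ultimately show ?thesis using vals by (auto simp: is_line_def)
qed

text \<open>Reduction to a pair by adding a transversal line with exponent 0, whose factor is at
  least 1 everywhere.\<close>

lemma loc_finite_one:
  assumes c: "is_component c" and p: "p \<noteq> 0" and cp: "eval_at c p = 0" and a: "0 \<le> a" "a < 2"
  shows "loc_finite (\<lambda>x. pw a (norm (eval_at c x))) p"
proof -
  obtain e w where ew: "local_frame p e w" "grad c p e = 1" "grad c p w = 0" using adapted_frame[OF c p cp] by blast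
  obtain \<nu> where \<nu>: "is_line \<nu>" "eval_at \<nu> e = 0" "eval_at \<nu> w = 1" using frame_line[OF ew(1)] by blast
  have ind: "indep_grad c \<nu> p" unfolding indep_grad_def using ew \<nu> grad_line[OF \<nu>(1)] by (intro exI[of _ e] exI[of _ w]) simp
  have c\<nu>: "is_component \<nu>" using \<nu> by (simp add: is_component_def)
  have L: "loc_finite (\<lambda>x. pw a (norm (eval_at c x)) * pw 0 (norm (eval_at \<nu> x))) p"
    by (rule loc_finite_pair[OF c c\<nu> ind a]) auto
  have le: "pw a (norm (eval_at c x)) \<le> 1 * (pw a (norm (eval_at c x)) * pw 0 (norm (eval_at \<nu> x)))" for x
  proof -
    have "1 \<le> pw 0 (norm (eval_at \<nu> x))" by (simp add: pw_def)
    hence "pw a (norm (eval_at c x)) * 1 \<le> pw a (norm (eval_at c x)) * pw 0 (norm (eval_at \<nu> x))" by (rule mult_left_mono) simp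
    thus ?thesis by simp
  qed
  have M: "(\<lambda>x. pw a (norm (eval_at c x)) * pw 0 (norm (eval_at \<nu> x))) \<in> borel_measurable borel"
    by measurable
  show ?thesis by (rule loc_finite_mono[OF L M _ zero_less_one le]) simp
qed

lemma continuous_near:
  fixes g :: "complex^3 \<Rightarrow> 'a::metric_space"
  assumes "continuous_on UNIV g" "\<epsilon> > 0"
  shows "\<exists>\<eta>>0. \<forall>x\<in>ball p \<eta>. dist (g x) (g p) < \<epsilon>"
proof -
  obtain d where "d > 0" "\<forall>x\<in>UNIV. dist x p < d \<longrightarrow> dist (g x) (g p) < \<epsilon>"
    using assms unfolding continuous_on_iff by blast
  thus ?thesis by (intro exI[of _ d]) (auto simp: dist_commute)
qed

text \<open>
  In a coordinate \<open>v = \<nu>\<close> along the common tangent, eliminating the linear terms from \<open>c\<close> and \<open>c'\<close>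
  leaves a unit times \<open>v\<^sup>2\<close>, because the contact has order exactly two.
\<close>

lemma tangent_pair_separation:
  assumes c: "is_component c" "is_component c'" and cp: "eval_at c p = 0" "eval_at c' p = 0"
    and tp: "tangent_pair c c' p"
  shows "\<exists>\<nu> K \<eta>. is_line \<nu> \<and> indep_grad c \<nu> p \<and> indep_grad c' \<nu> p \<and> K > 0 \<and> \<eta> > 0 \<and>
     (\<forall>x\<in>ball p \<eta>. (norm (eval_at \<nu> x))^2 \<le> K * max (norm (eval_at c x)) (norm (eval_at c' x)))"
proof -
  obtain \<kappa> e w where 1: "\<kappa> \<noteq> 0" "\<And>h. grad c' p h = \<kappa> * grad c p h" "grad c p e = 1" "grad c p w = 0"
     "local_frame p e w" "quad c' w \<noteq> \<kappa> * quad c w"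
    using tp unfolding tangent_pair_def by blast
  have w': "grad c' p w = 0" using 1 by simp
  obtain \<nu> where \<nu>: "is_line \<nu>" "eval_at \<nu> p = 0" "eval_at \<nu> e = 0" "eval_at \<nu> w = 1" using frame_line[OF 1(5)] by blast
  have i1: "indep_grad c \<nu> p" unfolding indep_grad_def using 1 \<nu> grad_line[OF \<nu>(1)] by (intro exI[of _ e] exI[of _ w]) simp
  have i2: "indep_grad c' \<nu> p"
  proof -
    have "grad \<nu> p e = 0" "grad \<nu> p w = 1" using \<nu> grad_line[OF \<nu>(1)] by auto
    thus ?thesis unfolding indep_grad_def using 1
      by (intro exI[of _ "(1/\<kappa>) *s e"] exI[of _ w]) (simp add: grad_smult)
  qed
  obtain Z U V where ZUV: "\<And>x. x = Z x *s p + U x *s e + V x *s w" "continuous_on UNIV Z" "continuous_on UNIV U" "continuous_on UNIV V"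
    "Z p = 1" "U p = 0" "V p = 0" by (rule local_frame_coords[OF 1(5)]) blast
  have V\<nu>: "V x = eval_at \<nu> x" for x
  proof -
    have "eval_at \<nu> x = grad \<nu> p x" using grad_line[OF \<nu>(1)] by simp
    also have "\<dots> = Z x * grad \<nu> p p + U x * grad \<nu> p e + V x * grad \<nu> p w" using ZUV(1)[of x] by (metis grad_add grad_smult)
    finally show ?thesis using grad_line[OF \<nu>(1)] \<nu> by simp
  qed
  obtain \<alpha> \<beta> \<gamma> where A: "\<And>z u v. eval_at c (z *s p + u *s e + v *s w) = u * (grad c p e + \<alpha> * (z - 1) + \<beta> * u + \<gamma> * v) + v^2 * quad c w"
    using component_tangent_coords[OF c(1) cp(1) 1(4)] by blast
  obtain \<alpha>' \<beta>' \<gamma>' where A': "\<And>z u v. eval_at c' (z *s p + u *s e + v *s w) = u * (grad c' p e + \<alpha>' * (z - 1) + \<beta>' * u + \<gamma>' * v) + v^2 * quad c' w"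
    using component_tangent_coords[OF c(2) cp(2) w'] by blast
  define m where "m x = 1 + \<alpha> * (Z x - 1) + \<beta> * U x + \<gamma> * V x" for x
  define m' where "m' x = \<kappa> + \<alpha>' * (Z x - 1) + \<beta>' * U x + \<gamma>' * V x" for x
  have ec: "eval_at c x = U x * m x + V x ^ 2 * quad c w" and ec': "eval_at c' x = U x * m' x + V x ^ 2 * quad c' w" for x
    using A[of "Z x" "U x" "V x"] A'[of "Z x" "U x" "V x"] ZUV(1)[of x] 1(2)[of e] 1(3) by (simp_all add: m_def m'_def)
  define d where "d x = quad c' w * m x - quad c w * m' x" for x
  have id: "V x ^ 2 * d x = eval_at c' x * m x - eval_at c x * m' x" for x
    unfolding ec ec' d_def by (simp add: algebra_simps)
  have cm: "continuous_on UNIV m" "continuous_on UNIV m'" "continuous_on UNIV d"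
    unfolding d_def m_def m'_def using ZUV by (intro continuous_intros; simp)+
  have p0: "m p = 1" "m' p = \<kappa>" "d p = quad c' w - \<kappa> * quad c w" using ZUV by (simp_all add: m_def m'_def d_def mult.commute)
  define \<delta> where "\<delta> = norm (d p) / 2"
  have \<delta>: "\<delta> > 0" using 1(6) p0 by (simp add: \<delta>_def)
  obtain \<eta>1 where \<eta>1: "\<eta>1 > 0" "\<And>x. x \<in> ball p \<eta>1 \<Longrightarrow> dist (d x) (d p) < \<delta>" using continuous_near[OF cm(3) \<delta>] by blast
  obtain \<eta>2 where \<eta>2: "\<eta>2 > 0" "\<And>x. x \<in> ball p \<eta>2 \<Longrightarrow> dist (m x) (m p) < 1" using continuous_near[OF cm(1) zero_less_one] by blast
  obtain \<eta>3 where \<eta>3: "\<eta>3 > 0" "\<And>x. x \<in> ball p \<eta>3 \<Longrightarrow> dist (m' x) (m' p) < 1" using continuous_near[OF cm(2) zero_less_one] by blast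
  \<comment> \<open>Near \<open>p\<close> the cofactors \<open>m\<close> and \<open>m'\<close> are
    bounded by 2 and \<open>1 + norm \<kappa>\<close>, and \<open>\<delta>\<close> bounds
    \<open>d\<close> from below.\<close>
  define K where "K = (3 + norm \<kappa>) / \<delta>"
  have K: "K > 0" unfolding K_def using \<delta> by (intro divide_pos_pos add_pos_nonneg) auto
  have "(norm (eval_at \<nu> x))^2 \<le> K * max (norm (eval_at c x)) (norm (eval_at c' x))"
    if x: "x \<in> ball p (min \<eta>1 (min \<eta>2 \<eta>3))" for x
  proof -
    let ?M = "max (norm (eval_at c x)) (norm (eval_at c' x))"
    have n: "norm (d x) \<ge> \<delta>" "norm (m x) \<le> 2" "norm (m' x) \<le> 1 + norm \<kappa>"
      using \<eta>1(2)[of x] \<eta>2(2)[of x] \<eta>3(2)[of x] x norm_triangle_ineq2[of "d p" "d p - d x"] norm_triangle_ineq2[of "m x" "1"] norm_triangle_ineq2[of "m' x" \<kappa>]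
      by (auto simp: dist_norm p0(1,2) norm_minus_commute \<delta>_def)
    have "\<delta> * (norm (V x))^2 \<le> norm (d x) * (norm (V x))^2" using n by (intro mult_right_mono) auto
    also have "\<dots> = norm (eval_at c' x * m x - eval_at c x * m' x)" unfolding id[symmetric] by (simp add: norm_mult norm_power)
    also have "\<dots> \<le> norm (eval_at c' x) * norm (m x) + norm (eval_at c x) * norm (m' x)"
      by (metis norm_mult norm_triangle_ineq4)
    also have "\<dots> \<le> ?M * 2 + ?M * (1 + norm \<kappa>)" using n by (intro add_mono mult_mono) (auto simp: le_max_iff_disj)
    also have "\<dots> = (3 + norm \<kappa>) * ?M" by (simp add: algebra_simps)
    finally show ?thesis using \<delta> unfolding K_def V\<nu> by (simp add: field_simps)
  qed
  thus ?thesis using \<nu>(1) i1 i2 K \<eta>1(1) \<eta>2(1) \<eta>3(1)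
    by (intro exI[of _ \<nu>] exI[of _ K] exI[of _ "min \<eta>1 (min \<eta>2 \<eta>3)"]) auto
qed

text \<open>Where \<open>g \<le> h\<close>, the larger factor has its exponent split: the part 1/2
  is passed to \<open>g\<close>, and the part \<open>2 * s - 1/2\<close> to the transversal line by
  means of the separation \<open>n^2 \<le> K * h\<close>. The exponents become
  \<open>2 * s + 1/2\<close> and \<open>4 * s - 1\<close>. With this split both are below 2 under
  the same condition \<open>s < 3/4\<close>, the log canonical threshold of a tacnode.\<close>

lemma loc_finite_tangent_pair:
  assumes c: "is_component c" "is_component c'" and cp: "eval_at c p = 0" "eval_at c' p = 0"
    and tp: "tangent_pair c c' p" and s: "1/2 \<le> s" "s < 3/4"
  shows "loc_finite (\<lambda>x. pw (2 * s) (norm (eval_at c x)) * pw (2 * s) (norm (eval_at c' x))) p"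
proof -
  obtain \<nu> K \<eta> where 1: "is_line \<nu>" "indep_grad c \<nu> p" "indep_grad c' \<nu> p" "K > 0" "\<eta> > 0"
    and sep: "\<And>x. x \<in> ball p \<eta> \<Longrightarrow> (norm (eval_at \<nu> x))^2 \<le> K * max (norm (eval_at c x)) (norm (eval_at c' x))"
    using tangent_pair_separation[OF c cp tp] by blast
  have c\<nu>: "is_component \<nu>" using 1 by (simp add: is_component_def)
  let ?a = "2 * s + 1/2" and ?b = "4 * s - 1"
  let ?g = "\<lambda>x. norm (eval_at c x)" and ?h = "\<lambda>x. norm (eval_at c' x)" and ?n = "\<lambda>x. norm (eval_at \<nu> x)"
  let ?C = "ennreal ((1/K) powr (-(2 * s - 1/2)))"
  have key: "pw (2 * s) g * pw (2 * s) h \<le> ?C * (pw ?a g * pw ?b n)"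
    if "0 \<le> g" "g \<le> h" "0 \<le> n" "n^2 \<le> K * h" for g h n :: real
  proof -
    have h: "h \<ge> (1/K) * (n * n)" using that 1(4) by (simp add: field_simps power2_eq_square)
    have "pw (2 * s) h = pw (1/2) h * pw (2 * s - 1/2) h" using that by (simp add: pw_add)
    also have "\<dots> \<le> pw (1/2) g * pw (2 * s - 1/2) ((1/K) * (n * n))"
      using that h s 1(4) by (intro mult_mono pw_antimono) auto
    also have "pw (2 * s - 1/2) ((1/K) * (n * n)) = ?C * pw ?b n"
      using that(3) 1(4) by (subst pw_scale) (simp_all add: pw_square algebra_simps)
    finally have "pw (2 * s) g * pw (2 * s) h \<le> pw (2 * s) g * (pw (1/2) g * (?C * pw ?b n))"
      by (rule mult_left_mono) simp
    also have "\<dots> = ?C * ((pw (2 * s) g * pw (1/2) g) * pw ?b n)" by (simp add: mult_ac)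
    finally show ?thesis using that(1) by (simp add: pw_add)
  qed
  have L: "loc_finite (\<lambda>x. pw ?a (?g x) * pw ?b (?n x)) p" "loc_finite (\<lambda>x. pw ?a (?h x) * pw ?b (?n x)) p"
    using s by (intro loc_finite_pair c c\<nu> 1; simp)+
  have "loc_finite (\<lambda>x. pw ?a (?g x) * pw ?b (?n x) + pw ?a (?h x) * pw ?b (?n x)) p"
    by (rule loc_finite_add[OF L]) measurable
  thus ?thesis
  proof (rule loc_finite_mono[where C = ?C and \<eta> = \<eta>])
    show "(\<lambda>x. pw ?a (?g x) * pw ?b (?n x) + pw ?a (?h x) * pw ?b (?n x)) \<in> borel_measurable borel" by measurable
    fix x assume x: "x \<in> ball p \<eta>"
    show "pw (2 * s) (?g x) * pw (2 * s) (?h x) \<le> ?C * (pw ?a (?g x) * pw ?b (?n x) + pw ?a (?h x) * pw ?b (?n x))"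
    proof (cases "?g x \<le> ?h x")
      case True
      hence "pw (2 * s) (?g x) * pw (2 * s) (?h x) \<le> ?C * (pw ?a (?g x) * pw ?b (?n x))"
        using sep[OF x] by (intro key) (auto simp: max_def)
      thus ?thesis by (simp add: distrib_left add_increasing2)
    next
      case False
      hence "pw (2 * s) (?h x) * pw (2 * s) (?g x) \<le> ?C * (pw ?a (?h x) * pw ?b (?n x))"
        using sep[OF x] by (intro key) (auto simp: max_def)
      thus ?thesis by (simp add: distrib_left add_increasing mult.commute)
    qed
  qed (use 1 in auto)
qed

text \<open>A linear relation between \<open>p\<close>, \<open>e0\<close>, \<open>e1\<close> is
  tested with the two differentials. These annihilate \<open>p\<close> by Euler's formula and are
  dual to \<open>e0\<close>, \<open>e1\<close>, so only a multiple of \<open>p\<close> could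
  remain.\<close>

lemma dual_local_frame:
  assumes c: "is_component c" "is_component c'" and cp: "eval_at c p = 0" "eval_at c' p = 0" and p: "p \<noteq> 0"
    and e: "grad c p e0 = 1" "grad c p e1 = 0" "grad c' p e0 = 0" "grad c' p e1 = 1"
  shows "local_frame p e0 e1"
proof -
  let ?M = "vector [p, e0, e1] :: complex^3^3"
  have "x = 0" if "transpose ?M *v x = 0" for x
  proof -
    have z: "x $ 1 *s p + x $ 2 *s e0 + x $ 3 *s e1 = 0"
      using that unfolding transpose_matrix_vector vector_matrix_expand .
    have g0: "grad q p 0 = 0" for q by (simp add: grad_def)
    have "x $ 2 = 0" using arg_cong[OF z, of "grad c p"] component_grad_self[OF c(1) cp(1)] e
      by (simp add: grad_add grad_smult g0)
    moreover have "x $ 3 = 0" using arg_cong[OF z, of "grad c' p"] component_grad_self[OF c(2) cp(2)] e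
      by (simp add: grad_add grad_smult g0)
    ultimately have "x $ 1 *s p = 0" using z by simp
    hence "x $ 1 = 0" using p by (auto simp: vec_eq_iff)
    thus ?thesis using \<open>x $ 2 = 0\<close> \<open>x $ 3 = 0\<close> by (simp add: vec_eq_iff forall_3)
  qed
  hence "invertible (transpose ?M)" using matrix_left_invertible_ker invertible_left_inverse by blast
  thus ?thesis unfolding local_frame_def by (simp add: invertible_det_nz)
qed

section \<open>Bounds for forms that vanish at a singular point\<close>

lemma eval_at_lipschitz: "\<exists>K\<ge>0. \<forall>x\<in>ball p 1. \<forall>y\<in>ball p 1. norm (eval_at g x - eval_at g y) \<le> K * norm (x - y)"
proof -
  define S where "S x = (\<Sum>i\<in>UNIV. norm (eval_at (partial_deriv i g) x))" for x
  have "continuous_on (cball p 1) S" unfolding S_def by (intro continuous_intros continuous_eval_at)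
  hence "bounded (S ` cball p 1)" by (intro compact_imp_bounded compact_continuous_image) auto
  then obtain K0 where K0: "\<And>x. x \<in> cball p 1 \<Longrightarrow> norm (S x) \<le> K0" unfolding bounded_iff by blast
  define K where "K = max K0 0"
  have b: "onorm (\<lambda>h. \<Sum>i\<in>UNIV. eval_at (partial_deriv i g) x * h $ i) \<le> K" if "x \<in> ball p 1" for x
  proof (rule onorm_bound)
    show "0 \<le> K" by (simp add: K_def)
    fix h :: "complex^3"
    have "norm (\<Sum>i\<in>UNIV. eval_at (partial_deriv i g) x * h $ i) \<le> (\<Sum>i\<in>UNIV. norm (eval_at (partial_deriv i g) x) * norm h)"
      by (intro sum_norm_le) (auto simp: norm_mult intro!: mult_left_mono Finite_Cartesian_Product.norm_nth_le)
    also have "\<dots> = S x * norm h" by (simp add: S_def sum_distrib_right)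
    also have "\<dots> \<le> K * norm h" using K0[of x] that by (intro mult_right_mono) (auto simp: K_def)
    finally show "norm (\<Sum>i\<in>UNIV. eval_at (partial_deriv i g) x * h $ i) \<le> K * norm h" .
  qed
  have "norm (eval_at g x - eval_at g y) \<le> K * norm (x - y)" if "x \<in> ball p 1" "y \<in> ball p 1" for x y
    by (rule differentiable_bound[OF convex_ball has_derivative_at_withinI[OF has_derivative_eval_at] b that])
  thus ?thesis by (intro exI[of _ K]) (auto simp: K_def)
qed

text \<open>A form vanishing at \<open>p\<close> vanishes on all multiples of \<open>p\<close>.
  Comparing \<open>x\<close> with the multiple \<open>y x\<close> that has the same radial
  coordinate bounds the form by the transversal coordinates \<open>U x\<close> and
  \<open>V x\<close>, and these are controlled by the values of \<open>c\<close> and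
  \<open>c'\<close>.\<close>

lemma vanishing_bound:
  assumes c: "is_component c" "is_component c'" and cp: "eval_at c p = 0" "eval_at c' p = 0" and p: "p \<noteq> 0"
    and ind: "indep_grad c c' p" and t: "t \<in> graded_part (int \<rho>)" "eval_at t p = 0"
  shows "\<exists>C \<eta>. \<eta> > 0 \<and> C \<ge> 0 \<and> (\<forall>x\<in>ball p \<eta>. norm (eval_at t x) \<le> C * (norm (eval_at c x) + norm (eval_at c' x)))"
proof -
  obtain e0 e1 where e: "grad c p e0 = 1" "grad c p e1 = 0" "grad c' p e0 = 0" "grad c' p e1 = 1"
    using ind unfolding indep_grad_def by blast
  have fr: "local_frame p e0 e1" by (rule dual_local_frame[OF c cp p e])
  obtain Z U V where ZUV: "\<And>x. x = Z x *s p + U x *s e0 + V x *s e1" "continuous_on UNIV Z" "Z p = 1"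
    by (rule local_frame_coords[OF fr]) blast
  define y where "y x = Z x *s p" for x
  have xy: "x - y x = U x *s e0 + V x *s e1" for x using ZUV(1)[of x] unfolding y_def by (metis add.assoc add_diff_cancel_left')
  define L where "L = norm e0 + norm e1 + 1"
  have L: "L > 0" unfolding L_def by (intro add_nonneg_pos add_nonneg_nonneg) auto
  have nxy: "norm (x - y x) \<le> L * (norm (U x) + norm (V x))" for x
  proof -
    have "norm (x - y x) \<le> norm (U x) * norm e0 + norm (V x) * norm e1"
      unfolding xy by (intro norm_triangle_le) (simp add: norm_vector_smult)
    also have "\<dots> \<le> norm (U x) * L + norm (V x) * L" by (intro add_mono mult_left_mono) (auto simp: L_def)
    finally show ?thesis by (simp add: algebra_simps)
  qed
  obtain K where K: "K \<ge> 0" "\<And>x y. x \<in> ball p 1 \<Longrightarrow> y \<in> ball p 1 \<Longrightarrow> norm (eval_at t x - eval_at t y) \<le> K * norm (x - y)"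
    using eval_at_lipschitz[of p t] by blast
  \<comment> \<open>With this accuracy each of the two errors is at most a quarter of
    \<open>norm (U x) + norm (V x)\<close>, so their sum can be absorbed on the left, at the price
    of a factor 2.\<close>
  have \<epsilon>: "1 / (4 * L) > 0" using L by simp
  obtain \<eta>1 where \<eta>1: "\<eta>1 > 0" "\<And>y y'. y \<in> ball p \<eta>1 \<Longrightarrow> y' \<in> ball p \<eta>1 \<Longrightarrow> norm (eval_at c y - eval_at c y' - grad c p (y - y')) \<le> 1/(4*L) * norm (y - y')"
    using component_sdiff[OF c(1), of p] \<epsilon> unfolding sdiff_def by blast
  obtain \<eta>2 where \<eta>2: "\<eta>2 > 0" "\<And>y y'. y \<in> ball p \<eta>2 \<Longrightarrow> y' \<in> ball p \<eta>2 \<Longrightarrow> norm (eval_at c' y - eval_at c' y' - grad c' p (y - y')) \<le> 1/(4*L) * norm (y - y')"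
    using component_sdiff[OF c(2), of p] \<epsilon> unfolding sdiff_def by blast
  define \<eta> where "\<eta> = min 1 (min \<eta>1 \<eta>2)"
  have \<eta>: "\<eta> > 0" using \<eta>1 \<eta>2 by (simp add: \<eta>_def)
  have cy: "continuous_on UNIV y" unfolding y_def vector_scalar_mult_def using ZUV(2) by (intro continuous_intros)
  have yp: "y p = p" using ZUV(3) by (simp add: y_def)
  obtain \<zeta> where \<zeta>: "\<zeta> > 0" "\<And>x. x \<in> ball p \<zeta> \<Longrightarrow> dist (y x) (y p) < \<eta>" using continuous_near[OF cy \<eta>] by blast
  have "norm (eval_at t x) \<le> (2 * K * L) * (norm (eval_at c x) + norm (eval_at c' x))" if x: "x \<in> ball p (min \<eta> \<zeta>)" for x
  proof -
    have xb: "x \<in> ball p \<eta>" and yb: "y x \<in> ball p \<eta>" using x \<zeta>(2)[of x] yp by (auto simp: dist_commute)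
    have z: "eval_at q (y x) = 0" if "q \<in> graded_part (int n)" "eval_at q p = 0" for q n
      unfolding y_def eval_at_smult[OF that(1)] that(2) by simp
    obtain n1 n2 where n: "c \<in> graded_part (int n1)" "c' \<in> graded_part (int n2)" using component_graded c by blast
    let ?S = "norm (U x) + norm (V x)"
    have "norm (eval_at c x - U x) \<le> 1/(4*L) * norm (x - y x)"
      using \<eta>1(2)[of x "y x"] xb yb z[OF n(1) cp(1)] by (simp add: \<eta>_def xy grad_add grad_smult e)
    also have "\<dots> \<le> 1/(4*L) * (L * ?S)" using L by (intro mult_left_mono nxy) auto
    finally have u: "norm (eval_at c x - U x) \<le> ?S / 4" using L by simp
    have "norm (eval_at c' x - V x) \<le> 1/(4*L) * norm (x - y x)"
      using \<eta>2(2)[of x "y x"] xb yb z[OF n(2) cp(2)] by (simp add: \<eta>_def xy grad_add grad_smult e)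
    also have "\<dots> \<le> 1/(4*L) * (L * ?S)" using L by (intro mult_left_mono nxy) auto
    finally have v: "norm (eval_at c' x - V x) \<le> ?S / 4" using L by simp
    have "norm (U x) \<le> norm (eval_at c x) + norm (eval_at c x - U x)" "norm (V x) \<le> norm (eval_at c' x) + norm (eval_at c' x - V x)"
      using norm_triangle_sub[of "U x" "eval_at c x"] norm_triangle_sub[of "V x" "eval_at c' x"] by (simp_all add: norm_minus_commute)
    moreover have "a + b \<le> 2 * (k + k')" if "a \<le> k + q" "b \<le> k' + q'" "q \<le> (a + b) / 4" "q' \<le> (a + b) / 4" for a b k k' q q' :: real
      using that by argo
    ultimately have S: "?S \<le> 2 * (norm (eval_at c x) + norm (eval_at c' x))" using u v by blast
    have "norm (eval_at t x) = norm (eval_at t x - eval_at t (y x))" using z[OF t] by simp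
    also have "\<dots> \<le> K * norm (x - y x)" using K(2)[of x "y x"] xb yb by (simp add: \<eta>_def)
    also have "\<dots> \<le> K * (L * (2 * (norm (eval_at c x) + norm (eval_at c' x))))"
      using K(1) L S by (intro mult_left_mono order_trans[OF nxy]) auto
    finally show ?thesis by (simp add: mult_ac)
  qed
  thus ?thesis using \<eta> \<zeta>(1) K(1) L by (intro exI[of _ "2 * K * L"] exI[of _ "min \<eta> \<zeta>"]) auto
qed

text \<open>The local hypothesis translated from branches to components. It also admits smooth
  points of the curve and points off it, so that it can be assumed at every nonzero vector.\<close>

definition branches_ok :: "nat set \<Rightarrow> (nat \<Rightarrow> poly3) \<Rightarrow> complex^3 \<Rightarrow> bool" where
  "branches_ok I c p \<longleftrightarrow> (let T = {i \<in> I. eval_at (c i) p = 0} in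
     T = {} \<or> (\<exists>i. T = {i}) \<or>
     (\<exists>i j. i \<noteq> j \<and> T = {i, j} \<and> (indep_grad (c i) (c j) p \<or> tangent_pair (c i) (c j) p)) \<or>
     (\<exists>i j k. i \<noteq> j \<and> i \<noteq> k \<and> j \<noteq> k \<and> T = {i, j, k} \<and>
        indep_grad (c i) (c j) p \<and> indep_grad (c i) (c k) p \<and> indep_grad (c j) (c k) p))"

definition triple_point :: "nat set \<Rightarrow> (nat \<Rightarrow> poly3) \<Rightarrow> complex^3 \<Rightarrow> nat \<Rightarrow> nat \<Rightarrow> nat \<Rightarrow> bool" where
  "triple_point I c p i j k \<longleftrightarrow> i \<noteq> j \<and> i \<noteq> k \<and> j \<noteq> k \<and> {i \<in> I. eval_at (c i) p = 0} = {i, j, k} \<and>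
        indep_grad (c i) (c j) p \<and> indep_grad (c i) (c k) p \<and> indep_grad (c j) (c k) p"

text \<open>The weight of the largest factor is shared equally by the two others, since
  \<open>z * z \<ge> x * y\<close>. The exponent \<open>3 * s\<close> is below 2 exactly for
  \<open>s < 2/3\<close>, the log canonical threshold of an ordinary triple point.\<close>

lemma pw_triple_max:
  assumes "0 \<le> x" "0 \<le> y" "x \<le> z" "y \<le> z" "0 \<le> s"
  shows "pw (2 * s) x * pw (2 * s) y * pw (2 * s) z \<le> pw (3 * s) x * pw (3 * s) y"
proof -
  have "pw (2 * s) z = pw s (z * z)" using assms by (simp add: pw_square)
  also have "\<dots> \<le> pw s (x * y)" using assms by (intro pw_antimono mult_mono) auto
  also have "\<dots> = pw s x * pw s y" using assms by (simp add: pw_mult)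
  finally have "pw (2 * s) x * pw (2 * s) y * pw (2 * s) z \<le> pw (2 * s) x * pw (2 * s) y * (pw s x * pw s y)"
    by (rule mult_left_mono) simp
  also have "\<dots> = (pw (2 * s) x * pw s x) * (pw (2 * s) y * pw s y)" by (simp add: mult_ac)
  finally show ?thesis using assms by (simp add: pw_add)
qed

lemma pw_triple:
  assumes "0 \<le> x" "0 \<le> y" "0 \<le> z" "0 \<le> s"
  shows "pw (2 * s) x * pw (2 * s) y * pw (2 * s) z \<le>
     pw (3 * s) x * pw (3 * s) y + pw (3 * s) x * pw (3 * s) z + pw (3 * s) y * pw (3 * s) z"
proof -
  consider "x \<le> z" "y \<le> z" | "x \<le> y" "z \<le> y" | "y \<le> x" "z \<le> x" by linarith
  thus ?thesis
  proof cases
    case 1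
    have "pw (2 * s) x * pw (2 * s) y * pw (2 * s) z \<le> pw (3 * s) x * pw (3 * s) y" by (rule pw_triple_max) (use assms 1 in auto)
    thus ?thesis by (simp add: add_increasing2 add.assoc)
  next
    case 2
    have "pw (2 * s) x * pw (2 * s) z * pw (2 * s) y \<le> pw (3 * s) x * pw (3 * s) z" by (rule pw_triple_max) (use assms 2 in auto)
    thus ?thesis by (simp add: add_increasing2 add_increasing mult_ac add.assoc)
  next
    case 3
    have "pw (2 * s) y * pw (2 * s) z * pw (2 * s) x \<le> pw (3 * s) y * pw (3 * s) z" by (rule pw_triple_max) (use assms 3 in auto)
    thus ?thesis by (simp add: add_increasing2 add_increasing mult_ac add.assoc)
  qed
qed

text \<open>The bound on \<open>b\<close> in terms of the two smaller values provides a factor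
  \<open>y^2\<close>, and \<open>z\<close> may be replaced by \<open>y\<close>. What remains of the
  exponent of \<open>y\<close> is \<open>4 * s - 2\<close>, which is below 1 for
  \<open>s < 3/4\<close>.\<close>

lemma pw_triple_vanishing_sorted:
  assumes "0 \<le> x" "x \<le> y" "y \<le> z" "0 \<le> s" and b: "b \<le> (C * (x + y))^2" "0 \<le> C"
  shows "ennreal b * (pw (2 * s) x * pw (2 * s) y * pw (2 * s) z) \<le> ennreal (4 * C^2) * (pw (2 * s) x * pw (4 * s - 2) y)"
proof -
  have "(C * (x + y))^2 \<le> (C * (2 * y))^2" using assms by (intro power_mono mult_left_mono) auto
  hence "ennreal b \<le> ennreal (4 * C^2 * y^2)" using b by (intro ennreal_leI) (simp add: power_mult_distrib)
  also have "\<dots> = ennreal (4 * C^2) * ennreal (y^2)" by (simp add: ennreal_mult)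
  finally have "ennreal b * (pw (2 * s) x * pw (2 * s) y * pw (2 * s) z) \<le> (ennreal (4 * C^2) * ennreal (y^2)) * (pw (2 * s) x * pw (2 * s) y * pw (2 * s) y)"
    using assms by (intro mult_mono mult_left_mono pw_antimono) auto
  also have "\<dots> = ennreal (4 * C^2) * (pw (2 * s) x * (ennreal (y^2) * (pw (2 * s) y * pw (2 * s) y)))" by (simp add: mult_ac)
  also have "\<dots> \<le> ennreal (4 * C^2) * (pw (2 * s) x * pw (4 * s - 2) y)"
    using power2_mult_pw[of y "4 * s"] assms by (intro mult_left_mono) (auto simp: pw_add)
  finally show ?thesis .
qed

lemma pw_triple_vanishing:
  assumes nn: "0 \<le> x" "0 \<le> y" "0 \<le> z" "0 \<le> s" "0 \<le> C"
    and b: "b \<le> (C * (x + y))^2" "b \<le> (C * (x + z))^2" "b \<le> (C * (y + z))^2"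
  defines "P \<equiv> \<lambda>x y. pw (2 * s) x * pw (4 * s - 2) y"
  shows "ennreal b * (pw (2 * s) x * pw (2 * s) y * pw (2 * s) z) \<le>
     ennreal (4 * C^2) * (P x y + P y x + P x z + P z x + P y z + P z y)"
proof -
  let ?R = "P x y + P y x + P x z + P z x + P y z + P z y"
  note S = pw_triple_vanishing_sorted[where s = s and C = C and b = b]
  have "\<exists>u v. ennreal b * (pw (2 * s) x * pw (2 * s) y * pw (2 * s) z) \<le> ennreal (4 * C^2) * P u v \<and> P u v \<le> ?R"
  proof -
    consider "x \<le> y" "y \<le> z" | "x \<le> z" "z \<le> y" | "y \<le> x" "x \<le> z" | "y \<le> z" "z \<le> x" | "z \<le> x" "x \<le> y" | "z \<le> y" "y \<le> x" by linarith
    thus ?thesis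
    proof cases
      case 1 show ?thesis using S[of x y z] nn b 1 unfolding P_def
        by (intro exI[of _ x] exI[of _ y]) (simp add: add_increasing2 add_increasing mult_ac add.assoc)
    next
      case 2 show ?thesis using S[of x z y] nn b 2 unfolding P_def
        by (intro exI[of _ x] exI[of _ z]) (simp add: add_increasing2 add_increasing mult_ac add_ac)
    next
      case 3 show ?thesis using S[of y x z] nn b 3 unfolding P_def
        by (intro exI[of _ y] exI[of _ x]) (simp add: add_increasing2 add_increasing mult_ac add_ac)
    next
      case 4 show ?thesis using S[of y z x] nn b 4 unfolding P_def
        by (intro exI[of _ y] exI[of _ z]) (simp add: add_increasing2 add_increasing mult_ac add_ac)
    next
      case 5 show ?thesis using S[of z x y] nn b 5 unfolding P_def
        by (intro exI[of _ z] exI[of _ x]) (simp add: add_increasing2 add_increasing mult_ac add_ac)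
    next
      case 6 show ?thesis using S[of z y x] nn b 6 unfolding P_def
        by (intro exI[of _ z] exI[of _ y]) (simp add: add_increasing2 add_increasing mult_ac add_ac)
    qed
  qed
  thus ?thesis by (meson mult_left_mono order_trans zero_le)
qed

text \<open>Near \<open>p\<close> the components that miss it are bounded away from 0 and enter only
  through a constant. The numerator \<open>B\<close> is replaced by its bound \<open>M\<close>
  throughout, except at a triple point with \<open>s \<ge> 2/3\<close>, where its quadratic
  vanishing compensates for the weight.\<close>

lemma loc_finite_product:
  fixes I :: "nat set" and B :: "complex^3 \<Rightarrow> real"
  assumes I: "finite I" and c: "\<And>i. i \<in> I \<Longrightarrow> is_component (c i)" and p: "p \<noteq> 0"
    and ok: "branches_ok I c p" and s: "1/2 \<le> s" "s < 3/4"
    and B: "\<zeta> > 0" "\<And>x. x \<in> ball p \<zeta> \<Longrightarrow> B x \<le> M" "0 \<le> M"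
    and tri: "\<And>i j k. triple_point I c p i j k \<Longrightarrow> s < 2/3 \<or> (\<exists>C\<ge>0. \<exists>\<eta>>0. \<forall>x\<in>ball p \<eta>. \<forall>a\<in>{i,j,k}. \<forall>b\<in>{i,j,k}. a \<noteq> b \<longrightarrow>
       B x \<le> (C * (norm (eval_at (c a) x) + norm (eval_at (c b) x)))^2)"
  shows "loc_finite (\<lambda>x. ennreal (B x) * pw (2 * s) (norm (eval_at (\<Prod>i\<in>I. c i) x))) p"
proof -
  define T where "T = {i \<in> I. eval_at (c i) p = 0}"
  have T: "finite T" "T \<subseteq> I" using I by (auto simp: T_def)
  define U where "U x = (\<Prod>i\<in>I - T. eval_at (c i) x)" for x
  let ?g = "\<lambda>i x. norm (eval_at (c i) x)"
  have cU: "continuous_on UNIV U" unfolding U_def by (intro continuous_intros continuous_eval_at)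
  have Up: "U p \<noteq> 0" using I by (auto simp: U_def T_def)
  define \<delta> where "\<delta> = norm (U p) / 2"
  have \<delta>: "\<delta> > 0" using Up by (simp add: \<delta>_def)
  obtain \<eta>0 where \<eta>0: "\<eta>0 > 0" "\<And>x. x \<in> ball p \<eta>0 \<Longrightarrow> dist (U x) (U p) < \<delta>" using continuous_near[OF cU \<delta>] by blast
  have Ud: "norm (U x) \<ge> \<delta>" if "x \<in> ball p \<eta>0" for x
    using \<eta>0(2)[OF that] norm_triangle_ineq2[of "U p" "U p - U x"] by (simp add: dist_norm norm_minus_commute \<delta>_def)
  have fU: "pw (2 * s) (norm (eval_at (\<Prod>i\<in>I. c i) x)) \<le> pw (2 * s) \<delta> * (\<Prod>i\<in>T. pw (2 * s) (?g i x))" if "x \<in> ball p \<eta>0" for x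
  proof -
    have "eval_at (\<Prod>i\<in>I. c i) x = U x * (\<Prod>i\<in>T. eval_at (c i) x)"
      unfolding U_def using prod.subset_diff[OF T(2) I] by simp
    hence "norm (eval_at (\<Prod>i\<in>I. c i) x) = norm (U x) * (\<Prod>i\<in>T. ?g i x)" by (simp add: norm_mult prod_norm)
    hence "pw (2 * s) (norm (eval_at (\<Prod>i\<in>I. c i) x)) = pw (2 * s) (norm (U x)) * (\<Prod>i\<in>T. pw (2 * s) (?g i x))"
      using T by (simp add: pw_mult pw_prod prod_nonneg)
    also have "\<dots> \<le> pw (2 * s) \<delta> * (\<Prod>i\<in>T. pw (2 * s) (?g i x))"
      using s \<delta> Ud[OF that] by (intro mult_right_mono pw_antimono) auto
    finally show ?thesis .
  qed
  have \<delta>fin: "pw (2 * s) \<delta> < \<infinity>" using \<delta> by (simp add: pw_def)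
  have key: ?thesis
    if G: "loc_finite G p" "G \<in> borel_measurable borel" and \<eta>: "\<eta> > 0"
      and le: "\<And>x. x \<in> ball p \<eta> \<Longrightarrow> ennreal (B x) * (\<Prod>i\<in>T. pw (2 * s) (?g i x)) \<le> ennreal C * G x" for G \<eta> C
  proof (rule loc_finite_mono[OF G, of "pw (2 * s) \<delta> * ennreal C" "min \<eta> \<eta>0"])
    show "pw (2 * s) \<delta> * ennreal C < \<infinity>" using \<delta>fin by (simp add: ennreal_mult_less_top)
    show "min \<eta> \<eta>0 > 0" using \<eta> \<eta>0 by simp
    fix x assume x: "x \<in> ball p (min \<eta> \<eta>0)"
    have "ennreal (B x) * pw (2 * s) (norm (eval_at (\<Prod>i\<in>I. c i) x)) \<le> ennreal (B x) * (pw (2 * s) \<delta> * (\<Prod>i\<in>T. pw (2 * s) (?g i x)))"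
      using x by (intro mult_left_mono fU) auto
    also have "\<dots> = pw (2 * s) \<delta> * (ennreal (B x) * (\<Prod>i\<in>T. pw (2 * s) (?g i x)))" by (simp add: mult_ac)
    also have "\<dots> \<le> pw (2 * s) \<delta> * (ennreal C * G x)" using x by (intro mult_left_mono le) auto
    finally show "ennreal (B x) * pw (2 * s) (norm (eval_at (\<Prod>i\<in>I. c i) x)) \<le> pw (2 * s) \<delta> * ennreal C * G x" by (simp add: mult_ac)
  qed
  have key1: ?thesis
    if G: "loc_finite G p" "G \<in> borel_measurable borel"
      and le: "\<And>x. (\<Prod>i\<in>T. pw (2 * s) (?g i x)) \<le> G x" for G
  proof (rule key[OF G B(1), of M])
    fix x assume "x \<in> ball p \<zeta>"
    thus "ennreal (B x) * (\<Prod>i\<in>T. pw (2 * s) (?g i x)) \<le> ennreal M * G x"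
      using B(2)[of x] by (intro mult_mono ennreal_leI le) auto
  qed
  have cp: "is_component (c i)" "eval_at (c i) p = 0" if "i \<in> T" for i using that c by (auto simp: T_def)
  have "T = {} \<or> (\<exists>i. T = {i}) \<or> (\<exists>i j. i \<noteq> j \<and> T = {i, j} \<and> (indep_grad (c i) (c j) p \<or> tangent_pair (c i) (c j) p)) \<or>
     (\<exists>i j k. triple_point I c p i j k)"
    using ok unfolding branches_ok_def Let_def T_def triple_point_def .
  thus ?thesis
  proof (elim disjE exE conjE)
    assume 0: "T = {}"
    show ?thesis by (rule key1[of "\<lambda>x. 1"]) (use 0 in \<open>auto intro: loc_finite_const\<close>)
  next
    fix i assume 1: "T = {i}"
    show ?thesis
    proof (rule key1)
      show "loc_finite (\<lambda>x. pw (2 * s) (?g i x)) p" using cp[of i] 1 s p by (intro loc_finite_one) auto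
    qed (use 1 in auto)
  next
    fix i j assume 2: "i \<noteq> j" "T = {i, j}" "indep_grad (c i) (c j) p"
    show ?thesis
    proof (rule key1)
      show "loc_finite (\<lambda>x. pw (2 * s) (?g i x) * pw (2 * s) (?g j x)) p" using cp[of i] cp[of j] 2 s by (intro loc_finite_pair) auto
    qed (use 2 in auto)
  next
    fix i j assume t: "i \<noteq> j" "T = {i, j}" "tangent_pair (c i) (c j) p"
    show ?thesis
    proof (rule key1)
      show "loc_finite (\<lambda>x. pw (2 * s) (?g i x) * pw (2 * s) (?g j x)) p" using cp[of i] cp[of j] t s by (intro loc_finite_tangent_pair) auto
    qed (use t in auto)
  next
    fix i j k assume 3: "triple_point I c p i j k"
    hence ijk: "i \<noteq> j" "i \<noteq> k" "j \<noteq> k" "T = {i, j, k}" "indep_grad (c i) (c j) p" "indep_grad (c i) (c k) p" "indep_grad (c j) (c k) p"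
      by (auto simp: triple_point_def T_def)
    have sym: "indep_grad c2 c1 p" if "indep_grad c1 c2 p" for c1 c2 using that unfolding indep_grad_def by blast
    have prod: "(\<Prod>i\<in>T. pw (2 * s) (?g i x)) = pw (2 * s) (?g i x) * pw (2 * s) (?g j x) * pw (2 * s) (?g k x)" for x
      using ijk by (simp add: mult.assoc)
    have L: "loc_finite (\<lambda>x. pw a (?g u x) * pw b (?g v x)) p" if "u \<in> {i,j,k}" "v \<in> {i,j,k}" "u \<noteq> v" "0 \<le> a" "a < 2" "0 \<le> b" "b < 2" for a b u v
      using that ijk cp sym by (intro loc_finite_pair) auto
    show ?thesis
    proof (cases "s < 2/3")
      case True
      let ?P = "\<lambda>u v x. pw (3 * s) (?g u x) * pw (3 * s) (?g v x)"
      show ?thesis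
      proof (rule key1)
        show "loc_finite (\<lambda>x. ?P i j x + ?P i k x + ?P j k x) p"
          using True s ijk by (intro loc_finite_add L) auto
        show "(\<lambda>x. ?P i j x + ?P i k x + ?P j k x) \<in> borel_measurable borel" by measurable
        show "(\<Prod>i\<in>T. pw (2 * s) (?g i x)) \<le> ?P i j x + ?P i k x + ?P j k x" for x
          unfolding prod using s by (intro pw_triple) auto
      qed
    next
      case False
      then obtain C \<eta> where C: "C \<ge> 0" "\<eta> > 0" "\<And>x a b. x \<in> ball p \<eta> \<Longrightarrow> a \<in> {i,j,k} \<Longrightarrow> b \<in> {i,j,k} \<Longrightarrow> a \<noteq> b \<Longrightarrow>
         B x \<le> (C * (?g a x + ?g b x))^2" using tri[OF 3] by blast
      let ?P = "\<lambda>u v x. pw (2 * s) (?g u x) * pw (4 * s - 2) (?g v x)"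
      let ?G = "\<lambda>x. ?P i j x + ?P j i x + ?P i k x + ?P k i x + ?P j k x + ?P k j x"
      show ?thesis
      proof (rule key)
        show "loc_finite ?G p" using s ijk by (intro loc_finite_add L) auto
        show "?G \<in> borel_measurable borel" by measurable
        show "\<eta> > 0" by fact
        fix x assume "x \<in> ball p \<eta>"
        thus "ennreal (B x) * (\<Prod>i\<in>T. pw (2 * s) (?g i x)) \<le> ennreal (4 * C^2) * ?G x"
          unfolding prod using C ijk s by (intro pw_triple_vanishing) auto
      qed
    qed
  qed
qed

section \<open>Vanishing at the triple points\<close>

lemma grad_mult: "grad (f * g) p y = grad f p y * eval_at g p + eval_at f p * grad g p y"
  unfolding grad_def eval_partial_deriv_mult
  by (simp add: sum_distrib_left sum_distrib_right sum.distrib algebra_simps)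

lemma grad_poly_sum: "grad (sum F A) p y = (\<Sum>a\<in>A. grad (F a) p y)"
proof (induction A rule: infinite_finite_induct)
  case (insert a A)
  thus ?case by (simp add: grad_def distrib_right sum.distrib)
qed (simp_all add: grad_def)

lemma grad_Var: "grad (Var i) p y = y $ i"
  by (simp add: grad_def if_distrib[of "\<lambda>c. c * _"] cong: if_cong)

lemma grad_Const: "grad (Const k) p y = 0"
  by (simp add: grad_def)

lemma quad_smult: "is_component c \<Longrightarrow> quad c (t *s y) = t^2 * quad c y"
proof -
  assume c: "is_component c"
  obtain L M where LM: "\<forall>i j. M i j = M j i" "c = qpoly L M" using component_rep[OF c] by (elim exE conjE) (rule that; assumption)
  show ?thesis unfolding LM(2) quad_qpoly[OF LM(1)[rule_format]]
    by (simp add: sum_distrib_left power2_eq_square mult_ac)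
qed

lemma eval_line_derivative: "((\<lambda>t. eval_at q (p + t *s y)) has_field_derivative grad q p y) (at 0)"
proof -
  have bl: "bounded_linear (\<lambda>t. t *s y)"
    by (rule bounded_linear_intro[of _ "norm y"]) (simp_all add: vec_eq_iff distrib_right norm_vector_smult)
  have "((\<lambda>t. p + t *s y) has_derivative (\<lambda>t. t *s y)) (at 0)"
    using has_derivative_add[OF has_derivative_const bounded_linear_imp_has_derivative[OF bl], of p "at 0"] by simp
  from has_derivative_compose[OF this, of "eval_at q" "\<lambda>h. \<Sum>i\<in>UNIV. eval_at (partial_deriv i q) p * h $ i"] has_derivative_eval_at[of q p]
  have "((\<lambda>t. eval_at q (p + t *s y)) has_derivative (\<lambda>t. \<Sum>i\<in>UNIV. eval_at (partial_deriv i q) p * (t *s y) $ i)) (at 0)" by simp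
  moreover have "(\<lambda>t. \<Sum>i\<in>UNIV. eval_at (partial_deriv i q) p * (t *s y) $ i) = (\<lambda>t. grad q p y * t)"
    by (simp add: grad_def sum_distrib_right sum_distrib_left mult_ac fun_eq_iff)
  ultimately show ?thesis unfolding has_field_derivative_def by simp
qed

text \<open>Euler's formula differentiated in the direction \<open>y\<close>.\<close>

lemma grad_euler:
  assumes "c \<in> graded_part (int n)"
  shows "(\<Sum>i\<in>UNIV. p $ i * grad (partial_deriv i c) p y) = (of_nat n - 1) * grad c p y"
proof -
  have "grad (\<Sum>i\<in>UNIV. Var i * partial_deriv i c) p y = grad (Const (of_nat n) * c) p y"
    unfolding euler_formula[OF assms] ..
  hence "(\<Sum>i\<in>UNIV. y $ i * eval_at (partial_deriv i c) p) + (\<Sum>i\<in>UNIV. p $ i * grad (partial_deriv i c) p y) = of_nat n * grad c p y"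
    by (simp add: grad_poly_sum grad_mult grad_Var grad_Const sum.distrib)
  moreover have "(\<Sum>i\<in>UNIV. y $ i * eval_at (partial_deriv i c) p) = grad c p y" by (simp add: grad_def mult.commute)
  ultimately show ?thesis by (simp add: algebra_simps)
qed

text \<open>
  At an ordinary triple point, the linear part of a logarithmic field \<open>\<theta>\<close> preserves three tangent
  directions, hence is a scalar modulo the radial direction; \<open>\<theta>(f) = 0\<close> ties this scalar to the
  radial component \<open>\<kappa>\<close> of \<open>\<theta>(p)\<close>, and the vanishing trace forces \<open>\<kappa> = 0\<close>.
\<close>

lemma triple_point_vanishing:
  fixes I :: "nat set" and \<theta> :: "3 \<Rightarrow> poly3" and n :: "nat \<Rightarrow> nat"
  assumes I: "finite I" and c: "\<And>i. i \<in> I \<Longrightarrow> is_component (c i)" and n: "\<And>i. i \<in> I \<Longrightarrow> c i \<in> graded_part (int (n i))"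
    and m: "m = (\<Sum>i\<in>I. n i)" and p: "p \<noteq> 0" and tp: "triple_point I c p i j k"
    and \<theta>: "\<And>l. \<theta> l \<in> graded_part (int r)" and syz: "(\<Sum>l\<in>UNIV. \<theta> l * partial_deriv l (\<Prod>i\<in>I. c i)) = 0"
    and div: "(\<Sum>l\<in>UNIV. partial_deriv l (\<theta> l)) = 0" and rm: "3 * (r + 2) \<noteq> 2 * m"
  shows "eval_at (\<theta> l) p = 0"
proof -
  have ijk: "i \<noteq> j" "i \<noteq> k" "j \<noteq> k" and T: "{i \<in> I. eval_at (c i) p = 0} = {i, j, k}"
    and ind: "indep_grad (c i) (c j) p" "indep_grad (c i) (c k) p" "indep_grad (c j) (c k) p"
    using tp unfolding triple_point_def by blast+
  have inI: "i \<in> I" "j \<in> I" "k \<in> I" and cp: "eval_at (c i) p = 0" "eval_at (c j) p = 0" "eval_at (c k) p = 0"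
    using T by blast+
  define u where "u = (\<Prod>i\<in>I - {i,j,k}. c i)"
  define N where "N = (\<Sum>i\<in>I - {i,j,k}. n i)"
  have up: "eval_at u p \<noteq> 0" unfolding u_def using I T by auto
  have ugr: "u \<in> graded_part (int N)" unfolding u_def N_def of_nat_sum by (intro graded_part_prod n) auto
  have sub: "{i,j,k} \<subseteq> I" using inI by simp
  have mN: "m = N + (n i + n j + n k)" unfolding m N_def using sum.subset_diff[OF sub I, of n] ijk by simp
  have f: "(\<Prod>i\<in>I. c i) = c i * c j * c k * u"
    unfolding u_def using prod.subset_diff[OF sub I, of c] ijk by (simp add: mult_ac)
  define D where "D q = (\<Sum>l\<in>UNIV. \<theta> l * partial_deriv l q)" for q
  have evD: "eval_at (D q) x = grad q x (\<chi> l. eval_at (\<theta> l) x)" for q x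
    by (simp add: D_def grad_def mult.commute)
  have Dm: "eval_at (D (q * q')) x = eval_at (D q) x * eval_at q' x + eval_at q x * eval_at (D q') x" for q q' x
    unfolding evD grad_mult ..
  have D0: "eval_at (D (c i * c j * c k * u)) x = 0" for x
    using arg_cong[OF syz, of "\<lambda>q. eval_at q x"] unfolding D_def f by simp
  let ?g = "\<lambda>l y. grad (c l) p y"
  \<comment> \<open>The equation of a component through \<open>p\<close> on the line
    \<open>p + t *s y\<close>, divided by \<open>t\<close>; the quotient is affine in
    \<open>t\<close> because the degree is at most two.\<close>
  define C where "C l y t = ?g l y + t * quad (c l) y" for l y t
  have ce: "eval_at (c l) (p + t *s y) = t * C l y t" if "l \<in> {i,j,k}" for l y t
    using component_taylor[OF c, of l p "t *s y"] that cp inI quad_smult[OF c, of l t y]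
    by (auto simp: grad_smult C_def algebra_simps power2_eq_square)
  \<comment> \<open>The value of \<open>D f\<close> on this line, expanded by the product rule and
    divided by \<open>t^2\<close>. It vanishes for nonzero \<open>t\<close>, hence also at 0
    together with its derivative; these two coefficients yield \<open>first\<close> and
    \<open>second\<close>.\<close>
  define S where "S y t = (let E = (\<lambda>q. eval_at q (p + t *s y)) in
     E (D (c i)) * (C j y t * C k y t * E u) + E (D (c j)) * (C i y t * C k y t * E u) + E (D (c k)) * (C i y t * C j y t * E u)
     + t * (C i y t * C j y t * C k y t * E (D u)))" for y t
  have S0: "t^2 * S y t = 0" for y t
  proof -
    have "eval_at (D (c i * c j * c k * u)) (p + t *s y) = t^2 * S y t"
      unfolding Dm S_def Let_def by (simp add: ce algebra_simps power2_eq_square)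
    thus ?thesis using D0 by simp
  qed
  have dE: "((\<lambda>t. eval_at q (p + t *s y)) has_field_derivative grad q p y) (at 0)" for q y
    by (rule eval_line_derivative)
  have dC: "((\<lambda>t. C l y t) has_field_derivative quad (c l) y) (at 0)" for l y
    unfolding C_def by (auto intro!: derivative_eq_intros)
  define S' where "S' y = grad (D (c i)) p y * (?g j y * ?g k y * eval_at u p) + grad (D (c j)) p y * (?g i y * ?g k y * eval_at u p)
     + grad (D (c k)) p y * (?g i y * ?g j y * eval_at u p) + ?g i y * ?g j y * ?g k y * eval_at (D u) p" for y
  have E0: "eval_at q (p + 0 *s y) = eval_at q p" for q y by simp
  have C0: "C l y 0 = ?g l y" for l y by (simp add: C_def)
  \<comment> \<open>The terms with \<open>R\<close> carry the factors
    \<open>eval_at (D (c l)) p\<close>, which \<open>first\<close> will show to be 0; only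
    \<open>S'\<close> survives.\<close>
  obtain R where dS: "\<And>y. (S y has_field_derivative (S' y + eval_at (D (c i)) p * R i y + eval_at (D (c j)) p * R j y + eval_at (D (c k)) p * R k y)) (at 0)"
  proof -
    define Q where "Q a b y = (quad (c a) y * ?g b y + quad (c b) y * ?g a y) * eval_at u p + grad u p y * (?g a y * ?g b y)" for a b y
    have prod3: "((\<lambda>t. eval_at q (p + t *s y) * (C a y t * C b y t * eval_at u (p + t *s y))) has_field_derivative
        (grad q p y * (?g a y * ?g b y * eval_at u p) + eval_at q p * Q a b y)) (at 0)" for q a b y
      using DERIV_mult[OF dE[of q y] DERIV_mult[OF DERIV_mult[OF dC[of a y] dC[of b y]] dE[of u y]]]
      by (simp add: C0 Q_def algebra_simps)
    have tt: "((\<lambda>t. t * W t) has_field_derivative W 0) (at 0)" if "(W has_field_derivative w) (at 0)" for W w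
      using DERIV_mult[OF DERIV_ident that] by simp
    have "(S y has_field_derivative (S' y + eval_at (D (c i)) p * Q j k y + eval_at (D (c j)) p * Q i k y + eval_at (D (c k)) p * Q i j y)) (at 0)" for y
    proof -
      note W = DERIV_mult[OF DERIV_mult[OF DERIV_mult[OF dC[of i y] dC[of j y]] dC[of k y]] dE[of "D u" y]]
      show ?thesis
        using DERIV_add[OF DERIV_add[OF DERIV_add[OF prod3[of "D (c i)" y j k] prod3[of "D (c j)" y i k]] prod3[of "D (c k)" y i j]] tt[OF W]]
        unfolding S_def[abs_def] Let_def S'_def by (simp add: C0 algebra_simps)
    qed
    thus ?thesis using ijk by (intro that[of "\<lambda>l. if l = i then Q j k else if l = j then Q i k else Q i j"]) auto
  qed
  have Sz: "S y t = 0" for y t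
  proof (cases "t = 0")
    case False thus ?thesis using S0[of t y] by simp
  next
    case True
    have "isCont (S y) 0" using DERIV_isCont[OF dS] .
    hence "(S y \<longlongrightarrow> S y 0) (at 0)" by (simp add: isCont_def)
    moreover have "(S y \<longlongrightarrow> 0) (at 0)"
    proof (rule tendsto_eventually)
      have "S y t = 0" if "t \<noteq> 0" for t using S0[of t y] that by simp
      thus "\<forall>\<^sub>F t in at 0. S y t = 0" by (simp add: eventually_at_filter)
    qed
    ultimately show ?thesis using True tendsto_unique[of "at (0::complex)" "S y"] by auto
  qed
  have first: "eval_at (D (c i)) p * (?g j y * ?g k y) + eval_at (D (c j)) p * (?g i y * ?g k y) + eval_at (D (c k)) p * (?g i y * ?g j y) = 0" for y
  proof -
    have "(eval_at (D (c i)) p * (?g j y * ?g k y) + eval_at (D (c j)) p * (?g i y * ?g k y) + eval_at (D (c k)) p * (?g i y * ?g j y)) * eval_at u p = S y 0"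
      unfolding S_def Let_def E0 C0 by (simp add: algebra_simps)
    thus ?thesis using Sz[of y 0] up by simp
  qed
  obtain e0 e1 where e: "?g i e0 = 1" "?g i e1 = 0" "?g j e0 = 0" "?g j e1 = 1"
    using ind(1) unfolding indep_grad_def by blast
  have fr: "local_frame p e0 e1" by (rule dual_local_frame[OF c[OF inI(1)] c[OF inI(2)] cp(1,2) p e])
  have gp: "?g i p = 0" "?g j p = 0" "?g k p = 0" using component_grad_self c inI cp by blast+
  obtain Z U V where ZUV: "\<And>x. x = Z x *s p + U x *s e0 + V x *s e1" by (rule local_frame_coords[OF fr]) blast
  have U: "U x = ?g i x" and V: "V x = ?g j x" for x
    using arg_cong[OF ZUV[of x], of "?g i"] arg_cong[OF ZUV[of x], of "?g j"] by (simp_all add: grad_add grad_smult e gp)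
  define \<alpha> where "\<alpha> = ?g k e0"
  define \<beta> where "\<beta> = ?g k e1"
  have gk: "?g k x = \<alpha> * ?g i x + \<beta> * ?g j x" for x
    using arg_cong[OF ZUV[of x], of "?g k"] by (simp add: grad_add grad_smult gp U V \<alpha>_def \<beta>_def mult.commute)
  have \<alpha>: "\<alpha> \<noteq> 0"
  proof
    assume "\<alpha> = 0"
    obtain f0 f1 where "?g j f0 = 1" "?g j f1 = 0" "?g k f0 = 0" "?g k f1 = 1" using ind(3) unfolding indep_grad_def by blast
    thus False using gk[of f1] \<open>\<alpha> = 0\<close> by simp
  qed
  have \<beta>: "\<beta> \<noteq> 0"
  proof
    assume "\<beta> = 0"
    obtain f0 f1 where "?g i f0 = 1" "?g i f1 = 0" "?g k f0 = 0" "?g k f1 = 1" using ind(2) unfolding indep_grad_def by blast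
    thus False using gk[of f1] \<open>\<beta> = 0\<close> by simp
  qed
  \<comment> \<open>The vectors \<open>e1\<close>, \<open>e0\<close> and \<open>?y\<close> are
    tangent to the components \<open>i\<close>, \<open>j\<close>, \<open>k\<close> respectively, so
    each of them isolates one summand of \<open>first\<close>.\<close>
  let ?y = "\<beta> *s e0 + (- \<alpha>) *s e1"
  have gy: "?g i ?y = \<beta>" "?g j ?y = - \<alpha>" unfolding grad_add grad_smult by (simp_all add: e)
  have gky: "?g k ?y = 0" unfolding gk gy by simp
  have Dz: "eval_at (D (c i)) p = 0" "eval_at (D (c j)) p = 0" "eval_at (D (c k)) p = 0"
    using first[of e1] first[of e0] first[of ?y] \<alpha> \<beta> unfolding gky gy by (simp_all add: e gk)
  define \<Theta> where "\<Theta> = (\<chi> l. eval_at (\<theta> l) p)"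
  define \<kappa> where "\<kappa> = Z \<Theta>"
  have \<Theta>: "\<Theta> = \<kappa> *s p"
    using ZUV[of \<Theta>] Dz unfolding evD \<Theta>_def[symmetric] U V \<kappa>_def by simp
  have \<theta>p: "eval_at (\<theta> l) p = \<kappa> * p $ l" for l using arg_cong[OF \<Theta>, of "\<lambda>x. x $ l"] by (simp add: \<Theta>_def)
  define A where "A y = (\<chi> l. grad (\<theta> l) p y)" for y
  have gD: "grad (D q) p y = grad q p (A y) + \<kappa> * (of_nat nq - 1) * grad q p y" if "q \<in> graded_part (int nq)" for q nq y
  proof -
    have "grad (D q) p y = (\<Sum>l\<in>UNIV. grad (\<theta> l) p y * eval_at (partial_deriv l q) p) + \<kappa> * (\<Sum>l\<in>UNIV. p $ l * grad (partial_deriv l q) p y)"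
      unfolding D_def grad_poly_sum grad_mult \<theta>p by (simp add: sum.distrib sum_distrib_left mult.assoc)
    also have "(\<Sum>l\<in>UNIV. grad (\<theta> l) p y * eval_at (partial_deriv l q) p) = grad q p (A y)"
      unfolding A_def grad_def[of q] by (simp add: mult.commute)
    finally show ?thesis unfolding grad_euler[OF that] by simp
  qed
  have Du: "eval_at (D u) p = \<kappa> * of_nat N * eval_at u p"
  proof -
    have "eval_at (D u) p = grad u p (\<kappa> *s p)" unfolding evD \<Theta>_def[symmetric] \<Theta> ..
    also have "\<dots> = \<kappa> * grad u p p" by (rule grad_smult)
    also have "grad u p p = of_nat N * eval_at u p" using eval_euler[OF ugr, of p] by (simp add: grad_def mult.commute)
    finally show ?thesis by simp
  qed
  have S'0: "S' y = 0" for y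
  proof -
    have "S y = (\<lambda>t. 0)" by (rule ext) (rule Sz)
    hence "((\<lambda>t. 0) has_field_derivative S' y) (at 0)" using dS[of y] unfolding Dz by simp
    thus ?thesis using DERIV_unique[OF _ DERIV_const] by blast
  qed
  \<comment> \<open>The constant \<open>m - 3\<close> adds up from the degrees: each of the three
    components contributes its degree minus 1 by \<open>grad_euler\<close>, and the remaining factor
    \<open>u\<close> contributes its full degree \<open>N\<close>.\<close>
  have second: "?g i (A y) * (?g j y * ?g k y) + ?g j (A y) * (?g i y * ?g k y) + ?g k (A y) * (?g i y * ?g j y)
     + \<kappa> * (of_nat m - 3) * (?g i y * ?g j y * ?g k y) = 0" for y
  proof -
    have "S' y = (?g i (A y) * (?g j y * ?g k y) + ?g j (A y) * (?g i y * ?g k y) + ?g k (A y) * (?g i y * ?g j y)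
     + \<kappa> * (of_nat m - 3) * (?g i y * ?g j y * ?g k y)) * eval_at u p"
      unfolding S'_def Du gD[OF n[OF inI(1)]] gD[OF n[OF inI(2)]] gD[OF n[OF inI(3)]] mN
      by (simp add: algebra_simps)
    thus ?thesis using S'0 up by simp
  qed
  have Aadd: "A (x + y) = A x + A y" and Asm: "A (t *s x) = t *s A x" for x y t
    by (simp_all add: A_def vec_eq_iff grad_add grad_smult)
  have a1: "?g i (A e1) = 0" using second[of e1] \<beta> by (simp add: e gk)
  have a2: "?g j (A e0) = 0" using second[of e0] \<alpha> by (simp add: e gk)
  define \<mu> where "\<mu> = ?g i (A e0)"
  have a3: "?g j (A e1) = \<mu>"
  proof -
    have "?g k (A ?y) = 0" using second[of ?y] \<alpha> \<beta> unfolding gky gy by simp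
    moreover have "?g k (A ?y) = \<alpha> * (\<beta> * \<mu>) + \<beta> * (- \<alpha> * ?g j (A e1))"
      unfolding gk Aadd Asm grad_add grad_smult a1 a2 by (simp add: \<mu>_def)
    ultimately show ?thesis using \<alpha> \<beta> by (simp add: algebra_simps)
  qed
  have \<mu>: "3 * \<mu> + \<kappa> * (of_nat m - 3) = 0"
  proof -
    \<comment> \<open>The direction \<open>?w\<close> has to avoid the three tangents, which means
      that \<open>t\<close> and \<open>\<alpha> + t * \<beta>\<close> are nonzero. If 1 fails, 2
      works: then \<open>\<alpha> + 2 * \<beta>\<close> is \<beta>.\<close>
    define t where "t = (if \<alpha> + \<beta> = 0 then 2 else 1 :: complex)"
    have t: "t \<noteq> 0" "\<alpha> + t * \<beta> \<noteq> 0"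
      using \<beta> by (auto simp: t_def add_eq_0_iff)
    let ?w = "e0 + t *s e1"
    have w: "?g i ?w = 1" "?g j ?w = t" by (simp_all add: grad_add grad_smult e)
    have Aw: "?g i (A ?w) = \<mu>" "?g j (A ?w) = t * \<mu>"
      by (simp_all add: Aadd Asm grad_add grad_smult a1 a2 a3 \<mu>_def)
    have "(3 * \<mu> + \<kappa> * (of_nat m - 3)) * (t * (\<alpha> + t * \<beta>)) = 0"
      using second[of ?w] unfolding gk w Aw by (simp add: algebra_simps)
    thus ?thesis using t by simp
  qed
  have Ap: "A p = (of_nat r * \<kappa>) *s p"
  proof -
    have "grad (\<theta> l) p p = of_nat r * eval_at (\<theta> l) p" for l
      using eval_euler[OF \<theta>, of p l] by (simp add: grad_def mult.commute)
    thus ?thesis by (simp add: A_def vec_eq_iff \<theta>p)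
  qed
  have prop_p: "A y - \<mu> *s y = Z (A y - \<mu> *s y) *s p" for y
  proof -
    have Ay: "A y = Z y *s A p + U y *s A e0 + V y *s A e1"
      using arg_cong[OF ZUV[of y], of A] unfolding Aadd Asm .
    have gA: "?g i (A y) = \<mu> * ?g i y" "?g j (A y) = \<mu> * ?g j y"
      unfolding Ay Ap grad_add grad_smult gp a1 a2 a3 U V by (simp_all add: \<mu>_def)
    have "U (A y - \<mu> *s y) = 0" "V (A y - \<mu> *s y) = 0"
      unfolding U V grad_diff grad_smult gA by simp_all
    thus ?thesis using ZUV[of "A y - \<mu> *s y"] by simp
  qed
  obtain l0 where l0: "p $ l0 \<noteq> 0" using p by (auto simp: vec_eq_iff)
  \<comment> \<open>The linear part \<open>A\<close> is the scalar \<mu> plus a map of rank at most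
    one with image in the line of \<open>p\<close>. Its trace is therefore
    \<open>3 * \<mu> + \<nu> p\<close>, and the action on \<open>p\<close> itself, known from
    Euler's formula, determines \<open>\<nu> p\<close>.\<close>
  define \<nu> where "\<nu> y = (A y - \<mu> *s y) $ l0 / p $ l0" for y
  have \<nu>: "A y = \<mu> *s y + \<nu> y *s p" for y
  proof -
    have "\<nu> y = Z (A y - \<mu> *s y)" unfolding \<nu>_def using arg_cong[OF prop_p[of y], of "\<lambda>x. x $ l0"] l0 by simp
    thus ?thesis using prop_p[of y] by (metis add_diff_cancel_left' add.commute diff_add_cancel)
  qed
  have tr: "(\<Sum>l\<in>UNIV. A (axis l 1) $ l) = 0"
  proof -
    have "A (axis l 1) $ l = eval_at (partial_deriv l (\<theta> l)) p" for l
      by (simp add: A_def grad_def axis_def if_distrib cong: if_cong)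
    thus ?thesis using arg_cong[OF div, of "\<lambda>q. eval_at q p"] by simp
  qed
  have "(\<Sum>l\<in>UNIV. A (axis l 1) $ l) = 3 * \<mu> + (\<Sum>l\<in>UNIV. \<nu> (axis l 1) * p $ l)"
    by (subst \<nu>) (simp add: sum.distrib axis_def)
  also have "(\<Sum>l\<in>UNIV. \<nu> (axis l 1) * p $ l) = \<nu> p"
  proof -
    have p_exp: "p = p $ 1 *s axis 1 1 + p $ 2 *s axis 2 1 + p $ 3 *s axis 3 1" by (simp add: vec_eq_iff forall_3 axis_def)
    have "\<nu> (x + y) = \<nu> x + \<nu> y" "\<nu> (t *s x) = t * \<nu> x" for x y t
      unfolding \<nu>_def Aadd Asm by (simp_all add: add_divide_distrib[symmetric] algebra_simps)
    hence "\<nu> (p $ 1 *s axis 1 1 + p $ 2 *s axis 2 1 + p $ 3 *s axis 3 1) = (\<Sum>l\<in>UNIV. \<nu> (axis l 1) * p $ l)" by (simp add: sum_3)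
    thus ?thesis using p_exp by simp
  qed
  also have "\<nu> p = of_nat r * \<kappa> - \<mu>" unfolding \<nu>_def Ap using l0 by (simp add: diff_divide_distrib)
  finally have "2 * \<mu> + of_nat r * \<kappa> = 0" unfolding tr by (simp add: algebra_simps)
  \<comment> \<open>Elimination of \<mu> from the trace condition and
    \<open>3 * \<mu> + \<kappa> * (of_nat m - 3) = 0\<close>. The factor vanishes exactly if
    \<open>(r + 2)/m\<close> is the threshold 2/3.\<close>
  hence "\<kappa> * (of_nat (3 * (r + 2)) - of_nat (2 * m)) = 0" using \<mu> by (simp add: algebra_simps) algebra
  moreover have "(of_nat (3 * (r + 2)) :: complex) - of_nat (2 * m) \<noteq> 0"
    using rm by (metis of_nat_eq_iff right_minus_eq)
  ultimately have "\<kappa> = 0" by simp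
  thus ?thesis by (simp add: \<theta>p)
qed

section \<open>The degree bound\<close>

lemma annulus_integral_finite:
  fixes I :: "nat set" and B :: "complex^3 \<Rightarrow> real"
  assumes I: "finite I" and c: "\<And>i. i \<in> I \<Longrightarrow> is_component (c i)"
    and ok: "\<And>p. p \<noteq> 0 \<Longrightarrow> branches_ok I c p" and s: "1/2 \<le> s" "s < 3/4"
    and B: "continuous_on UNIV B"
    and tri: "\<And>p i j k. p \<noteq> 0 \<Longrightarrow> triple_point I c p i j k \<Longrightarrow> s < 2/3 \<or> (\<exists>C\<ge>0. \<exists>\<eta>>0. \<forall>x\<in>ball p \<eta>. \<forall>a\<in>{i,j,k}. \<forall>b\<in>{i,j,k}. a \<noteq> b \<longrightarrow>
       B x \<le> (C * (norm (eval_at (c a) x) + norm (eval_at (c b) x)))^2)"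
  shows "(\<integral>\<^sup>+ x. indicator {x. 1 \<le> norm x \<and> norm x \<le> 2} x * (ennreal (B x) * pw (2 * s) (norm (eval_at (\<Prod>i\<in>I. c i) x))) \<partial>lborel) < \<infinity>"
proof (rule loc_finite_compact)
  have "{x::complex^3. 1 \<le> norm x \<and> norm x \<le> 2} = cball 0 2 - ball 0 1" by auto
  thus "compact {x::complex^3. 1 \<le> norm x \<and> norm x \<le> 2}" by (simp add: compact_diff)
  have [measurable]: "B \<in> borel_measurable borel" using B by (rule borel_measurable_continuous_onI)
  show "(\<lambda>x. ennreal (B x) * pw (2 * s) (norm (eval_at (\<Prod>i\<in>I. c i) x))) \<in> borel_measurable borel" by measurable
  fix p :: "complex^3" assume "p \<in> {x. 1 \<le> norm x \<and> norm x \<le> 2}"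
  hence p: "p \<noteq> 0" by auto
  have "bounded (B ` cball p 1)"
    by (intro compact_imp_bounded compact_continuous_image continuous_on_subset[OF B]) auto
  then obtain M where M: "\<And>x. x \<in> cball p 1 \<Longrightarrow> norm (B x) \<le> M" unfolding bounded_iff by blast
  show "loc_finite (\<lambda>x. ennreal (B x) * pw (2 * s) (norm (eval_at (\<Prod>i\<in>I. c i) x))) p"
  proof (rule loc_finite_product[OF I c p ok[OF p] s zero_less_one])
    show "B x \<le> max M 0" if "x \<in> ball p 1" for x using M[of x] that by auto
  qed (use tri[OF p] in auto)
qed

lemma component_nonzero: "is_component c \<Longrightarrow> c \<noteq> 0"
proof
  assume c: "is_component c" and z: "c = 0"
  have "axis 1 1 \<in> singular_points 0" by (simp add: singular_points_def zero_locus_def axis_eq_0_iff)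
  thus False using c z by (auto simp: is_component_def is_line_def is_smooth_conic_def)
qed

lemma singular_of_two_components:
  assumes I: "finite I" and ij: "i \<in> I" "j \<in> I" "i \<noteq> j" and z: "eval_at (c i) p = 0" "eval_at (c j) p = 0" and p: "p \<noteq> 0"
  shows "p \<in> singular_points (\<Prod>i\<in>I. c i)"
proof -
  have f: "(\<Prod>i\<in>I. c i) = c i * (c j * (\<Prod>i\<in>I - {i} - {j}. c i))"
    using I ij by (simp add: prod.remove[of I i] prod.remove[of "I - {i}" j])
  show ?thesis unfolding singular_points_def zero_locus_def f
    using p z by (simp add: eval_partial_deriv_mult)
qed

text \<open>Two components through \<open>p\<close> make it a singular point of the product, so that
  the hypothesis on singularities applies; with fewer components there is nothing to verify.\<close>

lemma branches_ok_of_singularities: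
  fixes I :: "nat set"
  assumes I: "finite I" and c: "\<And>i. i \<in> I \<Longrightarrow> is_component (c i)" and p: "p \<noteq> 0"
    and sing: "p \<in> singular_points (\<Prod>i\<in>I. c i) \<Longrightarrow>
       is_node (\<Prod>i\<in>I. c i) p \<or> is_tacnode (\<Prod>i\<in>I. c i) p \<or> is_ordinary_triple_point (\<Prod>i\<in>I. c i) p"
  shows "branches_ok I c p"
proof -
  define T where "T = {i \<in> I. eval_at (c i) p = 0}"
  consider "T = {}" | i where "T = {i}" | i j where "i \<in> T" "j \<in> T" "i \<noteq> j" by blast
  thus ?thesis
  proof cases
    case 1 thus ?thesis unfolding branches_ok_def Let_def T_def[symmetric] by simp
  next
    case 2 thus ?thesis unfolding branches_ok_def Let_def T_def[symmetric] by simp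
  next
    case (3 i j)
    hence "p \<in> singular_points (\<Prod>i\<in>I. c i)"
      by (intro singular_of_two_components[OF I, of i j] p) (auto simp: T_def)
    from sing[OF this] show ?thesis
    proof (elim disjE)
      assume "is_node (\<Prod>i\<in>I. c i) p"
      from node_components[OF I c p this] show ?thesis unfolding branches_ok_def Let_def by blast
    next
      assume "is_tacnode (\<Prod>i\<in>I. c i) p"
      from tacnode_components[OF I c p this] show ?thesis unfolding branches_ok_def Let_def by blast
    next
      assume "is_ordinary_triple_point (\<Prod>i\<in>I. c i) p"
      from triple_point_components[OF I c p this] show ?thesis unfolding branches_ok_def Let_def by blast
    qed
  qed
qed

text \<open>Finitely many estimates, one for each pair of branches and each coefficient of the
  field, are made uniform by the least radius and the sum of the constants.\<close>

lemma triple_point_vanishing_bound: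
  fixes I :: "nat set" and \<theta> :: "3 \<Rightarrow> poly3"
  assumes c: "\<And>i. i \<in> I \<Longrightarrow> is_component (c i)" and p: "p \<noteq> 0" and tp: "triple_point I c p i j k"
    and \<theta>: "\<And>l. \<theta> l \<in> graded_part (int r)" "\<And>l. eval_at (\<theta> l) p = 0"
  obtains C \<eta> where "C \<ge> 0" "\<eta> > 0"
    "\<And>x a b. x \<in> ball p \<eta> \<Longrightarrow> a \<in> {i,j,k} \<Longrightarrow> b \<in> {i,j,k} \<Longrightarrow> a \<noteq> b \<Longrightarrow>
     (\<Sum>l\<in>UNIV. norm (eval_at (\<theta> l) x)) \<le> C * (norm (eval_at (c a) x) + norm (eval_at (c b) x))"
proof -
  have T: "{i \<in> I. eval_at (c i) p = 0} = {i, j, k}"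
    and ind: "indep_grad (c i) (c j) p" "indep_grad (c i) (c k) p" "indep_grad (c j) (c k) p"
    using tp unfolding triple_point_def by blast+
  have sym: "indep_grad c2 c1 p" if "indep_grad c1 c2 p" for c1 c2 using that unfolding indep_grad_def by blast
  define S where "S = {(a, b). a \<in> {i,j,k} \<and> b \<in> {i,j,k} \<and> a \<noteq> b} \<times> (UNIV :: 3 set)"
  have "finite ({i,j,k} \<times> {i,j,k})" by simp
  hence "finite {(a, b). a \<in> {i,j,k} \<and> b \<in> {i,j,k} \<and> a \<noteq> b}" by (rule rev_finite_subset) auto
  hence finS: "finite S" unfolding S_def by (rule finite_cartesian_product) simp
  have "\<exists>C \<eta>. \<eta> > 0 \<and> C \<ge> 0 \<and> (\<forall>x\<in>ball p \<eta>. norm (eval_at (\<theta> (snd z)) x) \<le> C * (norm (eval_at (c (fst (fst z))) x) + norm (eval_at (c (snd (fst z))) x)))"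
    if z: "z \<in> S" for z
  proof -
    obtain a b l where ab: "z = ((a, b), l)" "a \<in> {i,j,k}" "b \<in> {i,j,k}" "a \<noteq> b" using z by (auto simp: S_def)
    have "a \<in> {i \<in> I. eval_at (c i) p = 0}" "b \<in> {i \<in> I. eval_at (c i) p = 0}" using ab T by auto
    hence ca: "is_component (c a)" "is_component (c b)" "eval_at (c a) p = 0" "eval_at (c b) p = 0" using c by auto
    have "indep_grad (c a) (c b) p" using ab ind sym by auto
    from vanishing_bound[OF ca p this \<theta>, of l] show ?thesis unfolding ab by simp
  qed
  then obtain C \<eta> where C: "\<And>z. z \<in> S \<Longrightarrow> \<eta> z > 0" "\<And>z. z \<in> S \<Longrightarrow> C z \<ge> 0"
    "\<And>z x. z \<in> S \<Longrightarrow> x \<in> ball p (\<eta> z) \<Longrightarrow> norm (eval_at (\<theta> (snd z)) x) \<le> C z * (norm (eval_at (c (fst (fst z))) x) + norm (eval_at (c (snd (fst z))) x))"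
    by metis
  define C0 where "C0 = sum C S"
  define \<eta>0 where "\<eta>0 = Min (insert 1 (\<eta> ` S))"
  have \<eta>0: "\<eta>0 > 0" "\<And>z. z \<in> S \<Longrightarrow> \<eta>0 \<le> \<eta> z" using finS C(1) by (auto simp: \<eta>0_def)
  have "(\<Sum>l\<in>UNIV. norm (eval_at (\<theta> l) x)) \<le> (\<Sum>l\<in>(UNIV::3 set). C0) * (norm (eval_at (c a) x) + norm (eval_at (c b) x))"
    if x: "x \<in> ball p \<eta>0" and ab: "a \<in> {i,j,k}" "b \<in> {i,j,k}" "a \<noteq> b" for x a b
    unfolding sum_distrib_right
  proof (rule sum_mono)
    fix l :: 3
    have z: "((a, b), l) \<in> S" using ab by (simp add: S_def)
    have "norm (eval_at (\<theta> l) x) \<le> C ((a, b), l) * (norm (eval_at (c a) x) + norm (eval_at (c b) x))"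
      using C(3)[OF z, of x] x \<eta>0(2)[OF z] by simp
    also have "\<dots> \<le> C0 * (norm (eval_at (c a) x) + norm (eval_at (c b) x))"
      unfolding C0_def by (intro mult_right_mono member_le_sum z finS C(2)) auto
    finally show "norm (eval_at (\<theta> l) x) \<le> C0 * (norm (eval_at (c a) x) + norm (eval_at (c b) x))" .
  qed
  show ?thesis
  proof (rule that[OF _ \<eta>0(1)])
    show "(\<Sum>l\<in>(UNIV::3 set). C0) \<ge> 0" unfolding C0_def by (intro sum_nonneg C(2))
  qed fact
qed

lemma nearly_free_degree_bound:
  fixes I :: "nat set" and n :: "nat \<Rightarrow> nat"
  assumes I: "finite I" and c: "\<And>i. i \<in> I \<Longrightarrow> is_component (c i)" and n: "\<And>i. i \<in> I \<Longrightarrow> c i \<in> graded_part (int (n i))"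
    and m: "m = (\<Sum>i\<in>I. n i)"
    and ok: "\<And>p. p \<noteq> 0 \<Longrightarrow> branches_ok I c p" and nf: "nearly_free (\<Prod>i\<in>I. c i)"
  shows "m \<le> 12"
proof (rule ccontr)
  assume "\<not> m \<le> 12"
  hence m13: "m \<ge> 13" by simp
  define f where "f = (\<Prod>i\<in>I. c i)"
  define r where "r = m div 2"
  have r: "m < 2 * r + 2" "2 * r \<le> m" by (auto simp: r_def)
  have fgr: "f \<in> graded_part (int m)" unfolding f_def m of_nat_sum by (intro graded_part_prod n)
  have f0: "f \<noteq> 0"
  proof -
    have "\<exists>p. \<forall>a\<in>I. eval_at (c a) p \<noteq> 0" using component_nonzero[OF c] by (intro prod_eval_nonzero[OF I])
    then obtain p where "\<forall>a\<in>I. eval_at (c a) p \<noteq> 0" ..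
    hence "eval_at f p \<noteq> 0" using I by (simp add: f_def)
    thus ?thesis by auto
  qed
  obtain \<theta> where \<theta>: "\<And>i. \<theta> i \<in> graded_part (int r)" "\<exists>i. \<theta> i \<noteq> 0" "(\<Sum>i\<in>UNIV. \<theta> i * partial_deriv i f) = 0"
    using syzygy_of_nearly_free[OF fgr f0 _ r(1)] m13 nf unfolding f_def by auto
  have \<theta>f: "(\<Sum>i\<in>UNIV. eval_at (\<theta> i) x * eval_at (partial_deriv i f) x) = 0" for x
    using arg_cong[OF \<theta>(3), of "\<lambda>q. eval_at q x"] by simp
  note fin = annulus_integral_finite[OF I c ok, folded f_def]
  have ae: "AE x in lborel. 1 \<le> norm x \<and> norm x \<le> 2 \<longrightarrow> eval_at f x \<noteq> 0"
  proof -
    \<comment> \<open>The exponent \<open>s = 1/2\<close> is within reach at all singular points.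
      Finiteness of this integral shows that the curve is a null set in the annulus, as the
      integrand is infinite there.\<close>
    let ?G = "\<lambda>x. indicator {x. 1 \<le> norm x \<and> norm x \<le> 2} x * (ennreal 1 * pw (2 * (1/2)) (norm (eval_at f x)))"
    have "(\<integral>\<^sup>+ x. ?G x \<partial>lborel) < \<infinity>" by (rule fin) auto
    hence "AE x in lborel. ?G x \<noteq> \<infinity>" by (intro nn_integral_noteq_infinite) auto
    thus ?thesis by eventually_elim (auto simp: pw_def)
  qed
  have cB: "continuous_on UNIV (\<lambda>x. norm (eval_at (\<Sum>i\<in>UNIV. partial_deriv i (T i)) x) * (\<Sum>i\<in>UNIV. norm (eval_at (T i) x)))" for T :: "3 \<Rightarrow> poly3"
    by (intro continuous_intros continuous_eval_at)
  have div: "(\<Sum>i\<in>UNIV. partial_deriv i (\<theta> i)) = 0"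
  proof (rule divergence_eq_0[OF fgr _ \<theta>(1) \<theta>f ae refl])
    show "0 < m" using m13 by simp
    let ?s = "(real r + 2) / real m"
    \<comment> \<open>The inequality \<open>r + 2 < 2 * m / 3\<close> follows from
      \<open>2 * r \<le> m\<close> as soon as \<open>m\<close> exceeds 12.\<close>
    have "real m < 2 * real r + 2" "2 * real r \<le> real m" "13 \<le> real m" using r m13 by linarith+
    hence s: "1/2 \<le> ?s" "?s < 3/4" "?s < 2/3" by (auto simp: field_simps)
    show "(\<integral>\<^sup>+ x. indicator {x. 1 \<le> norm x \<and> norm x \<le> 2} x * (ennreal (norm (eval_at (\<Sum>i\<in>UNIV. partial_deriv i (\<theta> i)) x) * (\<Sum>i\<in>UNIV. norm (eval_at (\<theta> i) x)))
          * pw (2 * ?s) (norm (eval_at f x))) \<partial>lborel) < \<infinity>"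
      by (rule fin[OF _ _ s(1,2) cB]) (use s(3) in auto)
  qed
  have van: "eval_at (\<theta> l) p = 0" if "p \<noteq> 0" "triple_point I c p i j k" for p i j k l
    by (rule triple_point_vanishing[OF I c n m that \<theta>(1) \<theta>(3)[unfolded f_def] div]) (use r m13 in auto)
  have "\<theta> k0 = 0" for k0
  proof -
    define T where "T i = Var k0 * \<theta> i" for i
    have Tgr: "T i \<in> graded_part (int (r + 1))" for i
      using graded_part_mult[OF graded_part_Var \<theta>(1), of k0 i] by (simp add: T_def add.commute)
    have Tf: "(\<Sum>i\<in>UNIV. eval_at (T i) x * eval_at (partial_deriv i f) x) = 0" for x
    proof -
      have "(\<Sum>i\<in>UNIV. eval_at (T i) x * eval_at (partial_deriv i f) x) = x $ k0 * (\<Sum>i\<in>UNIV. eval_at (\<theta> i) x * eval_at (partial_deriv i f) x)"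
        by (simp add: T_def sum_distrib_left mult.assoc)
      thus ?thesis using \<theta>f by simp
    qed
    have divT: "eval_at (\<Sum>i\<in>UNIV. partial_deriv i (T i)) x = eval_at (\<theta> k0) x" for x
    proof -
      have e: "eval_at (partial_deriv i (T i)) x = (if i = k0 then eval_at (\<theta> k0) x else 0) + x $ k0 * eval_at (partial_deriv i (\<theta> i)) x" for i
        unfolding T_def eval_partial_deriv_mult eval_partial_deriv_Var eval_at_simps by simp
      have "eval_at (\<Sum>i\<in>UNIV. partial_deriv i (T i)) x = (\<Sum>i\<in>UNIV. if i = k0 then eval_at (\<theta> k0) x else 0) + x $ k0 * eval_at (\<Sum>i\<in>UNIV. partial_deriv i (\<theta> i)) x"
        unfolding eval_at_simps e sum.distrib sum_distrib_left ..
      thus ?thesis unfolding div by simp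
    qed
    let ?s = "(real (r + 1) + 2) / real m"
    let ?B = "\<lambda>x. norm (eval_at (\<Sum>i\<in>UNIV. partial_deriv i (T i)) x) * (\<Sum>i\<in>UNIV. norm (eval_at (T i) x))"
    have "(\<Sum>i\<in>UNIV. partial_deriv i (T i)) = 0"
    proof (rule divergence_eq_0[OF fgr _ Tgr Tf ae refl])
      show "0 < m" using m13 by simp
      \<comment> \<open>Again \<open>2 * r \<le> m\<close> and \<open>m > 12\<close> give
        \<open>r + 3 < 3 * m / 4\<close>; the exponent may now be 2/3 or larger, which is why the
        triple points need a separate estimate.\<close>
      have "real m < 2 * real r + 2" "2 * real r \<le> real m" "13 \<le> real m" using r m13 by linarith+
      hence s: "1/2 \<le> ?s" "?s < 3/4" by (auto simp: field_simps)
      show "(\<integral>\<^sup>+ x. indicator {x. 1 \<le> norm x \<and> norm x \<le> 2} x * (ennreal (?B x) * pw (2 * ?s) (norm (eval_at f x))) \<partial>lborel) < \<infinity>"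
      proof (rule fin[OF _ _ s cB])
        fix p i j k assume p: "p \<noteq> 0" and tp: "triple_point I c p i j k"
        obtain C \<eta> where C: "C \<ge> 0" "\<eta> > 0"
          and bound: "\<forall>x\<in>ball p \<eta>. \<forall>a\<in>{i,j,k}. \<forall>b\<in>{i,j,k}. a \<noteq> b \<longrightarrow>
            (\<Sum>l\<in>UNIV. norm (eval_at (\<theta> l) x)) \<le> C * (norm (eval_at (c a) x) + norm (eval_at (c b) x))"
        proof (rule triple_point_vanishing_bound[where \<theta> = \<theta> and r = r, OF c p tp \<theta>(1) van[OF p tp]])
          fix C \<eta> assume A: "C \<ge> 0" "\<eta> > 0" "\<And>x a b. x \<in> ball p \<eta> \<Longrightarrow> a \<in> {i,j,k} \<Longrightarrow> b \<in> {i,j,k} \<Longrightarrow> a \<noteq> b \<Longrightarrow>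
            (\<Sum>l\<in>UNIV. norm (eval_at (\<theta> l) x)) \<le> C * (norm (eval_at (c a) x) + norm (eval_at (c b) x))"
          show thesis by (rule that[OF A(1,2)]) (intro ballI impI A(3))
        qed
        \<comment> \<open>Bounds the coordinate factor \<open>x $ k0\<close> on the unit ball around
          \<open>p\<close>. The divergence and the field then contribute one factor each that
          vanishes at \<open>p\<close>, hence the square.\<close>
        define R where "R = norm p + 1"
        have R: "R \<ge> 1" by (simp add: R_def)
        have "?B x \<le> ((R * C) * (norm (eval_at (c a) x) + norm (eval_at (c b) x)))^2"
          if x: "x \<in> ball p (min \<eta> 1)" and ab: "a \<in> {i,j,k}" "b \<in> {i,j,k}" "a \<noteq> b" for x a b
        proof -
          let ?S = "\<Sum>l\<in>UNIV. norm (eval_at (\<theta> l) x)" and ?N = "norm (eval_at (c a) x) + norm (eval_at (c b) x)"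
          have S: "0 \<le> ?S" "?S \<le> C * ?N" using bound[rule_format, OF _ ab, of x] x by (auto intro: sum_nonneg)
          have k: "norm (eval_at (\<theta> k0) x) \<le> ?S" by (rule member_le_sum) auto
          have "norm (x $ k0) \<le> norm x" by (rule Finite_Cartesian_Product.norm_nth_le)
          also have "norm x \<le> norm p + norm (x - p)" by (rule norm_triangle_sub)
          also have "\<dots> \<le> R" using x by (simp add: R_def dist_norm norm_minus_commute)
          finally have xk: "norm (x $ k0) \<le> R" .
          have "(\<Sum>i\<in>UNIV. norm (eval_at (T i) x)) = norm (x $ k0) * ?S" by (simp add: T_def norm_mult sum_distrib_left)
          hence "?B x = norm (eval_at (\<theta> k0) x) * (norm (x $ k0) * ?S)" unfolding divT by simp
          also have "\<dots> \<le> ?S * (R * ?S)" using S R by (intro mult_mono k xk) auto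
          also have "\<dots> \<le> (R * ?S) * (R * ?S)" using S R by (intro mult_right_mono) (auto simp: mult_le_cancel_right1)
          also have "\<dots> \<le> (R * (C * ?N)) * (R * (C * ?N))" using S R by (intro mult_mono mult_left_mono) auto
          finally show ?thesis by (simp add: power2_eq_square mult_ac)
        qed
        thus "?s < 2/3 \<or> (\<exists>C\<ge>0. \<exists>\<eta>>0. \<forall>x\<in>ball p \<eta>. \<forall>a\<in>{i,j,k}. \<forall>b\<in>{i,j,k}. a \<noteq> b \<longrightarrow>
           ?B x \<le> (C * (norm (eval_at (c a) x) + norm (eval_at (c b) x)))^2)"
          using C R by (intro disjI2 exI[of _ "R * C"] conjI exI[of _ "min \<eta> 1"]) auto
      qed auto
    qed
    hence "eval_at (\<theta> k0) x = 0" for x using divT[of x] by simp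
    thus ?thesis using poly3_eq_0_iff by blast
  qed
  thus False using \<theta>(2) by blast
qed

theorem proposition4p2:
  fixes d k m :: nat and l q :: "nat \<Rightarrow> poly3"
  assumes "d \<ge> 1" and "k \<ge> 1"
    and "conic_line_arrangement d k l q"
    and "m = 2 * k + d"
    and "\<And>p. p \<in> singular_points (defining_form d k l q) \<Longrightarrow>
           is_node (defining_form d k l q) p \<or>
           is_tacnode (defining_form d k l q) p \<or>
           is_ordinary_triple_point (defining_form d k l q) p"
    and "nearly_free (defining_form d k l q)"
  shows "m \<le> 12"
proof -
  \<comment> \<open>Lines and conics are numbered consecutively, the lines being the first
    \<open>d\<close>; their degrees are recorded by \<open>n\<close>.\<close>
  define c where "c i = (if i < d then l i else q (i - d))" for i
  define n where "n i = (if i < d then 1 else 2 :: nat)" for i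
  have split: "{..<d + k} = {..<d} \<union> (\<lambda>i. i + d) ` {..<k}"
  proof (intro set_eqI iffI)
    fix i assume "i \<in> {..<d + k}"
    hence "i < d \<or> (i = (i - d) + d \<and> i - d \<in> {..<k})" by auto
    thus "i \<in> {..<d} \<union> (\<lambda>i. i + d) ` {..<k}" by blast
  qed auto
  have f: "defining_form d k l q = (\<Prod>i\<in>{..<d + k}. c i)"
  proof -
    have "(\<Prod>i\<in>{..<d + k}. c i) = (\<Prod>i<d. c i) * (\<Prod>i\<in>(\<lambda>i. i + d) ` {..<k}. c i)"
      unfolding split by (rule prod.union_disjoint) auto
    also have "(\<Prod>i\<in>(\<lambda>i. i + d) ` {..<k}. c i) = (\<Prod>i<k. q i)"
      by (subst prod.reindex) (auto simp: c_def inj_on_def)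
    also have "(\<Prod>i<d. c i) = (\<Prod>i<d. l i)" by (simp add: c_def)
    finally show ?thesis by (simp add: defining_form_def)
  qed
  have m: "m = (\<Sum>i\<in>{..<d + k}. n i)"
  proof -
    have "(\<Sum>i\<in>{..<d + k}. n i) = (\<Sum>i<d. n i) + (\<Sum>i\<in>(\<lambda>i. i + d) ` {..<k}. n i)"
      unfolding split by (rule sum.union_disjoint) auto
    also have "(\<Sum>i\<in>(\<lambda>i. i + d) ` {..<k}. n i) = 2 * k"
      by (subst sum.reindex) (auto simp: n_def inj_on_def)
    also have "(\<Sum>i<d. n i) = d" by (simp add: n_def)
    finally show ?thesis using assms(4) by simp
  qed
  have c: "is_component (c i)" and n: "c i \<in> graded_part (int (n i))" if "i \<in> {..<d + k}" for i
  proof -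
    have "i < d \<or> i - d < k" using that by auto
    thus "is_component (c i)" "c i \<in> graded_part (int (n i))" using assms(3) that
      by (auto simp: conic_line_arrangement_def is_component_def is_line_def is_smooth_conic_def c_def n_def)
  qed
  have "branches_ok {..<d + k} c p" if "p \<noteq> 0" for p
    by (rule branches_ok_of_singularities[OF _ c that]) (use assms(5)[of p] f in auto)
  thus ?thesis
    by (intro nearly_free_degree_bound[OF _ c n m]) (use assms(6) f in auto)
qed

end
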